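(* Let $\Sigma$ be a closed oriented smooth surface and let $C,C'$ be oriented smooth simple closed curves in $\Sigma$ intersecting transversally at finitely many points $x_1,\dots,x_r$. Let $\epsilon_i=+1$ if (tangent of $C$ at $x_i$, tangent of $C'$ at $x_i$) is a positively oriented basis of $T_{x_i}\Sigma$ and $\epsilon_i=-1$ otherwise. Let $\{\cdot,\cdot\}$ be the Poisson bracket, as defined in the context, on functions on the space $\mathcal A(\Sigma)=\Omega^1(\Sigma)\otimes\mathfrak g$ of all connections on the trivialized principal $G$-bundle, arising from the Atiyah–Bott symplectic form $\Omega_A(v,w)=\operatorname{Tr}\int_\Sigma v\wedge w$, and let $W_C(A)=\operatorname{tr}\operatorname{hol}_C(A)$, where both $\operatorname{Tr}$ and $\operatorname{tr}$ are taken in the defining representation. 1. If $G=GL(n,\mathbb C)$, then for every $A\in\mathcal A(\Sigma)$ $$\{W_C,W_{C'}\}(A)=\sum_{i=1}^r\epsilon_i\,W_{C\star_iC'}(A).$$ 2. If $G=SU(2)$, then for every $A\in\mathcal A(\Sigma)$ $$\{W_C,W_{C'}\}(A)=\frac12\sum_{i=1}^r\epsilon_i\big(W_{C\star_iC'}(A)-W_{C\star_i\bar C'}(A)\big).$$ Here $C\star_iC'$ is the closed curve obtained by concatenating the oriented curves $C$ and $C'$ at the common basepoint $x_i$, and $\bar C'$ is $C'$ with reversed orientation.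
   Context: Holonomy: for a path $c:[0,1]\to\Sigma$, $\operatorname{hol}_c(A)=h(1)$ where $h'(t)=h(t)A(\dot c(t))$, $h(0)=I$; thus holonomies multiply left to right in order of traversal. The trace of the holonomy of a closed curve is independent of the basepoint. Poisson bracket. Let $\{e_\alpha\}$ be a basis of $\mathfrak g$ (over $\mathbb C$ for $\mathfrak{gl}(n,\mathbb C)$, over $\mathbb R$ for $\mathfrak{su}(2)$) and $g_{\alpha\beta}=\operatorname{Tr}(e_\alpha e_\beta)$. If a function $f$ on $\mathcal A(\Sigma)$ has derivative at $A$ represented by a smooth density, i.e. in oriented local coordinates $df_A(v)=\int\sum_{\alpha,a}\frac{\delta f}{\delta A^a_\alpha(x)}v^a_\alpha(x)\,d^2x$ for $v=\sum v^a_\alpha\,dx^a\otimes e_\alpha$, and likewise for $h$, then $$\{f,h\}(A)=\int_\Sigma d^2x\sum_{\alpha,\beta}\sum_{a,b}\epsilon_{ab}\,(g^{-1})_{\alpha\beta}\,\frac{\delta f}{\delta A^a_\alpha(x)}\frac{\delta h}{\delta A^b_\beta(x)},\qquad \epsilon_{12}=-\epsilon_{21}=1,\ \epsilon_{11}=\epsilon_{22}=0,$$ which is independent of the oriented local coordinates used. For $GL(n,\mathbb C)$, derivatives are complex-linear. The functions $W_C$ have distributional derivatives supported on $C$, so $\{W_C,W_{C'}\}$ is defined by regularization: $\{W_C,W_{C'}\}(A)=\lim_{s\to0^+}\{W^s_C,W^s_{C'}\}(A)$, where $W_C^s(A)=W_C(R_sA)$ and $R_s$ is smoothing of one-forms by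 convolution with a delta sequence. Concretely, for a finite atlas of oriented charts $U_k$ with subordinate partition of unity $\chi_k$ and cutoffs $\psi_k\in C_c^\infty(U_k)$ equal to $1$ near $\operatorname{supp}\chi_k$, set $R_sv=\sum_k\psi_k\cdot\big(\rho_s*(\chi_kv)\big)$, the convolution being taken componentwise in the coordinates of $U_k$, where $\rho_s(y)=s^{-2}\rho(y/s)$ with $\rho\in C_c^\infty(\mathbb R^2)$, $\rho\ge0$, $\int\rho=1$. *)

theory Defs
  imports "HOL-Analysis.Analysis"
begin

section \<open>Smooth maps between normed spaces\<close>

text \<open>Used on open sets \<open>S\<close> only. For a finite-dimensional domain, the condition says that all
  iterated directional derivatives up to order \<open>k\<close> exist and are continuous.\<close>

fun Ck_on :: "nat \<Rightarrow> 'a::real_normed_vector set \<Rightarrow> ('a \<Rightarrow> 'b::real_normed_vector) \<Rightarrow> bool" where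
  "Ck_on 0 S f \<longleftrightarrow> continuous_on S f"
| "Ck_on (Suc k) S f \<longleftrightarrow>
     (\<forall>x\<in>S. f differentiable (at x)) \<and> (\<forall>v. Ck_on k S (\<lambda>x. frechet_derivative f (at x) v))"

definition smooth_on :: "'a::real_normed_vector set \<Rightarrow> ('a \<Rightarrow> 'b::real_normed_vector) \<Rightarrow> bool" where
  "smooth_on S f \<longleftrightarrow> (\<forall>k. Ck_on k S f)"


section \<open>Closed oriented smooth surfaces\<close>

text \<open>The surface is the type \<open>'p\<close>, with a smooth oriented structure given by a maximal oriented
  atlas. A chart is its domain together with a coordinate map, which is irrelevant off the domain.\<close>

type_synonym 'p chart = "'p set \<times> ('p \<Rightarrow> real^2)"

abbreviation cdom :: "'p chart \<Rightarrow> 'p set" where "cdom \<equiv> fst"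
abbreviation cmap :: "'p chart \<Rightarrow> 'p \<Rightarrow> real^2" where "cmap \<equiv> snd"

definition cimg :: "'p chart \<Rightarrow> (real^2) set" where
  "cimg c = cmap c ` cdom c"

definition cinv :: "'p chart \<Rightarrow> real^2 \<Rightarrow> 'p" where
  "cinv c = inv_into (cdom c) (cmap c)"

definition is_chart :: "'p::topological_space chart \<Rightarrow> bool" where
  "is_chart c \<longleftrightarrow> open (cdom c) \<and> open (cimg c) \<and> homeomorphism (cdom c) (cimg c) (cmap c) (cinv c)"

definition overlap :: "'p chart \<Rightarrow> 'p chart \<Rightarrow> (real^2) set" where
  "overlap c d = cmap c ` (cdom c \<inter> cdom d)"

definition transition :: "'p chart \<Rightarrow> 'p chart \<Rightarrow> real^2 \<Rightarrow> real^2" where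
  "transition c d = cmap d \<circ> cinv c"

text \<open>\<open>jacobian f x $ i $ j\<close> is the derivative of the \<open>i\<close>-th component in the \<open>j\<close>-th direction.\<close>

definition jacobian :: "(real^2 \<Rightarrow> real^2) \<Rightarrow> real^2 \<Rightarrow> real^2^2" where
  "jacobian f x = matrix (frechet_derivative f (at x))"

definition oriented_compatible :: "'p chart \<Rightarrow> 'p chart \<Rightarrow> bool" where
  "oriented_compatible c d \<longleftrightarrow>
     smooth_on (overlap c d) (transition c d) \<and>
     (\<forall>x\<in>overlap c d. det (jacobian (transition c d) x) > 0)"

definition oriented_smooth_structure :: "'p::topological_space chart set \<Rightarrow> bool" where
  "oriented_smooth_structure M \<longleftrightarrow>
     (\<forall>c\<in>M. is_chart c) \<and>
     (\<Union>c\<in>M. cdom c) = UNIV \<and>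
     (\<forall>c\<in>M. \<forall>d\<in>M. oriented_compatible c d) \<and>
     (\<forall>c. is_chart c \<and> (\<forall>d\<in>M. oriented_compatible c d \<and> oriented_compatible d c) \<longrightarrow> c \<in> M)"

definition closed_oriented_surface :: "'p::t2_space chart set \<Rightarrow> bool" where
  "closed_oriented_surface M \<longleftrightarrow> compact (UNIV :: 'p set) \<and> oriented_smooth_structure M"

definition smooth_fun :: "'p chart set \<Rightarrow> ('p \<Rightarrow> real) \<Rightarrow> bool" where
  "smooth_fun M f \<longleftrightarrow> (\<forall>c\<in>M. smooth_on (cimg c) (f \<circ> cinv c))"

definition partition_of_unity ::
  "'p::topological_space chart set \<Rightarrow> nat \<Rightarrow> (nat \<Rightarrow> 'p chart) \<Rightarrow> (nat \<Rightarrow> 'p \<Rightarrow> real) \<Rightarrow> bool" where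
  "partition_of_unity M N U pu \<longleftrightarrow>
     (\<forall>k<N. U k \<in> M) \<and> (\<Union>k<N. cdom (U k)) = UNIV \<and>
     (\<forall>k<N. smooth_fun M (pu k) \<and> (\<forall>p. pu k p \<ge> 0) \<and> closure {p. pu k p \<noteq> 0} \<subseteq> cdom (U k)) \<and>
     (\<forall>p. (\<Sum>k<N. pu k p) = 1)"

text \<open>Integral over the surface of a complex density, given by its coefficient \<open>w c x\<close> of \<open>d\<^sup>2x\<close> in
  each oriented chart \<open>c\<close>.\<close>

definition surface_integral ::
  "'p::topological_space chart set \<Rightarrow> ('p chart \<Rightarrow> real^2 \<Rightarrow> complex) \<Rightarrow> complex" where
  "surface_integral M w =
     (THE I. \<forall>N U pu. partition_of_unity M N U pu \<longrightarrow>
        I = (\<Sum>k<N. LINT x:cimg (U k)|lborel. pu k (cinv (U k) x) *\<^sub>R w (U k) x))"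


section \<open>Lie algebras and connections\<close>

type_synonym 'n cmat = "complex^'n^'n"

definition cscale :: "complex \<Rightarrow> 'n cmat \<Rightarrow> 'n::finite cmat" where
  "cscale z X = (\<chi> i j. z * X $ i $ j)"

definition gl_algebra :: "('n::finite cmat) set" where
  "gl_algebra = UNIV"

definition su2_algebra :: "(2 cmat) set" where
  "su2_algebra = {X. (\<forall>i j. cnj (X $ j $ i) = - X $ i $ j) \<and> trace X = 0}"

text \<open>The field of scalars is a set \<open>K\<close> of complex numbers: \<open>UNIV\<close> for \<open>\<complex>\<close>, \<open>\<real>\<close> for the reals.\<close>

definition lie_basis :: "complex set \<Rightarrow> ('n::finite cmat) set \<Rightarrow> ('b::finite \<Rightarrow> 'n cmat) \<Rightarrow> bool" where
  "lie_basis K \<gg> e \<longleftrightarrow>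
     (\<forall>\<alpha>. e \<alpha> \<in> \<gg>) \<and>
     (\<forall>X\<in>\<gg>. \<exists>!k::complex^'b. (\<forall>\<alpha>. k $ \<alpha> \<in> K) \<and> X = (\<Sum>\<alpha>\<in>UNIV. cscale (k $ \<alpha>) (e \<alpha>)))"

definition lie_coords ::
  "complex set \<Rightarrow> ('b::finite \<Rightarrow> 'n::finite cmat) \<Rightarrow> 'n cmat \<Rightarrow> complex^'b" where
  "lie_coords K e X =
     (THE k. (\<forall>\<alpha>. k $ \<alpha> \<in> K) \<and> X = (\<Sum>\<alpha>\<in>UNIV. cscale (k $ \<alpha>) (e \<alpha>)))"

definition gram :: "('b::finite \<Rightarrow> 'n::finite cmat) \<Rightarrow> complex^'b^'b" where
  "gram e = (\<chi> \<alpha> \<beta>. trace (e \<alpha> ** e \<beta>))"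

text \<open>A matrix-valued one-form is the family of its local representatives: in the chart \<open>c\<close> it is
  the sum over \<open>a\<close> of \<open>(v c x $ a) dx\<^sup>a\<close>, subject to the transformation law of covectors. It is set
  to zero off the charts, so that equal one-forms are equal as functions.\<close>

type_synonym ('p, 'n) matform = "'p chart \<Rightarrow> real^2 \<Rightarrow> ('n cmat)^2"

definition one_form ::
  "'p chart set \<Rightarrow> ('n::finite cmat) set \<Rightarrow> ('p, 'n) matform \<Rightarrow> bool" where
  "one_form M \<gg> v \<longleftrightarrow>
     (\<forall>c\<in>M. smooth_on (cimg c) (v c)) \<and>
     (\<forall>c\<in>M. \<forall>x\<in>cimg c. \<forall>a. v c x $ a \<in> \<gg>) \<and>
     (\<forall>c\<in>M. \<forall>d\<in>M. \<forall>x\<in>overlap c d. \<forall>a.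
        v c x $ a =
          (\<Sum>b\<in>UNIV. (jacobian (transition c d) x $ b $ a) *\<^sub>R (v d (transition c d x) $ b))) \<and>
     (\<forall>c x. c \<notin> M \<or> x \<notin> cimg c \<longrightarrow> v c x = 0)"

definition form_add :: "('p, 'n::finite) matform \<Rightarrow> ('p, 'n) matform \<Rightarrow> ('p, 'n) matform" where
  "form_add v w = (\<lambda>c x. v c x + w c x)"

definition form_scale :: "complex \<Rightarrow> ('p, 'n::finite) matform \<Rightarrow> ('p, 'n) matform" where
  "form_scale z v = (\<lambda>c x. \<chi> a. cscale z (v c x $ a))"

definition form_support ::
  "'p::topological_space chart set \<Rightarrow> ('p, 'n::finite) matform \<Rightarrow> 'p set" where
  "form_support M v = closure {p. \<exists>c\<in>M. p \<in> cdom c \<and> v c (cmap c p) \<noteq> 0}"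


section \<open>Curves, holonomy and Wilson loops\<close>

text \<open>A closed curve is a 1-periodic map on the real line; as a path it is its restriction to the
  unit interval.\<close>

definition velocity :: "'p chart \<Rightarrow> (real \<Rightarrow> 'p) \<Rightarrow> real \<Rightarrow> real set \<Rightarrow> real^2" where
  "velocity c \<gamma> t S = vector_derivative (cmap c \<circ> \<gamma>) (at t within S)"

definition smooth_simple_closed_curve ::
  "'p::topological_space chart set \<Rightarrow> (real \<Rightarrow> 'p) \<Rightarrow> bool" where
  "smooth_simple_closed_curve M \<gamma> \<longleftrightarrow>
     (\<forall>t. \<gamma> (t + 1) = \<gamma> t) \<and>
     continuous_on UNIV \<gamma> \<and>
     (\<forall>c\<in>M. smooth_on {t. \<gamma> t \<in> cdom c} (cmap c \<circ> \<gamma>)) \<and>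
     (\<forall>c\<in>M. \<forall>t. \<gamma> t \<in> cdom c \<longrightarrow> velocity c \<gamma> t UNIV \<noteq> 0) \<and>
     simple_path \<gamma>"

text \<open>The finite exceptional set allows for piecewise smooth paths, such as concatenations.
  The sum is \<open>A\<close> applied to the velocity vector, written in the chart \<open>c\<close>.\<close>

definition parallel_transport ::
  "'p chart set \<Rightarrow> ('p, 'n::finite) matform \<Rightarrow> (real \<Rightarrow> 'p) \<Rightarrow> (real \<Rightarrow> 'n cmat) \<Rightarrow> bool" where
  "parallel_transport M A \<gamma> h \<longleftrightarrow>
     h 0 = mat 1 \<and> continuous_on {0..1} h \<and>
     (\<exists>S. finite S \<and> (\<forall>t\<in>{0..1} - S. \<forall>c\<in>M. \<gamma> t \<in> cdom c \<longrightarrow>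
        (h has_vector_derivative
           h t ** (\<Sum>a\<in>UNIV. (velocity c \<gamma> t {0..1} $ a) *\<^sub>R (A c (cmap c (\<gamma> t)) $ a)))
        (at t within {0..1})))"

definition hol :: "'p chart set \<Rightarrow> (real \<Rightarrow> 'p) \<Rightarrow> ('p, 'n::finite) matform \<Rightarrow> 'n cmat" where
  "hol M \<gamma> A = (THE H. \<exists>h. parallel_transport M A \<gamma> h \<and> h 1 = H)"

definition wilson :: "'p chart set \<Rightarrow> (real \<Rightarrow> 'p) \<Rightarrow> ('p, 'n::finite) matform \<Rightarrow> complex" where
  "wilson M \<gamma> A = trace (hol M \<gamma> A)"

definition param :: "(real \<Rightarrow> 'p) \<Rightarrow> 'p \<Rightarrow> real" where
  "param \<gamma> p = (THE t. t \<in> {0..<1} \<and> \<gamma> t = p)"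

definition intersections :: "(real \<Rightarrow> 'p) \<Rightarrow> (real \<Rightarrow> 'p) \<Rightarrow> 'p set" where
  "intersections \<gamma> \<gamma>' = range \<gamma> \<inter> range \<gamma>'"

definition transversal_at ::
  "'p chart set \<Rightarrow> (real \<Rightarrow> 'p) \<Rightarrow> (real \<Rightarrow> 'p) \<Rightarrow> 'p \<Rightarrow> bool" where
  "transversal_at M \<gamma> \<gamma>' p \<longleftrightarrow>
     (\<forall>c\<in>M. p \<in> cdom c \<longrightarrow>
        span {velocity c \<gamma> (param \<gamma> p) UNIV, velocity c \<gamma>' (param \<gamma>' p) UNIV} = UNIV)"

definition crossing_sign ::
  "'p chart set \<Rightarrow> (real \<Rightarrow> 'p) \<Rightarrow> (real \<Rightarrow> 'p) \<Rightarrow> 'p \<Rightarrow> complex" where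
  "crossing_sign M \<gamma> \<gamma>' p =
     (if \<exists>c\<in>M. p \<in> cdom c \<and>
          det (vector [velocity c \<gamma> (param \<gamma> p) UNIV, velocity c \<gamma>' (param \<gamma>' p) UNIV] :: real^2^2) > 0
      then 1 else -1)"

definition loop_product ::
  "(real \<Rightarrow> 'p::topological_space) \<Rightarrow> 'p \<Rightarrow> (real \<Rightarrow> 'p) \<Rightarrow> real \<Rightarrow> 'p" where
  "loop_product \<gamma> p \<gamma>' = shiftpath (param \<gamma> p) \<gamma> +++ shiftpath (param \<gamma>' p) \<gamma>'"


section \<open>The Poisson bracket\<close>

text \<open>\<open>D c x $ a $ \<alpha>\<close> is the functional derivative of \<open>f\<close> with respect to the component
  \<open>A\<^sup>a\<^sub>\<alpha>(x)\<close> in the chart \<open>c\<close>. The differential \<open>L\<close> of \<open>f\<close> at \<open>A\<close> is \<open>K\<close>-linear; since it is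
  determined by its values on forms supported in a single chart, it suffices to represent it by \<open>D\<close>
  on these.\<close>

definition has_functional_derivative ::
  "'p::topological_space chart set \<Rightarrow> complex set \<Rightarrow> ('n::finite cmat) set \<Rightarrow> ('b::finite \<Rightarrow> 'n cmat) \<Rightarrow>
   (('p, 'n) matform \<Rightarrow> complex) \<Rightarrow> ('p, 'n) matform \<Rightarrow>
   ('p chart \<Rightarrow> real^2 \<Rightarrow> (complex^'b)^2) \<Rightarrow> bool" where
  "has_functional_derivative M K \<gg> e f A D \<longleftrightarrow>
     (\<forall>c\<in>M. smooth_on (cimg c) (D c)) \<and>
     (\<forall>c x. c \<notin> M \<or> x \<notin> cimg c \<longrightarrow> D c x = 0) \<and>
     (\<exists>L :: ('p, 'n) matform \<Rightarrow> complex.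
        (\<forall>v w. one_form M \<gg> v \<longrightarrow> one_form M \<gg> w \<longrightarrow> L (form_add v w) = L v + L w) \<and>
        (\<forall>z\<in>K. \<forall>v. one_form M \<gg> v \<longrightarrow> L (form_scale z v) = z * L v) \<and>
        (\<forall>v. one_form M \<gg> v \<longrightarrow>
           ((\<lambda>t::real. f (form_add A (form_scale (of_real t) v))) has_vector_derivative L v) (at 0)) \<and>
        (\<forall>c\<in>M. \<forall>v. one_form M \<gg> v \<and> form_support M v \<subseteq> cdom c \<longrightarrow>
           L v = (LINT x:cimg c|lborel.
                    (\<Sum>a\<in>UNIV. \<Sum>\<alpha>\<in>UNIV. D c x $ a $ \<alpha> * lie_coords K e (v c x $ a) $ \<alpha>))))"

definition functional_derivative ::
  "'p::topological_space chart set \<Rightarrow> complex set \<Rightarrow> ('n::finite cmat) set \<Rightarrow> ('b::finite \<Rightarrow> 'n cmat) \<Rightarrow>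
   (('p, 'n) matform \<Rightarrow> complex) \<Rightarrow> ('p, 'n) matform \<Rightarrow>
   'p chart \<Rightarrow> real^2 \<Rightarrow> (complex^'b)^2" where
  "functional_derivative M K \<gg> e f A = (THE D. has_functional_derivative M K \<gg> e f A D)"

definition eps :: "2 \<Rightarrow> 2 \<Rightarrow> complex" where
  "eps a b = (if a = 1 \<and> b = 2 then 1 else if a = 2 \<and> b = 1 then -1 else 0)"

definition poisson_bracket ::
  "'p::topological_space chart set \<Rightarrow> complex set \<Rightarrow> ('n::finite cmat) set \<Rightarrow> ('b::finite \<Rightarrow> 'n cmat) \<Rightarrow>
   (('p, 'n) matform \<Rightarrow> complex) \<Rightarrow> (('p, 'n) matform \<Rightarrow> complex) \<Rightarrow> ('p, 'n) matform \<Rightarrow> complex" where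
  "poisson_bracket M K \<gg> e f h A =
     surface_integral M (\<lambda>c x.
       \<Sum>\<alpha>\<in>UNIV. \<Sum>\<beta>\<in>UNIV. \<Sum>a\<in>UNIV. \<Sum>b\<in>UNIV.
         eps a b * matrix_inv (gram e) $ \<alpha> $ \<beta> *
         functional_derivative M K \<gg> e f A c x $ a $ \<alpha> *
         functional_derivative M K \<gg> e h A c x $ b $ \<beta>)"


section \<open>Regularization\<close>

definition mollifier :: "(real^2 \<Rightarrow> real) \<Rightarrow> bool" where
  "mollifier \<rho> \<longleftrightarrow> smooth_on UNIV \<rho> \<and> compact (closure {y. \<rho> y \<noteq> 0}) \<and> (\<forall>y. \<rho> y \<ge> 0) \<and>
     (LINT y|lborel. \<rho> y) = 1"

definition smoothing_data ::
  "'p::topological_space chart set \<Rightarrow> nat \<Rightarrow> (nat \<Rightarrow> 'p chart) \<Rightarrow> (nat \<Rightarrow> 'p \<Rightarrow> real) \<Rightarrow>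
   (nat \<Rightarrow> 'p \<Rightarrow> real) \<Rightarrow> (real^2 \<Rightarrow> real) \<Rightarrow> bool" where
  "smoothing_data M N U pu cf \<rho> \<longleftrightarrow>
     partition_of_unity M N U pu \<and>
     (\<forall>k<N. smooth_fun M (cf k) \<and>
        compact (closure {p. cf k p \<noteq> 0}) \<and> closure {p. cf k p \<noteq> 0} \<subseteq> cdom (U k) \<and>
        (\<exists>V. open V \<and> closure {p. pu k p \<noteq> 0} \<subseteq> V \<and> (\<forall>p\<in>V. cf k p = 1))) \<and>
     mollifier \<rho>"

text \<open>In \<open>local_smoothing\<close> the integrand vanishes off the chart, because one-forms do.\<close>

definition local_smoothing ::
  "'p chart \<Rightarrow> ('p \<Rightarrow> real) \<Rightarrow> ('p \<Rightarrow> real) \<Rightarrow> (real^2 \<Rightarrow> real) \<Rightarrow> real \<Rightarrow>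
   (real^2 \<Rightarrow> ('n::finite cmat)^2) \<Rightarrow> real^2 \<Rightarrow> ('n cmat)^2" where
  "local_smoothing d u \<psi> \<rho> s w x =
     \<psi> (cinv d x) *\<^sub>R
     (LINT y|lborel. (\<rho> ((1 / s) *\<^sub>R (x - y)) / s\<^sup>2) *\<^sub>R (u (cinv d y) *\<^sub>R w y))"

text \<open>Extension by zero to the whole surface of a one-form on the chart \<open>d\<close>, given in the
  coordinates of \<open>d\<close>.\<close>

definition extend_form ::
  "'p chart set \<Rightarrow> 'p chart \<Rightarrow> (real^2 \<Rightarrow> ('n::finite cmat)^2) \<Rightarrow> ('p, 'n) matform" where
  "extend_form M d w = (\<lambda>c x.
     if c \<in> M \<and> x \<in> overlap c d
     then (\<chi> a. \<Sum>b\<in>UNIV. (jacobian (transition c d) x $ b $ a) *\<^sub>R (w (transition c d x) $ b))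
     else 0)"

definition smoothing ::
  "'p chart set \<Rightarrow> nat \<Rightarrow> (nat \<Rightarrow> 'p chart) \<Rightarrow> (nat \<Rightarrow> 'p \<Rightarrow> real) \<Rightarrow> (nat \<Rightarrow> 'p \<Rightarrow> real) \<Rightarrow>
   (real^2 \<Rightarrow> real) \<Rightarrow> real \<Rightarrow> ('p, 'n::finite) matform \<Rightarrow> ('p, 'n) matform" where
  "smoothing M N U pu cf \<rho> s v = (\<lambda>c x.
     \<Sum>k<N. extend_form M (U k) (local_smoothing (U k) (pu k) (cf k) \<rho> s (v (U k))) c x)"

text \<open>\<open>has_regularized_bracket M K \<gg> e R f h A B\<close>: the bracket of \<open>f\<close> and \<open>h\<close> at \<open>A\<close>, regularized
  by the smoothing operators \<open>R s\<close>, is defined and equal to \<open>B\<close>. Demanding the functional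
  derivatives to exist keeps the value independent of the totalization of the definite
  descriptions above.\<close>

definition has_regularized_bracket ::
  "'p::topological_space chart set \<Rightarrow> complex set \<Rightarrow> ('n::finite cmat) set \<Rightarrow> ('b::finite \<Rightarrow> 'n cmat) \<Rightarrow>
   (real \<Rightarrow> ('p, 'n) matform \<Rightarrow> ('p, 'n) matform) \<Rightarrow>
   (('p, 'n) matform \<Rightarrow> complex) \<Rightarrow> (('p, 'n) matform \<Rightarrow> complex) \<Rightarrow> ('p, 'n) matform \<Rightarrow>
   complex \<Rightarrow> bool" where
  "has_regularized_bracket M K \<gg> e R f h A B \<longleftrightarrow>
     (\<forall>\<^sub>F s in at_right 0.
        (\<exists>D. has_functional_derivative M K \<gg> e (\<lambda>A. f (R s A)) A D) \<and>
        (\<exists>D. has_functional_derivative M K \<gg> e (\<lambda>A. h (R s A)) A D)) \<and>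
     ((\<lambda>s. poisson_bracket M K \<gg> e (\<lambda>A. f (R s A)) (\<lambda>A. h (R s A)) A) \<longlongrightarrow> B) (at_right 0)"

end

theory Submission
  imports Defs "HOL-Analysis.Analysis"
begin

text \<open>
  Smoothing replaces the distributional derivative of \<open>W\<^sub>C\<close> by an honest density: if \<open>H\<^sub>s(t)\<close> denotes the
  holonomy of \<open>C\<close> based at \<open>C(t)\<close> for the smoothed connection, then by Duhamel's formula the derivative
  of \<open>W\<^sub>C \<circ> R\<^sub>s\<close> in the direction \<open>v\<close> is the integral of \<open>tr (H\<^sub>s(t) (R\<^sub>s v)(C'(t)))\<close>, and Fubini turns this
  into the pairing of \<open>v\<close> with a sum over the charts of the integrals over \<open>t\<close> of
  \<open>\<chi>\<^sub>k(y) \<psi>\<^sub>k(C(t)) \<rho>\<^sub>s(C(t) - y) C'(t) H\<^sub>s(t)\<close>. In the regularized bracket two such densities are multiplied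
  and integrated over the surface. The product of the two mollifiers is concentrated where \<open>x\<close>, \<open>C(t)\<close>
  and \<open>C'(t')\<close> are within \<open>O(s)\<close> of each other, that is, at the crossings; there the map
  \<open>(t, t', x) \<mapsto> (C(t) - x, C'(t') - x)\<close>, read in the charts, has an invertible derivative by
  transversality, so rescaling \<open>(t, t', x)\<close> by \<open>s\<close> and dominated convergence give the limit
  \<open>\<plusminus>1\<close> times the inverse trace form applied to the two holonomies. The cutoffs add up to \<open>1\<close>, and the
  theorem follows from the completeness relations of \<open>gl(n)\<close> and \<open>su(2)\<close>.
\<close>

section \<open>Calculus of the classes \<open>Ck_on\<close>\<close>

text \<open>The scaling is critical: two mollifiers contribute s^-4, exactly compensated by the four
  variables (t, t', x). The mollifiers live in two charts and the surface integral in a third. The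
  determinants of the transitions enter once as density weights and once, inverted and in absolute
  value, through the rescaled kernel; charts being oriented, they cancel. What is left of the
  tangents is their cross product divided by its absolute value, the crossing sign. The holonomies
  vary with s as well. A Lipschitz estimate in the generator makes them converge uniformly in the
  base time, which supplies the bound for dominated convergence. Functional derivative, surface
  integral and holonomy are definite descriptions, so each needs a uniqueness proof: test forms, a
  common refinement of two partitions of unity, and the inverse flow. For SU(2) the holonomies do
  not lie in the Lie algebra. Their traceless parts lie in its complex span, and Q^-1 = tr Q - Q for
  det Q = 1 converts a product of traces into a reversed loop.\<close>

lemma has_derivative_frechet:
  "f differentiable (at x) \<Longrightarrow> (f has_derivative frechet_derivative f (at x)) (at x)"
  by (simp add: frechet_derivative_works)

lemma frechet_derivative_eqI:
  "(f has_derivative f') (at x) \<Longrightarrow> frechet_derivative f (at x) = f'"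
  using frechet_derivative_at by metis

lemma Ck_on_subset: "Ck_on k S f \<Longrightarrow> T \<subseteq> S \<Longrightarrow> Ck_on k T f"
proof (induction k arbitrary: f)
  case 0 then show ?case by (auto intro: continuous_on_subset)
next
  case (Suc k) then show ?case by auto
qed

lemma Ck_on_SucD: "Ck_on (Suc k) S f \<Longrightarrow> Ck_on k S f"
proof (induction k arbitrary: f)
  case 0 then show ?case
    by (auto intro!: differentiable_imp_continuous_on differentiable_at_imp_differentiable_on)
next
  case (Suc k)
  show ?case unfolding Ck_on.simps(2)[of k]
  proof (intro conjI allI ballI)
    fix x assume "x \<in> S" then show "f differentiable (at x)"
      using Suc.prems unfolding Ck_on.simps(2) by blast
  next
    fix v have "Ck_on (Suc k) S (\<lambda>x. frechet_derivative f (at x) v)"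
      using Suc.prems unfolding Ck_on.simps(2)[of "Suc k"] by blast
    then show "Ck_on k S (\<lambda>x. frechet_derivative f (at x) v)" by (rule Suc.IH)
  qed
qed

lemma Ck_on_continuous: "Ck_on k S f \<Longrightarrow> continuous_on S f"
proof (induction k)
  case (Suc k) then show ?case using Ck_on_SucD by blast
qed simp

text \<open>Openness of \<open>S\<close> enters because the derivatives are taken in the whole
  space: agreement on \<open>S\<close> must be agreement near each of its points.\<close>

lemma Ck_on_cong:
  assumes "open S" "\<And>x. x \<in> S \<Longrightarrow> f x = g x" "Ck_on k S f" shows "Ck_on k S g"
  using assms(2,3)
proof (induction k arbitrary: f g)
  case 0 then show ?case by (auto cong: continuous_on_cong)
next
  case (Suc k)
  have der: "(g has_derivative frechet_derivative f (at x)) (at x)" if "x \<in> S" for x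
    using Suc.prems that assms(1)
    by (auto intro!: has_derivative_transform_within_open[of f _ x UNIV S g] has_derivative_frechet)
  have "Ck_on k S (\<lambda>x. frechet_derivative g (at x) v)" for v
  proof (rule Suc.IH[of "\<lambda>x. frechet_derivative f (at x) v"])
    show "frechet_derivative f (at x) v = frechet_derivative g (at x) v" if "x \<in> S" for x
      by (simp add: frechet_derivative_eqI[OF der[OF that]])
  qed (use Suc.prems in auto)
  then show ?case using der by (auto simp: differentiable_def)
qed

text \<open>Lets later proofs exhibit a convenient derivative \<open>f'\<close> instead of handling
  the choice made by \<open>frechet_derivative\<close>.\<close>

lemma Ck_on_SucI:
  assumes "open S" "\<And>x. x \<in> S \<Longrightarrow> (f has_derivative f' x) (at x)"
    "\<And>v. Ck_on k S (\<lambda>x. f' x v)"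
  shows "Ck_on (Suc k) S f"
proof -
  have "Ck_on k S (\<lambda>x. frechet_derivative f (at x) v)" for v
    by (rule Ck_on_cong[OF assms(1) _ assms(3)[of v]]) (simp add: frechet_derivative_eqI[OF assms(2)])
  then show ?thesis using assms(2) by (auto simp: differentiable_def)
qed

lemma Ck_on_SucE:
  assumes "Ck_on (Suc k) S f" "x \<in> S"
  shows "(f has_derivative frechet_derivative f (at x)) (at x)"
  using assms by (auto intro: has_derivative_frechet)

lemma Ck_on_zero [simp]: "Ck_on k S (\<lambda>x. 0)"
  by (induction k) (auto simp: frechet_derivative_const)

lemma Ck_on_const [simp]: "Ck_on k S (\<lambda>x. c)"
  by (cases k) (auto simp: frechet_derivative_const)

lemma Ck_on_bounded_linear:
  assumes "bounded_linear L" "open S" "Ck_on k S f" shows "Ck_on k S (\<lambda>x. L (f x))"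
  using assms(3)
proof (induction k arbitrary: f)
  case 0 then show ?case
    by (auto intro!: bounded_linear.continuous_on[OF assms(1)])
next
  case (Suc k)
  show ?case
  proof (rule Ck_on_SucI[OF assms(2)])
    show "((\<lambda>x. L (f x)) has_derivative (\<lambda>v. L (frechet_derivative f (at x) v))) (at x)" if "x \<in> S" for x
      by (rule bounded_linear.has_derivative[OF assms(1) Ck_on_SucE[OF Suc.prems that]])
    show "Ck_on k S (\<lambda>x. L (frechet_derivative f (at x) v))" for v
      using Suc.prems by (auto intro: Suc.IH)
  qed
qed

lemma Ck_on_add:
  assumes "open S" "Ck_on k S f" "Ck_on k S g" shows "Ck_on k S (\<lambda>x. f x + g x)"
  using assms(2,3)
proof (induction k arbitrary: f g)
  case 0 then show ?case by (auto intro: continuous_on_add)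
next
  case (Suc k)
  show ?case
  proof (rule Ck_on_SucI[OF assms(1)])
    show "((\<lambda>x. f x + g x) has_derivative (\<lambda>v. frechet_derivative f (at x) v + frechet_derivative g (at x) v)) (at x)" if "x \<in> S" for x
      by (intro has_derivative_add Ck_on_SucE[OF Suc.prems(1) that] Ck_on_SucE[OF Suc.prems(2) that])
    show "Ck_on k S (\<lambda>x. frechet_derivative f (at x) v + frechet_derivative g (at x) v)" for v
      using Suc.prems by (auto intro: Suc.IH)
  qed
qed

lemma Ck_on_sum:
  assumes "open S" "\<And>i. i \<in> I \<Longrightarrow> Ck_on k S (f i)" shows "Ck_on k S (\<lambda>x. \<Sum>i\<in>I. f i x)"
  using assms(2) by (induction I rule: infinite_finite_induct) (auto intro: Ck_on_add[OF assms(1)])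

lemma Ck_on_bilinear:
  assumes "bounded_bilinear B" "open S" "Ck_on k S f" "Ck_on k S g"
  shows "Ck_on k S (\<lambda>x. B (f x) (g x))"
  using assms(3,4)
proof (induction k arbitrary: f g)
  case 0 then show ?case by (auto intro: bounded_bilinear.continuous_on[OF assms(1)])
next
  case (Suc k)
  show ?case
  proof (rule Ck_on_SucI[OF assms(2)])
    show "((\<lambda>x. B (f x) (g x)) has_derivative
        (\<lambda>v. B (f x) (frechet_derivative g (at x) v) + B (frechet_derivative f (at x) v) (g x))) (at x)"
      if "x \<in> S" for x
      by (rule bounded_bilinear.FDERIV[OF assms(1) Ck_on_SucE[OF Suc.prems(1) that] Ck_on_SucE[OF Suc.prems(2) that]])
    show "Ck_on k S (\<lambda>x. B (f x) (frechet_derivative g (at x) v) + B (frechet_derivative f (at x) v) (g x))" for v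
      using Suc.prems Ck_on_SucD[OF Suc.prems(1)] Ck_on_SucD[OF Suc.prems(2)]
      by (auto intro!: Ck_on_add[OF assms(2)] Suc.IH)
  qed
qed

text \<open>By the chain rule the derivative of \<open>f\<close> is taken in a direction that varies
  with the point, which the recursion of \<open>Ck_on\<close> does not allow. Expanding that
  direction in a basis leaves derivatives of \<open>f\<close> in fixed directions with scalar
  coefficients, so the product rule and the induction hypothesis apply.\<close>

lemma Ck_on_compose:
  fixes g :: "'a::real_normed_vector \<Rightarrow> 'b::euclidean_space" and f :: "'b \<Rightarrow> 'c::real_normed_vector"
  assumes "open S" "open T" "Ck_on k T f" "Ck_on k S g" "g ` S \<subseteq> T"
  shows "Ck_on k S (\<lambda>x. f (g x))"
  using assms(3,4)
proof (induction k arbitrary: f)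
  case 0 then show ?case using assms(5) by (auto intro: continuous_on_compose2)
next
  case (Suc k)
  have g: "Ck_on k S g" by (rule Ck_on_SucD[OF Suc.prems(2)])
  show ?case
  proof (rule Ck_on_SucI[OF assms(1)])
    fix x assume x: "x \<in> S"
    then have gx: "g x \<in> T" using assms(5) by auto
    show "((\<lambda>x. f (g x)) has_derivative
      (\<lambda>v. \<Sum>i\<in>Basis. (frechet_derivative g (at x) v \<bullet> i) *\<^sub>R frechet_derivative f (at (g x)) i)) (at x)"
    proof (rule has_derivative_eq_rhs[OF diff_chain_at[OF Ck_on_SucE[OF Suc.prems(2) x] Ck_on_SucE[OF Suc.prems(1) gx], unfolded o_def]])
      have lin: "linear (frechet_derivative f (at (g x)))"
        using Ck_on_SucE[OF Suc.prems(1) gx] by (rule has_derivative_linear)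
      have "frechet_derivative f (at (g x)) w = (\<Sum>i\<in>Basis. (w \<bullet> i) *\<^sub>R frechet_derivative f (at (g x)) i)" for w
        by (subst euclidean_representation[symmetric, of w]) (simp add: linear_sum[OF lin] linear_cmul[OF lin])
      then show "(\<lambda>v. frechet_derivative f (at (g x)) (frechet_derivative g (at x) v)) =
        (\<lambda>v. \<Sum>i\<in>Basis. (frechet_derivative g (at x) v \<bullet> i) *\<^sub>R frechet_derivative f (at (g x)) i)" by blast
    qed
  next
    show "Ck_on k S (\<lambda>x. \<Sum>i\<in>Basis. (frechet_derivative g (at x) v \<bullet> i) *\<^sub>R frechet_derivative f (at (g x)) i)" for v
    proof (intro Ck_on_sum[OF assms(1)] Ck_on_bilinear[OF bounded_bilinear_scaleR assms(1)])
      fix i :: 'b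
      show "Ck_on k S (\<lambda>x. frechet_derivative g (at x) v \<bullet> i)"
        using Suc.prems(2) by (intro Ck_on_bounded_linear[OF bounded_linear_inner_left assms(1)]) auto
      show "Ck_on k S (\<lambda>x. frechet_derivative f (at (g x)) i)"
        using Suc.prems(1) g by (intro Suc.IH) auto
    qed
  qed
qed

lemma Ck_on_Un:
  assumes "open S" "open T" "Ck_on k S f" "Ck_on k T f" shows "Ck_on k (S \<union> T) f"
  using assms(3,4)
proof (induction k arbitrary: f)
  case 0 then show ?case using assms by (auto intro: continuous_on_open_Un)
next
  case (Suc k) then show ?case by auto
qed

text \<open>Used for everything that is expressed in a chart and cut off inside it: the formula is
  meaningful on the open set \<open>S\<close>, the support lies in the closed set \<open>L\<close>,
  and these two open sets \<open>S\<close> and \<open>- L\<close> cover the space.\<close>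

lemma continuous_on_extend_zero:
  fixes f :: "'a::topological_space \<Rightarrow> 'b::real_normed_vector"
  assumes "open S" "continuous_on S f" "closed L" "L \<subseteq> S" "\<And>x. x \<notin> L \<Longrightarrow> f x = 0"
  shows "continuous_on UNIV f"
proof -
  have "continuous_on (- L) f \<longleftrightarrow> continuous_on (-L) (\<lambda>x. 0::'b)"
    by (intro continuous_on_cong) (use assms in auto)
  then have "continuous_on (S \<union> - L) f" using assms by (intro continuous_on_open_Un) auto
  moreover have "S \<union> - L = UNIV" using assms by auto
  ultimately show ?thesis by simp
qed

section \<open>Closure properties of infinitely differentiable maps\<close>

lemma smooth_on_cong: "open S \<Longrightarrow> (\<And>x. x \<in> S \<Longrightarrow> f x = g x) \<Longrightarrow> smooth_on S f \<Longrightarrow> smooth_on S g"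
  unfolding smooth_on_def by (intro allI Ck_on_cong[of S f g]) auto

lemma smooth_on_subset: "smooth_on S f \<Longrightarrow> T \<subseteq> S \<Longrightarrow> smooth_on T f"
  unfolding smooth_on_def by (intro allI Ck_on_subset[of _ S f T]) auto

lemma smooth_on_continuous: "smooth_on S f \<Longrightarrow> continuous_on S f"
  unfolding smooth_on_def by (simp add: Ck_on_continuous[of 0])

lemma smooth_on_has_derivative:
  assumes "smooth_on S f" "x \<in> S" shows "(f has_derivative frechet_derivative f (at x)) (at x)"
  using assms Ck_on_SucE[of 0 S f x] unfolding smooth_on_def by blast

lemma smooth_on_frechet: "smooth_on S f \<Longrightarrow> smooth_on S (\<lambda>x. frechet_derivative f (at x) v)"
  unfolding smooth_on_def
proof
  fix k assume "\<forall>k. Ck_on k S f"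
  then have "Ck_on (Suc k) S f" by blast
  then show "Ck_on k S (\<lambda>x. frechet_derivative f (at x) v)" by simp
qed

lemma smooth_on_const [simp]: "smooth_on S (\<lambda>x. c)"
  unfolding smooth_on_def by simp

lemma smooth_on_bounded_linear: "bounded_linear L \<Longrightarrow> open S \<Longrightarrow> smooth_on S f \<Longrightarrow> smooth_on S (\<lambda>x. L (f x))"
  unfolding smooth_on_def by (intro allI Ck_on_bounded_linear[of L S _ f]) auto

lemma smooth_on_add: "open S \<Longrightarrow> smooth_on S f \<Longrightarrow> smooth_on S g \<Longrightarrow> smooth_on S (\<lambda>x. f x + g x)"
  unfolding smooth_on_def by (intro allI Ck_on_add[of S _ f g]) auto

lemma smooth_on_sum: "open S \<Longrightarrow> (\<And>i. i \<in> I \<Longrightarrow> smooth_on S (f i)) \<Longrightarrow> smooth_on S (\<lambda>x. \<Sum>i\<in>I. f i x)"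
  unfolding smooth_on_def by (intro allI Ck_on_sum[of S I _ f]) auto

lemma smooth_on_bilinear:
  "bounded_bilinear B \<Longrightarrow> open S \<Longrightarrow> smooth_on S f \<Longrightarrow> smooth_on S g \<Longrightarrow> smooth_on S (\<lambda>x. B (f x) (g x))"
  unfolding smooth_on_def by (intro allI Ck_on_bilinear[of B S _ f g]) auto

lemma smooth_on_scaleR: "open S \<Longrightarrow> smooth_on S f \<Longrightarrow> smooth_on S g \<Longrightarrow> smooth_on S (\<lambda>x. f x *\<^sub>R g x)"
  by (rule smooth_on_bilinear[OF bounded_bilinear_scaleR])

lemma smooth_on_mult:
  fixes f g :: "'a::real_normed_vector \<Rightarrow> 'b::real_normed_algebra"
  shows "open S \<Longrightarrow> smooth_on S f \<Longrightarrow> smooth_on S g \<Longrightarrow> smooth_on S (\<lambda>x. f x * g x)"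
  by (rule smooth_on_bilinear[OF bounded_bilinear_mult])

lemma smooth_on_compose:
  fixes g :: "'a::real_normed_vector \<Rightarrow> 'b::euclidean_space"
  shows "open S \<Longrightarrow> open T \<Longrightarrow> smooth_on T f \<Longrightarrow> smooth_on S g \<Longrightarrow> g ` S \<subseteq> T \<Longrightarrow> smooth_on S (\<lambda>x. f (g x))"
  unfolding smooth_on_def by (intro allI Ck_on_compose[of S T _ f g]) auto

lemma smooth_on_Un: "open S \<Longrightarrow> open T \<Longrightarrow> smooth_on S f \<Longrightarrow> smooth_on T f \<Longrightarrow> smooth_on (S \<union> T) f"
  unfolding smooth_on_def by (intro allI Ck_on_Un[of S T _ f]) auto

lemma smooth_on_ident: assumes "open S" shows "smooth_on S (\<lambda>x. x)"
  unfolding smooth_on_def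
proof
  show "Ck_on k S (\<lambda>x. x)" for k
  proof (cases k)
    case (Suc m)
    show ?thesis unfolding Suc by (rule Ck_on_SucI[OF assms, of _ "\<lambda>x v. v"]) auto
  qed simp
qed

lemma smooth_on_vec_nth:
  fixes f :: "'a::real_normed_vector \<Rightarrow> 'b::real_normed_vector^'i"
  shows "open S \<Longrightarrow> smooth_on S f \<Longrightarrow> smooth_on S (\<lambda>x. f x $ i)"
  by (rule smooth_on_bounded_linear[OF bounded_linear_vec_nth])

lemma bounded_linear_axis: "bounded_linear (axis i :: 'b::euclidean_space \<Rightarrow> 'b^'i)"
proof -
  have "linear (axis i :: 'b \<Rightarrow> 'b^'i)"
    by (rule linearI) (simp_all add: vec_eq_iff axis_def)
  then show ?thesis by (simp add: linear_conv_bounded_linear)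
qed

lemma vec_eq_sum_axis: "(\<chi> i. f i) = (\<Sum>i\<in>UNIV. axis i (f i) :: 'b::real_normed_vector^'i)"
proof -
  have "(\<Sum>i\<in>UNIV. axis i (f i)) $ j = f j" for j
    by (simp add: axis_def sum.delta)
  then show ?thesis by (simp add: vec_eq_iff)
qed

lemma smooth_on_vec_lambda:
  fixes f :: "'i::finite \<Rightarrow> 'a::real_normed_vector \<Rightarrow> 'b::euclidean_space"
  assumes "open S" "\<And>i. smooth_on S (f i)" shows "smooth_on S (\<lambda>x. \<chi> i. f i x)"
  unfolding vec_eq_sum_axis
  by (intro smooth_on_sum assms(1) smooth_on_bounded_linear[OF bounded_linear_axis] assms(2))

section \<open>Smoothness of curve integrals of translates\<close>

text \<open>The derivative in a direction v under the integral has the same shape, with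
  \<open>r\<close> replaced by minus its derivative along v; hence the induction over
  \<open>k\<close> with \<open>r\<close> arbitrary. The path \<open>c\<close> is controlled only on
  \<open>S\<close>, and the factor \<open>\<phi>\<close> vanishes elsewhere.\<close>

lemma Ck_on_translate_integral:
  fixes r :: "real^2 \<Rightarrow> real" and \<phi> :: "real \<Rightarrow> 'b::euclidean_space" and c :: "real \<Rightarrow> real^2"
  assumes S: "open S" "continuous_on S c" and L: "closed L" "L \<subseteq> S" "\<And>t. t \<notin> L \<Longrightarrow> \<phi> t = 0"
    and cont_factor: "continuous_on UNIV \<phi>"
  shows "Ck_on k UNIV r \<Longrightarrow> Ck_on k UNIV (\<lambda>y. integral (cbox a b) (\<lambda>t. r (c t - y) *\<^sub>R \<phi> t))"
proof (induction k arbitrary: r)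
  have cont: "continuous_on (UNIV :: ((real^2) \<times> real) set) (\<lambda>(y, t). q (c t - y) *\<^sub>R \<phi> t)"
    if q: "continuous_on UNIV q" for q :: "real^2 \<Rightarrow> real"
  proof (rule continuous_on_extend_zero[of "UNIV \<times> S" _ "UNIV \<times> L"])
    show "continuous_on (UNIV \<times> S) (\<lambda>(y, t). q (c t - y) *\<^sub>R \<phi> t)"
      unfolding case_prod_beta
      by (intro continuous_intros continuous_on_compose2[OF q] continuous_on_compose2[OF S(2)]
          continuous_on_compose2[OF cont_factor]) auto
  next
    show "(case z of (y, t) \<Rightarrow> q (c t - y) *\<^sub>R \<phi> t) = 0" if "z \<notin> UNIV \<times> L" for z
      using L(3) that by (cases z) auto
  qed (use S L in \<open>auto intro: open_Times closed_Times\<close>)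
  {
    case 0
    then show ?case
      unfolding Ck_on.simps(1) by (intro integral_continuous_on_param continuous_on_subset[OF cont]) auto
  next
    case (Suc k)
    \<comment> \<open>The rule for differentiating under the integral asks for a continuous family
      of bounded linear maps, so the derivative is rebuilt as a \<open>blinfun\<close> from its
      values on the basis.\<close>
    define bl where "bl = (\<lambda>z. blinfun_of_matrix (\<lambda>(i::real) j. frechet_derivative r (at z) j) :: (real^2) \<Rightarrow>\<^sub>L real)"
    have fr: "(r has_derivative frechet_derivative r (at z)) (at z)" for z
      using Ck_on_SucE[OF Suc.prems] by auto
    have frc: "continuous_on UNIV (\<lambda>z. frechet_derivative r (at z) v)" for v
      using Suc.prems by (intro Ck_on_continuous[of k]) auto
    have blA: "blinfun_apply (bl z) v = frechet_derivative r (at z) v" for z v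
    proof -
      have lin: "linear (frechet_derivative r (at z))" using fr by (rule has_derivative_linear)
      have "frechet_derivative r (at z) v = (\<Sum>j\<in>Basis. (v \<bullet> j) *\<^sub>R frechet_derivative r (at z) j)"
        by (subst euclidean_representation[symmetric, of v]) (simp add: linear_sum[OF lin] linear_cmul[OF lin])
      then show ?thesis unfolding bl_def blinfun_of_matrix_apply by simp
    qed
    define fx where "fx = (\<lambda>y t. - (blinfun_scaleR_left (\<phi> t) o\<^sub>L bl (c t - y)))"
    have fxA: "blinfun_apply (fx y t) v = - (frechet_derivative r (at (c t - y)) v *\<^sub>R \<phi> t)" for y t v
      by (simp add: fx_def blA blinfun.minus_left)
    have contr: "continuous_on UNIV r" using Suc.prems by (rule Ck_on_continuous)
    have fxcont: "continuous_on (UNIV \<times> cbox a b) (\<lambda>(y, t). fx y t)"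
    proof (rule continuous_on_blinfun_componentwise)
      fix i :: "real^2"
      have "continuous_on (UNIV \<times> cbox a b) (\<lambda>x. - (case x of (y, t) \<Rightarrow> frechet_derivative r (at (c t - y)) i *\<^sub>R \<phi> t))"
        by (intro continuous_on_minus continuous_on_subset[OF cont[OF frc]]) auto
      then show "continuous_on (UNIV \<times> cbox a b) (\<lambda>x. blinfun_apply (case x of (y, t) \<Rightarrow> fx y t) i)"
        by (simp add: case_prod_beta fxA)
    qed
    have fxint: "fx y integrable_on cbox a b" for y
    proof (rule integrable_continuous)
      have "continuous_on (cbox a b) (\<lambda>t. (\<lambda>(y, t). fx y t) (y, t))"
        by (rule continuous_on_compose2[OF fxcont]) (auto intro!: continuous_intros)
      then show "continuous_on (cbox a b) (fx y)" by simp
    qed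
    show ?case
    proof (rule Ck_on_SucI)
      fix y :: "real^2"
      show "((\<lambda>y. integral (cbox a b) (\<lambda>t. r (c t - y) *\<^sub>R \<phi> t)) has_derivative
        blinfun_apply (integral (cbox a b) (fx y))) (at y)"
      proof (rule leibniz_rule[where U=UNIV, OF _ _ fxcont])
        show "((\<lambda>x. r (c t - x) *\<^sub>R \<phi> t) has_derivative blinfun_apply (fx x t)) (at x)" for x t
        proof -
          have "((\<lambda>x. r (c t - x)) has_derivative (\<lambda>v. frechet_derivative r (at (c t - x)) (0 - v))) (at x)"
            by (rule has_derivative_compose[OF _ fr]) (intro derivative_intros)
          from has_derivative_scaleR_left[OF this, of "\<phi> t"]
          show ?thesis
            by (rule has_derivative_eq_rhs)
              (use has_derivative_linear[OF fr] in \<open>auto simp: fun_eq_iff fxA linear_neg\<close>)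
        qed
        show "(\<lambda>t. r (c t - x) *\<^sub>R \<phi> t) integrable_on cbox a b" for x
        proof (rule integrable_continuous)
          have "continuous_on (cbox a b) (\<lambda>t. (\<lambda>(y, t). r (c t - y) *\<^sub>R \<phi> t) (x, t))"
            by (rule continuous_on_compose2[OF cont[OF contr]]) (auto intro!: continuous_intros)
          then show "continuous_on (cbox a b) (\<lambda>t. r (c t - x) *\<^sub>R \<phi> t)" by simp
        qed
      qed auto
    next
      fix v :: "real^2"
      have eq: "blinfun_apply (integral (cbox a b) (fx y)) v =
        integral (cbox a b) (\<lambda>t. (- frechet_derivative r (at (c t - y)) v) *\<^sub>R \<phi> t)" for y
        using integral_linear[OF fxint blinfun.bounded_linear_left, of v y]
        by (simp add: o_def fxA)
      show "Ck_on k UNIV (\<lambda>y. blinfun_apply (integral (cbox a b) (fx y)) v)"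
        unfolding eq
        by (rule Suc.IH[of "\<lambda>z. - frechet_derivative r (at z) v"],
            rule Ck_on_bounded_linear[OF bounded_linear_minus[OF bounded_linear_ident]])
          (use Suc.prems in auto)
    qed auto
  }
qed

lemma smooth_on_translate_integral:
  fixes r :: "real^2 \<Rightarrow> real" and \<phi> :: "real \<Rightarrow> 'b::euclidean_space" and c :: "real \<Rightarrow> real^2"
  assumes "open S" "continuous_on S c" "closed L" "L \<subseteq> S" "\<And>t. t \<notin> L \<Longrightarrow> \<phi> t = 0"
    "continuous_on UNIV \<phi>" "smooth_on UNIV r"
  shows "smooth_on UNIV (\<lambda>y. integral (cbox a b) (\<lambda>t. r (c t - y) *\<^sub>R \<phi> t))"
  using assms unfolding smooth_on_def by (intro allI Ck_on_translate_integral) auto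

section \<open>Linear matrix differential equations\<close>

lemma bounded_bilinear_matmul: "bounded_bilinear ((**) :: 'n cmat \<Rightarrow> 'n cmat \<Rightarrow> 'n::finite cmat)"
proof -
  have "linear (\<lambda>y::'n cmat. x ** y)" for x :: "'n cmat"
    by (rule linearI)
      (simp_all add: matrix_matrix_mult_def vec_eq_iff algebra_simps sum.distrib scaleR_sum_right)
  moreover have "linear (\<lambda>x::'n cmat. x ** y)" for y :: "'n cmat"
    by (rule linearI)
      (simp_all add: matrix_matrix_mult_def vec_eq_iff algebra_simps sum.distrib scaleR_sum_right)
  ultimately show ?thesis
    by (simp add: bilinear_conv_bounded_bilinear[symmetric] bilinear_def)
qed

lemma bounded_linear_trace: "bounded_linear (trace :: 'n::finite cmat \<Rightarrow> complex)"
proof -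
  have "linear (trace :: 'n cmat \<Rightarrow> complex)"
    by (rule linearI) (simp_all add: trace_def sum.distrib scaleR_sum_right)
  then show ?thesis by (simp add: linear_conv_bounded_linear)
qed

lemma bounded_linear_transpose: "bounded_linear (transpose :: 'n::finite cmat \<Rightarrow> 'n cmat)"
proof -
  have "linear (transpose :: 'n cmat \<Rightarrow> 'n cmat)"
    by (rule linearI) (simp_all add: transpose_def vec_eq_iff)
  then show ?thesis by (simp add: linear_conv_bounded_linear)
qed

lemmas matmul_has_vector_derivative = bounded_bilinear.has_vector_derivative[OF bounded_bilinear_matmul]
lemmas matmul_continuous_on = bounded_bilinear.continuous_on[OF bounded_bilinear_matmul]
lemmas matmul_diff_right = bounded_bilinear.diff_right[OF bounded_bilinear_matmul]
lemmas matmul_diff_left = bounded_bilinear.diff_left[OF bounded_bilinear_matmul]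
lemmas matmul_minus_right = bounded_bilinear.minus_right[OF bounded_bilinear_matmul]
lemmas matmul_minus_left = bounded_bilinear.minus_left[OF bounded_bilinear_matmul]
lemmas matmul_scaleR_right = bounded_bilinear.scaleR_right[OF bounded_bilinear_matmul]
lemmas matmul_scaleR_left = bounded_bilinear.scaleR_left[OF bounded_bilinear_matmul]
lemmas matmul_sum_right = bounded_bilinear.sum_right[OF bounded_bilinear_matmul]
lemmas matmul_add_right = bounded_bilinear.add_right[OF bounded_bilinear_matmul]

lemma has_vector_derivative_affine:
  fixes f :: "real \<Rightarrow> 'a::real_normed_vector"
  assumes "(f has_vector_derivative f') (at (a + m * t))"
  shows "((\<lambda>t. f (a + m * t)) has_vector_derivative m *\<^sub>R f') (at t)"
proof -
  have "((\<lambda>t. a + m * t) has_vector_derivative m) (at t)"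
    by (auto intro!: derivative_eq_intros simp: has_vector_derivative_def)
  from vector_diff_chain_at[OF this assms] show ?thesis by (simp add: o_def)
qed

lemma global_antiderivative:
  fixes f :: "real \<Rightarrow> 'a::euclidean_space"
  assumes "continuous_on UNIV f"
  shows "\<exists>F. F 0 = 0 \<and> (\<forall>t. (F has_vector_derivative f t) (at t))"
proof -
  have "\<exists>F. \<forall>x::real. -\<infinity> < ereal x \<longrightarrow> ereal x < \<infinity> \<longrightarrow> (F has_vector_derivative f x) (at x)"
    by (rule einterval_antiderivative) (use assms in \<open>auto simp: continuous_on_eq_continuous_at\<close>)
  then obtain F where "\<forall>x::real. (F has_vector_derivative f x) (at x)" by auto
  then show ?thesis
    by (intro exI[of _ "\<lambda>t. F t - F 0"]) (auto intro!: derivative_eq_intros)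
qed

text \<open>The induction step for the factorial bounds of Picard iteration: one more integration
  raises the exponent and the factorial by one.\<close>

lemma norm_antiderivative_le:
  fixes F :: "real \<Rightarrow> 'a::real_normed_vector"
  assumes F: "F 0 = 0" "\<And>t. (F has_vector_derivative f t) (at t)"
    and f: "\<And>t. norm (f t) \<le> c * (b * \<bar>t\<bar>) ^ n / fact n * b"
  shows "norm (F t) \<le> c * (b * \<bar>t\<bar>) ^ Suc n / fact (Suc n)"
proof (cases "t = 0")
  case False
  \<comment> \<open>Moving from 0 towards \<open>t\<close> along its sign reduces negative times to
    a mean value estimate on a positive interval.\<close>
  define \<sigma> where "\<sigma> = sgn t"
  have \<sigma>: "\<bar>\<sigma>\<bar> = 1" "\<sigma> * \<bar>t\<bar> = t" using False by (auto simp: \<sigma>_def sgn_if)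
  define \<phi> where "\<phi> = (\<lambda>u. c * (b * u) ^ Suc n / fact (Suc n))"
  have dF: "((\<lambda>u. F (\<sigma> * u)) has_vector_derivative \<sigma> *\<^sub>R f (\<sigma> * u)) (at u)" for u
    using has_vector_derivative_affine[of F _ 0 \<sigma> u] F(2) by simp
  have d\<phi>: "(\<phi> has_vector_derivative c * (b * u) ^ n / fact n * b) (at u)" for u
  proof -
    have "(\<phi> has_real_derivative c * (real (Suc n) * (b * u) ^ n * b) / fact (Suc n)) (at u)"
      unfolding \<phi>_def by (auto intro!: derivative_eq_intros simp del: fact_Suc power_Suc of_nat_Suc)
    moreover have "c * (real (Suc n) * (b * u) ^ n * b) / fact (Suc n) = c * (b * u) ^ n / fact n * b"
      by (simp add: divide_simps del: of_nat_Suc)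
    ultimately show ?thesis by (metis has_real_derivative_iff_has_vector_derivative)
  qed
  have "norm (F (\<sigma> * \<bar>t\<bar>) - F (\<sigma> * 0)) \<le> \<phi> \<bar>t\<bar> - \<phi> 0"
  proof (rule differentiable_bound_general)
    show "continuous_on {0..\<bar>t\<bar>} (\<lambda>u. F (\<sigma> * u))" "continuous_on {0..\<bar>t\<bar>} \<phi>"
      using dF d\<phi> by (auto intro!: continuous_at_imp_continuous_on has_vector_derivative_continuous)
    show "norm (\<sigma> *\<^sub>R f (\<sigma> * u)) \<le> c * (b * u) ^ n / fact n * b" if "0 < u" "u < \<bar>t\<bar>" for u
      using f[of "\<sigma> * u"] that \<sigma> by (simp add: abs_mult)
  qed (use False dF d\<phi> in auto)
  then show ?thesis by (simp add: \<sigma> F(1) \<phi>_def)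
qed (simp add: F)

text \<open>The solution is the series of iterated integrals, dominated by an exponential series; a
  global bound on \<open>X\<close> therefore gives a solution for all times together with its
  growth. The constant \<open>K\<close> enters because the norm of the matrix type enters only
  through its bound on products.\<close>

lemma linear_ode_solution:
  fixes X :: "real \<Rightarrow> 'n::finite cmat"
  assumes X: "continuous_on UNIV X" "\<And>t. norm (X t) \<le> B"
    and K: "\<And>P Q. norm (P ** Q :: 'n cmat) \<le> norm (P :: 'n cmat) * norm (Q :: 'n cmat) * K" "K \<ge> 0"
  shows "\<exists>h. h 0 = mat 1 \<and> (\<forall>t. (h has_vector_derivative h t ** X t) (at t)) \<and>
    (\<forall>t. norm (h t) \<le> norm (mat 1 :: 'n cmat) * exp (K * B * \<bar>t\<bar>))"
proof -
  have B: "B \<ge> 0" using X(2)[of 0] norm_ge_zero order_trans by blast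
  define J where "J = (\<lambda>f::real \<Rightarrow> 'n cmat. SOME F. F 0 = 0 \<and> (\<forall>t. (F has_vector_derivative f t) (at t)))"
  have J: "J f 0 = 0" "(J f has_vector_derivative f t) (at t)" if "continuous_on UNIV f" for f t
    using someI_ex[OF global_antiderivative[OF that]] unfolding J_def by auto
  \<comment> \<open>\<open>T n\<close> is the n-fold iterated integral, the n-th term of the Dyson
    series.\<close>
  define T where "T = rec_nat (\<lambda>t. mat 1 :: 'n cmat) (\<lambda>n f. J (\<lambda>t. f t ** X t))"
  have T0: "T 0 = (\<lambda>t. mat 1)" and TS: "T (Suc n) = J (\<lambda>t. T n t ** X t)" for n by (auto simp: T_def)
  have Tc: "continuous_on UNIV (T n)" for n
  proof (induction n)
    case (Suc n)
    then have "continuous_on UNIV (\<lambda>t. T n t ** X t)" by (intro matmul_continuous_on X)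
    from J(2)[OF this] show ?case unfolding TS
      by (intro continuous_at_imp_continuous_on ballI has_vector_derivative_continuous)
  qed (simp add: T0)
  have TX: "continuous_on UNIV (\<lambda>t. T n t ** X t)" for n by (intro matmul_continuous_on X Tc)
  define N0 where "N0 = norm (mat 1 :: 'n cmat)"
  have step: "norm (P ** X t) \<le> norm P * (K * B)" for P :: "'n cmat" and t
  proof -
    have "norm (P ** X t) \<le> norm P * norm (X t) * K" by (rule K)
    also have "\<dots> \<le> norm P * B * K" by (intro mult_right_mono mult_left_mono X K) auto
    finally show ?thesis by (simp add: ac_simps)
  qed
  have Tb: "norm (T n t) \<le> N0 * (K * B * \<bar>t\<bar>) ^ n / fact n" for n t
  proof (induction n arbitrary: t)
    case (Suc n)
    show ?case unfolding TS
    proof (rule norm_antiderivative_le)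
      show "norm (T n t ** X t) \<le> N0 * (K * B * \<bar>t\<bar>) ^ n / fact n * (K * B)" for t
        using step[of "T n t" t] mult_right_mono[OF Suc[of t], of "K * B"] K B by auto
    qed (use J[OF TX] in auto)
  qed (simp add: T0 N0_def)
  have sumE: "summable (\<lambda>n. N0 * r ^ n / fact n)" "(\<Sum>n. N0 * r ^ n / fact n) = N0 * exp r" for r :: real
    using summable_exp_generic[of r, THEN summable_mult, of N0]
      suminf_mult[OF summable_exp_generic[of r], of N0]
    by (simp_all add: exp_def divide_inverse ac_simps)
  have Ts: "summable (\<lambda>n. T n t)" for t
    by (rule summable_comparison_test'[OF sumE(1) Tb])
  define h where "h = (\<lambda>t. \<Sum>n. T n t)"
  have h0: "h 0 = mat 1"
  proof -
    have "T n 0 = (if n = 0 then mat 1 else 0)" for n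
      by (cases n) (auto simp: T0 TS J(1)[OF TX])
    then show ?thesis unfolding h_def using suminf_finite[of "{0}" "\<lambda>n. T n 0"] by simp
  qed
  have hb: "norm (h t) \<le> N0 * exp (K * B * \<bar>t\<bar>)" for t
  proof -
    have "norm (h t) \<le> (\<Sum>n. N0 * (K * B * \<bar>t\<bar>) ^ n / fact n)"
      unfolding h_def by (rule norm_suminf_le[OF Tb sumE(1)])
    then show ?thesis by (simp add: sumE)
  qed
  have hd: "(h has_vector_derivative h t ** X t) (at t)" for t
  proof -
    define R where "R = \<bar>t\<bar> + 1"
    \<comment> \<open>Termwise derivatives: differentiating one iterated integral gives the previous
      one times \<open>X\<close>, so \<open>d\<close> is the series of \<open>h t ** X t\<close>
      shifted by one with a zero in front. On the ball of radius \<open>R\<close> it has the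
      summable majorant \<open>M\<close>.\<close>
    define d where "d = (\<lambda>n t. case n of 0 \<Rightarrow> 0 | Suc m \<Rightarrow> T m t ** X t)"
    have Td: "(T n has_vector_derivative d n u) (at u)" for n u
      by (cases n) (auto simp: T0 TS d_def J(2)[OF TX])
    define M where "M = (\<lambda>n. case n of 0 \<Rightarrow> 0 | Suc m \<Rightarrow> N0 * (K * B * R) ^ m / fact m * (K * B))"
    have dM: "norm (d n u) \<le> M n" if "u \<in> ball (0::real) R" for n u
    proof (cases n)
      case (Suc m)
      have "norm (T m u ** X u) \<le> norm (T m u) * (K * B)" by (rule step)
      also have "\<dots> \<le> N0 * (K * B * \<bar>u\<bar>) ^ m / fact m * (K * B)"
        by (intro mult_right_mono Tb) (use K B in auto)
      also have "\<dots> \<le> N0 * (K * B * R) ^ m / fact m * (K * B)"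
        by (intro mult_right_mono divide_right_mono mult_left_mono power_mono)
          (use K B that in \<open>auto simp: N0_def\<close>)
      finally show ?thesis by (simp add: d_def M_def Suc)
    qed (simp add: d_def M_def)
    have "summable (\<lambda>n. M (Suc n))" by (simp only: M_def nat.case) (intro summable_mult2 sumE)
    then have Ms: "summable M" by (simp add: summable_Suc_iff)
    have unif: "uniform_limit (ball (0::real) R) (\<lambda>n x. \<Sum>i<n. d i x) (\<lambda>x. suminf (\<lambda>i. d i x)) sequentially"
      by (rule Weierstrass_m_test[OF dM Ms])
    have sd: "suminf (\<lambda>i. d i x) = h x ** X x" for x :: real
    proof -
      have bl: "bounded_linear (\<lambda>P :: 'n cmat. P ** X x)" by (rule bounded_bilinear.bounded_linear_left[OF bounded_bilinear_matmul])
      have "(\<lambda>n. d (Suc n) x) sums (h x ** X x)"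
        unfolding d_def h_def by (simp add: bounded_linear.sums[OF bl summable_sums[OF Ts]])
      then have "(\<lambda>n. d n x) sums (h x ** X x + d 0 x)" by (rule sums_Suc)
      then show ?thesis by (simp add: d_def sums_unique[symmetric])
    qed
    have "\<exists>g. \<forall>x\<in>ball (0::real) R. (\<lambda>n. T n x) sums (g x) \<and> (g has_derivative (\<lambda>u. u *\<^sub>R (h x ** X x))) (at x within ball (0::real) R)"
    proof (rule has_derivative_series[where f'="\<lambda>n x u. u *\<^sub>R d n x" and x=0])
      show "(T n has_derivative (\<lambda>u. u *\<^sub>R d n x)) (at x within ball (0::real) R)" for n x
        using Td[of n x] by (simp add: has_vector_derivative_def has_derivative_at_withinI)
      fix e :: real assume "e > 0"
      from uniform_limitD[OF unif this]
      show "\<forall>\<^sub>F n in sequentially. \<forall>x\<in>ball (0::real) R. \<forall>u.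
          norm ((\<Sum>i<n. u *\<^sub>R d i x) - u *\<^sub>R (h x ** X x)) \<le> e * norm u"
      proof (rule eventually_mono, intro ballI allI)
        fix n x and u :: real
        assume "\<forall>x\<in>ball (0::real) R. dist (\<Sum>i<n. d i x) (\<Sum>i. d i x) < e" "x \<in> ball (0::real) R"
        then have "norm ((\<Sum>i<n. d i x) - h x ** X x) \<le> e" by (simp add: sd dist_norm less_imp_le)
        moreover have "(\<Sum>i<n. u *\<^sub>R d i x) - u *\<^sub>R (h x ** X x) = u *\<^sub>R ((\<Sum>i<n. d i x) - h x ** X x)"
          by (simp add: scaleR_sum_right scaleR_diff_right)
        ultimately show "norm ((\<Sum>i<n. u *\<^sub>R d i x) - u *\<^sub>R (h x ** X x)) \<le> e * norm u"
          by (metis mult.commute mult_left_mono norm_ge_zero norm_scaleR real_norm_def)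
      qed
    qed (use summable_sums[OF Ts[of 0]] in \<open>auto simp: R_def\<close>)
    then obtain g where g: "\<And>x. x \<in> ball (0::real) R \<Longrightarrow> (\<lambda>n. T n x) sums g x"
       "\<And>x. x \<in> ball (0::real) R \<Longrightarrow> (g has_derivative (\<lambda>u. u *\<^sub>R (h x ** X x))) (at x within ball (0::real) R)" by blast
    have gh: "g x = h x" if "x \<in> ball (0::real) R" for x using g(1)[OF that] by (simp add: h_def sums_unique)
    have t: "t \<in> ball (0::real) R" by (auto simp: R_def)
    have "(g has_derivative (\<lambda>u. u *\<^sub>R (h t ** X t))) (at t)"
      using g(2)[OF t] t at_within_open[OF t open_ball] by simp
    then have "(h has_derivative (\<lambda>u. u *\<^sub>R (h t ** X t))) (at t)"
      by (rule has_derivative_transform_within_open[OF _ open_ball t]) (simp add: gh)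
    then show ?thesis by (simp add: has_vector_derivative_def)
  qed
  show ?thesis using h0 hb hd unfolding N0_def by blast
qed

text \<open>The inverse \<open>g\<close> is carried along because it makes uniqueness and Duhamel's formula product-rule
  computations.\<close>

definition flow :: "(real \<Rightarrow> 'n cmat) \<Rightarrow> (real \<Rightarrow> 'n cmat) \<Rightarrow> (real \<Rightarrow> 'n::finite cmat) \<Rightarrow> bool" where
  "flow X h g \<longleftrightarrow> h 0 = mat 1 \<and> g 0 = mat 1 \<and>
     (\<forall>t. h t ** g t = mat 1 \<and> g t ** h t = mat 1 \<and>
        (h has_vector_derivative h t ** X t) (at t) \<and> (g has_vector_derivative - (X t ** g t)) (at t))"

lemma flowD:
  assumes "flow X h g"
  shows "h 0 = mat 1" "g 0 = mat 1" "h t ** g t = mat 1" "g t ** h t = mat 1"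
    "(h has_vector_derivative h t ** X t) (at t)" "(g has_vector_derivative - (X t ** g t)) (at t)"
  using assms unfolding flow_def by auto

lemma constant_vector_derivative_zero:
  fixes f :: "real \<Rightarrow> 'a::banach"
  assumes "\<And>t. (f has_vector_derivative 0) (at t)" shows "f a = f b"
proof -
  have "(f has_derivative (\<lambda>h. 0)) (at x within UNIV)" for x
    using assms[of x] by (simp add: has_vector_derivative_def)
  from has_derivative_zero_constant[OF convex_UNIV this]
  obtain c where "\<And>x. f x = c" by auto
  then show ?thesis by simp
qed

text \<open>Gives the inverse flow, obtained from a transposed equation, the same growth bound as
  the flow.\<close>

lemma norm_transpose: "norm (transpose (P :: 'n::finite cmat)) = norm P"
proof -
  have "(norm Q)\<^sup>2 = (\<Sum>i\<in>UNIV. \<Sum>j\<in>UNIV. (norm (Q $ i $ j))\<^sup>2)" for Q :: "'n cmat"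
    by (simp add: norm_vec_def L2_set_def sum_nonneg)
  then have "(norm (transpose P))\<^sup>2 = (norm P)\<^sup>2"
    by (simp add: transpose_def, subst sum.swap) simp
  then show ?thesis by simp
qed

text \<open>The equation for the inverse multiplies by the generator from the other side.
  Transposing turns it into the solved form with generator minus the transpose of \<open>X\<close>.
  The product \<open>h t ** g t\<close> then has derivative zero, and a one-sided inverse of a
  square matrix is two-sided.\<close>

lemma flow_exists:
  "\<exists>K\<ge>0. \<forall>(X :: real \<Rightarrow> 'n::finite cmat) B. continuous_on UNIV X \<and> (\<forall>t. norm (X t) \<le> B) \<longrightarrow>
    (\<exists>h g. flow X h g \<and>
      (\<forall>t. norm (h t) \<le> norm (mat 1 :: 'n cmat) * exp (K * B * \<bar>t\<bar>) \<and>
           norm (g t) \<le> norm (mat 1 :: 'n cmat) * exp (K * B * \<bar>t\<bar>)))"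
proof -
  obtain K where K: "K > 0" "\<And>P Q. norm (P ** Q :: 'n cmat) \<le> norm (P :: 'n cmat) * norm (Q :: 'n cmat) * K"
    using bounded_bilinear.pos_bounded[OF bounded_bilinear_matmul] by blast
  show ?thesis
  proof (intro exI[of _ K] conjI allI impI)
    fix X :: "real \<Rightarrow> 'n cmat" and B
    assume X: "continuous_on UNIV X \<and> (\<forall>t. norm (X t) \<le> B)"
    obtain h where h: "h 0 = mat 1" "\<And>t. (h has_vector_derivative h t ** X t) (at t)"
      "\<And>t. norm (h t) \<le> norm (mat 1 :: 'n cmat) * exp (K * B * \<bar>t\<bar>)"
      using linear_ode_solution[of X B K] X K by auto
    have "continuous_on UNIV (\<lambda>t. - transpose (X t))"
      by (intro continuous_on_minus bounded_linear.continuous_on[OF bounded_linear_transpose]) (use X in auto)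
    then obtain k where k: "k 0 = mat 1" "\<And>t. (k has_vector_derivative k t ** - transpose (X t)) (at t)"
      "\<And>t. norm (k t) \<le> norm (mat 1 :: 'n cmat) * exp (K * B * \<bar>t\<bar>)"
      using linear_ode_solution[of "\<lambda>t. - transpose (X t)" B K] X K by (auto simp: norm_transpose)
    define g where "g = (\<lambda>t. transpose (k t))"
    have g0: "g 0 = mat 1" by (simp add: g_def k transpose_mat)
    have gd: "(g has_vector_derivative - (X t ** g t)) (at t)" for t
      using bounded_linear.has_vector_derivative[OF bounded_linear_transpose k(2)]
      by (simp add: g_def matmul_minus_right matrix_transpose_mul transpose_transpose
          linear_neg[OF bounded_linear.linear[OF bounded_linear_transpose]])
    have "((\<lambda>t. h t ** g t) has_vector_derivative 0) (at t)" for t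
      using matmul_has_vector_derivative[OF h(2) gd] by (simp add: matmul_minus_right matrix_mul_assoc)
    then have hg: "h t ** g t = mat 1" for t
      using constant_vector_derivative_zero[of "\<lambda>t. h t ** g t" t 0] by (simp add: h(1) g0)
    then have "g t ** h t = mat 1" for t using matrix_left_right_inverse by blast
    then show "\<exists>h g. flow X h g \<and>
      (\<forall>t. norm (h t) \<le> norm (mat 1 :: 'n cmat) * exp (K * B * \<bar>t\<bar>) \<and>
           norm (g t) \<le> norm (mat 1 :: 'n cmat) * exp (K * B * \<bar>t\<bar>))"
      using h g0 gd hg k(3) by (intro exI[of _ h] exI[of _ g]) (auto simp: flow_def g_def norm_transpose)
  qed (use K in auto)
qed

text \<open>Comparison of two transports in which only the difference of the generators appears.
  Equal generators give uniqueness, close ones a Lipschitz bound, and a one-parameter family the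
  first variation of the holonomy.\<close>

lemma flow_Duhamel:
  assumes "flow X h g" "flow Y k l"
  shows "((\<lambda>t. k t ** g t) has_vector_derivative k t ** (Y t - X t) ** g t) (at t)"
  using matmul_has_vector_derivative[OF flowD(5)[OF assms(2)] flowD(6)[OF assms(1)], of t]
  by (simp add: matmul_minus_right matmul_diff_right matmul_diff_left matrix_mul_assoc)

lemma flow_continuous:
  assumes "flow X h g" shows "continuous_on S h" "continuous_on S g"
  using flowD(5,6)[OF assms]
  by (auto intro!: continuous_at_imp_continuous_on has_vector_derivative_continuous)

text \<open>Transport multiplies from left to right, so the transport from time \<open>a\<close> to
  \<open>a + t\<close> is the inverse of the first piece followed by the whole.\<close>

lemma flow_shift:
  assumes "flow X h g"
  shows "flow (\<lambda>t. X (a + t)) (\<lambda>t. g a ** h (a + t)) (\<lambda>t. g (a + t) ** h a)"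
proof -
  note D = flowD[OF assms]
  have "((\<lambda>t. h (a + t)) has_vector_derivative h (a + t) ** X (a + t)) (at t)" for t
    using has_vector_derivative_affine[of h _ a 1 t] D(5)[of "a + t"] by simp
  from matmul_has_vector_derivative[OF has_vector_derivative_const this]
  have 1: "((\<lambda>t. g a ** h (a + t)) has_vector_derivative g a ** h (a + t) ** X (a + t)) (at t)" for t
    by (simp add: matrix_mul_assoc)
  have "((\<lambda>t. g (a + t)) has_vector_derivative - (X (a + t) ** g (a + t))) (at t)" for t
    using has_vector_derivative_affine[of g _ a 1 t] D(6)[of "a + t"] by simp
  from matmul_has_vector_derivative[OF this has_vector_derivative_const]
  have 2: "((\<lambda>t. g (a + t) ** h a) has_vector_derivative - (X (a + t) ** (g (a + t) ** h a))) (at t)" for t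
    by (simp add: matrix_mul_assoc matmul_minus_left)
  have "g a ** h (a + t) ** (g (a + t) ** h a) = g a ** (h (a + t) ** g (a + t)) ** h a" for t
    by (simp add: matrix_mul_assoc)
  moreover have "g (a + t) ** h a ** (g a ** h (a + t)) = g (a + t) ** (h a ** g a) ** h (a + t)" for t
    by (simp add: matrix_mul_assoc)
  ultimately show ?thesis unfolding flow_def using 1 2 by (simp add: D)
qed

text \<open>Running back from 1 to \<open>1 - t\<close> inverts the transport from
  \<open>1 - t\<close> to 1, which is \<open>g (1 - t) ** h 1\<close>; the velocity changes
  sign.\<close>

lemma flow_reverse:
  assumes "flow X h g"
  shows "flow (\<lambda>t. - X (1 - t)) (\<lambda>t. g 1 ** h (1 - t)) (\<lambda>t. g (1 - t) ** h 1)"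
proof -
  note D = flowD[OF assms]
  have "((\<lambda>t. h (1 - t)) has_vector_derivative h (1 - t) ** - X (1 - t)) (at t)" for t
    using has_vector_derivative_affine[of h _ 1 "-1" t] D(5)[of "1 - t"] by (simp add: matmul_minus_right)
  from matmul_has_vector_derivative[OF has_vector_derivative_const this]
  have 1: "((\<lambda>t. g 1 ** h (1 - t)) has_vector_derivative g 1 ** h (1 - t) ** - X (1 - t)) (at t)" for t
    by (simp add: matrix_mul_assoc)
  have "((\<lambda>t. g (1 - t)) has_vector_derivative (X (1 - t) ** g (1 - t))) (at t)" for t
    using has_vector_derivative_affine[of g _ 1 "-1" t] D(6)[of "1 - t"] by fastforce
  from matmul_has_vector_derivative[OF this has_vector_derivative_const]
  have 2: "((\<lambda>t. g (1 - t) ** h 1) has_vector_derivative - (- X (1 - t) ** (g (1 - t) ** h 1))) (at t)" for t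
    by (simp add: matrix_mul_assoc matmul_minus_left)
  have "g 1 ** h (1 - t) ** (g (1 - t) ** h 1) = g 1 ** (h (1 - t) ** g (1 - t)) ** h 1" for t
    by (simp add: matrix_mul_assoc)
  moreover have "g (1 - t) ** h 1 ** (g 1 ** h (1 - t)) = g (1 - t) ** (h 1 ** g 1) ** h (1 - t)" for t
    by (simp add: matrix_mul_assoc)
  ultimately show ?thesis unfolding flow_def using 1 2 by (simp add: D)
qed

lemma flow_unique:
  assumes "flow X h g" "flow X k l" shows "k t = h t"
proof -
  have "((\<lambda>t. k t ** g t) has_vector_derivative 0) (at t)" for t
    using flow_Duhamel[OF assms, of t] by (simp add: bounded_bilinear.zero_left[OF bounded_bilinear_matmul] bounded_bilinear.zero_right[OF bounded_bilinear_matmul])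
  then have "k t ** g t = k 0 ** g 0" by (rule constant_vector_derivative_zero)
  then have "k t ** g t ** h t = h t" by (simp add: flowD[OF assms(1)] flowD[OF assms(2)])
  then show ?thesis by (simp add: matrix_mul_assoc[symmetric] flowD[OF assms(1)])
qed

text \<open>For a 1-periodic generator the flow restarted at time 1 solves the original equation, so
  it is the original flow.\<close>

lemma flow_periodic:
  assumes "flow X h g" "\<And>t. X (t + 1) = X t" shows "h (t + 1) = h 1 ** h t"
proof -
  have X: "(\<lambda>t. X (1 + t)) = X" using assms(2) by (simp add: add.commute)
  have "g 1 ** h (1 + t) = h t"
    using flow_unique[OF assms(1) flow_shift[OF assms(1), of 1, unfolded X], of t] .
  then have "h 1 ** (g 1 ** h (1 + t)) = h 1 ** h t" by simp
  then show ?thesis by (simp add: matrix_mul_assoc flowD[OF assms(1)] add.commute)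
qed

section \<open>Charts, transition maps and change of variables\<close>

lemma borel_measurable_indicator_continuous:
  fixes f :: "'a::euclidean_space \<Rightarrow> 'b::euclidean_space"
  assumes "open S" "continuous_on S f" shows "(\<lambda>x. indicator S x *\<^sub>R f x) \<in> borel_measurable lborel"
  using borel_measurable_continuous_on_indicator[OF _ assms(2)] assms(1) by simp

text \<open>The substitution theorem concerns Lebesgue measure, the definitions concern
  \<open>lborel\<close>; continuity on an open set supplies the Borel measurability that identifies
  the two notions.\<close>

lemma set_integrable_lborel_iff:
  fixes f :: "'a::euclidean_space \<Rightarrow> 'b::euclidean_space"
  assumes "open S" "continuous_on S f"
  shows "set_integrable lborel S f \<longleftrightarrow> f absolutely_integrable_on S"
  unfolding set_integrable_def
  using integrable_completion[OF borel_measurable_indicator_continuous[OF assms]] by simp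

lemma set_integral_eq_integral:
  fixes f :: "'a::euclidean_space \<Rightarrow> 'b::euclidean_space"
  assumes "open S" "continuous_on S f" "f absolutely_integrable_on S"
  shows "(LINT x:S|lborel. f x) = integral S f"
  using set_borel_integral_eq_integral(2) set_integrable_lborel_iff[OF assms(1,2)] assms(3) by blast

lemma lborel_change_of_variables:
  fixes f :: "real^2 \<Rightarrow> complex" and g :: "real^2 \<Rightarrow> real^2"
  assumes S: "open S" and der: "\<And>x. x \<in> S \<Longrightarrow> (g has_derivative g' x) (at x)"
    and inj: "inj_on g S" and gS: "open (g ` S)" and f: "continuous_on (g ` S) f"
    and det: "continuous_on S (\<lambda>x. det (matrix (g' x)))"
  shows "(LINT y:g ` S|lborel. f y) = (LINT x:S|lborel. \<bar>det (matrix (g' x))\<bar> *\<^sub>R f (g x))"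
proof -
  \<comment> \<open>The substitution theorem that is used takes values in real vectors, so complex
    numbers are encoded as elements of \<open>real^2\<close>.\<close>
  define \<iota> :: "complex \<Rightarrow> real^2" where "\<iota> z = (\<chi> i. if i = 1 then Re z else Im z)" for z
  define \<pi> :: "real^2 \<Rightarrow> complex" where "\<pi> v = Complex (v $ 1) (v $ 2)" for v
  have "linear \<iota>" by (rule linearI) (auto simp: \<iota>_def vec_eq_iff)
  then have \<iota>: "bounded_linear \<iota>" by (simp add: linear_conv_bounded_linear)
  have "linear \<pi>" by (rule linearI) (auto simp: \<pi>_def complex_eq_iff)
  then have \<pi>: "bounded_linear \<pi>" by (simp add: linear_conv_bounded_linear)
  have \<pi>\<iota>: "\<pi> (\<iota> z) = z" for z by (simp add: \<pi>_def \<iota>_def complex_eq_iff)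
  define F where "F = (\<lambda>x. \<bar>det (matrix (g' x))\<bar> *\<^sub>R f (g x))"
  have contg: "continuous_on S g"
    using der by (auto intro!: continuous_at_imp_continuous_on has_derivative_continuous)
  have contF: "continuous_on S F"
    unfolding F_def by (intro continuous_intros det continuous_on_compose2[OF f contg]) auto
  have \<iota>F: "\<iota> (F x) = \<bar>det (matrix (g' x))\<bar> *\<^sub>R \<iota> (f (g x))" for x
    by (simp add: F_def linear_cmul[OF bounded_linear.linear[OF \<iota>]])
  have lin_iff: "(\<lambda>x. \<iota> (h x)) absolutely_integrable_on T \<longleftrightarrow> h absolutely_integrable_on T" for h and T :: "(real^2) set"
    using absolutely_integrable_linear[OF _ \<iota>, where f=h and s=T]
      absolutely_integrable_linear[OF _ \<pi>, where f="\<lambda>x. \<iota> (h x)" and s=T]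
    by (auto simp: o_def \<pi>\<iota>)
  have der': "\<And>x. x \<in> S \<Longrightarrow> (g has_derivative g' x) (at x within S)" using der has_derivative_at_withinI by blast
  have Sl: "S \<in> sets lebesgue" using S by (simp add: lmeasurable_open borel_open)
  note cov = has_absolute_integral_change_of_variables[OF Sl der' inj, of "\<lambda>y. \<iota> (f y)", folded \<iota>F]
  show ?thesis
  proof (cases "f absolutely_integrable_on g ` S")
    case True
    then have *: "F absolutely_integrable_on S" "integral S (\<lambda>x. \<iota> (F x)) = integral (g ` S) (\<lambda>x. \<iota> (f x))"
      using cov[of "integral (g ` S) (\<lambda>x. \<iota> (f x))"] by (auto simp: lin_iff)
    have int: "F integrable_on S" "f integrable_on g ` S"
      using * True set_lebesgue_integral_eq_integral(1) by blast+
    have "\<iota> (integral S F) = \<iota> (integral (g ` S) f)"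
      using integral_linear[OF int(1) \<iota>] integral_linear[OF int(2) \<iota>] *(2) by (simp add: o_def)
    then have "integral S F = integral (g ` S) f" using \<pi>\<iota> by metis
    then show ?thesis
      using set_integral_eq_integral[OF gS f True] set_integral_eq_integral[OF S contF *(1)] by (simp add: F_def)
  next
    \<comment> \<open>When neither side is integrable, both integrals have the default value 0, so
      the equation persists.\<close>
    case False
    then have "\<not> F absolutely_integrable_on S"
      using cov[of "integral S (\<lambda>x. \<iota> (F x))"] by (auto simp: lin_iff)
    then have "\<not> set_integrable lborel S F" "\<not> set_integrable lborel (g ` S) f"
      using False set_integrable_lborel_iff[OF gS f] set_integrable_lborel_iff[OF S contF] by auto
    then show ?thesis
      unfolding set_lebesgue_integral_def set_integrable_def F_def by (simp add: not_integrable_integral_eq)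
  qed
qed

locale surface =
  fixes M :: "'p::t2_space chart set"
  assumes closed_oriented_surface: "closed_oriented_surface M"
begin

lemma compact_surface: assumes "closed (L :: 'p set)" shows "compact L"
proof -
  have "compact (UNIV :: 'p set)"
    using closed_oriented_surface unfolding closed_oriented_surface_def by (rule conjunct1)
  from compact_Int_closed[OF this assms] show ?thesis by simp
qed

lemma smooth_structure: "oriented_smooth_structure M"
  using closed_oriented_surface unfolding closed_oriented_surface_def by (rule conjunct2)

lemma chart:
  assumes "c \<in> M"
  shows "open (cdom c)" "open (cimg c)" "homeomorphism (cdom c) (cimg c) (cmap c) (cinv c)"
proof -
  have "is_chart c" using smooth_structure assms unfolding oriented_smooth_structure_def by blast
  then show "open (cdom c)" "open (cimg c)" "homeomorphism (cdom c) (cimg c) (cmap c) (cinv c)"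
    unfolding is_chart_def by blast+
qed

lemma compatible: "c \<in> M \<Longrightarrow> d \<in> M \<Longrightarrow> oriented_compatible c d"
  using smooth_structure unfolding oriented_smooth_structure_def by blast

lemma ex_chart: "\<exists>c\<in>M. p \<in> cdom c"
proof -
  have "(\<Union>c\<in>M. cdom c) = UNIV" using smooth_structure unfolding oriented_smooth_structure_def by blast
  then have "p \<in> (\<Union>c\<in>M. cdom c)" by simp
  then show ?thesis by (rule UN_E) blast
qed

lemma
  assumes "c \<in> M"
  shows cinv_cmap: "p \<in> cdom c \<Longrightarrow> cinv c (cmap c p) = p"
    and cmap_cinv: "x \<in> cimg c \<Longrightarrow> cmap c (cinv c x) = x"
    and cinv_in: "x \<in> cimg c \<Longrightarrow> cinv c x \<in> cdom c"
    and cmap_in: "p \<in> cdom c \<Longrightarrow> cmap c p \<in> cimg c"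
    and cmap_continuous: "continuous_on (cdom c) (cmap c)"
    and cinv_continuous: "continuous_on (cimg c) (cinv c)"
  using chart(3)[OF assms] by (auto simp: homeomorphism_def)

lemma overlap_iff:
  assumes "c \<in> M" shows "x \<in> overlap c d \<longleftrightarrow> x \<in> cimg c \<and> cinv c x \<in> cdom d"
proof
  assume "x \<in> overlap c d"
  then obtain p where "p \<in> cdom c" "p \<in> cdom d" "x = cmap c p" by (auto simp: overlap_def)
  then show "x \<in> cimg c \<and> cinv c x \<in> cdom d" by (simp add: cinv_cmap cmap_in assms)
next
  assume x: "x \<in> cimg c \<and> cinv c x \<in> cdom d"
  then have "cinv c x \<in> cdom c \<inter> cdom d" "x = cmap c (cinv c x)"
    by (simp_all add: cinv_in cmap_cinv assms)
  then show "x \<in> overlap c d" unfolding overlap_def by blast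
qed

lemma overlap_subset: "overlap c d \<subseteq> cimg c"
  by (auto simp: overlap_def cimg_def)

lemma open_overlap: assumes "c \<in> M" "d \<in> M" shows "open (overlap c d)"
proof -
  have "overlap c d = cimg c \<inter> cinv c -` cdom d"
    by (rule set_eqI) (simp add: overlap_iff[OF assms(1)])
  then show ?thesis
    using continuous_on_open_vimage[OF chart(2)[OF assms(1)], of "cinv c"]
      cinv_continuous[OF assms(1)] chart(1)[OF assms(2)] by (auto simp: Int_commute)
qed

lemma transition_cmap: "c \<in> M \<Longrightarrow> p \<in> cdom c \<Longrightarrow> transition c d (cmap c p) = cmap d p"
  by (simp add: transition_def cinv_cmap)

lemma cinv_transition: "c \<in> M \<Longrightarrow> d \<in> M \<Longrightarrow> x \<in> overlap c d \<Longrightarrow> cinv d (transition c d x) = cinv c x"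
  by (simp add: transition_def cinv_cmap overlap_iff)

lemma transition_in_overlap: "c \<in> M \<Longrightarrow> d \<in> M \<Longrightarrow> x \<in> overlap c d \<Longrightarrow> transition c d x \<in> overlap d c"
  by (auto simp: overlap_iff cinv_transition cinv_in) (simp add: transition_def cmap_in)

lemma transition_in_cimg: "c \<in> M \<Longrightarrow> d \<in> M \<Longrightarrow> x \<in> overlap c d \<Longrightarrow> transition c d x \<in> cimg d"
  using transition_in_overlap overlap_subset by blast

lemma transition_inverse: "c \<in> M \<Longrightarrow> d \<in> M \<Longrightarrow> x \<in> overlap c d \<Longrightarrow> transition d c (transition c d x) = x"
  by (simp add: transition_def[of d c] cinv_transition cmap_cinv overlap_iff)

lemma transition_image: assumes "c \<in> M" "d \<in> M" shows "transition c d ` overlap c d = overlap d c"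
proof -
  have "y \<in> transition c d ` overlap c d" if "y \<in> overlap d c" for y
    using transition_inverse[OF assms(2,1) that] transition_in_overlap[OF assms(2,1) that] by (metis image_eqI)
  then show ?thesis using transition_in_overlap assms by blast
qed

lemma transition_inj: "c \<in> M \<Longrightarrow> d \<in> M \<Longrightarrow> inj_on (transition c d) (overlap c d)"
  by (rule inj_on_inverseI[of _ "transition d c"]) (rule transition_inverse)

lemma transition_compose:
  "c \<in> M \<Longrightarrow> d \<in> M \<Longrightarrow> x \<in> overlap c d \<Longrightarrow> transition d e (transition c d x) = transition c e x"
  by (simp add: transition_def[of d e] cinv_transition) (simp add: transition_def)

lemma smooth_transition:
  assumes "c \<in> M" "d \<in> M" shows "smooth_on (overlap c d) (transition c d)"
  using compatible[OF assms] unfolding oriented_compatible_def by blast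

lemma jacobian_det_pos: "c \<in> M \<Longrightarrow> d \<in> M \<Longrightarrow> x \<in> overlap c d \<Longrightarrow> det (jacobian (transition c d) x) > 0"
  using compatible unfolding oriented_compatible_def by blast

lemma transition_has_derivative:
  assumes "c \<in> M" "d \<in> M" "x \<in> overlap c d"
  shows "(transition c d has_derivative (\<lambda>v. jacobian (transition c d) x *v v)) (at x)"
proof -
  have *: "(transition c d has_derivative frechet_derivative (transition c d) (at x)) (at x)"
    by (rule smooth_on_has_derivative[OF smooth_transition[OF assms(1,2)] assms(3)])
  have "(\<lambda>v. jacobian (transition c d) x *v v) = frechet_derivative (transition c d) (at x)"
    unfolding jacobian_def using matrix_vector_mul(2)[OF has_derivative_linear[OF *]] .
  then show ?thesis using * by simp
qed

lemma jacobian_eqI: "(f has_derivative (\<lambda>v. J *v v)) (at x) \<Longrightarrow> jacobian f x = J"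
  unfolding jacobian_def by (simp add: frechet_derivative_eqI matrix_of_matrix_vector_mul)

lemma jacobian_chain:
  assumes "c \<in> M" "d \<in> M" "e \<in> M" "x \<in> overlap c d" "x \<in> overlap c e"
  shows "jacobian (transition c e) x =
    jacobian (transition d e) (transition c d x) ** jacobian (transition c d) x"
proof -
  let ?y = "transition c d x"
  have y: "?y \<in> overlap d e"
    using assms by (auto simp: overlap_iff cinv_transition transition_in_cimg)
  have "((\<lambda>u. transition d e (transition c d u)) has_derivative
      (\<lambda>v. jacobian (transition d e) ?y *v (jacobian (transition c d) x *v v))) (at x)"
    by (rule has_derivative_compose[OF transition_has_derivative[OF assms(1,2,4)] transition_has_derivative[OF assms(2,3) y]])
  then have "(transition c e has_derivative
      (\<lambda>v. jacobian (transition d e) ?y *v (jacobian (transition c d) x *v v))) (at x)"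
    by (rule has_derivative_transform_within_open[OF _ open_overlap[OF assms(1,2)] assms(4)])
      (simp add: transition_compose assms)
  then show ?thesis
    by (intro jacobian_eqI) (simp add: matrix_vector_mul_assoc)
qed

lemma transition_self: "c \<in> M \<Longrightarrow> x \<in> cimg c \<Longrightarrow> transition c c x = x"
  by (simp add: transition_def cmap_cinv)

lemma overlap_self: "overlap c c = cimg c"
  by (simp add: overlap_def cimg_def)

lemma jacobian_self: assumes "c \<in> M" "x \<in> cimg c" shows "jacobian (transition c c) x = mat 1"
proof (rule jacobian_eqI)
  have "((\<lambda>x. x) has_derivative (\<lambda>v. mat 1 *v v)) (at x)" by simp
  then show "(transition c c has_derivative (\<lambda>v. mat 1 *v v)) (at x)"
    by (rule has_derivative_transform_within_open[OF _ chart(2)[OF assms(1)] assms(2)])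
      (simp add: transition_self assms)
qed

lemma jacobian_inverse:
  assumes "c \<in> M" "d \<in> M" "x \<in> overlap c d"
  shows "jacobian (transition d c) (transition c d x) ** jacobian (transition c d) x = mat 1"
proof -
  have x: "x \<in> cimg c" using assms(3) overlap_subset by blast
  then have "x \<in> overlap c c" by (simp add: overlap_self)
  from jacobian_chain[OF assms(1,2,1,3) this] show ?thesis
    using jacobian_self[OF assms(1) x] by simp
qed

lemma jacobian_entry: "jacobian f x $ i $ j = frechet_derivative f (at x) (axis j 1) $ i"
  by (simp add: jacobian_def matrix_def)

lemma smooth_jacobian:
  assumes "c \<in> M" "d \<in> M" shows "smooth_on (overlap c d) (\<lambda>x. jacobian (transition c d) x $ i $ j)"
  unfolding jacobian_entry
  by (intro smooth_on_vec_nth open_overlap assms smooth_on_frechet smooth_transition)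

lemma smooth_det_jacobian:
  assumes "c \<in> M" "d \<in> M" shows "smooth_on (overlap c d) (\<lambda>x. det (jacobian (transition c d) x))"
proof -
  have eq: "det (jacobian (transition c d) x) =
    jacobian (transition c d) x $ 1 $ 1 * jacobian (transition c d) x $ 2 $ 2 +
    - (jacobian (transition c d) x $ 1 $ 2 * jacobian (transition c d) x $ 2 $ 1)" for x by (simp add: det_2)
  show ?thesis unfolding eq
    by (intro smooth_on_add smooth_on_mult open_overlap assms smooth_jacobian
        smooth_on_bounded_linear[OF bounded_linear_minus[OF bounded_linear_ident]])
qed

lemma continuous_jacobian:
  assumes "c \<in> M" "d \<in> M" shows "continuous_on (overlap c d) (\<lambda>x. jacobian (transition c d) x $ i $ j)"
  by (rule smooth_on_continuous[OF smooth_jacobian[OF assms]])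

lemma continuous_det_jacobian:
  assumes "c \<in> M" "d \<in> M" shows "continuous_on (overlap c d) (\<lambda>x. det (jacobian (transition c d) x))"
  by (rule smooth_on_continuous[OF smooth_det_jacobian[OF assms]])

text \<open>\<open>F\<close> and \<open>G\<close> are the coefficients, in two charts, of one
  density that vanishes outside the common domain. Orientation makes the determinant equal to its
  absolute value in the substitution formula.\<close>

lemma integral_transition:
  fixes F G :: "real^2 \<Rightarrow> complex"
  assumes "c \<in> M" "d \<in> M"
    and F0: "\<And>x. x \<in> cimg c - overlap c d \<Longrightarrow> F x = 0"
    and G0: "\<And>x. x \<in> cimg d - overlap d c \<Longrightarrow> G x = 0"
    and FG: "\<And>x. x \<in> overlap c d \<Longrightarrow> F x = det (jacobian (transition c d) x) *\<^sub>R G (transition c d x)"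
    and cont: "continuous_on (overlap d c) G"
  shows "(LINT x:cimg c|lborel. F x) = (LINT y:cimg d|lborel. G y)"
proof -
  have "(LINT x:cimg c|lborel. F x) = (LINT x:overlap c d|lborel. \<bar>det (jacobian (transition c d) x)\<bar> *\<^sub>R G (transition c d x))"
    unfolding set_lebesgue_integral_def
  proof (rule Bochner_Integration.integral_cong[OF refl])
    fix x
    show "indicator (cimg c) x *\<^sub>R F x =
      indicator (overlap c d) x *\<^sub>R \<bar>det (jacobian (transition c d) x)\<bar> *\<^sub>R G (transition c d x)"
    proof (cases "x \<in> overlap c d")
      case True
      then show ?thesis
        using FG[OF True] jacobian_det_pos[OF assms(1,2) True] subsetD[OF overlap_subset True] by simp
    next
      case False then show ?thesis using F0[of x] by (cases "x \<in> cimg c") auto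
    qed
  qed
  also have "\<dots> = (LINT y:transition c d ` overlap c d|lborel. G y)"
    using lborel_change_of_variables[OF open_overlap[OF assms(1,2)] transition_has_derivative[OF assms(1,2)]
        transition_inj[OF assms(1,2)], of G]
    by (simp add: transition_image assms open_overlap cont continuous_det_jacobian matrix_of_matrix_vector_mul)
  also have "\<dots> = (LINT y:cimg d|lborel. G y)"
    unfolding set_lebesgue_integral_def transition_image[OF assms(1,2)]
  proof (rule Bochner_Integration.integral_cong[OF refl])
    fix x
    show "indicator (overlap d c) x *\<^sub>R G x = indicator (cimg d) x *\<^sub>R G x"
      using G0[of x] subsetD[OF overlap_subset, of x d c]
      by (cases "x \<in> overlap d c"; cases "x \<in> cimg d") auto
  qed
  finally show ?thesis .
qed

text \<open>The surface is compact, so a closed support inside the chart domain has a compact image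
  in the plane, on which the integrand is continuous.\<close>

lemma set_integrable_chart:
  fixes f :: "real^2 \<Rightarrow> 'b::euclidean_space"
  assumes "c \<in> M" "continuous_on (cimg c) f" "closed L" "L \<subseteq> cdom c"
    and 0: "\<And>x. x \<in> cimg c \<Longrightarrow> cinv c x \<notin> L \<Longrightarrow> f x = 0"
  shows "set_integrable lborel (cimg c) f"
proof -
  let ?K = "cmap c ` L"
  have K: "compact ?K"
    using compact_surface[OF assms(3)] continuous_on_subset[OF cmap_continuous[OF assms(1)] assms(4)]
    by (rule compact_continuous_image[rotated])
  have KS: "?K \<subseteq> cimg c" using assms cmap_in by blast
  have "indicator (cimg c) x *\<^sub>R f x = indicator ?K x *\<^sub>R f x" for x
    using 0[of x] KS cmap_cinv[OF assms(1), of x] by (force simp: indicator_def)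
  then show ?thesis unfolding set_integrable_def
    using borel_integrable_compact[OF K continuous_on_subset[OF assms(2) KS]] by presburger
qed

section \<open>Densities and the surface integral\<close>

definition density :: "('p chart \<Rightarrow> real^2 \<Rightarrow> complex) \<Rightarrow> bool" where
  "density w \<longleftrightarrow> (\<forall>c\<in>M. continuous_on (cimg c) (w c)) \<and>
     (\<forall>c\<in>M. \<forall>d\<in>M. \<forall>x\<in>overlap c d. w c x = det (jacobian (transition c d) x) *\<^sub>R w d (transition c d x))"

lemma partition_of_unityD:
  assumes "partition_of_unity M N U pu" "k < N"
  shows "U k \<in> M" "closed (closure {p. pu k p \<noteq> 0})" "closure {p. pu k p \<noteq> 0} \<subseteq> cdom (U k)"
    "c \<in> M \<Longrightarrow> smooth_on (cimg c) (\<lambda>x. pu k (cinv c x))"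
    "c \<in> M \<Longrightarrow> continuous_on (cimg c) (\<lambda>x. pu k (cinv c x))"
    "p \<notin> closure {p. pu k p \<noteq> 0} \<Longrightarrow> pu k p = 0" "p \<notin> cdom (U k) \<Longrightarrow> pu k p = 0"
proof -
  have *: "smooth_fun M (pu k)" and sub: "closure {p. pu k p \<noteq> 0} \<subseteq> cdom (U k)"
    and U: "U k \<in> M"
    using assms unfolding partition_of_unity_def by blast+
  show "U k \<in> M" "closed (closure {p. pu k p \<noteq> 0})" "closure {p. pu k p \<noteq> 0} \<subseteq> cdom (U k)"
    using U sub by auto
  show sm: "smooth_on (cimg c) (\<lambda>x. pu k (cinv c x))" if "c \<in> M"
    using * that unfolding smooth_fun_def o_def by blast
  show "continuous_on (cimg c) (\<lambda>x. pu k (cinv c x))" if "c \<in> M"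
    using smooth_on_continuous[OF sm[OF that]] .
  show "pu k p = 0" if "p \<notin> closure {p. pu k p \<noteq> 0}" for p
    using that subsetD[OF closure_subset[of "{p. pu k p \<noteq> 0}"], of p] by auto
  then show "pu k p = 0" if "p \<notin> cdom (U k)" for p using sub that by blast
qed

text \<open>The surface integral is a definite description over all partitions of unity, so the
  value must be independent of the partition. Both sums are refined by the products of their
  functions; each product is supported in two charts, and the two integrals over it agree by the
  substitution formula.\<close>

lemma surface_integral_eq:
  assumes w: "density w" and P: "partition_of_unity M N U pu"
  shows "surface_integral M w = (\<Sum>k<N. LINT x:cimg (U k)|lborel. pu k (cinv (U k) x) *\<^sub>R w (U k) x)"
proof -
  have *: "(\<Sum>k<N. LINT x:cimg (U k)|lborel. pu k (cinv (U k) x) *\<^sub>R w (U k) x) =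
    (\<Sum>k<N. \<Sum>j<N'. LINT x:cimg (U k)|lborel. pu k (cinv (U k) x) *\<^sub>R qu j (cinv (U k) x) *\<^sub>R w (U k) x)"
    if P: "partition_of_unity M N U pu" and Q: "partition_of_unity M N' V qu" for N U pu N' V qu
  proof (rule sum.cong[OF refl])
    fix k assume "k \<in> {..<N}"
    then have k: "k < N" by simp
    note k' = partition_of_unityD[OF P k]
    have wc: "continuous_on (cimg (U k)) (w (U k))" using w k'(1) unfolding density_def by blast
    have "set_integrable lborel (cimg (U k)) (\<lambda>x. pu k (cinv (U k) x) *\<^sub>R qu j (cinv (U k) x) *\<^sub>R w (U k) x)" if "j < N'" for j
    proof (rule set_integrable_chart[OF k'(1) _ k'(2,3)])
      show "continuous_on (cimg (U k)) (\<lambda>x. pu k (cinv (U k) x) *\<^sub>R qu j (cinv (U k) x) *\<^sub>R w (U k) x)"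
        by (intro continuous_intros wc k'(5) partition_of_unityD(5)[OF Q that] k'(1))
      show "pu k (cinv (U k) x) *\<^sub>R qu j (cinv (U k) x) *\<^sub>R w (U k) x = 0" if "cinv (U k) x \<notin> closure {p. pu k p \<noteq> 0}" for x
        using k'(6)[OF that] by simp
    qed
    then have "(\<Sum>j<N'. LINT x:cimg (U k)|lborel. pu k (cinv (U k) x) *\<^sub>R qu j (cinv (U k) x) *\<^sub>R w (U k) x) =
      (LINT x:cimg (U k)|lborel. \<Sum>j<N'. pu k (cinv (U k) x) *\<^sub>R qu j (cinv (U k) x) *\<^sub>R w (U k) x)"
      unfolding set_lebesgue_integral_def set_integrable_def scaleR_sum_right
      by (intro Bochner_Integration.integral_sum[symmetric]) auto
    also have "\<dots> = (LINT x:cimg (U k)|lborel. pu k (cinv (U k) x) *\<^sub>R w (U k) x)"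
    proof -
      have "(\<Sum>j<N'. qu j p) = 1" for p using Q by (auto simp: partition_of_unity_def)
      then show ?thesis by (simp only: scaleR_sum_right[symmetric] scaleR_sum_left[symmetric] scaleR_one)
    qed
    finally show "(LINT x:cimg (U k)|lborel. pu k (cinv (U k) x) *\<^sub>R w (U k) x) =
       (\<Sum>j<N'. LINT x:cimg (U k)|lborel. pu k (cinv (U k) x) *\<^sub>R qu j (cinv (U k) x) *\<^sub>R w (U k) x)" ..
  qed
  \<comment> \<open>After inserting the other partition on both sides, the double sums differ only
    by the order of summation and by the chart in which each product is integrated.\<close>
  have indep: "(\<Sum>k<N. LINT x:cimg (U k)|lborel. pu k (cinv (U k) x) *\<^sub>R w (U k) x) =
      (\<Sum>j<N'. LINT x:cimg (V j)|lborel. qu j (cinv (V j) x) *\<^sub>R w (V j) x)"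
    if Q: "partition_of_unity M N' V qu" for N' V qu
  proof -
    have "(LINT x:cimg (U k)|lborel. pu k (cinv (U k) x) *\<^sub>R qu j (cinv (U k) x) *\<^sub>R w (U k) x) =
      (LINT x:cimg (V j)|lborel. qu j (cinv (V j) x) *\<^sub>R pu k (cinv (V j) x) *\<^sub>R w (V j) x)"
      if k: "k < N" and j: "j < N'" for k j
    proof -
      note k' = partition_of_unityD[OF P k] and j' = partition_of_unityD[OF Q j]
      have wc: "continuous_on (cimg (V j)) (w (V j))" using w j'(1) unfolding density_def by blast
      show ?thesis
      proof (rule integral_transition[OF k'(1) j'(1)])
        show "continuous_on (overlap (V j) (U k)) (\<lambda>x. qu j (cinv (V j) x) *\<^sub>R pu k (cinv (V j) x) *\<^sub>R w (V j) x)"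
          by (rule continuous_on_subset[OF _ overlap_subset]) (intro continuous_intros wc k'(5) j'(5) j'(1))
        fix x assume x: "x \<in> overlap (U k) (V j)"
        have "w (U k) x = det (jacobian (transition (U k) (V j)) x) *\<^sub>R w (V j) (transition (U k) (V j) x)"
          using w k'(1) j'(1) x unfolding density_def by blast
        then show "pu k (cinv (U k) x) *\<^sub>R qu j (cinv (U k) x) *\<^sub>R w (U k) x =
          det (jacobian (transition (U k) (V j)) x) *\<^sub>R
            qu j (cinv (V j) (transition (U k) (V j) x)) *\<^sub>R
            pu k (cinv (V j) (transition (U k) (V j) x)) *\<^sub>R w (V j) (transition (U k) (V j) x)"
          by (simp add: cinv_transition k'(1) j'(1) x ac_simps)
      next
        show "pu k (cinv (U k) x) *\<^sub>R qu j (cinv (U k) x) *\<^sub>R w (U k) x = 0" if "x \<in> cimg (U k) - overlap (U k) (V j)" for x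
          using that j'(7) by (simp add: overlap_iff k'(1))
        show "qu j (cinv (V j) x) *\<^sub>R pu k (cinv (V j) x) *\<^sub>R w (V j) x = 0" if "x \<in> cimg (V j) - overlap (V j) (U k)" for x
          using that k'(7) by (simp add: overlap_iff j'(1))
      qed
    qed
    then show ?thesis
      unfolding *[OF P Q] *[OF Q P] by (subst (2) sum.swap) auto
  qed
  show ?thesis unfolding surface_integral_def
  proof (rule the_equality)
    show "\<forall>N' V qu. partition_of_unity M N' V qu \<longrightarrow>
       (\<Sum>k<N. LINT x:cimg (U k)|lborel. pu k (cinv (U k) x) *\<^sub>R w (U k) x) =
       (\<Sum>k<N'. LINT x:cimg (V k)|lborel. qu k (cinv (V k) x) *\<^sub>R w (V k) x)"
      using indep by blast
  qed (use P in blast)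
qed

end

section \<open>Holonomy of closed paths\<close>

context surface
begin

text \<open>Keeps only what holonomies depend on, so that it transfers to the reversed curve without
  going back to injectivity and nonvanishing velocity.\<close>

definition closed_path :: "(real \<Rightarrow> 'p) \<Rightarrow> bool" where
  "closed_path \<gamma> \<longleftrightarrow> (\<forall>t. \<gamma> (t + 1) = \<gamma> t) \<and> continuous_on UNIV \<gamma> \<and>
     (\<forall>c\<in>M. smooth_on {t. \<gamma> t \<in> cdom c} (cmap c \<circ> \<gamma>))"

lemma simple_imp_closed_path: "smooth_simple_closed_curve M \<gamma> \<Longrightarrow> closed_path \<gamma>"
  unfolding smooth_simple_closed_curve_def closed_path_def by blast

lemma closed_path_periodic: "closed_path \<gamma> \<Longrightarrow> \<gamma> (t + 1) = \<gamma> t"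
  unfolding closed_path_def by blast

lemma closed_path_continuous: "closed_path \<gamma> \<Longrightarrow> continuous_on UNIV \<gamma>"
  unfolding closed_path_def by blast

lemma open_path_vimage:
  assumes "closed_path \<gamma>" "open W" shows "open {t. \<gamma> t \<in> W}"
  using open_vimage[OF assms(2) closed_path_continuous[OF assms(1)]] by (simp add: vimage_def)

lemma closed_path_vimage:
  assumes "closed_path \<gamma>" "closed W" shows "closed {t. \<gamma> t \<in> W}"
  using closed_vimage[OF assms(2) closed_path_continuous[OF assms(1)]] by (simp add: vimage_def)

lemma path_smooth: "closed_path \<gamma> \<Longrightarrow> c \<in> M \<Longrightarrow> smooth_on {t. \<gamma> t \<in> cdom c} (\<lambda>t. cmap c (\<gamma> t))"
  unfolding closed_path_def o_def by blast

lemma path_chart_continuous: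
  "closed_path \<gamma> \<Longrightarrow> c \<in> M \<Longrightarrow> continuous_on {t. \<gamma> t \<in> cdom c} (\<lambda>t. cmap c (\<gamma> t))"
  using smooth_on_continuous[OF path_smooth] .

lemma path_has_derivative:
  assumes "closed_path \<gamma>" "c \<in> M" "\<gamma> t \<in> cdom c"
  shows "((\<lambda>t. cmap c (\<gamma> t)) has_vector_derivative velocity c \<gamma> t UNIV) (at t)"
proof -
  have "((\<lambda>t. cmap c (\<gamma> t)) has_derivative frechet_derivative (\<lambda>t. cmap c (\<gamma> t)) (at t)) (at t)"
    by (rule smooth_on_has_derivative[OF path_smooth[OF assms(1,2)]]) (use assms(3) in simp)
  then have "(\<lambda>t. cmap c (\<gamma> t)) differentiable (at t)" by (rule differentiableI)
  then show ?thesis unfolding velocity_def o_def by (simp add: vector_derivative_works)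
qed

lemma velocity_eqI:
  "((\<lambda>t. cmap c (\<gamma> t)) has_vector_derivative v) (at t) \<Longrightarrow> velocity c \<gamma> t UNIV = v"
  unfolding velocity_def o_def by (rule vector_derivative_at)

lemma velocity_within_eqI:
  "((\<lambda>t. cmap c (\<gamma> t)) has_vector_derivative v) (at t) \<Longrightarrow> t \<in> {0..1} \<Longrightarrow> velocity c \<gamma> t {0..1} = v"
  unfolding velocity_def o_def by (rule vector_derivative_at_within_ivl) auto

lemma velocity_continuous:
  assumes "closed_path \<gamma>" "c \<in> M"
  shows "continuous_on {t. \<gamma> t \<in> cdom c} (\<lambda>t. velocity c \<gamma> t UNIV)"
proof -
  have "continuous_on {t. \<gamma> t \<in> cdom c} (\<lambda>t. frechet_derivative (\<lambda>t. cmap c (\<gamma> t)) (at t) 1)"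
    by (rule smooth_on_continuous[OF smooth_on_frechet[OF path_smooth[OF assms]]])
  moreover have "frechet_derivative (\<lambda>t. cmap c (\<gamma> t)) (at t) 1 = velocity c \<gamma> t UNIV"
    if "t \<in> {t. \<gamma> t \<in> cdom c}" for t
    using frechet_derivative_eqI[OF path_has_derivative[OF assms, unfolded has_vector_derivative_def], of t] that
    by simp
  ultimately show ?thesis by (rule continuous_on_eq)
qed

lemma velocity_periodic: assumes "closed_path \<gamma>" "c \<in> M" "\<gamma> t \<in> cdom c"
  shows "velocity c \<gamma> (t + 1) UNIV = velocity c \<gamma> t UNIV"
proof (rule velocity_eqI)
  have "((\<lambda>t. cmap c (\<gamma> (-1 + 1 * t))) has_vector_derivative 1 *\<^sub>R velocity c \<gamma> t UNIV) (at (t + 1))"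
    by (rule has_vector_derivative_affine) (use path_has_derivative[OF assms] in simp)
  moreover have "\<gamma> (-1 + 1 * t) = \<gamma> t" for t
    using closed_path_periodic[OF assms(1), of "-1 + t"] by simp
  ultimately show "((\<lambda>t. cmap c (\<gamma> t)) has_vector_derivative velocity c \<gamma> t UNIV) (at (t + 1))" by simp
qed

lemma velocity_transition:
  assumes "closed_path \<gamma>" "c \<in> M" "d \<in> M" "\<gamma> t \<in> cdom c" "\<gamma> t \<in> cdom d"
  shows "velocity d \<gamma> t UNIV = jacobian (transition c d) (cmap c (\<gamma> t)) *v velocity c \<gamma> t UNIV"
proof (rule velocity_eqI)
  have x: "cmap c (\<gamma> t) \<in> overlap c d" using assms by (simp add: overlap_iff cmap_in cinv_cmap)
  have "((\<lambda>t. transition c d (cmap c (\<gamma> t))) has_derivative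
      (\<lambda>u. jacobian (transition c d) (cmap c (\<gamma> t)) *v (u *\<^sub>R velocity c \<gamma> t UNIV))) (at t)"
    by (rule has_derivative_compose[OF path_has_derivative[OF assms(1,2,4), unfolded has_vector_derivative_def]
          transition_has_derivative[OF assms(2,3) x]])
  then have "((\<lambda>t. transition c d (cmap c (\<gamma> t))) has_vector_derivative
      jacobian (transition c d) (cmap c (\<gamma> t)) *v velocity c \<gamma> t UNIV) (at t)"
    by (simp add: has_vector_derivative_def matrix_vector_mult_scaleR)
  then show "((\<lambda>t. cmap d (\<gamma> t)) has_vector_derivative
      jacobian (transition c d) (cmap c (\<gamma> t)) *v velocity c \<gamma> t UNIV) (at t)"
    by (rule has_vector_derivative_transform_within_open[OF _ open_path_vimage[OF assms(1) chart(1)[OF assms(2)]]])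
      (use assms in \<open>simp_all add: transition_cmap\<close>)
qed

text \<open>Uniqueness for the description in \<open>hol\<close>: if \<open>k\<close> is another
  transport, \<open>k t ** g t\<close> is continuous with zero derivative off a finite set, hence
  constant, and multiplying by \<open>h 1\<close> yields the same endpoint.\<close>

lemma hol_eqI:
  fixes v :: "('p, 'n::finite) matform"
  assumes fin: "finite S" and h0: "h 0 = mat 1"
    and cont: "continuous_on {0..1} h" "continuous_on {0..1} g"
    and inv: "\<And>t. t \<in> {0..1} \<Longrightarrow> h t ** g t = mat 1"
    and X: "\<And>t c. t \<in> {0..1} - S \<Longrightarrow> c \<in> M \<Longrightarrow> \<gamma> t \<in> cdom c \<Longrightarrow>
      (\<Sum>a\<in>UNIV. (velocity c \<gamma> t {0..1} $ a) *\<^sub>R (v c (cmap c (\<gamma> t)) $ a)) = X t"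
    and h: "\<And>t. t \<in> {0..1} - S \<Longrightarrow> (h has_vector_derivative h t ** X t) (at t within {0..1})"
    and g: "\<And>t. t \<in> {0..1} - S \<Longrightarrow> (g has_vector_derivative - (X t ** g t)) (at t within {0..1})"
  shows "hol M \<gamma> v = h 1"
  unfolding hol_def
proof (rule the_equality)
  have "parallel_transport M v \<gamma> h"
    unfolding parallel_transport_def using h0 cont(1)
    by (intro conjI exI[of _ S] fin ballI impI) (simp_all add: X h)
  then show "\<exists>ha. parallel_transport M v \<gamma> ha \<and> ha 1 = h 1" by blast
next
  fix H assume "\<exists>k. parallel_transport M v \<gamma> k \<and> k 1 = H"
  then obtain k where k: "parallel_transport M v \<gamma> k" "k 1 = H" by blast
  then obtain T where T: "finite T" and dk: "\<And>t c. t \<in> {0..1} - T \<Longrightarrow> c \<in> M \<Longrightarrow> \<gamma> t \<in> cdom c \<Longrightarrow>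
    (k has_vector_derivative
           k t ** (\<Sum>a\<in>UNIV. (velocity c \<gamma> t {0..1} $ a) *\<^sub>R (v c (cmap c (\<gamma> t)) $ a)))
        (at t within {0..1})"
    and k0: "k 0 = mat 1" and kc: "continuous_on {0..1} k"
    unfolding parallel_transport_def by blast
  have der: "((\<lambda>t. k t ** g t) has_derivative (\<lambda>h. 0)) (at t within {0..1})" if t: "t \<in> {0..1} - (S \<union> T)" for t
  proof -
    obtain c where c: "c \<in> M" "\<gamma> t \<in> cdom c" using ex_chart by blast
    have 1: "(k has_vector_derivative k t ** X t) (at t within {0..1})"
      using dk[of t c] X[of t c] t c by simp
    have "((\<lambda>t. k t ** g t) has_vector_derivative k t ** - (X t ** g t) + k t ** X t ** g t) (at t within {0..1})"
      by (rule matmul_has_vector_derivative[OF 1 g]) (use t in simp)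
    then show ?thesis by (simp add: has_vector_derivative_def matmul_minus_right matrix_mul_assoc)
  qed
  have g0: "g 0 = mat 1" using inv[of 0] h0 by simp
  have "k 1 ** g 1 = mat 1"
    by (rule has_derivative_zero_unique_strong_interval[of "S \<union> T" 0 1 "\<lambda>t. k t ** g t"])
      (use fin T k0 g0 der cont kc in \<open>auto intro!: matmul_continuous_on\<close>)
  then have "k 1 ** g 1 ** h 1 = h 1" by simp
  moreover have "g 1 ** h 1 = mat 1" using inv[of 1] matrix_left_right_inverse by auto
  ultimately show "H = h 1" using k(2) by (simp add: matrix_mul_assoc[symmetric])
qed

text \<open>\<open>X\<close> is the pullback of the form to the parameter line. Quantifying over all
  charts at once records that it does not depend on the chart.\<close>

definition pulls_back :: "('p, 'n::finite) matform \<Rightarrow> (real \<Rightarrow> 'p) \<Rightarrow> (real \<Rightarrow> 'n cmat) \<Rightarrow> bool" where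
  "pulls_back v \<gamma> X \<longleftrightarrow> (\<forall>t. \<forall>c\<in>M. \<gamma> t \<in> cdom c \<longrightarrow>
     (\<Sum>a\<in>UNIV. (velocity c \<gamma> t UNIV $ a) *\<^sub>R (v c (cmap c (\<gamma> t)) $ a)) = X t)"

lemma pulls_backD:
  "pulls_back v \<gamma> X \<Longrightarrow> c \<in> M \<Longrightarrow> \<gamma> t \<in> cdom c \<Longrightarrow>
     (\<Sum>a\<in>UNIV. (velocity c \<gamma> t UNIV $ a) *\<^sub>R (v c (cmap c (\<gamma> t)) $ a)) = X t"
  unfolding pulls_back_def by blast

lemma pulls_back_periodic:
  assumes "closed_path \<gamma>" "pulls_back v \<gamma> X" shows "X (t + 1) = X t"
proof -
  obtain c where c: "c \<in> M" "\<gamma> t \<in> cdom c" using ex_chart by blast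
  show ?thesis
    using pulls_backD[OF assms(2) c] pulls_backD[OF assms(2) c(1), of "t + 1"] c(2)
    by (simp add: closed_path_periodic[OF assms(1)] velocity_periodic[OF assms(1) c])
qed

lemma hol_closed_path:
  assumes "closed_path \<gamma>" "pulls_back v \<gamma> X" "flow X h g"
  shows "hol M \<gamma> v = h 1"
proof (rule hol_eqI[of "{}" h g])
  fix t :: real and c assume t: "t \<in> {0..1} - {}" "c \<in> M" "\<gamma> t \<in> cdom c"
  have "velocity c \<gamma> t {0..1} = velocity c \<gamma> t UNIV"
    by (rule velocity_within_eqI[OF path_has_derivative[OF assms(1) t(2,3)]]) (use t in simp)
  then show "(\<Sum>a\<in>UNIV. (velocity c \<gamma> t {0..1} $ a) *\<^sub>R (v c (cmap c (\<gamma> t)) $ a)) = X t"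
    using pulls_backD[OF assms(2) t(2,3)] by simp
qed (use flowD[OF assms(3)] flow_continuous[OF assms(3)] in \<open>auto intro: has_vector_derivative_at_within\<close>)

text \<open>\<open>shiftpath\<close> wraps around at time 1; for a 1-periodic path both of its
  branches are the plain translate.\<close>

lemma shiftpath_periodic: "closed_path \<gamma> \<Longrightarrow> shiftpath a \<gamma> t = \<gamma> (a + t)"
  using closed_path_periodic[of \<gamma> "a + t - 1"] by (simp add: shiftpath_def)

text \<open>Each factor on the right is the holonomy of one loop based at its parameter, a conjugate
  of the holonomy from time 0. The concatenation has a corner at 1/2, which becomes the exceptional
  point.\<close>

lemma hol_loop_product:
  fixes v :: "('p, 'n::finite) matform"
  assumes \<gamma>: "closed_path \<gamma>" "pulls_back v \<gamma> X" "flow X h g"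
    and \<gamma>': "closed_path \<gamma>'" "pulls_back v \<gamma>' X'" "flow X' h' g'"
  shows "hol M (shiftpath a \<gamma> +++ shiftpath b \<gamma>') v = (g a ** h 1 ** h a) ** (g' b ** h' 1 ** h' b)"
proof -
  define h1 g1 where "h1 = (\<lambda>t. g a ** h (a + t))" and "g1 = (\<lambda>t. g (a + t) ** h a)"
  define h2 g2 where "h2 = (\<lambda>t. g' b ** h' (b + t))" and "g2 = (\<lambda>t. g' (b + t) ** h' b)"
  have f1: "flow (\<lambda>t. X (a + t)) h1 g1" unfolding h1_def g1_def by (rule flow_shift[OF \<gamma>(3)])
  have f2: "flow (\<lambda>t. X' (b + t)) h2 g2" unfolding h2_def g2_def by (rule flow_shift[OF \<gamma>'(3)])
  define P where "P = shiftpath a \<gamma> +++ shiftpath b \<gamma>'"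
  have P: "P t = (if t \<le> 1/2 then \<gamma> (a + 2 * t) else \<gamma>' (b - 1 + 2 * t))" for t
    by (simp add: P_def joinpaths_def shiftpath_periodic \<gamma> \<gamma>' algebra_simps)
  \<comment> \<open>Transport along the concatenation: after 1/2 the complete first loop stands to
    the left of the second transport, and the inverse \<open>G\<close> has the opposite order. The
    factor 2 in \<open>Y\<close> is the doubled speed.\<close>
  define H where "H = (\<lambda>t. if t \<le> 1/2 then h1 (2 * t) else h1 1 ** h2 (2 * t - 1))"
  define G where "G = (\<lambda>t. if t \<le> 1/2 then g1 (2 * t) else g2 (2 * t - 1) ** g1 1)"
  define Y where "Y = (\<lambda>t. if t \<le> 1/2 then 2 *\<^sub>R X (a + 2 * t) else 2 *\<^sub>R X' (b - 1 + 2 * t))"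
  note D1 = flowD[OF f1] and D2 = flowD[OF f2]
  have "h1 1 = g a ** h 1 ** h a"
    using flow_periodic[OF \<gamma>(3) pulls_back_periodic[OF \<gamma>(1,2)], of a]
    by (simp add: h1_def add.commute matrix_mul_assoc)
  moreover have "h2 1 = g' b ** h' 1 ** h' b"
    using flow_periodic[OF \<gamma>'(3) pulls_back_periodic[OF \<gamma>'(1,2)], of b]
    by (simp add: h2_def add.commute matrix_mul_assoc)
  ultimately have H1: "H 1 = (g a ** h 1 ** h a) ** (g' b ** h' 1 ** h' b)" by (simp add: H_def)
  \<comment> \<open>Away from 1/2 only one branch is visible in an open half-line, so derivatives
    can be computed there branch by branch.\<close>
  have split: "(F has_vector_derivative D) (at t)"
    if "(if t \<le> 1/2 then F1 t else F2 t) = F t" "t \<noteq> 1/2"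
      "t < 1/2 \<Longrightarrow> (F1 has_vector_derivative D) (at t)" "1/2 < t \<Longrightarrow> (F2 has_vector_derivative D) (at t)"
      "\<And>t. F t = (if t \<le> 1/2 then F1 t else F2 t)"
    for F F1 F2 :: "real \<Rightarrow> 'z::real_normed_vector" and D t
  proof (cases "t < 1/2")
    case True
    show ?thesis
      by (rule has_vector_derivative_transform_within_open[OF that(3)[OF True], of "{..<1/2}"]) (use True that(5) in auto)
  next
    case False
    then have t: "1/2 < t" using that by simp
    show ?thesis
      by (rule has_vector_derivative_transform_within_open[OF that(4)[OF t], of "{1/2<..}"]) (use t that(5) in auto)
  qed
  have contH: "continuous_on {0..1} H"
  proof -
    have "continuous_on ({0..1/2} \<union> {1/2..1}) H" unfolding H_def
      by (intro continuous_on_If matmul_continuous_on continuous_intros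
          continuous_on_compose2[OF flow_continuous(1)[OF f1, of UNIV]]
          continuous_on_compose2[OF flow_continuous(1)[OF f2, of UNIV]]) (auto simp: D2 mult.commute[of _ 2])
    moreover have "{0..1/2} \<union> {1/2..1} = {0..1::real}" by auto
    ultimately show ?thesis by simp
  qed
  have contG: "continuous_on {0..1} G"
  proof -
    have "continuous_on ({0..1/2} \<union> {1/2..1}) G" unfolding G_def
      by (intro continuous_on_If matmul_continuous_on continuous_intros
          continuous_on_compose2[OF flow_continuous(2)[OF f1, of UNIV]]
          continuous_on_compose2[OF flow_continuous(2)[OF f2, of UNIV]]) (auto simp: D2 mult.commute[of _ 2])
    moreover have "{0..1/2} \<union> {1/2..1} = {0..1::real}" by auto
    ultimately show ?thesis by simp
  qed
  have "hol M P v = H 1"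
  proof (rule hol_eqI[of "{1/2}" H G])
    show "H t ** G t = mat 1" for t
    proof (cases "t \<le> 1/2")
      case False
      have "h1 1 ** h2 (2 * t - 1) ** (g2 (2 * t - 1) ** g1 1) = h1 1 ** (h2 (2 * t - 1) ** g2 (2 * t - 1)) ** g1 1"
        by (simp add: matrix_mul_assoc)
      then show ?thesis using False by (simp add: H_def G_def D1 D2)
    qed (simp add: H_def G_def D1)
  next
    fix t :: real assume t: "t \<in> {0..1} - {1/2}"
    have "(H has_vector_derivative H t ** Y t) (at t)"
    proof (rule split[of t "\<lambda>t. h1 (2 * t)" "\<lambda>t. h1 1 ** h2 (2 * t - 1)"])
      assume "t < 1/2"
      then show "((\<lambda>t. h1 (2 * t)) has_vector_derivative H t ** Y t) (at t)"
        using has_vector_derivative_affine[of h1 _ 0 2 t] D1(5)[of "2 * t"]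
        by (simp add: H_def Y_def matmul_scaleR_right)
    next
      assume "1/2 < t"
      have "((\<lambda>t. h2 (-1 + 2 * t)) has_vector_derivative 2 *\<^sub>R (h2 (-1 + 2 * t) ** X' (b + (-1 + 2 * t)))) (at t)"
        by (rule has_vector_derivative_affine[of h2 _ "-1" 2 t, OF D2(5)])
      from matmul_has_vector_derivative[OF has_vector_derivative_const[of "h1 1"] this]
      show "((\<lambda>t. h1 1 ** h2 (2 * t - 1)) has_vector_derivative H t ** Y t) (at t)"
        using \<open>1/2 < t\<close> by (simp add: H_def Y_def matmul_scaleR_right matrix_mul_assoc algebra_simps)
    qed (use t in \<open>auto simp: H_def\<close>)
    then show "(H has_vector_derivative H t ** Y t) (at t within {0..1})" by (rule has_vector_derivative_at_within)
    have "(G has_vector_derivative - (Y t ** G t)) (at t)"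
    proof (rule split[of t "\<lambda>t. g1 (2 * t)" "\<lambda>t. g2 (2 * t - 1) ** g1 1"])
      assume "t < 1/2"
      then show "((\<lambda>t. g1 (2 * t)) has_vector_derivative - (Y t ** G t)) (at t)"
        using has_vector_derivative_affine[of g1 _ 0 2 t] D1(6)[of "2 * t"]
        by (simp add: G_def Y_def matmul_scaleR_left scaleR_minus_right[symmetric] del: scaleR_minus_right)
    next
      assume "1/2 < t"
      have "((\<lambda>t. g2 (-1 + 2 * t)) has_vector_derivative 2 *\<^sub>R - (X' (b + (-1 + 2 * t)) ** g2 (-1 + 2 * t))) (at t)"
        by (rule has_vector_derivative_affine[of g2 _ "-1" 2 t, OF D2(6)])
      from matmul_has_vector_derivative[OF this has_vector_derivative_const[of "g1 1"]]
      show "((\<lambda>t. g2 (2 * t - 1) ** g1 1) has_vector_derivative - (Y t ** G t)) (at t)"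
        using \<open>1/2 < t\<close> by (simp add: G_def Y_def matmul_scaleR_left matmul_minus_left matrix_mul_assoc algebra_simps)
    qed (use t in \<open>auto simp: G_def\<close>)
    then show "(G has_vector_derivative - (Y t ** G t)) (at t within {0..1})" by (rule has_vector_derivative_at_within)
  next
    fix t :: real and c assume t: "t \<in> {0..1} - {1/2}" and c: "c \<in> M" "P t \<in> cdom c"
    show "(\<Sum>a\<in>UNIV. (velocity c P t {0..1} $ a) *\<^sub>R (v c (cmap c (P t)) $ a)) = Y t"
    proof (cases "t < 1/2")
      case True
      then have Pt: "P t = \<gamma> (a + 2 * t)" by (simp add: P)
      have "((\<lambda>t. cmap c (P t)) has_vector_derivative 2 *\<^sub>R velocity c \<gamma> (a + 2 * t) UNIV) (at t)"
      proof (rule split[of t "\<lambda>t. cmap c (\<gamma> (a + 2 * t))" "\<lambda>t. cmap c (\<gamma>' (b - 1 + 2 * t))"])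
        show "((\<lambda>t. cmap c (\<gamma> (a + 2 * t))) has_vector_derivative 2 *\<^sub>R velocity c \<gamma> (a + 2 * t) UNIV) (at t)"
          using path_has_derivative[OF \<gamma>(1) c(1)] c(2) Pt
          by (intro has_vector_derivative_affine[of "\<lambda>t. cmap c (\<gamma> t)"]) simp
      qed (use True P in auto)
      from velocity_within_eqI[OF this] t
      have "velocity c P t {0..1} = 2 *\<^sub>R velocity c \<gamma> (a + 2 * t) UNIV" by simp
      then show ?thesis
        using pulls_backD[OF \<gamma>(2) c(1), of "a + 2 * t"] c(2) True
        by (simp add: Pt Y_def scaleR_sum_right[symmetric] scaleR_scaleR[symmetric] del: scaleR_scaleR)
    next
      case False
      then have t2: "1/2 < t" using t by simp
      then have Pt: "P t = \<gamma>' (b - 1 + 2 * t)" by (simp add: P)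
      have "((\<lambda>t. cmap c (P t)) has_vector_derivative 2 *\<^sub>R velocity c \<gamma>' (b - 1 + 2 * t) UNIV) (at t)"
      proof (rule split[of t "\<lambda>t. cmap c (\<gamma> (a + 2 * t))" "\<lambda>t. cmap c (\<gamma>' (b - 1 + 2 * t))"])
        show "((\<lambda>t. cmap c (\<gamma>' (b - 1 + 2 * t))) has_vector_derivative 2 *\<^sub>R velocity c \<gamma>' (b - 1 + 2 * t) UNIV) (at t)"
          using path_has_derivative[OF \<gamma>'(1) c(1)] c(2) Pt
          by (intro has_vector_derivative_affine[of "\<lambda>t. cmap c (\<gamma>' t)"]) simp
      qed (use t2 P in auto)
      from velocity_within_eqI[OF this] t
      have "velocity c P t {0..1} = 2 *\<^sub>R velocity c \<gamma>' (b - 1 + 2 * t) UNIV" by simp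
      then show ?thesis
        using pulls_backD[OF \<gamma>'(2) c(1), of "b - 1 + 2 * t"] c(2) t2
        by (simp add: Pt Y_def scaleR_sum_right[symmetric] scaleR_scaleR[symmetric] del: scaleR_scaleR)
    qed
  qed (use contH contG in \<open>auto simp: H_def D1\<close>)
  then show ?thesis unfolding P_def H1 .
qed

lemma closed_path_reverse:
  assumes "closed_path \<gamma>" shows "closed_path (reversepath \<gamma>)"
  unfolding closed_path_def
proof (intro conjI allI ballI)
  show "reversepath \<gamma> (t + 1) = reversepath \<gamma> t" for t
    using closed_path_periodic[OF assms, of "- t"] by (simp add: reversepath_def algebra_simps)
  show "continuous_on UNIV (reversepath \<gamma>)" unfolding reversepath_def
    by (rule continuous_on_compose2[OF closed_path_continuous[OF assms]]) (auto intro!: continuous_intros)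
  fix c assume c: "c \<in> M"
  have op: "open {t. \<gamma> t \<in> cdom c}" "open {t. \<gamma> (1 - t) \<in> cdom c}"
    using open_path_vimage[OF assms chart(1)[OF c]]
      open_vimage[OF open_path_vimage[OF assms chart(1)[OF c]], of "\<lambda>t. 1 - t"]
    by (simp_all add: vimage_def continuous_on_diff)
  have "smooth_on {t. \<gamma> (1 - t) \<in> cdom c} (\<lambda>t::real. 1 + - t)"
    by (intro smooth_on_add op smooth_on_const smooth_on_ident
        smooth_on_bounded_linear[OF bounded_linear_minus[OF bounded_linear_ident]])
  then have "smooth_on {t. \<gamma> (1 - t) \<in> cdom c} (\<lambda>t. cmap c (\<gamma> (1 + - t)))"
    by (intro smooth_on_compose[OF op(2,1) path_smooth[OF assms c]]) auto
  then show "smooth_on {t. reversepath \<gamma> t \<in> cdom c} (cmap c \<circ> reversepath \<gamma>)"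
    by (simp add: reversepath_def o_def)
qed

lemma pulls_back_reverse:
  assumes "closed_path \<gamma>" "pulls_back v \<gamma> X"
  shows "pulls_back v (reversepath \<gamma>) (\<lambda>t. - X (1 - t))"
  unfolding pulls_back_def
proof (intro allI ballI impI)
  fix t c assume c: "c \<in> M" "reversepath \<gamma> t \<in> cdom c"
  then have g: "\<gamma> (1 - t) \<in> cdom c" by (simp add: reversepath_def)
  have "((\<lambda>t. cmap c (\<gamma> (1 + (-1) * t))) has_vector_derivative (-1) *\<^sub>R velocity c \<gamma> (1 - t) UNIV) (at t)"
    using path_has_derivative[OF assms(1) c(1) g]
    by (intro has_vector_derivative_affine[of "\<lambda>t. cmap c (\<gamma> t)"]) simp
  then have "velocity c (reversepath \<gamma>) t UNIV = - velocity c \<gamma> (1 - t) UNIV"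
    by (intro velocity_eqI) (simp add: reversepath_def)
  then show "(\<Sum>a\<in>UNIV. (velocity c (reversepath \<gamma>) t UNIV $ a) *\<^sub>R (v c (cmap c (reversepath \<gamma> t)) $ a)) = - X (1 - t)"
    using pulls_backD[OF assms(2) c(1) g] by (simp add: reversepath_def sum_negf)
qed

end

section \<open>Concentration of integrals at nondegenerate zeros\<close>

lemma lborel_integral_affine:
  fixes f :: "'a::euclidean_space \<Rightarrow> 'b::{banach, second_countable_topology}"
  assumes "c \<noteq> 0" "f \<in> borel_measurable borel"
  shows "(LINT x|lborel. f x) = \<bar>c\<bar> ^ DIM('a) *\<^sub>R (LINT x|lborel. f (t + c *\<^sub>R x))"
proof -
  have "(LINT x|lborel. f x) =
    (LINT x|density (distr lborel borel (\<lambda>x. t + c *\<^sub>R x)) (\<lambda>_. ennreal (\<bar>c\<bar> ^ DIM('a))). f x)"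
    using lborel_affine[OF assms(1), of t] by (simp add: ennreal_power)
  also have "\<dots> = (LINT x|distr lborel borel (\<lambda>x. t + c *\<^sub>R x). \<bar>c\<bar> ^ DIM('a) *\<^sub>R f x)"
    using assms(2) by (subst integral_density) auto
  also have "\<dots> = (LINT x|lborel. \<bar>c\<bar> ^ DIM('a) *\<^sub>R f (t + c *\<^sub>R x))"
    using assms(2) by (subst integral_distr) auto
  finally show ?thesis by simp
qed

lemma bounded_compact_support:
  fixes \<kappa> :: "'a::euclidean_space \<Rightarrow> real"
  assumes "continuous_on UNIV \<kappa>" "\<And>w. \<kappa> w \<noteq> 0 \<Longrightarrow> norm w \<le> R"
  shows "\<exists>K\<ge>0. \<forall>w. \<bar>\<kappa> w\<bar> \<le> K"
proof -
  have "compact (\<kappa> ` cball 0 R)"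
    by (intro compact_continuous_image continuous_on_subset[OF assms(1)]) auto
  then obtain K where K: "\<And>w. w \<in> cball 0 R \<Longrightarrow> norm (\<kappa> w) \<le> K"
    using compact_imp_bounded bounded_iff by (metis image_eqI)
  have "\<bar>\<kappa> w\<bar> \<le> max K 0" for w
    using K[of w] assms(2)[of w] by (cases "\<kappa> w = 0") auto
  then show ?thesis by (intro exI[of _ "max K 0"]) auto
qed

text \<open>An injective linear map is bounded below, so the composed kernel still has bounded
  support; this holds even if the target space is larger.\<close>

lemma integrable_kernel_linear:
  fixes \<kappa> :: "'w::euclidean_space \<Rightarrow> real" and L :: "'z::euclidean_space \<Rightarrow> 'w"
  assumes "continuous_on UNIV \<kappa>" "\<And>w. \<kappa> w \<noteq> 0 \<Longrightarrow> norm w \<le> R" "linear L" "inj L"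
  shows "integrable lborel (\<lambda>z. \<kappa> (L z))"
proof -
  obtain c where c: "c > 0" "\<And>x. c * norm x \<le> norm (L x)"
    using linear_inj_bounded_below_pos[OF assms(3,4)] by (metis mult.commute)
  have "continuous_on (cball 0 (R / c)) (\<lambda>z. \<kappa> (L z))"
    by (intro continuous_on_compose2[OF assms(1)] linear_continuous_on) (use assms(3) in \<open>auto simp: linear_conv_bounded_linear\<close>)
  from borel_integrable_compact[OF compact_cball this]
  have "integrable lborel (\<lambda>z. indicator (cball 0 (R / c)) z *\<^sub>R \<kappa> (L z))" .
  moreover have "indicator (cball 0 (R / c)) z *\<^sub>R \<kappa> (L z) = \<kappa> (L z)" for z
  proof (cases "\<kappa> (L z) = 0")
    case False
    then have "norm (L z) \<le> R" by (rule assms(2))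
    then have "c * norm z \<le> R" using c(2)[of z] by simp
    then show ?thesis using c(1) by (simp add: field_simps)
  qed simp
  ultimately show ?thesis by (simp only:)
qed

text \<open>The lower bound of the injective derivative beats the first-order error. It isolates the
  zero quantitatively and confines the rescaled kernel to a fixed ball.\<close>

lemma derivative_inj_lower_bound:
  fixes \<Phi> :: "'z::euclidean_space \<Rightarrow> 'w::euclidean_space"
  assumes "(\<Phi> has_derivative L) (at z)" "inj L" "\<Phi> z = 0"
  shows "\<exists>c>0. \<exists>d>0. \<forall>u. norm (u - z) < d \<longrightarrow> c * norm (u - z) \<le> norm (\<Phi> u)"
proof -
  have lin: "linear L" using assms(1) by (rule has_derivative_linear)
  obtain c where c: "c > 0" "\<And>x. c * norm x \<le> norm (L x)"
    using linear_inj_bounded_below_pos[OF lin assms(2)] by (metis mult.commute)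
  \<comment> \<open>The error is allowed half of the lower bound \<open>c\<close>, leaving the other
    half.\<close>
  from assms(1)[unfolded has_derivative_at_alt] c(1) obtain d where
    d: "d > 0" "\<And>u. norm (u - z) < d \<Longrightarrow> norm (\<Phi> u - \<Phi> z - L (u - z)) \<le> c / 2 * norm (u - z)"
    by (metis half_gt_zero)
  have "c / 2 * norm (u - z) \<le> norm (\<Phi> u)" if "norm (u - z) < d" for u
  proof -
    have "norm (L (u - z)) - norm (\<Phi> u) \<le> norm (\<Phi> u - L (u - z))"
      by (metis norm_minus_commute norm_triangle_ineq2)
    then show ?thesis using d(2)[OF that] c(2)[of "u - z"] assms(3) by simp
  qed
  then show ?thesis using c d by (intro exI[of _ "c / 2"] conjI exI[of _ d]) auto
qed

text \<open>Dominated convergence for a parameter decreasing to 0, reduced to the version at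
  infinity by passing to the inverse parameter.\<close>

lemma tendsto_at_right_integral_dominated:
  fixes f :: "'a \<Rightarrow> complex" and s :: "real \<Rightarrow> 'a \<Rightarrow> complex"
  assumes "f \<in> borel_measurable N" "\<And>t. 0 < t \<Longrightarrow> s t \<in> borel_measurable N" "integrable N w"
    and lim: "\<And>x. ((\<lambda>t. s t x) \<longlongrightarrow> f x) (at_right 0)"
    and bound: "\<And>t x. 0 < t \<Longrightarrow> t < t0 \<Longrightarrow> norm (s t x) \<le> w x" and t0: "t0 > 0"
  shows "((\<lambda>t. integral\<^sup>L N (s t)) \<longlongrightarrow> integral\<^sup>L N f) (at_right 0)"
proof -
  define s' where "s' = (\<lambda>t. if 0 < t then s (inverse t) else (\<lambda>_. 0))"
  have ev: "\<forall>\<^sub>F t in at_top. s' t = s (inverse t)"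
    using eventually_gt_at_top[of "0::real"] by eventually_elim (simp add: s'_def)
  have "((\<lambda>t. integral\<^sup>L N (s' t)) \<longlongrightarrow> integral\<^sup>L N f) at_top"
  proof (rule integral_dominated_convergence_at_top[OF assms(1) _ assms(3)])
    show "s' t \<in> borel_measurable N" for t using assms(2) by (simp add: s'_def)
    have "((\<lambda>t. s' t x) \<longlongrightarrow> f x) at_top" for x
    proof (rule Lim_transform_eventually)
      show "((\<lambda>t. s (inverse t) x) \<longlongrightarrow> f x) at_top"
        using lim[of x] by (simp add: filterlim_at_right_to_top)
      show "\<forall>\<^sub>F t in at_top. s (inverse t) x = s' t x" using ev by eventually_elim simp
    qed
    then show "AE x in N. ((\<lambda>t. s' t x) \<longlongrightarrow> f x) at_top" by simp
    have "norm (s' t x) \<le> w x" if "inverse t0 < t" for t x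
    proof -
      have t: "0 < t" using that t0 by (meson less_trans positive_imp_inverse_positive)
      then have "inverse t < t0" using that t0 by (metis inverse_inverse_eq less_imp_inverse_less positive_imp_inverse_positive)
      then show ?thesis using bound[of "inverse t" x] t by (simp add: s'_def)
    qed
    then show "\<forall>\<^sub>F t in at_top. AE x in N. norm (s' t x) \<le> w x"
      by (intro eventually_mono[OF eventually_gt_at_top[of "inverse t0"]]) simp
  qed
  then have "((\<lambda>t. integral\<^sup>L N (s (inverse t))) \<longlongrightarrow> integral\<^sup>L N f) at_top"
    by (rule Lim_transform_eventually) (use ev in eventually_elim, simp)
  then show ?thesis by (simp add: filterlim_at_right_to_top)
qed

text \<open>Substituting u = z + s \<zeta> absorbs the power of s into the volume element, and
  \<Phi>(z + s \<zeta>) / s tends to L \<zeta>. The weight \<open>F\<close> may depend on s and has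
  to converge only along the rays from \<open>z\<close>.\<close>

lemma blow_up_ball:
  fixes \<Phi> :: "'z::euclidean_space \<Rightarrow> 'w::euclidean_space" and \<kappa> :: "'w \<Rightarrow> real"
    and F :: "real \<Rightarrow> 'z \<Rightarrow> complex"
  assumes \<kappa>: "continuous_on UNIV \<kappa>" "\<And>w. \<kappa> w \<noteq> 0 \<Longrightarrow> norm w \<le> R"
    and bound: "\<And>s z. 0 < s \<Longrightarrow> s < s0 \<Longrightarrow> norm (F s z) \<le> B" and s0: "s0 > 0"
    and meas: "\<And>s. 0 < s \<Longrightarrow> (\<lambda>z. \<kappa> (\<Phi> z /\<^sub>R s) *\<^sub>R F s z) \<in> borel_measurable borel"
    and z: "\<Phi> z = 0" "(\<Phi> has_derivative L) (at z)" "inj L"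
    and lim: "\<And>\<zeta>. ((\<lambda>s. F s (z + s *\<^sub>R \<zeta>)) \<longlongrightarrow> F0) (at_right 0)"
    and d: "d > 0" and c: "c > 0" "\<And>u. norm (u - z) < d \<Longrightarrow> c * norm (u - z) \<le> norm (\<Phi> u)"
  shows "((\<lambda>s. LINT u|lborel. indicator (ball z d) u *\<^sub>R (\<kappa> (\<Phi> u /\<^sub>R s) / s ^ DIM('z)) *\<^sub>R F s u) \<longlongrightarrow>
     (LINT \<zeta>|lborel. \<kappa> (L \<zeta>)) *\<^sub>R F0) (at_right 0)"
proof -
  have lin: "bounded_linear L" using z(2) by (rule has_derivative_bounded_linear)
  obtain K where K: "K \<ge> 0" "\<And>w. \<bar>\<kappa> w\<bar> \<le> K" using bounded_compact_support[OF \<kappa>] by blast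
  define g where "g = (\<lambda>s u. indicator (ball z d) u *\<^sub>R (\<kappa> (\<Phi> u /\<^sub>R s) *\<^sub>R F s u))"
  define G where "G = (\<lambda>s \<zeta>. g s (z + s *\<^sub>R \<zeta>))"
  have gm: "g s \<in> borel_measurable borel" if "0 < s" for s
    unfolding g_def by (rule borel_measurable_scaleR[OF borel_measurable_indicator meas[OF that]]) simp
  have Gm: "G s \<in> borel_measurable lborel" if "0 < s" for s
    unfolding G_def using gm[OF that] by measurable
  have eq: "(LINT u|lborel. indicator (ball z d) u *\<^sub>R (\<kappa> (\<Phi> u /\<^sub>R s) / s ^ DIM('z)) *\<^sub>R F s u) = integral\<^sup>L lborel (G s)"
    if "0 < s" for s
  proof -
    have "(LINT u|lborel. indicator (ball z d) u *\<^sub>R (\<kappa> (\<Phi> u /\<^sub>R s) / s ^ DIM('z)) *\<^sub>R F s u) =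
       (LINT u|lborel. (1 / s ^ DIM('z)) *\<^sub>R g s u)"
      by (rule Bochner_Integration.integral_cong) (auto simp: g_def field_simps)
    also have "\<dots> = (1 / s ^ DIM('z)) *\<^sub>R (LINT u|lborel. g s u)" by simp
    also have "\<dots> = (1 / s ^ DIM('z)) *\<^sub>R (\<bar>s\<bar> ^ DIM('z) *\<^sub>R (LINT \<zeta>|lborel. g s (z + s *\<^sub>R \<zeta>)))"
      using lborel_integral_affine[of s "g s" z] gm[OF that] that by simp
    also have "\<dots> = integral\<^sup>L lborel (G s)" using that by (simp add: G_def)
    finally show ?thesis .
  qed
  have ev0: "\<forall>\<^sub>F s in at_right (0::real). 0 < s"
    by (simp add: eventually_at_right_less)
  have "((\<lambda>s. integral\<^sup>L lborel (G s)) \<longlongrightarrow> (LINT \<zeta>|lborel. \<kappa> (L \<zeta>) *\<^sub>R F0)) (at_right 0)"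
  proof (rule tendsto_at_right_integral_dominated[OF _ Gm _ _ _ s0])
    have "continuous_on UNIV (\<lambda>\<zeta>. \<kappa> (L \<zeta>) *\<^sub>R F0)"
      by (intro continuous_intros continuous_on_compose2[OF \<kappa>(1)] linear_continuous_on lin) auto
    then show "(\<lambda>\<zeta>. \<kappa> (L \<zeta>) *\<^sub>R F0) \<in> borel_measurable lborel"
      using borel_measurable_continuous_onI by auto
    \<comment> \<open>The majorant: a nonzero kernel forces c * norm \<zeta> to be at most
      \<open>R\<close>, and there the integrand is bounded by the bounds of kernel and
      weight.\<close>
    show "integrable lborel (\<lambda>\<zeta>. indicator (cball (0::'z) (R / c)) \<zeta> *\<^sub>R (K * B))"
      by (rule borel_integrable_compact) auto
    show "norm (G s \<zeta>) \<le> indicator (cball 0 (R / c)) \<zeta> *\<^sub>R (K * B)" if s: "0 < s" "s < s0" for s \<zeta>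
    proof (cases "G s \<zeta> = 0")
      case True
      have "0 \<le> B" using bound[OF s, of z] norm_ge_zero order_trans by blast
      then show ?thesis using True K by (simp add: indicator_def)
    next
      case False
      then have ne: "z + s *\<^sub>R \<zeta> \<in> ball z d" "\<kappa> (\<Phi> (z + s *\<^sub>R \<zeta>) /\<^sub>R s) \<noteq> 0"
        by (auto simp: G_def g_def indicator_def split: if_splits)
      have "norm (\<Phi> (z + s *\<^sub>R \<zeta>) /\<^sub>R s) \<le> R" using ne(2) by (rule \<kappa>(2))
      then have "norm (\<Phi> (z + s *\<^sub>R \<zeta>)) \<le> R * s" using s by (simp add: field_simps)
      moreover have "c * norm (s *\<^sub>R \<zeta>) \<le> norm (\<Phi> (z + s *\<^sub>R \<zeta>))"
        using c(2)[of "z + s *\<^sub>R \<zeta>"] ne(1) by (simp add: dist_norm)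
      ultimately have "c * norm (s *\<^sub>R \<zeta>) \<le> R * s" by linarith
      then have "c * (s * norm \<zeta>) \<le> R * s" using s(1) by (simp only: norm_scaleR abs_of_pos)
      then have "(c * norm \<zeta>) * s \<le> R * s" by (simp only: ac_simps)
      then have "c * norm \<zeta> \<le> R" using s by simp
      then have "\<zeta> \<in> cball 0 (R / c)" using c(1) by (simp add: field_simps)
      moreover have "norm (G s \<zeta>) \<le> K * B"
        using ne(1) K bound[OF s, of "z + s *\<^sub>R \<zeta>"] by (auto simp: G_def g_def intro!: mult_mono)
      ultimately show ?thesis by simp
    qed
    \<comment> \<open>The argument of the kernel is the difference quotient of \<Phi> along the ray,
      and for small s the indicator of the ball equals 1.\<close>
    show "((\<lambda>s. G s \<zeta>) \<longlongrightarrow> \<kappa> (L \<zeta>) *\<^sub>R F0) (at_right 0)" for \<zeta>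
    proof (rule Lim_transform_eventually)
      have "((\<lambda>s. \<Phi> (z + s *\<^sub>R \<zeta>)) has_derivative (\<lambda>u. L (u *\<^sub>R \<zeta>))) (at 0)"
      proof (rule has_derivative_compose[where g=\<Phi>])
        show "((\<lambda>s. z + s *\<^sub>R \<zeta>) has_derivative (\<lambda>u. u *\<^sub>R \<zeta>)) (at 0)" by (auto intro!: derivative_eq_intros)
      qed (use z(2) in simp)
      then have "((\<lambda>s. \<Phi> (z + s *\<^sub>R \<zeta>)) has_vector_derivative L \<zeta>) (at 0)"
        by (simp add: has_vector_derivative_def linear_cmul[OF bounded_linear.linear[OF lin]])
      then have h: "((\<lambda>s. norm (\<Phi> (z + (0 + s) *\<^sub>R \<zeta>) - \<Phi> (z + 0 *\<^sub>R \<zeta>) - s *\<^sub>R L \<zeta>) / norm s) \<longlongrightarrow> 0) (at 0)"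
        unfolding has_vector_derivative_def has_derivative_at by blast
      have "((\<lambda>s. \<Phi> (z + s *\<^sub>R \<zeta>) /\<^sub>R s - L \<zeta>) \<longlongrightarrow> 0) (at 0)"
      proof (rule tendsto_norm_zero_cancel, rule Lim_transform_eventually[OF h])
        have "norm (\<Phi> (z + (0 + s) *\<^sub>R \<zeta>) - \<Phi> (z + 0 *\<^sub>R \<zeta>) - s *\<^sub>R L \<zeta>) / norm s =
          norm (\<Phi> (z + s *\<^sub>R \<zeta>) /\<^sub>R s - L \<zeta>)" if "s \<noteq> 0" for s
        proof -
          have "\<Phi> (z + s *\<^sub>R \<zeta>) /\<^sub>R s - L \<zeta> =
            inverse s *\<^sub>R (\<Phi> (z + (0 + s) *\<^sub>R \<zeta>) - \<Phi> (z + 0 *\<^sub>R \<zeta>) - s *\<^sub>R L \<zeta>)"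
            using that z(1) by (simp add: scaleR_diff_right)
          then show ?thesis by (simp only: norm_scaleR) (simp add: divide_inverse mult.commute)
        qed
        then show "\<forall>\<^sub>F s in at 0. norm (\<Phi> (z + (0 + s) *\<^sub>R \<zeta>) - \<Phi> (z + 0 *\<^sub>R \<zeta>) - s *\<^sub>R L \<zeta>) / norm s =
          norm (\<Phi> (z + s *\<^sub>R \<zeta>) /\<^sub>R s - L \<zeta>)"
          by (simp add: eventually_at_filter)
      qed
      then have "((\<lambda>s. \<Phi> (z + s *\<^sub>R \<zeta>) /\<^sub>R s) \<longlongrightarrow> L \<zeta>) (at 0)"
        by (rule Lim_null[THEN iffD2])
      then have "((\<lambda>s. \<Phi> (z + s *\<^sub>R \<zeta>) /\<^sub>R s) \<longlongrightarrow> L \<zeta>) (at_right 0)"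
        by (simp add: filterlim_at_split)
      then have "((\<lambda>s. \<kappa> (\<Phi> (z + s *\<^sub>R \<zeta>) /\<^sub>R s)) \<longlongrightarrow> \<kappa> (L \<zeta>)) (at_right 0)"
        using \<kappa>(1) by (intro isCont_tendsto_compose[of _ \<kappa>]) (auto simp: continuous_on_eq_continuous_at)
      then show "((\<lambda>s. \<kappa> (\<Phi> (z + s *\<^sub>R \<zeta>) /\<^sub>R s) *\<^sub>R F s (z + s *\<^sub>R \<zeta>)) \<longlongrightarrow> \<kappa> (L \<zeta>) *\<^sub>R F0) (at_right 0)"
        by (intro tendsto_scaleR lim)
      have "((\<lambda>s. z + s *\<^sub>R \<zeta>) \<longlongrightarrow> z + 0 *\<^sub>R \<zeta>) (at_right 0)" by (intro tendsto_intros)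
      then have "\<forall>\<^sub>F s in at_right 0. z + s *\<^sub>R \<zeta> \<in> ball z d"
        using d by (intro topological_tendstoD) auto
      then show "\<forall>\<^sub>F s in at_right 0. \<kappa> (\<Phi> (z + s *\<^sub>R \<zeta>) /\<^sub>R s) *\<^sub>R F s (z + s *\<^sub>R \<zeta>) = G s \<zeta>"
        by eventually_elim (simp add: G_def g_def)
    qed
  qed
  moreover have "(LINT \<zeta>|lborel. \<kappa> (L \<zeta>) *\<^sub>R F0) = (LINT \<zeta>|lborel. \<kappa> (L \<zeta>)) *\<^sub>R F0"
    using integrable_kernel_linear[OF \<kappa> bounded_linear.linear[OF lin] z(3)] by simp
  moreover have "\<forall>\<^sub>F s in at_right 0. integral\<^sup>L lborel (G s) =
      (LINT u|lborel. indicator (ball z d) u *\<^sub>R (\<kappa> (\<Phi> u /\<^sub>R s) / s ^ DIM('z)) *\<^sub>R F s u)"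
    using ev0 by eventually_elim (rule eq[symmetric])
  ultimately show ?thesis by (simp only: Lim_transform_eventually)
qed

text \<open>Localization to the zeros: on the part of the compact set \<open>Z\<close> outside small
  balls, \<Phi> stays away from 0, so a kernel of bounded support vanishes there once s is small.
  The remaining balls are disjoint and treated one at a time.\<close>

lemma blow_up:
  fixes \<Phi> :: "'z::euclidean_space \<Rightarrow> 'w::euclidean_space" and \<kappa> :: "'w \<Rightarrow> real"
    and F :: "real \<Rightarrow> 'z \<Rightarrow> complex"
  assumes \<kappa>: "continuous_on UNIV \<kappa>" "\<And>w. \<kappa> w \<noteq> 0 \<Longrightarrow> norm w \<le> R"
    and Z: "compact Z" "continuous_on Z \<Phi>" "\<And>s z. z \<notin> Z \<Longrightarrow> F s z = 0"
    and bound: "\<And>s z. 0 < s \<Longrightarrow> s < s0 \<Longrightarrow> norm (F s z) \<le> B" and s0: "s0 > 0"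
    and meas: "\<And>s. 0 < s \<Longrightarrow> (\<lambda>z. \<kappa> (\<Phi> z /\<^sub>R s) *\<^sub>R F s z) \<in> borel_measurable borel"
    and E: "finite E" "\<And>z. z \<in> Z \<Longrightarrow> \<Phi> z = 0 \<Longrightarrow> z \<in> E" "\<And>z. z \<in> E \<Longrightarrow> \<Phi> z = 0"
    and der: "\<And>z. z \<in> E \<Longrightarrow> (\<Phi> has_derivative L z) (at z)" "\<And>z. z \<in> E \<Longrightarrow> inj (L z)"
    and lim: "\<And>z \<zeta>. z \<in> E \<Longrightarrow> ((\<lambda>s. F s (z + s *\<^sub>R \<zeta>)) \<longlongrightarrow> F0 z) (at_right 0)"
  shows "((\<lambda>s. LINT u|lborel. (\<kappa> (\<Phi> u /\<^sub>R s) / s ^ DIM('z)) *\<^sub>R F s u) \<longlongrightarrow>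
     (\<Sum>z\<in>E. (LINT \<zeta>|lborel. \<kappa> (L z \<zeta>)) *\<^sub>R F0 z)) (at_right 0)"
proof -
  \<comment> \<open>The radius at each zero is also at most half the distance to the other zeros,
    which makes the balls disjoint.\<close>
  have "\<exists>c d. 0 < c \<and> 0 < d \<and> (\<forall>u. norm (u - z) < d \<longrightarrow> c * norm (u - z) \<le> norm (\<Phi> u)) \<and>
     (\<forall>z'\<in>E. z' \<noteq> z \<longrightarrow> 2 * d \<le> dist z z')" if z: "z \<in> E" for z
  proof -
    obtain c d where cd: "c > 0" "d > 0" "\<And>u. norm (u - z) < d \<Longrightarrow> c * norm (u - z) \<le> norm (\<Phi> u)"
      using derivative_inj_lower_bound[OF der(1)[OF z] der(2)[OF z] E(3)[OF z]] by blast
    obtain e where e: "e > 0" "\<forall>z'\<in>E. z' \<noteq> z \<longrightarrow> e \<le> dist z z'" using finite_set_avoid[OF E(1)] by blast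
    show ?thesis
      by (intro exI[of _ c] exI[of _ "min d (e / 2)"]) (use cd e in auto)
  qed
  then obtain c d where cd: "\<And>z. z \<in> E \<Longrightarrow> 0 < c z" "\<And>z. z \<in> E \<Longrightarrow> 0 < d z"
    "\<And>z u. z \<in> E \<Longrightarrow> norm (u - z) < d z \<Longrightarrow> c z * norm (u - z) \<le> norm (\<Phi> u)"
    "\<And>z z'. z \<in> E \<Longrightarrow> z' \<in> E \<Longrightarrow> z' \<noteq> z \<Longrightarrow> 2 * d z \<le> dist z z'"
    by metis
  obtain K where K: "K \<ge> 0" "\<And>w. \<bar>\<kappa> w\<bar> \<le> K" using bounded_compact_support[OF \<kappa>] by blast
  define G where "G = (\<lambda>s u. (\<kappa> (\<Phi> u /\<^sub>R s) / s ^ DIM('z)) *\<^sub>R F s u)"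
  have disj: "ball z (d z) \<inter> ball z' (d z') = {}" if "z \<in> E" "z' \<in> E" "z \<noteq> z'" for z z'
  proof (rule ccontr)
    assume "ball z (d z) \<inter> ball z' (d z') \<noteq> {}"
    then obtain u where "dist z u < d z" "dist z' u < d z'" by auto
    then have "dist z z' < d z + d z'" using dist_triangle2[of z z' u] by simp
    then show False using cd(4)[OF that(1,2)] cd(4)[OF that(2,1)] that(3) by (simp add: dist_commute)
  qed
  \<comment> \<open>Compact and free of zeros, hence \<Phi> has a positive minimum \<open>m\<close>
    of its norm on it; \<open>R * s < m\<close> then makes the kernel vanish.\<close>
  define Z' where "Z' = Z - (\<Union>z\<in>E. ball z (d z))"
  have Z': "compact Z'" unfolding Z'_def by (intro compact_diff Z(1)) auto
  have ne: "\<Phi> u \<noteq> 0" if "u \<in> Z'" for u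
  proof
    assume "\<Phi> u = 0"
    then have "u \<in> E" using E(2) that by (auto simp: Z'_def)
    then show False using that cd(2)[of u] by (auto simp: Z'_def)
  qed
  have "\<exists>m>0. \<forall>u\<in>Z'. m \<le> norm (\<Phi> u)"
  proof (cases "Z' = {}")
    case False
    have "continuous_on Z' (\<lambda>u. norm (\<Phi> u))"
      by (intro continuous_intros continuous_on_subset[OF Z(2)]) (auto simp: Z'_def)
    from continuous_attains_inf[OF Z' False this] obtain x where "x \<in> Z'" "\<forall>u\<in>Z'. norm (\<Phi> x) \<le> norm (\<Phi> u)" by blast
    then show ?thesis using ne by (intro exI[of _ "norm (\<Phi> x)"]) auto
  qed (auto intro: exI[of _ 1])
  then obtain m where m: "m > 0" "\<And>u. u \<in> Z' \<Longrightarrow> m \<le> norm (\<Phi> u)" by blast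
  have ev: "\<forall>\<^sub>F s in at_right (0::real). 0 < s \<and> s < s0 \<and> R * s < m"
  proof (intro eventually_conj)
    show "\<forall>\<^sub>F s in at_right (0::real). s < s0" using s0 by (rule eventually_at_right_real[THEN eventually_mono]) auto
    have "((\<lambda>s. R * s) \<longlongrightarrow> R * 0) (at_right 0)" by (intro tendsto_intros)
    then show "\<forall>\<^sub>F s in at_right 0. R * s < m" using m(1) by (intro order_tendstoD) auto
  qed (simp add: eventually_at_right_less)
  have eq: "integral\<^sup>L lborel (G s) = (\<Sum>z\<in>E. LINT u|lborel. indicator (ball z (d z)) u *\<^sub>R G s u)"
    if s: "0 < s" "s < s0" "R * s < m" for s
  proof -
    have Gm: "G s \<in> borel_measurable borel"
    proof -
      have "(\<lambda>u. (1 / s ^ DIM('z)) *\<^sub>R (\<kappa> (\<Phi> u /\<^sub>R s) *\<^sub>R F s u)) \<in> borel_measurable borel"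
        using meas[OF s(1)] by measurable
      then show ?thesis by (simp add: G_def)
    qed
    have int: "integrable lborel (\<lambda>u. indicator (ball z (d z)) u *\<^sub>R G s u)" for z
    proof (rule integrableI_bounded_set_indicator)
      have "norm (G s u) \<le> K / s ^ DIM('z) * B" for u
        unfolding G_def using K s bound[OF s(1,2), of u]
        by (auto intro!: mult_mono divide_right_mono)
      then show "AE x in lborel. x \<in> ball z (d z) \<longrightarrow> norm (G s x) \<le> K / s ^ DIM('z) * B" by simp
    qed (use Gm emeasure_bounded_finite in auto)
    have pt: "G s u = (\<Sum>z\<in>E. indicator (ball z (d z)) u *\<^sub>R G s u)" for u
    proof (cases "u \<in> (\<Union>z\<in>E. ball z (d z))")
      case True
      then obtain z where z: "z \<in> E" "u \<in> ball z (d z)" by blast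
      have "(\<Sum>z'\<in>E. indicator (ball z' (d z')) u *\<^sub>R G s u) = (\<Sum>z'\<in>E. if z' = z then G s u else 0)"
      proof (rule sum.cong[OF refl])
        fix z' assume "z' \<in> E"
        then have "z' \<noteq> z \<Longrightarrow> u \<notin> ball z' (d z')" using disj[of z' z] z by blast
        then show "indicator (ball z' (d z')) u *\<^sub>R G s u = (if z' = z then G s u else 0)"
          using z(2) by (cases "z' = z") auto
      qed
      then show ?thesis using z E(1) by simp
    next
      case False
      have "G s u = 0"
      proof (cases "u \<in> Z")
        case True
        then have "m \<le> norm (\<Phi> u)" using False m(2) by (simp add: Z'_def)
        then have "\<not> norm (\<Phi> u /\<^sub>R s) \<le> R" using s by (simp add: field_simps)
        then have "\<kappa> (\<Phi> u /\<^sub>R s) = 0" using \<kappa>(2) by blast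
        then show ?thesis by (simp add: G_def)
      qed (simp add: G_def Z(3))
      then show ?thesis by simp
    qed
    show ?thesis
      by (subst Bochner_Integration.integral_sum[symmetric, OF int])
        (rule Bochner_Integration.integral_cong[OF refl pt])
  qed
  have "((\<lambda>s. \<Sum>z\<in>E. LINT u|lborel. indicator (ball z (d z)) u *\<^sub>R G s u) \<longlongrightarrow>
     (\<Sum>z\<in>E. (LINT \<zeta>|lborel. \<kappa> (L z \<zeta>)) *\<^sub>R F0 z)) (at_right 0)"
  proof (rule tendsto_sum)
    fix z assume z: "z \<in> E"
    show "((\<lambda>s. LINT u|lborel. indicator (ball z (d z)) u *\<^sub>R G s u) \<longlongrightarrow>
      (LINT \<zeta>|lborel. \<kappa> (L z \<zeta>)) *\<^sub>R F0 z) (at_right 0)"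
      unfolding G_def
      by (rule blow_up_ball[where ?s0.0=s0 and B=B and c="c z" and R=R])
       (use \<kappa> bound s0 meas E(3)[OF z] der[OF z] lim[OF z] cd(1,2)[OF z] cd(3)[OF z] in auto)
  qed
  moreover have "\<forall>\<^sub>F s in at_right 0. (\<Sum>z\<in>E. LINT u|lborel. indicator (ball z (d z)) u *\<^sub>R G s u) =
     (LINT u|lborel. (\<kappa> (\<Phi> u /\<^sub>R s) / s ^ DIM('z)) *\<^sub>R F s u)"
    using ev
  proof eventually_elim
    case (elim s)
    then have "integral\<^sup>L lborel (G s) = (\<Sum>z\<in>E. LINT u|lborel. indicator (ball z (d z)) u *\<^sub>R G s u)"
      using eq by blast
    then show ?case unfolding G_def by (rule sym)
  qed
  ultimately show ?thesis by (rule Lim_transform_eventually)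
qed

section \<open>The crossing integral\<close>

lemma continuous_on_vec2: "continuous_on UNIV (\<lambda>p::real\<times>real. vector [fst p, snd p] :: real^2)"
proof -
  have "(\<lambda>p::real\<times>real. vector [fst p, snd p] :: real^2) = (\<lambda>p. \<chi> i. if i = 1 then fst p else snd p)"
    by (auto simp: vec_eq_iff forall_2)
  moreover have "continuous_on UNIV (\<lambda>p::real\<times>real. if i = 1 then fst p else snd p)" for i :: 2
    by (cases "i = 1") (auto intro!: continuous_intros)
  ultimately show ?thesis by (simp only:) (intro continuous_on_vec_lambda)
qed

text \<open>The two time parameters form a pair, while determinants act on \<open>real^2\<close>;
  comparing measures of boxes identifies the two Lebesgue measures.\<close>

lemma distr_pair_vec2: "distr lborel lborel (\<lambda>p::real\<times>real. vector [fst p, snd p] :: real^2) = lborel"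
proof (rule lborel_eqI[symmetric])
  have meas: "(\<lambda>p::real\<times>real. vector [fst p, snd p] :: real^2) \<in> borel_measurable borel"
    by (rule borel_measurable_continuous_onI[OF continuous_on_vec2])
  fix l u :: "real^2" assume lu: "\<And>b. b \<in> Basis \<Longrightarrow> l \<bullet> b \<le> u \<bullet> b"
  have lu': "l $ i \<le> u $ i" for i
    using lu[of "axis i 1"] by (simp add: axis_in_Basis_iff inner_axis)
  have pre: "(\<lambda>p::real\<times>real. vector [fst p, snd p] :: real^2) -` box l u = {l $ 1<..<u $ 1} \<times> {l $ 2<..<u $ 2}"
    by (auto simp: mem_box_cart forall_2)
  have B: "(Basis :: (real^2) set) = {axis 1 1, axis 2 1}" by (auto simp: Basis_vec_def UNIV_2)
  have ne: "axis 1 1 \<noteq> (axis 2 1 :: real^2)" by (simp add: axis_eq_axis)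
  have "emeasure (distr lborel lborel (\<lambda>p::real\<times>real. vector [fst p, snd p] :: real^2)) (box l u) =
    emeasure (lborel \<Otimes>\<^sub>M lborel) ({l $ 1<..<u $ 1} \<times> {l $ 2<..<u $ 2})"
    using meas by (subst emeasure_distr) (auto simp: pre lborel_prod)
  also have "\<dots> = emeasure lborel {l $ 1<..<u $ 1} * emeasure lborel {l $ 2<..<u $ 2}"
    by (rule lborel.emeasure_pair_measure_Times) auto
  also have "\<dots> = ennreal (\<Prod>b\<in>Basis. (u - l) \<bullet> b)"
    using lu' ne by (simp add: B inner_axis ennreal_mult)
  finally show "emeasure (distr lborel lborel (\<lambda>p::real\<times>real. vector [fst p, snd p] :: real^2)) (box l u) =
    ennreal (\<Prod>b\<in>Basis. (u - l) \<bullet> b)" .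
qed simp

lemma integral_pair_vec2:
  fixes f :: "real^2 \<Rightarrow> real"
  assumes "f \<in> borel_measurable borel"
  shows "(LINT p|lborel. f (vector [fst p, snd p])) = (LINT q|lborel. f q)"
proof -
  have "(\<lambda>p::real\<times>real. vector [fst p, snd p] :: real^2) \<in> borel_measurable borel"
    by (rule borel_measurable_continuous_onI[OF continuous_on_vec2])
  then show ?thesis
    using integral_distr[of "\<lambda>p::real\<times>real. vector [fst p, snd p] :: real^2" lborel lborel f] assms
    by (simp add: distr_pair_vec2)
qed

lemma integral_linear_vec2:
  fixes r :: "real^2 \<Rightarrow> real" and A :: "real^2^2"
  assumes "continuous_on UNIV r" "det A \<noteq> 0"
  shows "(LINT x|lborel. r (A *v x + b)) = (LINT x|lborel. r x) / \<bar>det A\<bar>"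
proof -
  define g where "g = (\<lambda>x. A *v x + b)"
  have inv: "invertible A" using assms(2) by (simp add: invertible_det_nz)
  have inj: "inj g"
    using inj_matrix_vector_mult[OF inv] by (auto simp: g_def inj_def)
  have surj: "range g = UNIV"
  proof -
    obtain B where "A ** B = mat 1" using inv by (auto simp: invertible_def)
    then have "g (B *v (y - b)) = y" for y by (simp add: g_def matrix_vector_mul_assoc)
    then show ?thesis by (rule surjI)
  qed
  \<comment> \<open>The substitution formula above is for complex integrands, hence the detour
    through complex values.\<close>
  have "(LINT y:range g|lborel. complex_of_real (r y)) =
    (LINT x:UNIV|lborel. \<bar>det (matrix ((*v) A))\<bar> *\<^sub>R complex_of_real (r (g x)))"
  proof (rule lborel_change_of_variables)
    show "(g has_derivative (*v) A) (at x)" for x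
    proof -
      have "((*v) A has_derivative (*v) A) (at x)" by (rule bounded_linear_imp_has_derivative) simp
      then show ?thesis unfolding g_def by (auto intro!: derivative_eq_intros)
    qed
    show "continuous_on (range g) (\<lambda>y. complex_of_real (r y))"
      using assms(1) by (auto simp: surj intro!: continuous_intros)
  qed (use inj in \<open>auto simp: surj\<close>)
  then have "(LINT y|lborel. complex_of_real (r y)) = (LINT x|lborel. complex_of_real (\<bar>det A\<bar> * r (g x)))"
    by (simp add: surj set_lebesgue_integral_def matrix_of_matrix_vector_mul scaleR_conv_of_real)
  then have "(LINT y|lborel. r y) = (LINT x|lborel. \<bar>det A\<bar> * r (g x))"
    by (simp only: integral_complex_of_real of_real_eq_iff)
  then show ?thesis using assms(2) by (simp add: g_def field_simps)
qed

text \<open>\<open>L\<close> is the derivative at a crossing of the map comparing each curve with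
  the surface point x, in two charts with Jacobians \<open>A\<close> and \<open>A'\<close>. A kernel
  vector satisfies t v = x = t' v', and independence of the tangents forces t = t' = 0.\<close>

lemma crossing_map_inj:
  fixes A A' :: "real^2^2" and v v' :: "real^2"
  assumes "det A \<noteq> 0" "det A' \<noteq> 0" "det (vector [v, v'] :: real^2^2) \<noteq> 0"
  defines "L \<equiv> \<lambda>\<zeta>::(real \<times> real) \<times> (real^2).
    (A *v (fst (fst \<zeta>) *\<^sub>R v - snd \<zeta>), A' *v (snd (fst \<zeta>) *\<^sub>R v' - snd \<zeta>))"
  shows "linear L" "inj L"
proof -
  show lin: "linear L" unfolding L_def
    by (rule linearI) (auto simp: algebra_simps matrix_vector_right_distrib matrix_vector_mult_diff_distrib
        matrix_vector_mult_scaleR scaleR_add_left)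
  have i: "x = 0" if "B *v x = 0" "det B \<noteq> 0" for B :: "real^2^2" and x
    using injD[OF inj_matrix_vector_mult[of B], of x 0] that by (simp add: invertible_det_nz)
  have "\<zeta> = 0" if "L \<zeta> = 0" for \<zeta>
  proof -
    obtain t t' x where \<zeta>: "\<zeta> = ((t, t'), x)" by (metis prod.collapse)
    have "A *v (t *\<^sub>R v - x) = 0" "A' *v (t' *\<^sub>R v' - x) = 0" using that by (simp_all add: L_def \<zeta> zero_prod_def)
    then have x: "t *\<^sub>R v = x" "t' *\<^sub>R v' = x" using i assms(1,2) by (metis eq_iff_diff_eq_0)+
    have D: "v $ 1 * v' $ 2 - v $ 2 * v' $ 1 \<noteq> 0" using assms(3) by (simp add: det_2)
    have "(t *\<^sub>R v) $ i = (t' *\<^sub>R v') $ i" for i using x by simp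
    then have "t * v $ 1 = t' * v' $ 1" "t * v $ 2 = t' * v' $ 2" by simp_all
    then have "t * (v $ 1 * v' $ 2 - v $ 2 * v' $ 1) = 0" "t' * (v $ 1 * v' $ 2 - v $ 2 * v' $ 1) = 0"
      by algebra+
    then have "t = 0" "t' = 0" using D by auto
    then show ?thesis using x by (simp add: \<zeta> zero_prod_def)
  qed
  then show "inj L" using lin by (simp add: linear_injective_0)
qed

text \<open>After x is replaced by t v - x the first factor depends on x alone. For fixed x the
  second factor is a mollifier of an affine function of (t, t'), contributing the determinants of
  \<open>A'\<close> and of the tangents; the integral over x contributes that of \<open>A\<close>.
  The mass 1 of \<rho> is used twice.\<close>

lemma crossing_integral:
  fixes \<rho> :: "real^2 \<Rightarrow> real" and A A' :: "real^2^2" and v v' :: "real^2"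
  assumes \<rho>: "continuous_on UNIV \<rho>" "\<And>w. \<rho> w \<noteq> 0 \<Longrightarrow> norm w \<le> R" "(LINT y|lborel. \<rho> y) = 1"
    and det: "det A \<noteq> 0" "det A' \<noteq> 0" "det (vector [v, v'] :: real^2^2) \<noteq> 0"
  shows "(LINT \<zeta>|lborel. \<rho> (A *v (fst (fst \<zeta>) *\<^sub>R v - snd \<zeta>)) * \<rho> (A' *v (snd (fst \<zeta>) *\<^sub>R v' - snd \<zeta>))) =
     1 / (\<bar>det A\<bar> * \<bar>det A'\<bar> * \<bar>det (vector [v, v'] :: real^2^2)\<bar>)"
proof -
  define \<kappa> :: "(real^2) \<times> (real^2) \<Rightarrow> real" where "\<kappa> = (\<lambda>w. \<rho> (fst w) * \<rho> (snd w))"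
  have \<kappa>c: "continuous_on UNIV \<kappa>" unfolding \<kappa>_def
    by (intro continuous_intros continuous_on_compose2[OF \<rho>(1)]) auto
  have \<kappa>s: "norm w \<le> R + R" if "\<kappa> w \<noteq> 0" for w
    using norm_Pair_le[of "fst w" "snd w"] \<rho>(2)[of "fst w"] \<rho>(2)[of "snd w"] that
    by (auto simp: \<kappa>_def)
  define L where "L = (\<lambda>\<zeta>::(real \<times> real) \<times> (real^2).
    (A *v (fst (fst \<zeta>) *\<^sub>R v - snd \<zeta>), A' *v (snd (fst \<zeta>) *\<^sub>R v' - snd \<zeta>)))"
  have L: "linear L" "inj L" unfolding L_def using crossing_map_inj[OF det] by auto
  \<comment> \<open>An involution that preserves Lebesgue measure: for fixed times it is a
    reflection followed by a translation in x.\<close>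
  define T where "T = (\<lambda>\<zeta>::(real \<times> real) \<times> (real^2). (fst \<zeta>, fst (fst \<zeta>) *\<^sub>R v - snd \<zeta>))"
  have T: "linear T" unfolding T_def by (rule linearI) (auto simp: algebra_simps)
  have TT: "T (T \<zeta>) = \<zeta>" for \<zeta> by (simp add: T_def)
  have injT: "inj T" by (metis TT injI)
  have LT: "linear (\<lambda>\<zeta>. L (T \<zeta>))" "inj (\<lambda>\<zeta>. L (T \<zeta>))"
    using linear_compose[OF T L(1)] inj_compose[OF L(2) injT] by (auto simp: o_def)
  have int1: "integrable (lborel \<Otimes>\<^sub>M lborel) (\<lambda>\<zeta>. \<kappa> (L \<zeta>))"
    using integrable_kernel_linear[OF \<kappa>c \<kappa>s L] by (simp add: lborel_prod)
  have int2: "integrable (lborel \<Otimes>\<^sub>M lborel) (\<lambda>\<zeta>. \<kappa> (L (T \<zeta>)))"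
    using integrable_kernel_linear[OF \<kappa>c \<kappa>s LT] by (simp add: lborel_prod)
  have \<kappa>L: "(\<lambda>x. \<kappa> (L (p, x))) \<in> borel_measurable borel" for p
  proof (rule borel_measurable_continuous_onI)
    have "continuous_on UNIV (\<lambda>\<zeta>. \<kappa> (L \<zeta>))"
      using L(1) by (intro continuous_on_compose2[OF \<kappa>c] linear_continuous_on) (auto simp: linear_conv_bounded_linear)
    then show "continuous_on UNIV (\<lambda>x. \<kappa> (L (p, x)))"
      by (rule continuous_on_compose2[of _ _ _ "\<lambda>x. (p, x)"]) (auto intro!: continuous_intros)
  qed
  have "(LINT \<zeta>|lborel. \<kappa> (L \<zeta>)) = (LINT p|lborel. LINT x|lborel. \<kappa> (L (p, x)))"
    using lborel_pair.integral_fst'[OF int1] by (simp add: lborel_prod)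
  also have "\<dots> = (LINT p|lborel. LINT x|lborel. \<kappa> (L (T (p, x))))"
  proof (rule Bochner_Integration.integral_cong[OF refl])
    fix p :: "real \<times> real"
    show "(LINT x|lborel. \<kappa> (L (p, x))) = (LINT x|lborel. \<kappa> (L (T (p, x))))"
      using lborel_integral_affine[of "-1" "\<lambda>x. \<kappa> (L (p, x))" "fst p *\<^sub>R v"] \<kappa>L by (simp add: T_def)
  qed
  also have "\<dots> = (LINT x|lborel. LINT p|lborel. \<kappa> (L (T (p, x))))"
    using lborel_pair.Fubini_integral[of "\<lambda>p x. \<kappa> (L (T (p, x)))"] int2 by (simp add: case_prod_beta')
  also have "\<dots> = (LINT x|lborel. \<rho> (A *v x) * (1 / (\<bar>det A'\<bar> * \<bar>det (vector [v, v'] :: real^2^2)\<bar>)))"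
  proof (rule Bochner_Integration.integral_cong[OF refl])
    fix x :: "real^2"
    \<comment> \<open>The transpose turns - v and v' into columns, so \<open>N\<close> sends (t, t')
      to A' (t' v' - t v).\<close>
    define N where "N = A' ** transpose (vector [- v, v'] :: real^2^2)"
    have detN: "\<bar>det N\<bar> = \<bar>det A'\<bar> * \<bar>det (vector [v, v'] :: real^2^2)\<bar>"
    proof -
      have "det (vector [- v, v'] :: real^2^2) = - det (vector [v, v'] :: real^2^2)" by (simp add: det_2)
      then show ?thesis by (simp add: N_def det_mul det_transpose abs_mult)
    qed
    have Nq: "N *v vector [t, t'] + A' *v x = A' *v (t' *\<^sub>R v' - (t *\<^sub>R v - x))" for t t'
    proof -
      have "transpose (vector [- v, v'] :: real^2^2) *v vector [t, t'] = t' *\<^sub>R v' - t *\<^sub>R v"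
        by (simp add: vec_eq_iff forall_2 matrix_vector_mult_def transpose_def sum_2)
      then show ?thesis
        by (simp add: N_def matrix_vector_mul_assoc[symmetric] matrix_vector_mult_diff_distrib)
    qed
    have "(LINT p|lborel. \<kappa> (L (T (p, x)))) =
      (LINT p|lborel. \<rho> (A *v x) * \<rho> (N *v vector [fst p, snd p] + A' *v x))"
      by (simp add: \<kappa>_def L_def T_def Nq)
    also have "\<dots> = \<rho> (A *v x) * (LINT p|lborel. \<rho> (N *v vector [fst p, snd p] + A' *v x))" by simp
    also have "(LINT p|lborel. \<rho> (N *v vector [fst p, snd p] + A' *v x)) = (LINT q|lborel. \<rho> (N *v q + A' *v x))"
    proof (rule integral_pair_vec2)
      have "continuous_on UNIV (\<lambda>q. \<rho> (N *v q + A' *v x))"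
        by (intro continuous_on_compose2[OF \<rho>(1)] continuous_intros) auto
      then show "(\<lambda>q. \<rho> (N *v q + A' *v x)) \<in> borel_measurable borel" by (rule borel_measurable_continuous_onI)
    qed
    also have "\<dots> = 1 / \<bar>det N\<bar>"
    proof -
      have "\<bar>det N\<bar> \<noteq> 0" using detN det by simp
      then have "det N \<noteq> 0" by simp
      from integral_linear_vec2[OF \<rho>(1) this] show ?thesis by (simp add: \<rho>(3))
    qed
    finally show "(LINT p|lborel. \<kappa> (L (T (p, x)))) =
      \<rho> (A *v x) * (1 / (\<bar>det A'\<bar> * \<bar>det (vector [v, v'] :: real^2^2)\<bar>))" by (simp add: detN)
  qed
  also have "\<dots> = (LINT x|lborel. \<rho> (A *v x)) * (1 / (\<bar>det A'\<bar> * \<bar>det (vector [v, v'] :: real^2^2)\<bar>))"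
    by (simp only: integral_mult_left_zero)
  also have "(LINT x|lborel. \<rho> (A *v x)) = 1 / \<bar>det A\<bar>"
    using integral_linear_vec2[OF \<rho>(1) det(1), of 0] by (simp add: \<rho>(3))
  finally show ?thesis by (simp add: \<kappa>_def L_def mult.assoc)
qed

section \<open>Perturbation of holonomies\<close>

text \<open>The holonomy of the loop based at time \<open>t\<close>, if \<open>X\<close> is 1-periodic. The flow chosen by \<open>SOME\<close> is unique.\<close>

definition monodromy :: "(real \<Rightarrow> 'n cmat) \<Rightarrow> real \<Rightarrow> 'n::finite cmat" where
  "monodromy X t = (let p = (SOME p. flow X (fst p) (snd p)) in snd p t ** fst p 1 ** fst p t)"

lemma flow_unique_inverse:
  assumes "flow X h g" "flow X k l" shows "l t = g t"
proof -
  have "l t ** h t = mat 1" using flowD(4)[OF assms(2), of t] flow_unique[OF assms] by simp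
  then have "l t ** h t ** g t = g t" by simp
  then show ?thesis by (simp add: matrix_mul_assoc[symmetric] flowD(3)[OF assms(1)])
qed

lemma monodromy_eq: assumes "flow X h g" shows "monodromy X t = g t ** h 1 ** h t"
proof -
  define p where "p = (SOME p. flow X (fst p) (snd p))"
  have "flow X (fst p) (snd p)" unfolding p_def by (rule someI[of _ "(h, g)"]) (simp add: assms)
  from flow_unique[OF assms this] flow_unique_inverse[OF assms this]
  show ?thesis by (simp add: monodromy_def p_def[symmetric] Let_def)
qed

text \<open>Advancing by one period replaces \<open>h t\<close> by \<open>h 1 ** h t\<close>, and
  conjugating \<open>h 1\<close> by itself changes nothing.\<close>

lemma monodromy_periodic:
  assumes "flow X h g" "\<And>t. X (t + 1) = X t" shows "monodromy X (t + 1) = monodromy X t"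
proof -
  have 1: "h (t + 1) = h 1 ** h t" by (rule flow_periodic[OF assms])
  have "g (t + 1) ** h 1 = g t"
  proof -
    have "g (t + 1) ** (h 1 ** h t) = mat 1" using flowD(4)[OF assms(1), of "t + 1"] 1 by simp
    then have "g (t + 1) ** (h 1 ** h t) ** g t = g t" by simp
    then show ?thesis by (simp add: matrix_mul_assoc[symmetric] flowD[OF assms(1)])
  qed
  then show ?thesis by (simp add: monodromy_eq[OF assms(1)] 1 matrix_mul_assoc)
qed

lemma monodromy_continuous: "flow X h g \<Longrightarrow> continuous_on S (monodromy X)"
  using monodromy_eq[of X h g]
  by (simp add: matmul_continuous_on flow_continuous cong: continuous_on_cong)

lemma periodic_of_int:
  fixes f :: "real \<Rightarrow> 'a"
  assumes "\<And>t. f (t + 1) = f t" shows "f (t + of_int n) = f t"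
proof (induction n rule: int_induct[where k=0])
  case (step1 i) then show ?case using assms[of "t + of_int i"] by (simp add: add.assoc[symmetric])
next
  case (step2 i) then show ?case using assms[of "t + of_int (i - 1)"] by (simp add: algebra_simps)
qed simp

lemma periodic_bounded:
  fixes f :: "real \<Rightarrow> 'a::real_normed_vector"
  assumes "continuous_on UNIV f" "\<And>t. f (t + 1) = f t" shows "\<exists>B. \<forall>t. norm (f t) \<le> B"
proof -
  have "compact (f ` {0..1})"
    by (intro compact_continuous_image continuous_on_subset[OF assms(1)]) auto
  then obtain B where B: "\<And>t. t \<in> {0..1} \<Longrightarrow> norm (f t) \<le> B"
    using compact_imp_bounded bounded_iff by (metis image_eqI)
  have "norm (f t) \<le> B" for t
  proof -
    have "frac t \<in> {0..1}" using frac_lt_1[of t] by (simp add: less_imp_le)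
    moreover have "f t = f (frac t)" using periodic_of_int[of f "frac t" "\<lfloor>t\<rfloor>", OF assms(2)] by (simp add: frac_def)
    ultimately show ?thesis using B by simp
  qed
  then show ?thesis by blast
qed

lemma matmul_norm_bound:
  "\<exists>K>0. \<forall>P Q. norm (P ** Q :: 'n::finite cmat) \<le> K * norm (P :: 'n cmat) * norm (Q :: 'n cmat)"
  using bounded_bilinear.pos_bounded[OF bounded_bilinear_matmul] by (metis mult.commute mult.left_commute)

lemma vector_derivative_norm_bound:
  fixes f :: "real \<Rightarrow> 'a::real_normed_vector"
  assumes "\<And>u. (f has_vector_derivative f' u) (at u)" "\<And>u. \<bar>u\<bar> \<le> \<bar>t\<bar> \<Longrightarrow> norm (f' u) \<le> B"
  shows "norm (f t - f 0) \<le> B * \<bar>t\<bar>"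
proof -
  have "norm (f t - f 0) \<le> B * norm (t - 0)"
  proof (rule differentiable_bound[of "cball 0 \<bar>t\<bar>" f "\<lambda>u h. h *\<^sub>R f' u"])
    show "(f has_derivative (\<lambda>h. h *\<^sub>R f' u)) (at u within cball 0 \<bar>t\<bar>)" for u
      using assms(1)[of u] by (simp add: has_vector_derivative_def has_derivative_at_withinI)
    show "onorm (\<lambda>h. h *\<^sub>R f' u) \<le> B" if "u \<in> cball 0 \<bar>t\<bar>" for u
      by (rule onorm_le) (use assms(2)[of u] that in \<open>simp add: mult.commute[of B] mult_left_mono\<close>)
  qed auto
  then show ?thesis by simp
qed

text \<open>Integrating Duhamel's formula bounds \<open>k t ** g t - mat 1\<close> by a multiple of
  \<open>e\<close>; multiplying back by the known flow gives the difference of the flows. The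
  constant depends only on \<open>B\<close> and \<open>T\<close>, so it serves all smoothing
  parameters at once.\<close>

lemma flow_lipschitz:
  "\<exists>C\<ge>0. \<forall>(X :: real \<Rightarrow> 'n::finite cmat) Y h g k l e.
     continuous_on UNIV X \<longrightarrow> continuous_on UNIV Y \<longrightarrow> (\<forall>t. norm (X t) \<le> B) \<longrightarrow> (\<forall>t. norm (Y t) \<le> B) \<longrightarrow>
     (\<forall>t. norm (Y t - X t) \<le> e) \<longrightarrow> flow X h g \<longrightarrow> flow Y k l \<longrightarrow>
     (\<forall>t. \<bar>t\<bar> \<le> T \<longrightarrow> norm (h t) \<le> C \<and> norm (g t) \<le> C \<and> norm (k t - h t) \<le> C * e \<and> norm (l t - g t) \<le> C * e)"
proof -
  obtain K where K: "K > 0" "\<And>P Q. norm (P ** Q :: 'n cmat) \<le> K * norm (P :: 'n cmat) * norm (Q :: 'n cmat)"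
    using matmul_norm_bound by blast
  obtain K' where K': "\<And>(X :: real \<Rightarrow> 'n cmat) B. continuous_on UNIV X \<Longrightarrow> (\<And>t. norm (X t) \<le> B) \<Longrightarrow>
    (\<exists>h g. flow X h g \<and>
      (\<forall>t. norm (h t) \<le> norm (mat 1 :: 'n cmat) * exp (K' * B * \<bar>t\<bar>) \<and>
           norm (g t) \<le> norm (mat 1 :: 'n cmat) * exp (K' * B * \<bar>t\<bar>)))" "K' \<ge> 0"
    using flow_exists[where 'n='n] by blast
  \<comment> \<open>The absolute values make this a common bound for both flows and their inverses
    without sign conditions on \<open>B\<close> and \<open>T\<close>.\<close>
  define b where "b = norm (mat 1 :: 'n cmat) * exp (K' * \<bar>B\<bar> * \<bar>T\<bar>)"
  have b0: "b \<ge> 0" by (simp add: b_def)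
  have bd: "norm (h t) \<le> b \<and> norm (g t) \<le> b"
    if X: "continuous_on UNIV X" "\<And>t. norm (X t) \<le> B" "flow X h g" "\<bar>t\<bar> \<le> T" for X :: "real \<Rightarrow> 'n cmat" and h g t
  proof -
    obtain h' g' where *: "flow X h' g'" "norm (h' t) \<le> norm (mat 1 :: 'n cmat) * exp (K' * B * \<bar>t\<bar>)"
       "norm (g' t) \<le> norm (mat 1 :: 'n cmat) * exp (K' * B * \<bar>t\<bar>)" using K'(1)[OF X(1,2)] by blast
    have "B \<ge> 0" using X(2)[of 0] norm_ge_zero order_trans by blast
    then have "exp (K' * B * \<bar>t\<bar>) \<le> exp (K' * \<bar>B\<bar> * \<bar>T\<bar>)"
      using X(4) K'(2) by (auto intro!: mult_left_mono)
    then have "norm (mat 1 :: 'n cmat) * exp (K' * B * \<bar>t\<bar>) \<le> b"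
      unfolding b_def by (rule mult_left_mono) simp
    then show ?thesis using *(2,3) flow_unique[OF X(3) *(1), of t] flow_unique_inverse[OF X(3) *(1), of t] by simp
  qed
  \<comment> \<open>The second entry collects one factor \<open>K\<close> for each of the three
    matrix products, a bound \<open>b\<close> for each of the flow factors, and the length of the
    time interval; the maximum also bounds the flows themselves.\<close>
  define C where "C = max b (K * ((K * (K * b * b) * \<bar>T\<bar>) * b))"
  have tri: "norm (P ** Q ** S) \<le> K * (K * p * q) * r"
    if "norm P \<le> p" "norm Q \<le> q" "norm S \<le> r" for P Q S :: "'n cmat" and p q r
  proof -
    have "0 \<le> p" "0 \<le> q" "0 \<le> r" using that norm_ge_zero order_trans by blast+
    have "norm (P ** Q ** S) \<le> K * norm (P ** Q) * norm S" by (rule K)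
    also have "\<dots> \<le> K * (K * norm P * norm Q) * norm S" using K by (intro mult_right_mono mult_left_mono) auto
    also have "\<dots> \<le> K * (K * p * q) * r"
      using that K(1) \<open>0 \<le> p\<close> \<open>0 \<le> q\<close> by (intro mult_mono) auto
    finally show ?thesis .
  qed
  show ?thesis
  proof (intro exI[of _ C] conjI allI impI)
    show "C \<ge> 0" using b0 by (simp add: C_def)
    fix X Y h g k l :: "real \<Rightarrow> 'n cmat" and e t
    assume X: "continuous_on UNIV X" "continuous_on UNIV Y" "\<forall>t. norm (X t) \<le> B" "\<forall>t. norm (Y t) \<le> B"
      and e: "\<forall>t. norm (Y t - X t) \<le> e" and f: "flow X h g" "flow Y k l" and t: "\<bar>t\<bar> \<le> T"
    have e0: "e \<ge> 0" using e[rule_format, of 0] norm_ge_zero order_trans by blast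
    have bX: "norm (h u) \<le> b" "norm (g u) \<le> b" "norm (k u) \<le> b" "norm (l u) \<le> b" if "\<bar>u\<bar> \<le> T" for u
      using bd[OF X(1) _ f(1) that] bd[OF X(2) _ f(2) that] X(3,4) by blast+
    then show "norm (h t) \<le> C" "norm (g t) \<le> C" using t unfolding C_def by (meson max.coboundedI1)+
    have est: "norm (P ** Q - Q) \<le> C * e" "norm (Q ** P - Q) \<le> C * e"
      if P: "norm (P - mat 1) \<le> K * (K * b * e) * b * \<bar>T\<bar>" and Q: "norm Q \<le> b" for P Q :: "'n cmat"
    proof -
      have le: "K * norm (P - mat 1) * norm Q \<le> C * e"
      proof -
        have "K * norm (P - mat 1) * norm Q \<le> K * (K * (K * b * e) * b * \<bar>T\<bar>) * b"
          using P Q K(1) b0 e0 by (intro mult_mono) auto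
        also have "\<dots> = (K * ((K * (K * b * b) * \<bar>T\<bar>) * b)) * e" by (simp add: ac_simps)
        also have "\<dots> \<le> C * e" unfolding C_def by (intro mult_right_mono e0) simp
        finally show ?thesis .
      qed
      have "norm (P ** Q - Q) = norm ((P - mat 1) ** Q)" by (simp add: matmul_diff_left)
      also have "\<dots> \<le> K * norm (P - mat 1) * norm Q" by (rule K)
      finally show "norm (P ** Q - Q) \<le> C * e" using le by linarith
      have "norm (Q ** P - Q) = norm (Q ** (P - mat 1))" by (simp add: matmul_diff_right)
      also have "\<dots> \<le> K * norm Q * norm (P - mat 1)" by (rule K)
      finally show "norm (Q ** P - Q) \<le> C * e" using le by (simp add: ac_simps)
    qed
    have "norm (k t ** g t - k 0 ** g 0) \<le> K * (K * b * e) * b * \<bar>t\<bar>"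
      by (rule vector_derivative_norm_bound[OF flow_Duhamel[OF f]]) (use t bX e in \<open>auto intro!: tri\<close>)
    also have "\<dots> \<le> K * (K * b * e) * b * \<bar>T\<bar>" using t K(1) b0 e0 by (intro mult_left_mono) auto
    finally have 1: "norm (k t ** g t - mat 1) \<le> K * (K * b * e) * b * \<bar>T\<bar>"
      by (simp add: flowD[OF f(1)] flowD[OF f(2)])
    have "k t ** g t ** h t = k t" by (simp add: matrix_mul_assoc[symmetric] flowD[OF f(1)])
    then show "norm (k t - h t) \<le> C * e" using est(1)[OF 1 bX(1)[OF t]] by simp
    have e': "norm (X t - Y t) \<le> e" for t using e by (simp add: norm_minus_commute)
    have "norm (h t ** l t - h 0 ** l 0) \<le> K * (K * b * e) * b * \<bar>t\<bar>"
      by (rule vector_derivative_norm_bound[OF flow_Duhamel[OF f(2,1)]]) (use t bX e' in \<open>auto intro!: tri\<close>)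
    also have "\<dots> \<le> K * (K * b * e) * b * \<bar>T\<bar>" using t K(1) b0 e0 by (intro mult_left_mono) auto
    finally have 2: "norm (h t ** l t - mat 1) \<le> K * (K * b * e) * b * \<bar>T\<bar>"
      by (simp add: flowD[OF f(1)] flowD[OF f(2)])
    have "g t ** (h t ** l t) = l t" by (simp add: matrix_mul_assoc flowD[OF f(1)])
    then show "norm (l t - g t) \<le> C * e" using est(2)[OF 2 bX(2)[OF t]] by simp
  qed
qed

text \<open>The monodromy is a product of three flow factors, so the difference telescopes into
  three terms, which is the factor 3 in the constant.\<close>

lemma monodromy_lipschitz:
  "\<exists>C\<ge>0. \<forall>(X :: real \<Rightarrow> 'n::finite cmat) Y e.
     continuous_on UNIV X \<longrightarrow> continuous_on UNIV Y \<longrightarrow> (\<forall>t. norm (X t) \<le> B) \<longrightarrow> (\<forall>t. norm (Y t) \<le> B) \<longrightarrow>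
     (\<forall>t. norm (Y t - X t) \<le> e) \<longrightarrow>
     (\<forall>t. \<bar>t\<bar> \<le> T \<longrightarrow> norm (monodromy X t) \<le> C \<and> norm (monodromy Y t - monodromy X t) \<le> C * e)"
proof -
  obtain K where K: "K > 0" "\<And>P Q. norm (P ** Q :: 'n cmat) \<le> K * norm (P :: 'n cmat) * norm (Q :: 'n cmat)"
    using matmul_norm_bound by blast
  \<comment> \<open>The monodromy at time t also involves the flow at time 1, even when
    \<open>T\<close> is smaller.\<close>
  define T' where "T' = max T 1"
  obtain C where C: "C \<ge> 0" "\<And>(X :: real \<Rightarrow> 'n cmat) Y h g k l e t.
     continuous_on UNIV X \<Longrightarrow> continuous_on UNIV Y \<Longrightarrow> (\<forall>t. norm (X t) \<le> B) \<Longrightarrow> (\<forall>t. norm (Y t) \<le> B) \<Longrightarrow>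
     (\<forall>t. norm (Y t - X t) \<le> e) \<Longrightarrow> flow X h g \<Longrightarrow> flow Y k l \<Longrightarrow> \<bar>t\<bar> \<le> T' \<Longrightarrow>
     norm (h t) \<le> C \<and> norm (g t) \<le> C \<and> norm (k t - h t) \<le> C * e \<and> norm (l t - g t) \<le> C * e"
    using flow_lipschitz[of B T', where 'n='n] by blast
  define C1 where "C1 = K * K * C * C * C"
  have C1: "0 \<le> C1" using C K by (simp add: C1_def)
  have tri: "norm (P ** Q ** S) \<le> K * (K * p * q) * r"
    if "norm P \<le> p" "norm Q \<le> q" "norm S \<le> r" for P Q S :: "'n cmat" and p q r
  proof -
    have "0 \<le> p" "0 \<le> q" "0 \<le> r" using that norm_ge_zero order_trans by blast+
    have "norm (P ** Q ** S) \<le> K * norm (P ** Q) * norm S" by (rule K)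
    also have "\<dots> \<le> K * (K * norm P * norm Q) * norm S" using K by (intro mult_right_mono mult_left_mono) auto
    also have "\<dots> \<le> K * (K * p * q) * r"
      using that K(1) \<open>0 \<le> p\<close> \<open>0 \<le> q\<close> by (intro mult_mono) auto
    finally show ?thesis .
  qed
  show ?thesis
  proof (intro exI[of _ "3 * C1"] conjI allI impI)
    fix X Y :: "real \<Rightarrow> 'n cmat" and e t
    assume X: "continuous_on UNIV X" "continuous_on UNIV Y" "\<forall>t. norm (X t) \<le> B" "\<forall>t. norm (Y t) \<le> B"
      and e: "\<forall>t. norm (Y t - X t) \<le> e" and t: "\<bar>t\<bar> \<le> T"
    have e0: "e \<ge> 0" using e[rule_format, of 0] norm_ge_zero order_trans by blast
    obtain h g k l where f: "flow X h g" "flow Y k l"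
      using flow_exists[where 'n='n] X by metis
    have tT: "\<bar>t\<bar> \<le> T'" "\<bar>1::real\<bar> \<le> T'" using t by (auto simp: T'_def)
    have b: "norm (h u) \<le> C" "norm (g u) \<le> C" "norm (k u - h u) \<le> C * e" "norm (l u - g u) \<le> C * e"
      "norm (k u) \<le> C" "norm (l u) \<le> C" if "\<bar>u\<bar> \<le> T'" for u
      using C(2)[OF X e f that] C(2)[OF X(2,2,4,4) _ f(2,2) that, of 0] by auto
    have m: "monodromy X t = g t ** h 1 ** h t" "monodromy Y t = l t ** k 1 ** k t"
      by (rule monodromy_eq[OF f(1)], rule monodromy_eq[OF f(2)])
    have "norm (monodromy X t) \<le> K * (K * C * C) * C" unfolding m by (intro tri b tT)
    then show "norm (monodromy X t) \<le> 3 * C1" using C1 by (simp add: C1_def ac_simps)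
    have "monodromy Y t - monodromy X t =
      (l t - g t) ** k 1 ** k t + (g t ** (k 1 - h 1) ** k t + g t ** h 1 ** (k t - h t))"
      by (simp add: m matmul_diff_left matmul_diff_right)
    also have "norm \<dots> \<le> K * (K * (C * e) * C) * C + (K * (K * C * (C * e)) * C + K * (K * C * C) * (C * e))"
      by (intro norm_triangle_mono tri b tT)
    also have "\<dots> = 3 * C1 * e" by (simp add: C1_def ac_simps)
    finally show "norm (monodromy Y t - monodromy X t) \<le> 3 * C1 * e" .
  qed (use C1 in simp)
qed

text \<open>A quadratic remainder at a single parameter suffices, so the flow never has to be
  differentiated as a function of its generator.\<close>

lemma has_vector_derivative_quadratic:
  fixes f :: "real \<Rightarrow> 'a::real_normed_vector"
  assumes "\<And>\<tau>. \<bar>\<tau>\<bar> \<le> 1 \<Longrightarrow> norm (f \<tau> - f 0 - \<tau> *\<^sub>R L) \<le> C * \<tau>\<^sup>2"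
  shows "(f has_vector_derivative L) (at 0)"
  unfolding has_vector_derivative_def has_derivative_at
proof
  show "bounded_linear (\<lambda>x. x *\<^sub>R L)" by (rule bounded_linear_scaleR_left)
  show "(\<lambda>y. norm (f (0 + y) - f 0 - y *\<^sub>R L) / norm y) \<midarrow>0\<rightarrow> 0"
  proof (rule Lim_null_comparison)
    have "norm (norm (f (0 + y) - f 0 - y *\<^sub>R L) / norm y) \<le> C * \<bar>y\<bar>" if "\<bar>y\<bar> \<le> 1" "y \<noteq> 0" for y
    proof -
      have "norm (f (0 + y) - f 0 - y *\<^sub>R L) / norm y \<le> (C * y\<^sup>2) / norm y"
        using assms[OF that(1)] by (intro divide_right_mono) auto
      also have "\<dots> = C * \<bar>y\<bar>" 
      proof -
        have "y\<^sup>2 = \<bar>y\<bar> * \<bar>y\<bar>" by (simp add: power2_eq_square)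
        then have "C * y\<^sup>2 / norm y = (C * \<bar>y\<bar>) * \<bar>y\<bar> / \<bar>y\<bar>" by (simp only: real_norm_def mult.assoc)
        also have "\<dots> = C * \<bar>y\<bar>" by (rule nonzero_mult_div_cancel_right) (use that(2) in simp)
        finally show ?thesis .
      qed
      finally show ?thesis by simp
    qed
    then show "\<forall>\<^sub>F y in at 0. norm (norm (f (0 + y) - f 0 - y *\<^sub>R L) / norm y) \<le> C * \<bar>y\<bar>"
      unfolding eventually_at by (intro exI[of _ 1]) (auto simp: dist_norm)
    have "((\<lambda>y::real. C * \<bar>y\<bar>) \<longlongrightarrow> C * \<bar>0\<bar>) (at 0)" by (intro tendsto_intros)
    then show "(\<lambda>y. C * \<bar>y\<bar>) \<midarrow>0\<rightarrow> 0" by simp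
  qed
qed

text \<open>To first order in \<tau> the product of the perturbed flow with the unperturbed inverse
  is 1 + \<tau> Z, where Z integrates \<open>h t ** Y t ** g t\<close>. Multiplying by
  \<open>h 1\<close> and using cyclicity of the trace moves the insertion of \<open>Y t\<close> next
  to the monodromy at t.\<close>

lemma trace_flow_has_derivative:
  fixes X Y :: "real \<Rightarrow> 'n::finite cmat"
  assumes X: "continuous_on UNIV X" "\<And>t. norm (X t) \<le> B1" and Y: "continuous_on UNIV Y" "\<And>t. norm (Y t) \<le> B2"
    and f: "\<And>\<tau>. flow (\<lambda>t. X t + \<tau> *\<^sub>R Y t) (k \<tau>) (l \<tau>)"
  shows "((\<lambda>\<tau>. trace (k \<tau> 1)) has_vector_derivative integral {0..1} (\<lambda>t. trace (monodromy X t ** Y t))) (at 0)"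
proof -
  define h g where "h = k 0" and "g = l 0"
  have f0: "flow X h g" using f[of 0] by (simp add: h_def g_def)
  note D = flowD[OF f0]
  obtain K where K: "K > 0" "\<And>P Q. norm (P ** Q :: 'n cmat) \<le> K * norm (P :: 'n cmat) * norm (Q :: 'n cmat)"
    using matmul_norm_bound by blast
  obtain C where C: "C \<ge> 0" "\<And>(X :: real \<Rightarrow> 'n cmat) Y h g k l e t.
     continuous_on UNIV X \<Longrightarrow> continuous_on UNIV Y \<Longrightarrow> (\<forall>t. norm (X t) \<le> B1 + B2) \<Longrightarrow> (\<forall>t. norm (Y t) \<le> B1 + B2) \<Longrightarrow>
     (\<forall>t. norm (Y t - X t) \<le> e) \<Longrightarrow> flow X h g \<Longrightarrow> flow Y k l \<Longrightarrow> \<bar>t\<bar> \<le> 1 \<Longrightarrow>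
     norm (h t) \<le> C \<and> norm (g t) \<le> C \<and> norm (k t - h t) \<le> C * e \<and> norm (l t - g t) \<le> C * e"
    using flow_lipschitz[of "B1 + B2" 1, where 'n='n] by blast
  have B2: "B2 \<ge> 0" using Y(2)[of 0] norm_ge_zero order_trans by blast
  have est: "norm (k \<tau> t - h t) \<le> C * (\<bar>\<tau>\<bar> * B2)" "norm (h t) \<le> C" "norm (g t) \<le> C"
    if "\<bar>\<tau>\<bar> \<le> 1" "\<bar>t\<bar> \<le> 1" for \<tau> t
  proof -
    have Xb: "\<forall>t. norm (X t) \<le> B1 + B2" using X(2) B2 by (meson add_increasing2 order_refl)
    have Zb: "\<forall>t. norm (X t + \<tau> *\<^sub>R Y t) \<le> B1 + B2"
    proof
      fix t
      have "norm (\<tau> *\<^sub>R Y t) \<le> 1 * B2" unfolding norm_scaleR using that(1) Y(2)[of t] by (intro mult_mono) auto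
      then show "norm (X t + \<tau> *\<^sub>R Y t) \<le> B1 + B2" using norm_triangle_mono[OF X(2)[of t]] by fastforce
    qed
    have "\<forall>t. norm (X t + \<tau> *\<^sub>R Y t - X t) \<le> \<bar>\<tau>\<bar> * B2" using Y(2) by (simp add: mult_left_mono)
    moreover have "continuous_on UNIV (\<lambda>t. X t + \<tau> *\<^sub>R Y t)" by (intro continuous_intros X Y)
    ultimately show "norm (k \<tau> t - h t) \<le> C * (\<bar>\<tau>\<bar> * B2)" "norm (h t) \<le> C" "norm (g t) \<le> C"
      using C(2)[OF X(1) _ Xb Zb _ f0 f that(2)] by blast+
  qed
  have hYg: "continuous_on UNIV (\<lambda>t. h t ** Y t ** g t)"
    by (intro matmul_continuous_on flow_continuous[OF f0] Y)
  obtain Z where Z: "Z 0 = 0" "\<And>t. (Z has_vector_derivative h t ** Y t ** g t) (at t)"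
    using global_antiderivative[OF hYg] by blast
  have blh: "bounded_linear (\<lambda>P :: 'n cmat. trace (P ** h 1))"
    using bounded_linear_compose[OF bounded_linear_trace bounded_bilinear.bounded_linear_left[OF bounded_bilinear_matmul]] .
  obtain C' where C': "C' > 0" "\<And>P. norm (trace (P ** h 1)) \<le> norm P * C'"
    using bounded_linear.pos_bounded[OF blh] by blast
  have quad: "norm (trace (k \<tau> 1) - trace (k 0 1) - \<tau> *\<^sub>R trace (Z 1 ** h 1)) \<le> (K * (K * (C * B2) * B2) * C * C') * \<tau>\<^sup>2"
    if \<tau>: "\<bar>\<tau>\<bar> \<le> 1" for \<tau>
  proof -
    \<comment> \<open>Subtracting the linear term leaves \<open>k \<tau> t - h t\<close> in the
      derivative, which is itself of order \<tau>; with the factor in front the remainder is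
      quadratic.\<close>
    have der: "((\<lambda>t. k \<tau> t ** g t - \<tau> *\<^sub>R Z t) has_vector_derivative \<tau> *\<^sub>R ((k \<tau> t - h t) ** Y t ** g t)) (at t)" for t
    proof -
      have "((\<lambda>t. k \<tau> t ** g t - \<tau> *\<^sub>R Z t) has_vector_derivative
          k \<tau> t ** (\<tau> *\<^sub>R Y t) ** g t - \<tau> *\<^sub>R (h t ** Y t ** g t)) (at t)"
        using flow_Duhamel[OF f0 f[of \<tau>], of t] Z(2)[of t]
        by (intro has_vector_derivative_diff bounded_linear.has_vector_derivative[OF bounded_linear_scaleR_right]) auto
      then show ?thesis
        by (simp add: matmul_diff_left matmul_scaleR_right matmul_scaleR_left scaleR_diff_right)
    qed
    have "norm ((k \<tau> 1 ** g 1 - \<tau> *\<^sub>R Z 1) - (k \<tau> 0 ** g 0 - \<tau> *\<^sub>R Z 0)) \<le>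
        (\<bar>\<tau>\<bar> * (K * (K * (C * (\<bar>\<tau>\<bar> * B2)) * B2) * C)) * \<bar>1\<bar>"
    proof (rule vector_derivative_norm_bound[OF der])
      fix u :: real assume u: "\<bar>u\<bar> \<le> \<bar>1\<bar>"
      have "norm ((k \<tau> u - h u) ** Y u ** g u) \<le> K * norm ((k \<tau> u - h u) ** Y u) * norm (g u)" by (rule K)
      also have "\<dots> \<le> K * (K * norm (k \<tau> u - h u) * norm (Y u)) * norm (g u)"
        using K by (intro mult_right_mono mult_left_mono) auto
      also have "\<dots> \<le> K * (K * (C * (\<bar>\<tau>\<bar> * B2)) * B2) * C"
        using K(1) C(1) B2 est[OF \<tau>, of u] u Y(2)[of u] by (intro mult_mono) auto
      finally show "norm (\<tau> *\<^sub>R ((k \<tau> u - h u) ** Y u ** g u)) \<le> \<bar>\<tau>\<bar> * (K * (K * (C * (\<bar>\<tau>\<bar> * B2)) * B2) * C)"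
        unfolding norm_scaleR by (intro mult_left_mono) auto
    qed
    then have 1: "norm (k \<tau> 1 ** g 1 - \<tau> *\<^sub>R Z 1 - mat 1) \<le> (K * (K * (C * B2) * B2) * C) * \<tau>\<^sup>2"
      by (simp add: flowD[OF f] D Z power2_eq_square ac_simps abs_mult_self_eq)
    have "(k \<tau> 1 ** g 1 - \<tau> *\<^sub>R Z 1 - mat 1) ** h 1 = k \<tau> 1 - \<tau> *\<^sub>R (Z 1 ** h 1) - h 1"
      by (simp add: matmul_diff_left matmul_scaleR_left matrix_mul_assoc[symmetric] D)
    then have "trace (k \<tau> 1) - trace (k 0 1) - \<tau> *\<^sub>R trace (Z 1 ** h 1) =
        trace ((k \<tau> 1 ** g 1 - \<tau> *\<^sub>R Z 1 - mat 1) ** h 1)"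
      by (simp only: linear_diff[OF bounded_linear.linear[OF bounded_linear_trace]]
          linear_cmul[OF bounded_linear.linear[OF bounded_linear_trace]]) (simp add: h_def)
    also have "norm \<dots> \<le> norm (k \<tau> 1 ** g 1 - \<tau> *\<^sub>R Z 1 - mat 1) * C'" by (rule C')
    also have "\<dots> \<le> ((K * (K * (C * B2) * B2) * C) * \<tau>\<^sup>2) * C'" using 1 C'(1) by (intro mult_right_mono) auto
    finally show ?thesis by (simp add: ac_simps)
  qed
  have "((\<lambda>t. trace (monodromy X t ** Y t)) has_integral trace (Z 1 ** h 1) - trace (Z 0 ** h 1)) {0..1}"
  proof (rule fundamental_theorem_of_calculus)
    fix t :: real
    \<comment> \<open>Cyclic rotation of the trace, so that the integrand is the derivative of
      \<open>trace (Z t ** h 1)\<close>.\<close>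
    have "trace (monodromy X t ** Y t) = trace (g t ** (h 1 ** h t ** Y t))"
      by (simp add: monodromy_eq[OF f0] matrix_mul_assoc)
    also have "\<dots> = trace (h 1 ** (h t ** Y t ** g t))"
      by (subst trace_mul_sym) (simp add: matrix_mul_assoc)
    also have "\<dots> = trace (h t ** Y t ** g t ** h 1)" by (rule trace_mul_sym)
    finally show "((\<lambda>t. trace (Z t ** h 1)) has_vector_derivative trace (monodromy X t ** Y t)) (at t within {0..1})"
      using has_vector_derivative_at_within[OF bounded_linear.has_vector_derivative[OF blh Z(2)]] by simp
  qed simp
  then have "integral {0..1} (\<lambda>t. trace (monodromy X t ** Y t)) = trace (Z 1 ** h 1)"
    using Z(1) linear_0[OF bounded_linear.linear[OF blh]] by (simp add: integral_unique)
  then show ?thesis using has_vector_derivative_quadratic[of "\<lambda>\<tau>. trace (k \<tau> 1)", OF quad] by simp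
qed

section \<open>Mollification\<close>

text \<open>Convolution after the substitution y = x - s u. In this form no negative power of s
  occurs and s = 0 is a legitimate value.\<close>

definition moll :: "(real^2 \<Rightarrow> real) \<Rightarrow> real \<Rightarrow> (real^2 \<Rightarrow> 'b) \<Rightarrow> real^2 \<Rightarrow> 'b::euclidean_space" where
  "moll \<rho> s f x = (LINT u|lborel. \<rho> u *\<^sub>R f (x - s *\<^sub>R u))"

lemma mollifierD:
  assumes "mollifier \<rho>"
  shows "smooth_on UNIV \<rho>" "continuous_on UNIV \<rho>" "\<rho> y \<ge> 0" "integrable lborel \<rho>" "(LINT y|lborel. \<rho> y) = 1"
    "\<exists>R>0. \<forall>y. \<rho> y \<noteq> 0 \<longrightarrow> norm y \<le> R"
proof -
  have sm: "smooth_on UNIV \<rho>" and 1: "(LINT y|lborel. \<rho> y) = 1"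
    and c: "compact (closure {y. \<rho> y \<noteq> 0})" using assms unfolding mollifier_def by blast+
  show "smooth_on UNIV \<rho>" "(LINT y|lborel. \<rho> y) = 1" by (rule sm, rule 1)
  show "\<rho> y \<ge> 0" using assms unfolding mollifier_def by blast
  from sm show "continuous_on UNIV \<rho>" by (intro smooth_on_continuous)
  \<comment> \<open>A non-integrable function would have the default integral 0, contradicting total
    mass 1.\<close>
  show "integrable lborel \<rho>" using 1 not_integrable_integral_eq by fastforce
  obtain B where B: "B > 0" "\<And>y. y \<in> closure {y. \<rho> y \<noteq> 0} \<Longrightarrow> norm y \<le> B"
    using compact_imp_bounded[OF c] by (auto simp: bounded_pos)
  show "\<exists>R>0. \<forall>y. \<rho> y \<noteq> 0 \<longrightarrow> norm y \<le> R"
    using B closure_subset[of "{y. \<rho> y \<noteq> 0}"] by (intro exI[of _ B]) auto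
qed

lemma moll_integrable:
  assumes "mollifier \<rho>" "continuous_on UNIV f"
  shows "integrable lborel (\<lambda>u. \<rho> u *\<^sub>R (f (x - s *\<^sub>R u) :: 'b::euclidean_space))"
proof -
  obtain R where R: "\<And>y. \<rho> y \<noteq> 0 \<Longrightarrow> norm y \<le> R" using mollifierD(6)[OF assms(1)] by blast
  have "continuous_on (cball 0 R) (\<lambda>u. \<rho> u *\<^sub>R f (x - s *\<^sub>R u))"
    by (intro continuous_intros continuous_on_compose2[OF assms(2)]
        continuous_on_subset[OF mollifierD(2)[OF assms(1)]]) auto
  from borel_integrable_compact[OF compact_cball this]
  have "integrable lborel (\<lambda>u. indicator (cball 0 R) u *\<^sub>R \<rho> u *\<^sub>R f (x - s *\<^sub>R u))" .
  moreover have "indicator (cball 0 R) u *\<^sub>R \<rho> u *\<^sub>R f (x - s *\<^sub>R u) = \<rho> u *\<^sub>R f (x - s *\<^sub>R u)" for u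
    using R[of u] by (cases "\<rho> u = 0") auto
  ultimately show ?thesis by (simp only:)
qed

lemma moll_bounded_linear:
  assumes "mollifier \<rho>" "continuous_on UNIV f" "bounded_linear L"
  shows "moll \<rho> s (\<lambda>y. L (f y)) x = L (moll \<rho> s f x)"
  unfolding moll_def
  by (subst integral_bounded_linear[OF assms(3) moll_integrable[OF assms(1,2)], symmetric])
    (simp add: linear_cmul[OF bounded_linear.linear[OF assms(3)]])

lemma moll_add:
  assumes "mollifier \<rho>" "continuous_on UNIV f" "continuous_on UNIV g"
  shows "moll \<rho> s (\<lambda>y. f y + g y) x = moll \<rho> s f x + moll \<rho> s g x"
  unfolding moll_def scaleR_add_right
  by (intro Bochner_Integration.integral_add moll_integrable assms)

text \<open>An average against a probability density. Equal parameters give continuity in the point,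
  \<open>s' = 0\<close> gives convergence of the smoothing.\<close>

lemma moll_diff_le:
  assumes m: "mollifier \<rho>" and f: "continuous_on UNIV f"
    and e: "\<And>u. \<rho> u \<noteq> 0 \<Longrightarrow> norm (f (x - s *\<^sub>R u) - f (x' - s' *\<^sub>R u)) \<le> e"
  shows "norm (moll \<rho> s f x - moll \<rho> s' f x') \<le> e"
proof -
  note int = moll_integrable[OF m f]
  have "moll \<rho> s f x - moll \<rho> s' f x' = (LINT u|lborel. \<rho> u *\<^sub>R f (x - s *\<^sub>R u) - \<rho> u *\<^sub>R f (x' - s' *\<^sub>R u))"
    unfolding moll_def by (rule Bochner_Integration.integral_diff[OF int int, symmetric])
  also have "norm \<dots> \<le> (LINT u|lborel. \<rho> u * e)"
  proof (rule order_trans[OF integral_norm_bound], rule integral_mono)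
    show "norm (\<rho> u *\<^sub>R f (x - s *\<^sub>R u) - \<rho> u *\<^sub>R f (x' - s' *\<^sub>R u)) \<le> \<rho> u * e" for u
      using e[of u] mollifierD(3)[OF m, of u]
      by (cases "\<rho> u = 0") (simp_all add: scaleR_diff_right[symmetric] mult_left_mono)
  qed (use int mollifierD(4)[OF m] in auto)
  also have "\<dots> = e" using mollifierD(5)[OF m] by simp
  finally show ?thesis .
qed

lemma moll_zero: assumes "mollifier \<rho>" shows "moll \<rho> 0 f x = f x"
  unfolding moll_def using mollifierD(4,5)[OF assms] by simp

lemma moll_eq_convolution:
  assumes m: "mollifier \<rho>" and f: "continuous_on UNIV f" and s: "s > 0"
  shows "(LINT y|lborel. (\<rho> ((1 / s) *\<^sub>R (x - y)) / s\<^sup>2) *\<^sub>R f y) = moll \<rho> s f x"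
proof -
  have "(\<lambda>y. (\<rho> ((1 / s) *\<^sub>R (x - y)) / s\<^sup>2) *\<^sub>R f y) \<in> borel_measurable borel"
    by (intro borel_measurable_continuous_onI continuous_intros f
        continuous_on_compose2[OF mollifierD(2)[OF m]]) (use s in auto)
  from lborel_integral_affine[of "- s", OF _ this, of x]
  have "(LINT y|lborel. (\<rho> ((1 / s) *\<^sub>R (x - y)) / s\<^sup>2) *\<^sub>R f y) =
    s\<^sup>2 *\<^sub>R (LINT u|lborel. (\<rho> u / s\<^sup>2) *\<^sub>R f (x - s *\<^sub>R u))"
    using s by simp
  also have "\<dots> = (LINT u|lborel. s\<^sup>2 *\<^sub>R ((\<rho> u / s\<^sup>2) *\<^sub>R f (x - s *\<^sub>R u)))"
    by (rule integral_scaleR_right[symmetric])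
  also have "\<dots> = moll \<rho> s f x" unfolding moll_def using s by simp
  finally show ?thesis .
qed

text \<open>Two points at distance below 1, one of them in the support, both lie in a ball enlarged
  by 1, where Heine-Cantor applies.\<close>

lemma compact_support_uniformly_continuous:
  fixes f :: "'a::euclidean_space \<Rightarrow> 'b::real_normed_vector"
  assumes f: "continuous_on UNIV f" and K: "compact K" "\<And>y. y \<notin> K \<Longrightarrow> f y = 0" and e: "e > 0"
  shows "\<exists>d>0. \<forall>x y. norm (x - y) < d \<longrightarrow> norm (f x - f y) < e"
proof -
  obtain B where B: "\<And>y. y \<in> K \<Longrightarrow> norm y \<le> B" using compact_imp_bounded[OF K(1)] by (auto simp: bounded_iff)
  have "uniformly_continuous_on (cball 0 (B + 1)) f"
    by (rule compact_uniformly_continuous[OF continuous_on_subset[OF f]]) auto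
  then obtain d where d: "d > 0" "\<And>x y. x \<in> cball 0 (B + 1) \<Longrightarrow> y \<in> cball 0 (B + 1) \<Longrightarrow> dist y x < d \<Longrightarrow> dist (f y) (f x) < e"
    unfolding uniformly_continuous_on_def using e by metis
  have "norm (f x - f y) < e" if xy: "norm (x - y) < min d 1" for x y
  proof (cases "x \<in> K \<or> y \<in> K")
    case True
    have "norm x \<le> norm y + norm (x - y)" by (metis add.commute diff_add_cancel norm_triangle_ineq)
    moreover have "norm y \<le> norm x + norm (x - y)" by (metis norm_minus_commute add.commute diff_add_cancel norm_triangle_ineq)
    ultimately have "norm x \<le> B + 1" "norm y \<le> B + 1" using True B[of x] B[of y] xy by auto
    then show ?thesis using d(2)[of y x] xy by (simp add: dist_norm)
  qed (use K(2) e in auto)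
  then show ?thesis using d(1) by (intro exI[of _ "min d 1"]) auto
qed

lemma moll_continuous:
  assumes m: "mollifier \<rho>" and f: "continuous_on UNIV f" "compact K" "\<And>y. y \<notin> K \<Longrightarrow> f y = 0"
  shows "continuous_on UNIV (moll \<rho> s f)"
  unfolding continuous_on_iff
proof (intro ballI allI impI)
  fix x :: "real^2" and e :: real assume e: "e > 0"
  obtain d where d: "d > 0" "\<And>x y. norm (x - y) < d \<Longrightarrow> norm (f x - f y) < e / 2"
    using compact_support_uniformly_continuous[OF f, of "e / 2"] e by auto
  have "dist (moll \<rho> s f x') (moll \<rho> s f x) < e" if "dist x' x < d" for x'
  proof -
    have "norm (moll \<rho> s f x' - moll \<rho> s f x) \<le> e / 2"
      by (rule moll_diff_le[OF m f(1)]) (use that d(2) in \<open>auto simp: dist_norm less_imp_le\<close>)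
    then show ?thesis using e by (simp add: dist_norm)
  qed
  then show "\<exists>d>0. \<forall>x'\<in>UNIV. dist x' x < d \<longrightarrow> dist (moll \<rho> s f x') (moll \<rho> s f x) < e" using d(1) by blast
qed

lemma moll_uniform:
  assumes m: "mollifier \<rho>" and f: "continuous_on UNIV f" "compact K" "\<And>y. y \<notin> K \<Longrightarrow> f y = 0" and e: "e > 0"
  shows "\<forall>\<^sub>F s in at_right 0. \<forall>x. norm (moll \<rho> s f x - f x) \<le> e"
proof -
  obtain R where R: "R > 0" "\<And>y. \<rho> y \<noteq> 0 \<Longrightarrow> norm y \<le> R" using mollifierD(6)[OF m] by blast
  obtain d where d: "d > 0" "\<And>x y. norm (x - y) < d \<Longrightarrow> norm (f x - f y) < e"
    using compact_support_uniformly_continuous[OF f e] by auto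
  have "norm (moll \<rho> s f x - f x) \<le> e" if s: "0 < s" "s < d / R" for s x
  proof -
    have "norm (moll \<rho> s f x - moll \<rho> 0 f x) \<le> e"
    proof (rule moll_diff_le[OF m f(1)])
      fix u assume "\<rho> u \<noteq> 0"
      then have "s * norm u \<le> s * R" using R(2) s by (intro mult_left_mono) auto
      moreover have "s * R < d" using s R(1) by (simp add: field_simps)
      ultimately have "s * norm u < d" by linarith
      then show "norm (f (x - s *\<^sub>R u) - f (x - 0 *\<^sub>R u)) \<le> e"
        using d(2)[of "x - s *\<^sub>R u" x] s by (simp add: less_imp_le)
    qed
    then show ?thesis by (simp add: moll_zero[OF m])
  qed
  moreover have "d / R > 0" using d R by simp
  ultimately show ?thesis
    unfolding eventually_at_right_field by blast
qed

section \<open>Smoothed forms along a curve\<close>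

definition contract :: "real^2 \<Rightarrow> ('n::finite cmat)^2 \<Rightarrow> 'n cmat" where
  "contract w P = (\<Sum>a\<in>UNIV. (w $ a) *\<^sub>R (P $ a))"

lemma bounded_bilinear_contract: "bounded_bilinear (contract :: real^2 \<Rightarrow> ('n::finite cmat)^2 \<Rightarrow> 'n cmat)"
proof -
  have "linear (contract w :: ('n cmat)^2 \<Rightarrow> 'n cmat)" for w
    by (rule linearI) (simp_all add: contract_def sum_2 algebra_simps)
  moreover have "linear (\<lambda>w. contract w (P :: ('n cmat)^2))" for P
    by (rule linearI) (simp_all add: contract_def sum_2 algebra_simps)
  ultimately show ?thesis
    by (simp add: bilinear_conv_bounded_bilinear[symmetric] bilinear_def)
qed

lemma one_formD:
  assumes "one_form M \<gg> v"
  shows "c \<in> M \<Longrightarrow> smooth_on (cimg c) (v c)" "c \<in> M \<Longrightarrow> x \<in> cimg c \<Longrightarrow> v c x $ a \<in> \<gg>"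
    "c \<in> M \<Longrightarrow> d \<in> M \<Longrightarrow> x \<in> overlap c d \<Longrightarrow>
        v c x $ a = (\<Sum>b\<in>UNIV. (jacobian (transition c d) x $ b $ a) *\<^sub>R (v d (transition c d x) $ b))"
    "c \<notin> M \<or> x \<notin> cimg c \<Longrightarrow> v c x = 0"
  using assms unfolding one_form_def by blast+

locale smoothing_setup = surface M for M :: "'p::t2_space chart set" +
  fixes N :: nat and U :: "nat \<Rightarrow> 'p chart" and pu cf :: "nat \<Rightarrow> 'p \<Rightarrow> real" and \<rho> :: "real^2 \<Rightarrow> real"
  assumes smoothing_data: "smoothing_data M N U pu cf \<rho>"
begin

lemma partition: "partition_of_unity M N U pu"
  and mollifier: "mollifier \<rho>"
  using smoothing_data unfolding smoothing_data_def by blast+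

lemmas pu = partition_of_unityD[OF partition]

lemma sum_pu: "(\<Sum>k<N. pu k p) = 1"
  using partition unfolding partition_of_unity_def by blast

text \<open>The last identity is the essential one: the cutoff is 1 near the support of the
  partition function, so it disappears wherever the two meet at one point.\<close>

lemma cf:
  assumes "k < N"
  shows "closure {p. cf k p \<noteq> 0} \<subseteq> cdom (U k)" "p \<notin> closure {p. cf k p \<noteq> 0} \<Longrightarrow> cf k p = 0"
    "c \<in> M \<Longrightarrow> continuous_on (cimg c) (\<lambda>x. cf k (cinv c x))" "pu k p * cf k p = pu k p"
proof -
  have *: "smooth_fun M (cf k)" "closure {p. cf k p \<noteq> 0} \<subseteq> cdom (U k)"
    "\<exists>V. open V \<and> closure {p. pu k p \<noteq> 0} \<subseteq> V \<and> (\<forall>p\<in>V. cf k p = 1)"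
    using smoothing_data assms unfolding smoothing_data_def by blast+
  show "closure {p. cf k p \<noteq> 0} \<subseteq> cdom (U k)" by (rule *)
  show "cf k p = 0" if "p \<notin> closure {p. cf k p \<noteq> 0}"
    using that subsetD[OF closure_subset[of "{p. cf k p \<noteq> 0}"], of p] by auto
  show "continuous_on (cimg c) (\<lambda>x. cf k (cinv c x))" if "c \<in> M"
    using *(1) that unfolding smooth_fun_def o_def by (intro smooth_on_continuous) blast
  show "pu k p * cf k p = pu k p"
  proof (cases "pu k p = 0")
    case False
    then have "p \<in> closure {p. pu k p \<noteq> 0}" using pu(6)[OF assms] by blast
    then have "cf k p = 1" using *(3) by blast
    then show ?thesis by simp
  qed simp
qed

lemma cf_path_continuous:
  assumes "closed_path \<gamma>" "k < N" shows "continuous_on {t. \<gamma> t \<in> cdom (U k)} (\<lambda>t. cf k (\<gamma> t))"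
proof -
  note Uk = pu(1)[OF assms(2)]
  have "continuous_on {t. \<gamma> t \<in> cdom (U k)} (\<lambda>t. cf k (cinv (U k) (cmap (U k) (\<gamma> t))))"
    by (rule continuous_on_compose2[OF cf(3)[OF assms(2) Uk] path_chart_continuous[OF assms(1) Uk]])
      (auto simp: cmap_in[OF Uk])
  then show ?thesis by (rule continuous_on_eq) (simp add: cinv_cmap[OF Uk])
qed

text \<open>The velocity in the chart is meaningful only while the curve is inside it; the cutoff
  vanishes before the curve leaves, so extension by zero is continuous for all times.\<close>

definition cutvel :: "(real \<Rightarrow> 'p) \<Rightarrow> nat \<Rightarrow> real \<Rightarrow> real^2" where
  "cutvel \<gamma> k t = (if \<gamma> t \<in> cdom (U k) then cf k (\<gamma> t) *\<^sub>R velocity (U k) \<gamma> t UNIV else 0)"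

lemma cutvel_support: "k < N \<Longrightarrow> \<gamma> t \<notin> closure {p. cf k p \<noteq> 0} \<Longrightarrow> cutvel \<gamma> k t = 0"
  using cf(2)[of k "\<gamma> t"] by (auto simp: cutvel_def)

lemma cutvel_domains:
  assumes "closed_path \<gamma>" "k < N"
  shows "open {t. \<gamma> t \<in> cdom (U k)}" "closed {t. \<gamma> t \<in> closure {p. cf k p \<noteq> 0}}"
    "{t. \<gamma> t \<in> closure {p. cf k p \<noteq> 0}} \<subseteq> {t. \<gamma> t \<in> cdom (U k)}"
  using open_path_vimage[OF assms(1) chart(1)[OF pu(1)[OF assms(2)]]]
    closed_path_vimage[OF assms(1) closed_closure] cf(1)[OF assms(2)] by auto

lemma cutvel_continuous:
  assumes "closed_path \<gamma>" "k < N" shows "continuous_on UNIV (cutvel \<gamma> k)"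
proof (rule continuous_on_extend_zero[OF cutvel_domains(1)[OF assms] _ cutvel_domains(2,3)[OF assms]])
  have "continuous_on {t. \<gamma> t \<in> cdom (U k)} (\<lambda>t. cf k (\<gamma> t) *\<^sub>R velocity (U k) \<gamma> t UNIV)"
    by (intro continuous_intros cf_path_continuous velocity_continuous assms pu(1))
  then show "continuous_on {t. \<gamma> t \<in> cdom (U k)} (cutvel \<gamma> k)"
    by (rule continuous_on_eq) (simp add: cutvel_def)
qed (simp add: cutvel_support assms)

lemma cutvel_periodic:
  assumes "closed_path \<gamma>" "k < N" shows "cutvel \<gamma> k (t + 1) = cutvel \<gamma> k t"
  using velocity_periodic[OF assms(1) pu(1)[OF assms(2)], of t] closed_path_periodic[OF assms(1), of t]
  by (auto simp: cutvel_def)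

definition localized :: "nat \<Rightarrow> ('p, 'n::finite) matform \<Rightarrow> real^2 \<Rightarrow> ('n cmat)^2" where
  "localized k v y = pu k (cinv (U k) y) *\<^sub>R v (U k) y"

definition patch :: "nat \<Rightarrow> (real^2) set" where
  "patch k = cmap (U k) ` closure {p. pu k p \<noteq> 0}"

lemma patch: assumes "k < N" shows "compact (patch k)" "patch k \<subseteq> cimg (U k)"
proof -
  show "compact (patch k)" unfolding patch_def
    by (rule compact_continuous_image[OF continuous_on_subset[OF cmap_continuous[OF pu(1)[OF assms]] pu(3)[OF assms]]])
      (simp add: compact_surface)
  show "patch k \<subseteq> cimg (U k)" unfolding patch_def using pu(3)[OF assms] cmap_in[OF pu(1)[OF assms]] by blast
qed

lemma not_in_patch:
  assumes "k < N" "y \<in> cimg (U k)" "y \<notin> patch k" shows "pu k (cinv (U k) y) = 0"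
proof (rule pu(6)[OF assms(1)], rule notI)
  assume "cinv (U k) y \<in> closure {p. pu k p \<noteq> 0}"
  then have "cmap (U k) (cinv (U k) y) \<in> patch k" unfolding patch_def by (rule imageI)
  then show False using assms cmap_cinv[OF pu(1)[OF assms(1)]] by simp
qed

text \<open>Retains what the smoothing integrals see of a form. Unlike \<open>one_form\<close>, it
  is closed under sums and all complex multiples whatever the Lie algebra is, so the variational
  formulas need no case distinction on scalars.\<close>

definition admissible :: "('p, 'n::finite) matform \<Rightarrow> bool" where
  "admissible v \<longleftrightarrow> (\<forall>k<N. continuous_on UNIV (localized k v) \<and> (\<forall>y. y \<notin> patch k \<longrightarrow> localized k v y = 0))"

lemma admissibleD:
  assumes "admissible v" "k < N"
  shows "continuous_on UNIV (localized k v)" "y \<notin> patch k \<Longrightarrow> localized k v y = 0"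
  using assms unfolding admissible_def by blast+

lemma one_form_admissible: assumes "one_form M \<gg> v" shows "admissible v"
  unfolding admissible_def
proof (intro allI impI conjI)
  fix k assume k: "k < N"
  note Uk = pu(1)[OF k]
  show 0: "localized k v y = 0" if "y \<notin> patch k" for y
    using not_in_patch[OF k _ that] one_formD(4)[OF assms, of "U k" y]
    by (cases "y \<in> cimg (U k)") (simp_all add: localized_def)
  show "continuous_on UNIV (localized k v)"
  proof (rule continuous_on_extend_zero[OF chart(2)[OF Uk] _ compact_imp_closed[OF patch(1)[OF k]] patch(2)[OF k] 0])
    show "continuous_on (cimg (U k)) (localized k v)" unfolding localized_def
      by (intro continuous_intros pu(5)[OF k Uk] smooth_on_continuous[OF one_formD(1)[OF assms Uk]])
  qed
qed

lemma localized_add: "localized k (form_add v w) y = localized k v y + localized k w y"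
  by (simp add: localized_def form_add_def scaleR_add_right)

lemma linear_cscale: "linear (cscale z :: 'n::finite cmat \<Rightarrow> 'n cmat)"
  by (rule linearI) (simp_all add: cscale_def vec_eq_iff algebra_simps)

definition cscale2 :: "complex \<Rightarrow> ('n::finite cmat)^2 \<Rightarrow> ('n cmat)^2" where
  "cscale2 z P = (\<chi> a. cscale z (P $ a))"

lemma bounded_linear_cscale2: "bounded_linear (cscale2 z :: ('n::finite cmat)^2 \<Rightarrow> ('n cmat)^2)"
proof -
  have "linear (cscale2 z :: ('n cmat)^2 \<Rightarrow> ('n cmat)^2)"
    by (rule linearI) (simp_all add: cscale2_def vec_eq_iff linear_add[OF linear_cscale] linear_cmul[OF linear_cscale])
  then show ?thesis by (simp add: linear_conv_bounded_linear)
qed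

lemma localized_scale: "localized k (form_scale z v) y = cscale2 z (localized k v y)"
  by (simp add: localized_def form_scale_def cscale2_def vec_eq_iff linear_cmul[OF linear_cscale])

lemma admissible_add: assumes "admissible v" "admissible w" shows "admissible (form_add v w)"
  using admissibleD[OF assms(1)] admissibleD[OF assms(2)]
  unfolding admissible_def localized_add[abs_def] by (auto intro!: continuous_intros)

lemma admissible_scale: assumes "admissible v" shows "admissible (form_scale z v)"
  using admissibleD[OF assms] linear_0[OF bounded_linear.linear[OF bounded_linear_cscale2]]
  unfolding admissible_def localized_scale[abs_def]
  by (auto intro!: bounded_linear.continuous_on[OF bounded_linear_cscale2])

text \<open>The pullback of \<open>R\<^sub>s v\<close> to the curve. The value \<open>s = 0\<close> is included and gives the pullback of \<open>v\<close>
  itself, because \<open>moll \<rho> 0\<close> is the identity.\<close>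

definition curveform :: "(real \<Rightarrow> 'p) \<Rightarrow> real \<Rightarrow> ('p, 'n::finite) matform \<Rightarrow> real \<Rightarrow> 'n cmat" where
  "curveform \<gamma> s v t = (\<Sum>k<N. contract (cutvel \<gamma> k t) (moll \<rho> s (localized k v) (cmap (U k) (\<gamma> t))))"

lemma curveform_add:
  assumes "admissible v" "admissible w"
  shows "curveform \<gamma> s (form_add v w) t = curveform \<gamma> s v t + curveform \<gamma> s w t"
  unfolding curveform_def sum.distrib[symmetric] localized_add[abs_def]
  by (rule sum.cong[OF refl])
    (simp add: moll_add mollifier admissibleD(1)[OF assms(1)] admissibleD(1)[OF assms(2)]
      bounded_bilinear.add_right[OF bounded_bilinear_contract])

lemma contract_cscale2: "contract w (cscale2 z P) = cscale z (contract w P)"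
  by (simp add: contract_def cscale2_def linear_sum[OF linear_cscale] linear_cmul[OF linear_cscale])

lemma curveform_scale:
  assumes "admissible v"
  shows "curveform \<gamma> s (form_scale z v) t = cscale z (curveform \<gamma> s v t)"
  unfolding curveform_def localized_scale[abs_def] linear_sum[OF linear_cscale]
  by (rule sum.cong[OF refl])
    (simp add: moll_bounded_linear[OF mollifier admissibleD(1)[OF assms] bounded_linear_cscale2] contract_cscale2)

lemma cscale_of_real: "cscale (of_real r) X = r *\<^sub>R X"
  by (simp add: cscale_def vec_eq_iff scaleR_conv_of_real[where 'a=complex])

lemma curveform_continuous:
  assumes "closed_path \<gamma>" "admissible v" shows "continuous_on UNIV (curveform \<gamma> s v)"
  unfolding curveform_def
proof (rule continuous_on_sum)
  fix k assume "k \<in> {..<N}"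
  then have k: "k < N" by simp
  show "continuous_on UNIV (\<lambda>t. contract (cutvel \<gamma> k t) (moll \<rho> s (localized k v) (cmap (U k) (\<gamma> t))))"
  proof (rule continuous_on_extend_zero[OF cutvel_domains(1)[OF assms(1) k] _ cutvel_domains(2,3)[OF assms(1) k]])
    show "continuous_on {t. \<gamma> t \<in> cdom (U k)}
       (\<lambda>t. contract (cutvel \<gamma> k t) (moll \<rho> s (localized k v) (cmap (U k) (\<gamma> t))))"
      by (intro bounded_bilinear.continuous_on[OF bounded_bilinear_contract]
          continuous_on_subset[OF cutvel_continuous[OF assms(1) k]]
          continuous_on_compose2[OF moll_continuous[OF mollifier admissibleD(1)[OF assms(2) k] patch(1)[OF k] admissibleD(2)[OF assms(2) k]]]
          path_chart_continuous assms pu(1) k) auto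
    show "contract (cutvel \<gamma> k t) (moll \<rho> s (localized k v) (cmap (U k) (\<gamma> t))) = 0"
      if "t \<notin> {t. \<gamma> t \<in> closure {p. cf k p \<noteq> 0}}" for t
      using that by (simp add: cutvel_support[OF k] contract_def)
  qed
qed

lemma curveform_periodic:
  assumes "closed_path \<gamma>" shows "curveform \<gamma> s v (t + 1) = curveform \<gamma> s v t"
  unfolding curveform_def by (simp add: cutvel_periodic assms closed_path_periodic[OF assms])

text \<open>Mollified components converge uniformly on the plane, and the cut-off velocities are
  bounded by periodicity, so the convergence is uniform in time.\<close>

lemma curveform_uniform:
  fixes v :: "('p, 'n::finite) matform"
  assumes \<gamma>: "closed_path \<gamma>" and v: "admissible v" and e: "e > 0"
  shows "\<forall>\<^sub>F s in at_right 0. \<forall>t. norm (curveform \<gamma> s v t - curveform \<gamma> 0 v t) \<le> e"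
proof -
  obtain K where K: "K > 0" "\<And>w (P :: ('n::finite cmat)^2). norm (contract w P) \<le> norm w * norm P * K"
    using bounded_bilinear.pos_bounded[OF bounded_bilinear_contract] by blast
  have "\<forall>k. \<exists>B. k < N \<longrightarrow> (\<forall>t. norm (cutvel \<gamma> k t) \<le> B)"
    using periodic_bounded[OF cutvel_continuous[OF \<gamma>] cutvel_periodic[OF \<gamma>]] by blast
  then obtain B where B: "\<And>k t. k < N \<Longrightarrow> norm (cutvel \<gamma> k t) \<le> B k" by metis
  \<comment> \<open>The summand 1 keeps \<open>b\<close> positive, so \<open>e / b\<close> is a
    valid tolerance even if all velocities vanish.\<close>
  define b where "b = 1 + (\<Sum>k<N. \<bar>B k\<bar>) * K"
  have b: "b > 0" unfolding b_def using K(1) by (intro add_pos_nonneg mult_nonneg_nonneg sum_nonneg) auto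
  have "\<forall>\<^sub>F s in at_right 0. \<forall>k\<in>{..<N}. \<forall>x. norm (moll \<rho> s (localized k v) x - localized k v x) \<le> e / b"
  proof (rule eventually_ball_finite)
    show "\<forall>k\<in>{..<N}. \<forall>\<^sub>F s in at_right 0. \<forall>x. norm (moll \<rho> s (localized k v) x - localized k v x) \<le> e / b"
    proof
      fix k assume "k \<in> {..<N}"
      then have k: "k < N" by simp
      show "\<forall>\<^sub>F s in at_right 0. \<forall>x. norm (moll \<rho> s (localized k v) x - localized k v x) \<le> e / b"
        by (rule moll_uniform[OF mollifier admissibleD(1)[OF v k] patch(1)[OF k] admissibleD(2)[OF v k]]) (use e b in simp_all)
    qed
  qed simp
  then show ?thesis
  proof eventually_elim
    case (elim s)
    show ?case
    proof
      fix t
      have "curveform \<gamma> s v t - curveform \<gamma> 0 v t = (\<Sum>k<N. contract (cutvel \<gamma> k t)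
          (moll \<rho> s (localized k v) (cmap (U k) (\<gamma> t)) - localized k v (cmap (U k) (\<gamma> t))))"
        by (simp add: curveform_def moll_zero[OF mollifier] sum_subtractf bounded_bilinear.diff_right[OF bounded_bilinear_contract])
      also have "norm \<dots> \<le> (\<Sum>k<N. \<bar>B k\<bar> * (e / b) * K)"
      proof (rule sum_norm_le)
        fix k assume k: "k \<in> {..<N}"
        let ?d = "moll \<rho> s (localized k v) (cmap (U k) (\<gamma> t)) - localized k v (cmap (U k) (\<gamma> t))"
        have "norm (contract (cutvel \<gamma> k t) ?d) \<le> norm (cutvel \<gamma> k t) * norm ?d * K" by (rule K)
        also have "\<dots> \<le> \<bar>B k\<bar> * (e / b) * K"
          using elim k B[of k t] K(1) by (intro mult_right_mono mult_mono) (auto intro: order_trans)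
        finally show "norm (contract (cutvel \<gamma> k t) ?d) \<le> \<bar>B k\<bar> * (e / b) * K" .
      qed
      also have "\<dots> = (\<Sum>k<N. \<bar>B k\<bar>) * K * (e / b)" by (simp only: sum_distrib_right sum_distrib_left ac_simps)
      also have "\<dots> \<le> b * (e / b)" using e b by (intro mult_right_mono) (auto simp: b_def)
      also have "\<dots> = e" using b by simp
      finally show "norm (curveform \<gamma> s v t - curveform \<gamma> 0 v t) \<le> e" .
    qed
  qed
qed

text \<open>Tangent vectors transform by the Jacobian and one-forms by its transpose, so their
  pairing is independent of the chart.\<close>

lemma velocity_contract:
  assumes "closed_path \<gamma>" "c \<in> M" "d \<in> M" "\<gamma> t \<in> cdom c" "\<gamma> t \<in> cdom d"
  shows "contract (velocity c \<gamma> t UNIV)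
      (\<chi> a. \<Sum>b\<in>UNIV. (jacobian (transition c d) (cmap c (\<gamma> t)) $ b $ a) *\<^sub>R (P $ b)) =
    contract (velocity d \<gamma> t UNIV) P"
  unfolding velocity_transition[OF assms] contract_def
  by (simp add: sum_2 matrix_vector_mult_def algebra_simps)

text \<open>At s = 0 the k-th summand is \<open>pu k * cf k = pu k\<close> times the
  chart-independent pairing, and the partition functions add up to 1.\<close>

lemma pulls_back_one_form:
  assumes "closed_path \<gamma>" "one_form M \<gg> v" shows "pulls_back v \<gamma> (curveform \<gamma> 0 v)"
  unfolding pulls_back_def
proof (intro allI ballI impI)
  fix t c assume c: "c \<in> M" "\<gamma> t \<in> cdom c"
  have "curveform \<gamma> 0 v t = (\<Sum>k<N. pu k (\<gamma> t) *\<^sub>R contract (velocity c \<gamma> t UNIV) (v c (cmap c (\<gamma> t))))"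
    unfolding curveform_def
  proof (rule sum.cong[OF refl])
    fix k assume "k \<in> {..<N}"
    then have k: "k < N" by simp
    note Uk = pu(1)[OF k]
    show "contract (cutvel \<gamma> k t) (moll \<rho> 0 (localized k v) (cmap (U k) (\<gamma> t))) =
      pu k (\<gamma> t) *\<^sub>R contract (velocity c \<gamma> t UNIV) (v c (cmap c (\<gamma> t)))"
    proof (cases "\<gamma> t \<in> cdom (U k)")
      case True
      let ?x = "cmap c (\<gamma> t)"
      have x: "?x \<in> overlap c (U k)" using c True by (simp add: overlap_iff cmap_in cinv_cmap)
      have "v c ?x = (\<chi> a. \<Sum>b\<in>UNIV. (jacobian (transition c (U k)) ?x $ b $ a) *\<^sub>R (v (U k) (cmap (U k) (\<gamma> t)) $ b))"
        using one_formD(3)[OF assms(2) c(1) Uk x] by (simp add: vec_eq_iff transition_cmap c)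
      then have "contract (velocity c \<gamma> t UNIV) (v c ?x) = contract (velocity (U k) \<gamma> t UNIV) (v (U k) (cmap (U k) (\<gamma> t)))"
        using velocity_contract[OF assms(1) c(1) Uk c(2) True, of "v (U k) (cmap (U k) (\<gamma> t))"] by simp
      moreover have "contract (cutvel \<gamma> k t) (localized k v (cmap (U k) (\<gamma> t))) =
         (pu k (\<gamma> t) * cf k (\<gamma> t)) *\<^sub>R contract (velocity (U k) \<gamma> t UNIV) (v (U k) (cmap (U k) (\<gamma> t)))"
        using True by (simp add: cutvel_def localized_def cinv_cmap[OF Uk]
            bounded_bilinear.scaleR_left[OF bounded_bilinear_contract]
            bounded_bilinear.scaleR_right[OF bounded_bilinear_contract])
      ultimately show ?thesis by (simp add: moll_zero[OF mollifier] cf(4)[OF k])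
    next
      case False
      then show ?thesis using pu(7)[OF k] by (simp add: cutvel_def contract_def)
    qed
  qed
  also have "\<dots> = contract (velocity c \<gamma> t UNIV) (v c (cmap c (\<gamma> t)))"
    by (simp add: scaleR_sum_left[symmetric] sum_pu)
  finally show "(\<Sum>a\<in>UNIV. (velocity c \<gamma> t UNIV $ a) *\<^sub>R (v c (cmap c (\<gamma> t)) $ a)) = curveform \<gamma> 0 v t"
    by (simp add: contract_def)
qed

lemma local_smoothing_eq:
  assumes "admissible v" "k < N" "s > 0"
  shows "local_smoothing (U k) (pu k) (cf k) \<rho> s (v (U k)) x = cf k (cinv (U k) x) *\<^sub>R moll \<rho> s (localized k v) x"
  using moll_eq_convolution[OF mollifier admissibleD(1)[OF assms(1,2)] assms(3), of x]
  by (simp add: local_smoothing_def localized_def)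

text \<open>Each extended piece is evaluated in its own chart, where its pairing with the velocity
  is the summand of \<open>curveform\<close>; when the curve is outside that chart both
  vanish.\<close>

lemma pulls_back_smoothing:
  assumes \<gamma>: "closed_path \<gamma>" and v: "admissible v" and s: "s > 0"
  shows "pulls_back (smoothing M N U pu cf \<rho> s v) \<gamma> (curveform \<gamma> s v)"
  unfolding pulls_back_def
proof (intro allI ballI impI)
  fix t c assume c: "c \<in> M" "\<gamma> t \<in> cdom c"
  let ?x = "cmap c (\<gamma> t)"
  have "contract (velocity c \<gamma> t UNIV) (smoothing M N U pu cf \<rho> s v c ?x) =
    (\<Sum>k<N. contract (velocity c \<gamma> t UNIV)
       (extend_form M (U k) (local_smoothing (U k) (pu k) (cf k) \<rho> s (v (U k))) c ?x))"
    unfolding smoothing_def by (rule bounded_bilinear.sum_right[OF bounded_bilinear_contract])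
  also have "\<dots> = curveform \<gamma> s v t"
    unfolding curveform_def
  proof (rule sum.cong[OF refl])
    fix k assume "k \<in> {..<N}"
    then have k: "k < N" by simp
    note Uk = pu(1)[OF k]
    show "contract (velocity c \<gamma> t UNIV)
       (extend_form M (U k) (local_smoothing (U k) (pu k) (cf k) \<rho> s (v (U k))) c ?x) =
       contract (cutvel \<gamma> k t) (moll \<rho> s (localized k v) (cmap (U k) (\<gamma> t)))"
    proof (cases "\<gamma> t \<in> cdom (U k)")
      case True
      then have x: "?x \<in> overlap c (U k)" using c by (simp add: overlap_iff cmap_in cinv_cmap)
      show ?thesis
        using velocity_contract[OF \<gamma> c(1) Uk c(2) True, of "local_smoothing (U k) (pu k) (cf k) \<rho> s (v (U k)) (cmap (U k) (\<gamma> t))"]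
        using True x c by (simp add: extend_form_def transition_cmap local_smoothing_eq[OF v k s] cinv_cmap[OF Uk] cutvel_def
            bounded_bilinear.scaleR_left[OF bounded_bilinear_contract]
            bounded_bilinear.scaleR_right[OF bounded_bilinear_contract])
    next
      case False
      then have "?x \<notin> overlap c (U k)" using c by (simp add: overlap_iff cinv_cmap)
      then show ?thesis using False by (simp add: extend_form_def cutvel_def contract_def)
    qed
  qed
  finally show "(\<Sum>a\<in>UNIV. (velocity c \<gamma> t UNIV $ a) *\<^sub>R (smoothing M N U pu cf \<rho> s v c ?x $ a)) = curveform \<gamma> s v t"
    by (simp add: contract_def)
qed

end

section \<open>Functional derivatives of smoothed Wilson loops\<close>

definition tpair :: "('n::finite cmat)^2 \<Rightarrow> ('n cmat)^2 \<Rightarrow> complex" where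
  "tpair P Q = (\<Sum>a\<in>UNIV. trace (P $ a ** Q $ a))"

text \<open>The transformation of a matrix-valued tangent vector under a linear map with matrix
  \<open>B\<close>; with a transposed Jacobian it is the pullback of one-forms.\<close>

definition push :: "real^2^2 \<Rightarrow> ('n::finite cmat)^2 \<Rightarrow> ('n cmat)^2" where
  "push B P = (\<chi> a. \<Sum>b\<in>UNIV. (B $ a $ b) *\<^sub>R (P $ b))"

lemmas trace_linear = bounded_linear.linear[OF bounded_linear_trace]

lemma bounded_bilinear_tpair: "bounded_bilinear (tpair :: ('n::finite cmat)^2 \<Rightarrow> ('n cmat)^2 \<Rightarrow> complex)"
proof -
  have "linear (tpair P :: ('n cmat)^2 \<Rightarrow> complex)" for P
    by (rule linearI)
      (simp_all add: tpair_def sum_2 matmul_add_right matmul_scaleR_right linear_add[OF trace_linear] linear_cmul[OF trace_linear] scaleR_add_right)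
  moreover have "linear (\<lambda>P. tpair P (Q :: ('n cmat)^2))" for Q
    by (rule linearI)
      (simp_all add: tpair_def sum_2 bounded_bilinear.add_left[OF bounded_bilinear_matmul] matmul_scaleR_left
        linear_add[OF trace_linear] linear_cmul[OF trace_linear] scaleR_add_right)
  ultimately show ?thesis
    by (simp add: bilinear_conv_bounded_bilinear[symmetric] bilinear_def)
qed

lemmas tpair_scaleR_left = bounded_bilinear.scaleR_left[OF bounded_bilinear_tpair]
lemmas tpair_scaleR_right = bounded_bilinear.scaleR_right[OF bounded_bilinear_tpair]
lemmas tpair_sum_left = bounded_bilinear.sum_left[OF bounded_bilinear_tpair]
lemmas tpair_continuous_on = bounded_bilinear.continuous_on[OF bounded_bilinear_tpair]

lemma tpair_zero [simp]: "tpair 0 Q = 0" "tpair P 0 = 0"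
  using bounded_bilinear.zero_left[OF bounded_bilinear_tpair] bounded_bilinear.zero_right[OF bounded_bilinear_tpair] by auto

lemma linear_push: "linear (push B)"
  by (rule linearI) (simp_all add: push_def vec_eq_iff sum_2 algebra_simps)

lemma push_scaleR: "push B (r *\<^sub>R P) = r *\<^sub>R push B P"
  by (rule linear_cmul[OF linear_push])

lemma push_push: "push A (push B P) = push (A ** B) P"
  by (simp add: push_def vec_eq_iff sum_2 matrix_matrix_mult_def algebra_simps)

lemma push_one [simp]: "push (mat 1) P = P"
  by (simp add: push_def vec_eq_iff sum_2 mat_def forall_2)

lemma tpair_push: "tpair (push B P) Q = tpair P (push (transpose B) Q)"
  by (simp add: tpair_def push_def sum_2 transpose_def matmul_add_right matmul_scaleR_right
      bounded_bilinear.add_left[OF bounded_bilinear_matmul] matmul_scaleR_left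
      linear_add[OF trace_linear] linear_cmul[OF trace_linear])

lemma trace_contract: "trace (m ** contract w Q) = tpair (\<chi> a. (w $ a) *\<^sub>R m) Q"
  by (simp add: tpair_def contract_def sum_2 matmul_add_right matmul_scaleR_right matmul_scaleR_left
      linear_add[OF trace_linear] linear_cmul[OF trace_linear])

lemma one_form_push:
  assumes "one_form M \<gg> v" "c \<in> M" "d \<in> M" "x \<in> overlap c d"
  shows "v c x = push (transpose (jacobian (transition c d) x)) (v d (transition c d x))"
  using one_formD(3)[OF assms] by (simp add: push_def vec_eq_iff transpose_def)

lemma trace_cscale_right: "trace (P ** cscale z Q) = z * trace (P ** Q)"
  by (simp add: trace_def matrix_matrix_mult_def cscale_def sum_distrib_left ac_simps)

lemma lie_coords:
  assumes "lie_basis K \<gg> e" "X \<in> \<gg>"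
  shows "lie_coords K e X $ \<alpha> \<in> K" "X = (\<Sum>\<alpha>\<in>UNIV. cscale (lie_coords K e X $ \<alpha>) (e \<alpha>))"
proof -
  have "\<exists>!k::complex^'b. (\<forall>\<alpha>. k $ \<alpha> \<in> K) \<and> X = (\<Sum>\<alpha>\<in>UNIV. cscale (k $ \<alpha>) (e \<alpha>))"
    using assms unfolding lie_basis_def by blast
  from theI'[OF this] show "lie_coords K e X $ \<alpha> \<in> K" "X = (\<Sum>\<alpha>\<in>UNIV. cscale (lie_coords K e X $ \<alpha>) (e \<alpha>))"
    unfolding lie_coords_def by blast+
qed

lemma lie_coords_eqI:
  assumes "lie_basis K \<gg> e" "X \<in> \<gg>" "\<And>\<alpha>. k $ \<alpha> \<in> K" "X = (\<Sum>\<alpha>\<in>UNIV. cscale (k $ \<alpha>) (e \<alpha>))"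
  shows "lie_coords K e X = k"
proof -
  have "\<exists>!k::complex^'b. (\<forall>\<alpha>. k $ \<alpha> \<in> K) \<and> X = (\<Sum>\<alpha>\<in>UNIV. cscale (k $ \<alpha>) (e \<alpha>))"
    using assms(1,2) unfolding lie_basis_def by blast
  then show ?thesis unfolding lie_coords_def by (rule the1_equality) (use assms(3,4) in blast)
qed

text \<open>Passes from the basis-free trace pairing to the components demanded by the functional
  derivative: these are the traces against the basis elements.\<close>

lemma tpair_lie_coords:
  assumes "lie_basis K \<gg> e" "\<And>a. Q $ a \<in> \<gg>"
  shows "tpair P Q = (\<Sum>a\<in>UNIV. \<Sum>\<alpha>\<in>UNIV. trace (P $ a ** e \<alpha>) * lie_coords K e (Q $ a) $ \<alpha>)"
  unfolding tpair_def
proof (rule sum.cong[OF refl])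
  fix a
  have "trace (P $ a ** Q $ a) = trace (P $ a ** (\<Sum>\<alpha>\<in>UNIV. cscale (lie_coords K e (Q $ a) $ \<alpha>) (e \<alpha>)))"
    using lie_coords(2)[OF assms] by simp
  also have "\<dots> = (\<Sum>\<alpha>\<in>UNIV. trace (P $ a ** e \<alpha>) * lie_coords K e (Q $ a) $ \<alpha>)"
    by (simp add: matmul_sum_right linear_sum[OF trace_linear] trace_cscale_right mult.commute)
  finally show "trace (P $ a ** Q $ a) = (\<Sum>\<alpha>\<in>UNIV. trace (P $ a ** e \<alpha>) * lie_coords K e (Q $ a) $ \<alpha>)" .
qed

lemma integrable_slab:
  fixes q :: "real \<times> (real^2) \<Rightarrow> complex"
  assumes "continuous_on UNIV q" "compact K" "\<And>t y. y \<notin> K \<Longrightarrow> q (t, y) = 0"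
  shows "integrable (lborel \<Otimes>\<^sub>M lborel) (\<lambda>z. indicator {a..b} (fst z) *\<^sub>R q z)"
proof -
  have "integrable lborel (\<lambda>z. indicator ({a..b} \<times> K) z *\<^sub>R q z)"
    by (intro borel_integrable_compact compact_Times assms(2) continuous_on_subset[OF assms(1)]) auto
  moreover have "indicator ({a..b} \<times> K) z *\<^sub>R q z = indicator {a..b} (fst z) *\<^sub>R q z" for z
    using assms(3)[of "snd z" "fst z"] by (cases z) (auto simp: indicator_def)
  ultimately show ?thesis by (simp add: lborel_prod)
qed

lemma cbox_integral_eq_lborel:
  fixes f :: "real \<Rightarrow> 'b::euclidean_space"
  assumes "continuous_on {a..b} f"
  shows "integral (cbox a b) f = (LINT t|lborel. indicator {a..b} t *\<^sub>R f t)"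
  using set_borel_integral_eq_integral(2)[of "{a..b}" f] borel_integrable_compact[OF compact_Icc assms]
  by (simp add: set_integrable_def set_lebesgue_integral_def)

context smoothing_setup
begin

definition rho_scaled :: "real \<Rightarrow> real^2 \<Rightarrow> real" where
  "rho_scaled s z = \<rho> ((1 / s) *\<^sub>R z) / s\<^sup>2"

lemma rho_scaled_smooth: "smooth_on UNIV (rho_scaled s)"
proof -
  have "smooth_on UNIV (\<lambda>z. (1 / s\<^sup>2) *\<^sub>R \<rho> ((1 / s) *\<^sub>R z))"
    by (intro smooth_on_bounded_linear[OF bounded_linear_scaleR_right] open_UNIV
        smooth_on_compose[OF _ _ mollifierD(1)[OF mollifier]] smooth_on_ident) auto
  then show ?thesis unfolding rho_scaled_def by (simp add: field_simps)
qed

lemma rho_scaled_continuous: "continuous_on UNIV (rho_scaled s)"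
  by (rule smooth_on_continuous[OF rho_scaled_smooth])

definition hol_velocity :: "(real \<Rightarrow> 'p) \<Rightarrow> (real \<Rightarrow> 'n::finite cmat) \<Rightarrow> nat \<Rightarrow> real \<Rightarrow> ('n cmat)^2" where
  "hol_velocity \<gamma> m k t = (\<chi> a. (cutvel \<gamma> k t $ a) *\<^sub>R m t)"

lemma hol_velocity_support: "k < N \<Longrightarrow> t \<notin> {t. \<gamma> t \<in> closure {p. cf k p \<noteq> 0}} \<Longrightarrow> hol_velocity \<gamma> m k t = 0"
  using cutvel_support[of k \<gamma> t] by (simp add: hol_velocity_def vec_eq_iff)

lemma hol_velocity_continuous:
  assumes "closed_path \<gamma>" "k < N" "continuous_on UNIV m" shows "continuous_on UNIV (hol_velocity \<gamma> m k)"
  unfolding hol_velocity_def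
  by (intro continuous_on_vec_lambda continuous_intros assms(3) cutvel_continuous assms(1,2))

text \<open>The k-th part of the differential of the smoothed Wilson loop, as a density in the
  coordinates of \<open>U k\<close>. The partition function is left with the test form, inside
  \<open>localized\<close>.\<close>

definition kernelE :: "(real \<Rightarrow> 'p) \<Rightarrow> real \<Rightarrow> (real \<Rightarrow> 'n::finite cmat) \<Rightarrow> nat \<Rightarrow> real^2 \<Rightarrow> ('n cmat)^2" where
  "kernelE \<gamma> s m k y = integral (cbox 0 1) (\<lambda>t. rho_scaled s (cmap (U k) (\<gamma> t) - y) *\<^sub>R hol_velocity \<gamma> m k t)"

lemma kernelE_smooth:
  assumes "closed_path \<gamma>" "k < N" "continuous_on UNIV m" shows "smooth_on UNIV (kernelE \<gamma> s m k)"
  unfolding kernelE_def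
  by (rule smooth_on_translate_integral[OF cutvel_domains(1)[OF assms(1,2)] path_chart_continuous[OF assms(1) pu(1)[OF assms(2)]]
     cutvel_domains(2,3)[OF assms(1,2)] hol_velocity_support[OF assms(2)] hol_velocity_continuous[OF assms] rho_scaled_smooth])

lemma kernel_jointly_continuous:
  fixes r :: "real^2 \<Rightarrow> real"
  assumes "closed_path \<gamma>" "k < N" "continuous_on UNIV m" "continuous_on UNIV r"
  shows "continuous_on UNIV (\<lambda>z::real\<times>(real^2). r (cmap (U k) (\<gamma> (fst z)) - snd z) *\<^sub>R hol_velocity \<gamma> m k (fst z))"
proof (rule continuous_on_extend_zero[of "{t. \<gamma> t \<in> cdom (U k)} \<times> UNIV" _ "{t. \<gamma> t \<in> closure {p. cf k p \<noteq> 0}} \<times> UNIV"])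
  show "continuous_on ({t. \<gamma> t \<in> cdom (U k)} \<times> UNIV)
    (\<lambda>z::real\<times>(real^2). r (cmap (U k) (\<gamma> (fst z)) - snd z) *\<^sub>R hol_velocity \<gamma> m k (fst z))"
    by (intro continuous_intros continuous_on_compose2[OF assms(4)]
        continuous_on_compose2[OF path_chart_continuous[OF assms(1) pu(1)[OF assms(2)]]]
        continuous_on_compose2[OF hol_velocity_continuous[OF assms(1-3)]]) auto
  show "{t. \<gamma> t \<in> closure {p. cf k p \<noteq> 0}} \<times> (UNIV :: (real^2) set) \<subseteq> {t. \<gamma> t \<in> cdom (U k)} \<times> UNIV"
    using cutvel_domains(3)[OF assms(1,2)] by blast
  show "r (cmap (U k) (\<gamma> (fst z)) - snd z) *\<^sub>R hol_velocity \<gamma> m k (fst z) = 0"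
    if "z \<notin> {t. \<gamma> t \<in> closure {p. cf k p \<noteq> 0}} \<times> (UNIV :: (real^2) set)" for z
  proof -
    have "fst z \<notin> {t. \<gamma> t \<in> closure {p. cf k p \<noteq> 0}}" using that by (cases z) simp
    then have "hol_velocity \<gamma> m k (fst z) = 0" by (rule hol_velocity_support[OF assms(2)])
    then show ?thesis by simp
  qed
qed (intro open_Times closed_Times open_UNIV closed_UNIV cutvel_domains[OF assms(1,2)])+

lemma kernelE_eq_lborel:
  assumes "closed_path \<gamma>" "k < N" "continuous_on UNIV m"
  shows "kernelE \<gamma> s m k y = (LINT t|lborel. indicator {0..1} t *\<^sub>R (rho_scaled s (cmap (U k) (\<gamma> t) - y) *\<^sub>R hol_velocity \<gamma> m k t))"
  unfolding kernelE_def
proof (rule cbox_integral_eq_lborel)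
  have "continuous_on {0..1} (\<lambda>t. (\<lambda>z::real\<times>(real^2). rho_scaled s (cmap (U k) (\<gamma> (fst z)) - snd z) *\<^sub>R hol_velocity \<gamma> m k (fst z)) (t, y))"
    by (rule continuous_on_compose2[OF kernel_jointly_continuous[OF assms rho_scaled_continuous]]) (auto intro!: continuous_intros)
  then show "continuous_on {0..1} (\<lambda>t. rho_scaled s (cmap (U k) (\<gamma> t) - y) *\<^sub>R hol_velocity \<gamma> m k t)" by simp
qed

definition dwilson :: "(real \<Rightarrow> 'p) \<Rightarrow> real \<Rightarrow> (real \<Rightarrow> 'n::finite cmat) \<Rightarrow> ('p, 'n) matform \<Rightarrow> complex" where
  "dwilson \<gamma> s m v = integral {0..1} (\<lambda>t. trace (m t ** curveform \<gamma> s v t))"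

text \<open>The mollification inside the pullback is written as an integral over y and exchanged
  with the integral over time. Fubini applies because the time interval and the patch are compact
  and the integrand is jointly continuous.\<close>

lemma dwilson_eq_kernelE:
  assumes \<gamma>: "closed_path \<gamma>" and m: "continuous_on UNIV m" and v: "admissible v" and s: "s > 0"
  shows "dwilson \<gamma> s m v = (\<Sum>k<N. LINT y|lborel. tpair (kernelE \<gamma> s m k y) (localized k v y))"
proof -
  have 1: "trace (m t ** curveform \<gamma> s v t) =
    (\<Sum>k<N. LINT y|lborel. rho_scaled s (cmap (U k) (\<gamma> t) - y) *\<^sub>R tpair (hol_velocity \<gamma> m k t) (localized k v y))" for t
    unfolding curveform_def matmul_sum_right linear_sum[OF trace_linear]
  proof (rule sum.cong[OF refl])
    fix k assume "k \<in> {..<N}"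
    then have k: "k < N" by simp
    let ?x = "cmap (U k) (\<gamma> t)"
    have moll: "moll \<rho> s (localized k v) ?x = (LINT y|lborel. rho_scaled s (?x - y) *\<^sub>R localized k v y)"
      using moll_eq_convolution[OF mollifier admissibleD(1)[OF v k] s, of ?x] by (simp add: rho_scaled_def)
    have "trace (m t ** contract (cutvel \<gamma> k t) (moll \<rho> s (localized k v) ?x)) =
      tpair (hol_velocity \<gamma> m k t) (LINT y|lborel. rho_scaled s (?x - y) *\<^sub>R localized k v y)"
      by (simp only: trace_contract hol_velocity_def moll)
    also have "\<dots> = (LINT y|lborel. tpair (hol_velocity \<gamma> m k t) (rho_scaled s (?x - y) *\<^sub>R localized k v y))"
    proof (rule integral_bounded_linear[symmetric, OF bounded_bilinear.bounded_linear_right[OF bounded_bilinear_tpair]])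
      have "continuous_on (patch k) (\<lambda>y. rho_scaled s (?x - y) *\<^sub>R localized k v y)"
        by (intro continuous_intros continuous_on_compose2[OF rho_scaled_continuous] continuous_on_subset[OF admissibleD(1)[OF v k]]) auto
      from borel_integrable_compact[OF patch(1)[OF k] this]
      have "integrable lborel (\<lambda>y. indicator (patch k) y *\<^sub>R rho_scaled s (?x - y) *\<^sub>R localized k v y)" .
      moreover have "indicator (patch k) y *\<^sub>R rho_scaled s (?x - y) *\<^sub>R localized k v y = rho_scaled s (?x - y) *\<^sub>R localized k v y" for y
        using admissibleD(2)[OF v k, of y] by (cases "y \<in> patch k") auto
      ultimately show "integrable lborel (\<lambda>y. rho_scaled s (?x - y) *\<^sub>R localized k v y)" by (simp only:)
    qed
    finally show "trace (m t ** contract (cutvel \<gamma> k t) (moll \<rho> s (localized k v) ?x)) =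
      (LINT y|lborel. rho_scaled s (?x - y) *\<^sub>R tpair (hol_velocity \<gamma> m k t) (localized k v y))"
      by (simp add: tpair_scaleR_right)
  qed
  define q where "q = (\<lambda>k (z::real\<times>(real^2)). tpair (rho_scaled s (cmap (U k) (\<gamma> (fst z)) - snd z) *\<^sub>R hol_velocity \<gamma> m k (fst z)) (localized k v (snd z)))"
  have q: "integrable (lborel \<Otimes>\<^sub>M lborel) (\<lambda>z. indicator {0..1} (fst z) *\<^sub>R q k z)" if k: "k < N" for k
  proof (rule integrable_slab)
    show "continuous_on UNIV (q k)" unfolding q_def
      by (intro tpair_continuous_on kernel_jointly_continuous \<gamma> k m rho_scaled_continuous
          continuous_on_compose2[OF admissibleD(1)[OF v k]] continuous_intros) auto
    show "compact (patch k)" by (rule patch(1)[OF k])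
    show "q k (t, y) = 0" if "y \<notin> patch k" for t y using admissibleD(2)[OF v k that] by (simp add: q_def)
  qed
  have "dwilson \<gamma> s m v = (LINT t|lborel. indicator {0..1} t *\<^sub>R trace (m t ** curveform \<gamma> s v t))"
    unfolding dwilson_def
    using cbox_integral_eq_lborel[of 0 1 "\<lambda>t. trace (m t ** curveform \<gamma> s v t)"]
    by (simp add: bounded_linear.continuous_on[OF bounded_linear_trace] matmul_continuous_on
        continuous_on_subset[OF m] continuous_on_subset[OF curveform_continuous[OF \<gamma> v]])
  also have "\<dots> = (LINT t|lborel. (\<Sum>k<N. LINT y|lborel. indicator {0..1} t *\<^sub>R q k (t, y)))"
  proof (rule Bochner_Integration.integral_cong[OF refl])
    fix t :: real
    have "indicator {0..1} t *\<^sub>R (LINT y|lborel. rho_scaled s (cmap (U k) (\<gamma> t) - y) *\<^sub>R tpair (hol_velocity \<gamma> m k t) (localized k v y)) =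
      (LINT y|lborel. indicator {0..1} t *\<^sub>R q k (t, y))" for k
      by (cases "t \<in> {0..1}") (simp_all add: q_def tpair_scaleR_left)
    then show "indicator {0..1} t *\<^sub>R trace (m t ** curveform \<gamma> s v t) =
       (\<Sum>k<N. LINT y|lborel. indicator {0..1} t *\<^sub>R q k (t, y))"
      by (simp only: 1 scaleR_sum_right)
  qed
  also have "\<dots> = (\<Sum>k<N. LINT t|lborel. LINT y|lborel. indicator {0..1} t *\<^sub>R q k (t, y))"
    by (rule Bochner_Integration.integral_sum) (use lborel_pair.integrable_fst'[OF q] in simp)
  also have "\<dots> = (\<Sum>k<N. LINT y|lborel. tpair (kernelE \<gamma> s m k y) (localized k v y))"
  proof (rule sum.cong[OF refl])
    fix k assume "k \<in> {..<N}"
    then have k: "k < N" by simp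
    have "(LINT t|lborel. LINT y|lborel. indicator {0..1} t *\<^sub>R q k (t, y)) =
      (LINT y|lborel. LINT t|lborel. indicator {0..1} t *\<^sub>R q k (t, y))"
      using lborel_pair.Fubini_integral[of "\<lambda>t y. indicator {0..1} t *\<^sub>R q k (t, y)"] q[OF k]
      by (simp add: case_prod_beta')
    also have "\<dots> = (LINT y|lborel. tpair (kernelE \<gamma> s m k y) (localized k v y))"
    proof (rule Bochner_Integration.integral_cong[OF refl])
      fix y
      let ?f = "\<lambda>t. rho_scaled s (cmap (U k) (\<gamma> t) - y) *\<^sub>R hol_velocity \<gamma> m k t"
      have "continuous_on {0..1} (\<lambda>t. (\<lambda>z::real\<times>(real^2). rho_scaled s (cmap (U k) (\<gamma> (fst z)) - snd z) *\<^sub>R hol_velocity \<gamma> m k (fst z)) (t, y))"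
        by (rule continuous_on_compose2[OF kernel_jointly_continuous[OF \<gamma> k m rho_scaled_continuous]]) (auto intro!: continuous_intros)
      then have "continuous_on {0..1} ?f" by simp
      from borel_integrable_compact[OF compact_Icc this]
      have int: "integrable lborel (\<lambda>t. indicator {0..1} t *\<^sub>R ?f t)" .
      have "(LINT t|lborel. indicator {0..1} t *\<^sub>R q k (t, y)) =
        (LINT t|lborel. tpair (indicator {0..1} t *\<^sub>R ?f t) (localized k v y))"
        by (simp add: q_def tpair_scaleR_left)
      also have "\<dots> = tpair (LINT t|lborel. indicator {0..1} t *\<^sub>R ?f t) (localized k v y)"
        by (rule integral_bounded_linear[OF bounded_bilinear.bounded_linear_left[OF bounded_bilinear_tpair] int])
      finally show "(LINT t|lborel. indicator {0..1} t *\<^sub>R q k (t, y)) = tpair (kernelE \<gamma> s m k y) (localized k v y)"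
        by (simp add: kernelE_eq_lborel[OF \<gamma> k m])
    qed
    finally show "(LINT t|lborel. LINT y|lborel. indicator {0..1} t *\<^sub>R q k (t, y)) =
      (LINT y|lborel. tpair (kernelE \<gamma> s m k y) (localized k v y))" .
  qed
  finally show ?thesis .
qed

definition patch_density :: "(real \<Rightarrow> 'p) \<Rightarrow> real \<Rightarrow> (real \<Rightarrow> 'n::finite cmat) \<Rightarrow> nat \<Rightarrow> 'p chart \<Rightarrow> real^2 \<Rightarrow> ('n cmat)^2" where
  "patch_density \<gamma> s m k c x = (if c \<in> M \<and> x \<in> overlap c (U k) then
     (pu k (cinv c x) * det (jacobian (transition c (U k)) x)) *\<^sub>R
       push (jacobian (transition (U k) c) (transition c (U k) x)) (kernelE \<gamma> s m k (transition c (U k) x))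
     else 0)"

text \<open>Multiplication by the determinant and by the inverse Jacobian is the transformation law of vector
  densities.\<close>

definition loop_density :: "(real \<Rightarrow> 'p) \<Rightarrow> real \<Rightarrow> (real \<Rightarrow> 'n::finite cmat) \<Rightarrow> 'p chart \<Rightarrow> real^2 \<Rightarrow> ('n cmat)^2" where
  "loop_density \<gamma> s m c x = (\<Sum>k<N. patch_density \<gamma> s m k c x)"

lemma open_chart_vimage:
  assumes "c \<in> M" "open W" shows "open {x \<in> cimg c. cinv c x \<in> W}"
proof -
  have "{x \<in> cimg c. cinv c x \<in> W} = cinv c -` W \<inter> cimg c" by blast
  then show ?thesis
    using continuous_on_open_vimage[OF chart(2)[OF assms(1)], of "cinv c"] cinv_continuous[OF assms(1)] assms(2) by simp
qed

text \<open>The chart is covered by two open sets: the overlap with \<open>U k\<close>, where the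
  formula is smooth, and the complement of the support of \<open>pu k\<close>, where the density is
  zero.\<close>

lemma patch_density_smooth:
  assumes "closed_path \<gamma>" "k < N" "continuous_on UNIV m" "c \<in> M" shows "smooth_on (cimg c) (patch_density \<gamma> s m k c)"
proof -
  note Uk = pu(1)[OF assms(2)]
  let ?T = "transition c (U k)"
  let ?S = "overlap c (U k)" and ?V = "{x \<in> cimg c. cinv c x \<in> - closure {p. pu k p \<noteq> 0}}"
  have S: "open ?S" by (rule open_overlap[OF assms(4) Uk])
  have V: "open ?V" by (rule open_chart_vimage[OF assms(4) open_Compl[OF closed_closure]])
  have img: "?T ` ?S \<subseteq> overlap (U k) c" using transition_image[OF assms(4) Uk] by simp
  have "smooth_on ?S (\<lambda>x. (pu k (cinv c x) * det (jacobian ?T x)) *\<^sub>R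
       push (jacobian (transition (U k) c) (?T x)) (kernelE \<gamma> s m k (?T x)))"
    unfolding push_def
    by (intro smooth_on_scaleR smooth_on_mult smooth_on_vec_lambda smooth_on_sum S smooth_det_jacobian assms(4) Uk
        smooth_on_subset[OF pu(4)[OF assms(2,4)] overlap_subset]
        smooth_on_compose[OF S open_overlap[OF Uk assms(4)] smooth_jacobian[OF Uk assms(4)] smooth_transition[OF assms(4) Uk] img]
        smooth_on_compose[OF S open_UNIV smooth_on_vec_nth[OF open_UNIV kernelE_smooth[OF assms(1-3)]] smooth_transition[OF assms(4) Uk]]) simp
  then have 1: "smooth_on ?S (patch_density \<gamma> s m k c)"
    by (rule smooth_on_cong[OF S, rotated]) (simp add: patch_density_def assms(4))
  have "0 = patch_density \<gamma> s m k c x" if "x \<in> ?V" for x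
    using pu(6)[OF assms(2), of "cinv c x"] that by (auto simp: patch_density_def)
  then have 2: "smooth_on ?V (patch_density \<gamma> s m k c)"
    by (rule smooth_on_cong[OF V _ smooth_on_const])
  have "?S \<union> ?V = cimg c"
    using pu(3)[OF assms(2)] overlap_iff[OF assms(4)] by blast
  with smooth_on_Un[OF S V 1 2] show ?thesis by simp
qed

lemma loop_density_smooth:
  assumes "closed_path \<gamma>" "continuous_on UNIV m" "c \<in> M" shows "smooth_on (cimg c) (loop_density \<gamma> s m c)"
  unfolding loop_density_def by (intro smooth_on_sum chart(2) assms(3) patch_density_smooth assms) simp

lemma loop_density_zero: "c \<notin> M \<or> x \<notin> cimg c \<Longrightarrow> loop_density \<gamma> s m c x = 0"
proof -
  assume *: "c \<notin> M \<or> x \<notin> cimg c"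
  have "patch_density \<gamma> s m k c x = 0" for k
    using subsetD[OF overlap_subset, of x c "U k"] * by (auto simp: patch_density_def)
  then show ?thesis by (simp add: loop_density_def)
qed

lemma jacobian_det_chain:
  assumes "c \<in> M" "d \<in> M" "e \<in> M" "x \<in> overlap c d" "x \<in> overlap c e"
  shows "det (jacobian (transition c e) x) =
    det (jacobian (transition c d) x) * det (jacobian (transition d e) (transition c d x))"
  by (simp add: jacobian_chain[OF assms] det_mul)

text \<open>The chain rule for Jacobians and multiplicativity of the determinant give the law of
  vector densities; outside \<open>U k\<close> both sides vanish.\<close>

lemma patch_density_transition:
  assumes "k < N" "c \<in> M" "d \<in> M" "x \<in> overlap c d"
  shows "patch_density \<gamma> s m k c x = det (jacobian (transition c d) x) *\<^sub>R
    push (jacobian (transition d c) (transition c d x)) (patch_density \<gamma> s m k d (transition c d x))"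
proof (cases "x \<in> overlap c (U k)")
  case True
  note Uk = pu(1)[OF assms(1)]
  let ?y = "transition c d x"
  have y: "?y \<in> overlap d (U k)"
    using True assms by (simp add: overlap_iff cinv_transition transition_in_cimg)
  have xk: "transition c (U k) x \<in> overlap (U k) d" "transition c (U k) x \<in> overlap (U k) c"
    using True assms Uk by (simp_all add: overlap_iff cinv_transition transition_in_cimg cinv_in)
  have T: "transition d (U k) ?y = transition c (U k) x" "transition (U k) d (transition c (U k) x) = ?y"
    using transition_compose assms Uk True by auto
  have "jacobian (transition (U k) c) (transition c (U k) x) =
     jacobian (transition d c) ?y ** jacobian (transition (U k) d) (transition c (U k) x)"
    using jacobian_chain[OF Uk assms(3,2) xk] T by simp
  moreover note jacobian_det_chain[OF assms(2,3) Uk assms(4) True]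
  ultimately show ?thesis
    using True y assms by (simp add: patch_density_def T push_scaleR push_push cinv_transition ac_simps)
next
  case False
  then have "transition c d x \<notin> overlap d (U k)"
    using assms overlap_subset[of c d] by (auto simp: overlap_iff cinv_transition)
  then show ?thesis using False by (simp add: patch_density_def linear_0[OF linear_push])
qed

lemma loop_density_transition:
  assumes "c \<in> M" "d \<in> M" "x \<in> overlap c d"
  shows "loop_density \<gamma> s m c x = det (jacobian (transition c d) x) *\<^sub>R
    push (jacobian (transition d c) (transition c d x)) (loop_density \<gamma> s m d (transition c d x))"
  unfolding loop_density_def linear_sum[OF linear_push] scaleR_sum_right
  by (rule sum.cong[OF refl], rule patch_density_transition) (use assms in auto)

lemma form_supportI:
  "c \<in> M \<Longrightarrow> p \<in> cdom c \<Longrightarrow> v c (cmap c p) \<noteq> 0 \<Longrightarrow> p \<in> form_support M v"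
  unfolding form_support_def by (rule subsetD[OF closure_subset]) blast

text \<open>Each kernel integral is moved from \<open>U k\<close> to the chart \<open>c\<close>. The
  inverse Jacobian of the density cancels against the transposed Jacobian of the form, leaving the
  determinant. The pieces vanish off the overlap: on one side by definition, on the other because
  the form is supported in \<open>c\<close>.\<close>

lemma dwilson_eq_chart_integral:
  assumes \<gamma>: "closed_path \<gamma>" and m: "continuous_on UNIV m" and v: "one_form M \<gg> v" and s: "s > 0"
    and c: "c \<in> M" "form_support M v \<subseteq> cdom c"
  shows "dwilson \<gamma> s m v = (LINT x:cimg c|lborel. tpair (loop_density \<gamma> s m c x) (v c x))"
proof -
  have adm: "admissible v" by (rule one_form_admissible[OF v])
  have zero: "v d x = 0" if "d \<in> M" "x \<in> cimg d" "cinv d x \<notin> form_support M v" for d x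
  proof (rule ccontr)
    assume "v d x \<noteq> 0"
    then have "cinv d x \<in> form_support M v"
      using form_supportI[of d "cinv d x" v] that(1,2) by (simp add: cinv_in cmap_cinv)
    then show False using that(3) by blast
  qed
  have eq: "(LINT y|lborel. tpair (kernelE \<gamma> s m k y) (localized k v y)) =
      (LINT x:cimg c|lborel. tpair (patch_density \<gamma> s m k c x) (v c x))" if k: "k < N" for k
  proof -
    note Uk = pu(1)[OF k]
    have "(LINT y|lborel. tpair (kernelE \<gamma> s m k y) (localized k v y)) =
      (LINT y:cimg (U k)|lborel. tpair (kernelE \<gamma> s m k y) (localized k v y))"
      unfolding set_lebesgue_integral_def
    proof (rule Bochner_Integration.integral_cong[OF refl])
      fix y
      show "tpair (kernelE \<gamma> s m k y) (localized k v y) = indicator (cimg (U k)) y *\<^sub>R tpair (kernelE \<gamma> s m k y) (localized k v y)"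
      proof (cases "y \<in> cimg (U k)")
        case False
        then have "y \<notin> patch k" using patch(2)[OF k] by blast
        from admissibleD(2)[OF adm k this] show ?thesis by simp
      qed simp
    qed
    also have "\<dots> = (LINT x:cimg c|lborel. tpair (patch_density \<gamma> s m k c x) (v c x))"
    proof (rule integral_transition[OF c(1) Uk, symmetric])
      show "tpair (patch_density \<gamma> s m k c x) (v c x) = 0" if "x \<in> cimg c - overlap c (U k)" for x
        using that by (simp add: patch_density_def)
      show "tpair (kernelE \<gamma> s m k y) (localized k v y) = 0" if y: "y \<in> cimg (U k) - overlap (U k) c" for y
      proof -
        have "cinv (U k) y \<notin> form_support M v" using y c(2) by (auto simp: overlap_iff[OF Uk])
        then show ?thesis using zero[OF Uk, of y] y by (simp add: localized_def)
      qed
      show "continuous_on (overlap (U k) c) (\<lambda>y. tpair (kernelE \<gamma> s m k y) (localized k v y))"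
        by (intro tpair_continuous_on continuous_on_subset[OF smooth_on_continuous[OF kernelE_smooth[OF \<gamma> k m]]]
            continuous_on_subset[OF admissibleD(1)[OF adm k]]) auto
      fix x assume x: "x \<in> overlap c (U k)"
      let ?y = "transition c (U k) x" and ?J = "jacobian (transition c (U k)) x"
        and ?J' = "jacobian (transition (U k) c) (transition c (U k) x)"
      have y: "?y \<in> overlap (U k) c" by (rule transition_in_overlap[OF c(1) Uk x])
      have "v (U k) ?y = push (transpose ?J') (v c x)"
        using one_form_push[OF v Uk c(1) y] transition_inverse[OF c(1) Uk x] by simp
      then show "tpair (patch_density \<gamma> s m k c x) (v c x) = det ?J *\<^sub>R tpair (kernelE \<gamma> s m k ?y) (localized k v ?y)"
        using x c(1) by (simp add: patch_density_def tpair_scaleR_left tpair_scaleR_right tpair_push localized_def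
            cinv_transition[OF c(1) Uk x])
    qed
    finally show ?thesis .
  qed
  have int: "set_integrable lborel (cimg c) (\<lambda>x. tpair (patch_density \<gamma> s m k c x) (v c x))" if k: "k < N" for k
  proof (rule set_integrable_chart[OF c(1) _ _ c(2)])
    show "continuous_on (cimg c) (\<lambda>x. tpair (patch_density \<gamma> s m k c x) (v c x))"
      by (intro tpair_continuous_on smooth_on_continuous[OF patch_density_smooth[OF \<gamma> k m c(1)]]
          smooth_on_continuous[OF one_formD(1)[OF v c(1)]])
    show "closed (form_support M v)" unfolding form_support_def by (rule closed_closure)
  qed (simp add: zero c(1))
  have "dwilson \<gamma> s m v = (\<Sum>k<N. LINT x:cimg c|lborel. tpair (patch_density \<gamma> s m k c x) (v c x))"
    unfolding dwilson_eq_kernelE[OF \<gamma> m adm s] by (rule sum.cong[OF refl]) (simp add: eq)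
  also have "\<dots> = (LINT x:cimg c|lborel. \<Sum>k<N. tpair (patch_density \<gamma> s m k c x) (v c x))"
    using int unfolding set_lebesgue_integral_def set_integrable_def scaleR_sum_right
    by (intro Bochner_Integration.integral_sum[symmetric]) auto
  finally show ?thesis by (simp add: loop_density_def tpair_sum_left)
qed

definition based_hol :: "(real \<Rightarrow> 'p) \<Rightarrow> real \<Rightarrow> ('p, 'n::finite) matform \<Rightarrow> real \<Rightarrow> 'n cmat" where
  "based_hol \<gamma> s A = monodromy (curveform \<gamma> s A)"

lemma curveform_flow:
  fixes A :: "('p, 'n::finite) matform"
  assumes "closed_path \<gamma>" "admissible A" shows "\<exists>h g. flow (curveform \<gamma> s A) h g"
proof -
  obtain B where "\<forall>t. norm (curveform \<gamma> s A t) \<le> B"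
    using periodic_bounded[OF curveform_continuous[OF assms] curveform_periodic[OF assms(1)]] by blast
  then show ?thesis using flow_exists[where 'n='n] curveform_continuous[OF assms, of s] by metis
qed

lemma based_hol_continuous:
  assumes "closed_path \<gamma>" "admissible A" shows "continuous_on UNIV (based_hol \<gamma> s A)"
  using curveform_flow[OF assms, of s] monodromy_continuous unfolding based_hol_def by blast

lemma based_hol_periodic:
  assumes "closed_path \<gamma>" "admissible A" shows "based_hol \<gamma> s A (t + 1) = based_hol \<gamma> s A t"
proof -
  obtain h g where "flow (curveform \<gamma> s A) h g" using curveform_flow[OF assms] by blast
  then show ?thesis unfolding based_hol_def by (rule monodromy_periodic) (rule curveform_periodic[OF assms(1)])
qed

lemma wilson_smoothing:
  assumes "closed_path \<gamma>" "admissible A" "s > 0" "flow (curveform \<gamma> s A) h g"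
  shows "wilson M \<gamma> (smoothing M N U pu cf \<rho> s A) = trace (h 1)"
  unfolding wilson_def by (simp add: hol_closed_path[OF assms(1) pulls_back_smoothing[OF assms(1-3)] assms(4)])

text \<open>Smoothing and pullback are linear in the connection, so a line of connections becomes a
  line of generators and the first variation of the flow applies.\<close>

lemma wilson_has_derivative:
  fixes A v :: "('p, 'n::finite) matform"
  assumes \<gamma>: "closed_path \<gamma>" and A: "admissible A" and v: "admissible v" and s: "s > 0"
  shows "((\<lambda>t::real. wilson M \<gamma> (smoothing M N U pu cf \<rho> s (form_add A (form_scale (of_real t) v))))
    has_vector_derivative dwilson \<gamma> s (based_hol \<gamma> s A) v) (at 0)"
proof -
  let ?X = "curveform \<gamma> s A" and ?Y = "curveform \<gamma> s v"
  obtain B1 where B1: "\<And>t. norm (?X t) \<le> B1"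
    using periodic_bounded[OF curveform_continuous[OF \<gamma> A] curveform_periodic[OF \<gamma>]] by blast
  obtain B2 where B2: "\<And>t. norm (?Y t) \<le> B2"
    using periodic_bounded[OF curveform_continuous[OF \<gamma> v] curveform_periodic[OF \<gamma>]] by blast
  have adm: "admissible (form_add A (form_scale (of_real \<tau>) v))" for \<tau> by (intro admissible_add admissible_scale A v)
  have X: "curveform \<gamma> s (form_add A (form_scale (of_real \<tau>) v)) = (\<lambda>t. ?X t + \<tau> *\<^sub>R ?Y t)" for \<tau>
    by (rule ext) (simp add: curveform_add[OF A admissible_scale[OF v]] curveform_scale[OF v] cscale_of_real)
  have "\<exists>k l. flow (\<lambda>t. ?X t + \<tau> *\<^sub>R ?Y t) k l" for \<tau>
    using curveform_flow[OF \<gamma> adm, of s \<tau>] by (simp add: X)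
  then obtain k l where kl: "\<And>\<tau>. flow (\<lambda>t. ?X t + \<tau> *\<^sub>R ?Y t) (k \<tau>) (l \<tau>)" by metis
  have "wilson M \<gamma> (smoothing M N U pu cf \<rho> s (form_add A (form_scale (of_real \<tau>) v))) = trace (k \<tau> 1)" for \<tau>
    by (rule wilson_smoothing[OF \<gamma> adm s, unfolded X, OF kl])
  then show ?thesis
    using trace_flow_has_derivative[OF curveform_continuous[OF \<gamma> A] B1 curveform_continuous[OF \<gamma> v] B2 kl]
    by (simp add: dwilson_def based_hol_def)
qed

lemma dwilson_integrable:
  assumes "closed_path \<gamma>" "continuous_on UNIV m" "admissible v"
  shows "(\<lambda>t. trace (m t ** curveform \<gamma> s v t)) integrable_on {0..1}"
  by (intro integrable_continuous_interval bounded_linear.continuous_on[OF bounded_linear_trace] matmul_continuous_on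
      continuous_on_subset[OF assms(2)] continuous_on_subset[OF curveform_continuous[OF assms(1,3)]]) auto

lemma dwilson_add:
  assumes "closed_path \<gamma>" "continuous_on UNIV m" "admissible v" "admissible w"
  shows "dwilson \<gamma> s m (form_add v w) = dwilson \<gamma> s m v + dwilson \<gamma> s m w"
  unfolding dwilson_def curveform_add[OF assms(3,4)] matmul_add_right linear_add[OF trace_linear]
  by (intro Henstock_Kurzweil_Integration.integral_add dwilson_integrable assms)

lemma dwilson_scale:
  assumes "closed_path \<gamma>" "continuous_on UNIV m" "admissible v"
  shows "dwilson \<gamma> s m (form_scale z v) = z * dwilson \<gamma> s m v"
  unfolding dwilson_def curveform_scale[OF assms(3)] trace_cscale_right by simp

definition wilson_derivative :: "('b::finite \<Rightarrow> 'n cmat) \<Rightarrow> (real \<Rightarrow> 'p) \<Rightarrow> real \<Rightarrow> ('p, 'n::finite) matform \<Rightarrow>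
   'p chart \<Rightarrow> real^2 \<Rightarrow> (complex^'b)^2" where
  "wilson_derivative e \<gamma> s A c x = (\<chi> a. \<chi> \<alpha>. trace (loop_density \<gamma> s (based_hol \<gamma> s A) c x $ a ** e \<alpha>))"

lemma wilson_functional_derivative:
  fixes A :: "('p, 'n::finite) matform" and e :: "'b::finite \<Rightarrow> 'n cmat"
  assumes e: "lie_basis K \<gg> e" and \<gamma>: "closed_path \<gamma>" and A: "admissible A" and s: "s > 0"
  shows "has_functional_derivative M K \<gg> e (\<lambda>A. wilson M \<gamma> (smoothing M N U pu cf \<rho> s A)) A (wilson_derivative e \<gamma> s A)"
  unfolding has_functional_derivative_def
proof (intro conjI ballI allI impI exI[of _ "dwilson \<gamma> s (based_hol \<gamma> s A)"])
  note m = based_hol_continuous[OF \<gamma> A, of s]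
  show "smooth_on (cimg c) (wilson_derivative e \<gamma> s A c)" if "c \<in> M" for c
    unfolding wilson_derivative_def
    by (intro smooth_on_vec_lambda chart(2)[OF that] smooth_on_bounded_linear[OF bounded_linear_trace]
        smooth_on_bounded_linear[OF bounded_bilinear.bounded_linear_left[OF bounded_bilinear_matmul]]
        smooth_on_vec_nth loop_density_smooth[OF \<gamma> m that])
  show "wilson_derivative e \<gamma> s A c x = 0" if "c \<notin> M \<or> x \<notin> cimg c" for c x
    using loop_density_zero[OF that, of \<gamma> s "based_hol \<gamma> s A"] bounded_bilinear.zero_left[OF bounded_bilinear_matmul] linear_0[OF trace_linear]
    by (simp only: wilson_derivative_def zero_index) (simp add: vec_eq_iff)
  fix v :: "('p, 'n) matform" assume v: "one_form M \<gg> v"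
  note adm = one_form_admissible[OF v]
  show "dwilson \<gamma> s (based_hol \<gamma> s A) (form_add v w) = dwilson \<gamma> s (based_hol \<gamma> s A) v + dwilson \<gamma> s (based_hol \<gamma> s A) w"
    if "one_form M \<gg> w" for w by (intro dwilson_add \<gamma> m adm one_form_admissible[OF that])
  show "dwilson \<gamma> s (based_hol \<gamma> s A) (form_scale z v) = z * dwilson \<gamma> s (based_hol \<gamma> s A) v" for z
    by (intro dwilson_scale \<gamma> m adm)
  show "((\<lambda>t::real. wilson M \<gamma> (smoothing M N U pu cf \<rho> s (form_add A (form_scale (of_real t) v))))
    has_vector_derivative dwilson \<gamma> s (based_hol \<gamma> s A) v) (at 0)"
    by (rule wilson_has_derivative[OF \<gamma> A adm s])
next
  fix c and v :: "('p, 'n) matform" assume c: "c \<in> M" and v: "one_form M \<gg> v \<and> form_support M v \<subseteq> cdom c"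
  have "dwilson \<gamma> s (based_hol \<gamma> s A) v = (LINT x:cimg c|lborel. tpair (loop_density \<gamma> s (based_hol \<gamma> s A) c x) (v c x))"
    using v by (intro dwilson_eq_chart_integral[OF \<gamma> based_hol_continuous[OF \<gamma> A] _ s c]) auto
  also have "\<dots> = (LINT x:cimg c|lborel. (\<Sum>a\<in>UNIV. \<Sum>\<alpha>\<in>UNIV. wilson_derivative e \<gamma> s A c x $ a $ \<alpha> * lie_coords K e (v c x $ a) $ \<alpha>))"
    unfolding set_lebesgue_integral_def
  proof (rule Bochner_Integration.integral_cong[OF refl])
    fix x
    show "indicator (cimg c) x *\<^sub>R tpair (loop_density \<gamma> s (based_hol \<gamma> s A) c x) (v c x) =
      indicator (cimg c) x *\<^sub>R (\<Sum>a\<in>UNIV. \<Sum>\<alpha>\<in>UNIV. wilson_derivative e \<gamma> s A c x $ a $ \<alpha> * lie_coords K e (v c x $ a) $ \<alpha>)"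
    proof (cases "x \<in> cimg c")
      case True
      have "v c x $ a \<in> \<gg>" for a using one_formD(2)[of M \<gg> v c x a] v c True by blast
      from tpair_lie_coords[OF e this] show ?thesis by (simp add: wilson_derivative_def)
    qed simp
  qed
  finally show "dwilson \<gamma> s (based_hol \<gamma> s A) v =
    (LINT x:cimg c|lborel. (\<Sum>a\<in>UNIV. \<Sum>\<alpha>\<in>UNIV. wilson_derivative e \<gamma> s A c x $ a $ \<alpha> * lie_coords K e (v c x $ a) $ \<alpha>))" .
qed

section \<open>Test forms and uniqueness of functional derivatives\<close>

lemma extend_form_push:
  "extend_form M c w d x = (if d \<in> M \<and> x \<in> overlap d c
     then push (transpose (jacobian (transition d c) x)) (w (transition d c x)) else 0)"
  by (simp add: extend_form_def push_def transpose_def)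

text \<open>Supplies smooth one-forms with prescribed coefficients in one chart. Compactness of
  \<open>W\<close> makes its image in the surface closed, so the extension by zero is smooth in
  every chart.\<close>

lemma
  fixes w :: "real^2 \<Rightarrow> ('n::finite cmat)^2"
  assumes c: "c \<in> M" and w: "smooth_on UNIV w" "\<And>y a. w y $ a \<in> \<gg>"
    and W: "compact W" "W \<subseteq> cimg c" "\<And>y. y \<notin> W \<Longrightarrow> w y = 0" and \<gg>: "subspace \<gg>"
  shows extend_form_one_form: "one_form M \<gg> (extend_form M c w)"
    and extend_form_support: "form_support M (extend_form M c w) \<subseteq> cdom c"
    and extend_form_chart: "x \<in> cimg c \<Longrightarrow> extend_form M c w c x = w x"
proof -
  let ?L = "cinv c ` W"
  have L: "closed ?L"
    by (intro compact_imp_closed compact_continuous_image W continuous_on_subset[OF cinv_continuous[OF c] W(2)])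
  have Lc: "?L \<subseteq> cdom c" using W(2) cinv_in[OF c] by blast
  have zero: "extend_form M c w d x = 0" if "d \<in> M" "x \<in> cimg d" "cinv d x \<notin> ?L" for d x
  proof (cases "x \<in> overlap d c")
    case True
    have "transition d c x \<notin> W"
    proof
      assume "transition d c x \<in> W"
      then have "cinv c (transition d c x) \<in> ?L" by (rule imageI)
      then show False using that True c by (simp add: cinv_transition)
    qed
    then show ?thesis using W(3) by (simp add: extend_form_push linear_0[OF linear_push])
  qed (simp add: extend_form_push)
  show "one_form M \<gg> (extend_form M c w)"
    unfolding one_form_def
  proof (intro conjI ballI allI impI)
    fix d assume d: "d \<in> M"
    let ?V = "{x \<in> cimg d. cinv d x \<in> - ?L}"
    have S: "open (overlap d c)" by (rule open_overlap[OF d c])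
    have V: "open ?V" by (rule open_chart_vimage[OF d open_Compl[OF L]])
    have "smooth_on (overlap d c) (\<lambda>x. push (transpose (jacobian (transition d c) x)) (w (transition d c x)))"
      unfolding push_def transpose_def vec_lambda_beta
      by (intro smooth_on_vec_lambda smooth_on_sum smooth_on_scaleR S smooth_jacobian d c
         smooth_on_compose[OF S open_UNIV smooth_on_vec_nth[OF open_UNIV w(1)] smooth_transition[OF d c]]) simp
    then have 1: "smooth_on (overlap d c) (extend_form M c w d)"
      by (rule smooth_on_cong[OF S, rotated]) (simp add: extend_form_push d)
    have 2: "smooth_on ?V (extend_form M c w d)"
      by (rule smooth_on_cong[OF V _ smooth_on_const[of _ 0]]) (use zero[OF d] in auto)
    have "overlap d c \<union> ?V = cimg d" using Lc overlap_iff[OF d] by blast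
    with smooth_on_Un[OF S V 1 2] show "smooth_on (cimg d) (extend_form M c w d)" by simp
    show "extend_form M c w d x $ a \<in> \<gg>" for x a
    proof (cases "x \<in> overlap d c")
      case True
      have "(\<Sum>b\<in>UNIV. B $ a $ b *\<^sub>R w y $ b) \<in> \<gg>" for B :: "real^2^2" and y
        by (intro subspace_sum subspace_scale \<gg> w(2))
      then show ?thesis using True d by (simp add: extend_form_push push_def)
    qed (simp add: extend_form_push subspace_0[OF \<gg>])
    fix d' x a assume d': "d' \<in> M" and x: "x \<in> overlap d d'"
    have "extend_form M c w d x = push (transpose (jacobian (transition d d') x)) (extend_form M c w d' (transition d d' x))"
    proof (cases "x \<in> overlap d c")
      case True
      have y: "transition d d' x \<in> overlap d' c"
        using True x d d' by (simp add: overlap_iff cinv_transition transition_in_cimg)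
      show ?thesis
        using True y d d' by (simp add: extend_form_push push_push transition_compose[OF d d' x]
           jacobian_chain[OF d d' c x True] matrix_transpose_mul)
    next
      case False
      then have "transition d d' x \<notin> overlap d' c"
        using x d d' overlap_subset[of d d'] by (auto simp: overlap_iff[of d] overlap_iff[of d'] cinv_transition)
      then show ?thesis using False by (simp add: extend_form_push linear_0[OF linear_push])
    qed
    then show "extend_form M c w d x $ a = (\<Sum>b\<in>UNIV. (jacobian (transition d d') x $ b $ a) *\<^sub>R
        (extend_form M c w d' (transition d d' x) $ b))"
      by (simp add: push_def transpose_def)
  next
    fix d x assume "d \<notin> M \<or> x \<notin> cimg d"
    then show "extend_form M c w d x = 0"
      using subsetD[OF overlap_subset, of x d c] by (auto simp: extend_form_push)
  qed
  have "{p. \<exists>d\<in>M. p \<in> cdom d \<and> extend_form M c w d (cmap d p) \<noteq> 0} \<subseteq> ?L"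
  proof
    fix p assume "p \<in> {p. \<exists>d\<in>M. p \<in> cdom d \<and> extend_form M c w d (cmap d p) \<noteq> 0}"
    then obtain d where d: "d \<in> M" "p \<in> cdom d" "extend_form M c w d (cmap d p) \<noteq> 0" by blast
    then have "cinv d (cmap d p) \<in> ?L" using zero[OF d(1) cmap_in[OF d(1,2)]] by blast
    then show "p \<in> ?L" by (simp only: cinv_cmap[OF d(1,2)])
  qed
  then have "form_support M (extend_form M c w) \<subseteq> ?L"
    unfolding form_support_def using L by (rule closure_minimal)
  then show "form_support M (extend_form M c w) \<subseteq> cdom c" using Lc by blast
  show "extend_form M c w c x = w x" if "x \<in> cimg c"
    using that c by (simp add: extend_form_push overlap_self jacobian_self transition_self)
qed

lemma has_functional_derivativeD:
  fixes e :: "'b::finite \<Rightarrow> 'n::finite cmat"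
  assumes "has_functional_derivative M K \<gg> e f A D"
  shows "c \<in> M \<Longrightarrow> smooth_on (cimg c) (D c)" "c \<notin> M \<or> x \<notin> cimg c \<Longrightarrow> D c x = 0"
    "\<exists>L. (\<forall>v. one_form M \<gg> v \<longrightarrow>
           ((\<lambda>t::real. f (form_add A (form_scale (of_real t) v))) has_vector_derivative L v) (at 0)) \<and>
        (\<forall>c\<in>M. \<forall>v. one_form M \<gg> v \<and> form_support M v \<subseteq> cdom c \<longrightarrow>
           L v = (LINT x:cimg c|lborel.
                    (\<Sum>a\<in>UNIV. \<Sum>\<alpha>\<in>UNIV. D c x $ a $ \<alpha> * lie_coords K e (v c x $ a) $ \<alpha>)))"
proof -
  note D = assms[unfolded has_functional_derivative_def]
  show "c \<in> M \<Longrightarrow> smooth_on (cimg c) (D c)" using conjunct1[OF D] by (rule bspec)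
  show "D c x = 0" if "c \<notin> M \<or> x \<notin> cimg c"
    using conjunct1[OF conjunct2[OF D], rule_format, OF that] .
  show "\<exists>L. (\<forall>v. one_form M \<gg> v \<longrightarrow>
           ((\<lambda>t::real. f (form_add A (form_scale (of_real t) v))) has_vector_derivative L v) (at 0)) \<and>
        (\<forall>c\<in>M. \<forall>v. one_form M \<gg> v \<and> form_support M v \<subseteq> cdom c \<longrightarrow>
           L v = (LINT x:cimg c|lborel.
                    (\<Sum>a\<in>UNIV. \<Sum>\<alpha>\<in>UNIV. D c x $ a $ \<alpha> * lie_coords K e (v c x $ a) $ \<alpha>)))"
    using conjunct2[OF conjunct2[OF D]] by (elim exE conjE) (intro exI conjI, assumption+)
qed

text \<open>The mollifier itself, rescaled at a point, provides the test forms.\<close>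

lemma functional_derivative_unique:
  fixes e :: "'b::finite \<Rightarrow> 'n::finite cmat"
  assumes e: "lie_basis K \<gg> e" and \<gg>: "subspace \<gg>" and K: "\<And>r::real. of_real r \<in> K"
    and D1: "has_functional_derivative M K \<gg> e f A D1" and D2: "has_functional_derivative M K \<gg> e f A D2"
  shows "D1 = D2"
proof (intro ext)
  fix c and x0 :: "real^2"
  show "D1 c x0 = D2 c x0"
  proof (cases "c \<in> M \<and> x0 \<in> cimg c")
    case False
    then have "c \<notin> M \<or> x0 \<notin> cimg c" by blast
    then show ?thesis using has_functional_derivativeD(2)[OF D1] has_functional_derivativeD(2)[OF D2] by simp
  next
    case True
    then have c: "c \<in> M" and x0: "x0 \<in> cimg c" by auto
    obtain L1 where L1: "\<And>v. one_form M \<gg> v \<Longrightarrow>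
         ((\<lambda>t::real. f (form_add A (form_scale (of_real t) v))) has_vector_derivative L1 v) (at 0)"
      "\<And>v. one_form M \<gg> v \<and> form_support M v \<subseteq> cdom c \<Longrightarrow> L1 v = (LINT x:cimg c|lborel.
        (\<Sum>a\<in>UNIV. \<Sum>\<alpha>\<in>UNIV. D1 c x $ a $ \<alpha> * lie_coords K e (v c x $ a) $ \<alpha>))"
      using has_functional_derivativeD(3)[OF D1] c by blast
    obtain L2 where L2: "\<And>v. one_form M \<gg> v \<Longrightarrow>
         ((\<lambda>t::real. f (form_add A (form_scale (of_real t) v))) has_vector_derivative L2 v) (at 0)"
      "\<And>v. one_form M \<gg> v \<and> form_support M v \<subseteq> cdom c \<Longrightarrow> L2 v = (LINT x:cimg c|lborel.
        (\<Sum>a\<in>UNIV. \<Sum>\<alpha>\<in>UNIV. D2 c x $ a $ \<alpha> * lie_coords K e (v c x $ a) $ \<alpha>))"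
      using has_functional_derivativeD(3)[OF D2] c by blast
    \<comment> \<open>Both linear functionals compute the same directional derivatives of
      \<open>f\<close>, so they agree on every test form.\<close>
    have L12: "L1 v = L2 v" if "one_form M \<gg> v" for v
      using vector_derivative_unique_at[OF L1(1)[OF that] L2(1)[OF that]] .
    have sm: "smooth_on (cimg c) (D1 c)" "smooth_on (cimg c) (D2 c)"
      by (rule has_functional_derivativeD(1)[OF D1 c], rule has_functional_derivativeD(1)[OF D2 c])
    have comp: "D1 c x0 $ a $ \<alpha> = D2 c x0 $ a $ \<alpha>" for a \<alpha>
    proof -
      obtain R where R: "R > 0" "\<And>y. \<rho> y \<noteq> 0 \<Longrightarrow> norm y \<le> R" using mollifierD(6)[OF mollifier] by blast
      obtain d where d: "d > 0" "cball x0 d \<subseteq> cimg c" using chart(2)[OF c] x0 open_contains_cball by blast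
      \<comment> \<open>An approximate identity at \<open>x0\<close>, obtained from
        \<open>blow_up\<close> for the map y -> x0 - y with its single zero.\<close>
      have conv: "((\<lambda>s. LINT y|lborel. (\<rho> ((x0 - y) /\<^sub>R s) / s ^ DIM(real^2)) *\<^sub>R
           (indicator (cball x0 d) y *\<^sub>R D c y $ a $ \<alpha>)) \<longlongrightarrow> D c x0 $ a $ \<alpha>) (at_right 0)"
        if D: "continuous_on (cimg c) (D c)" for D :: "'p chart \<Rightarrow> real^2 \<Rightarrow> (complex^'b)^2"
      proof -
        have Dc: "continuous_on (cball x0 d) (\<lambda>y. D c y $ a $ \<alpha>)"
          by (intro continuous_on_component continuous_on_subset[OF D d(2)])
        have "bounded ((\<lambda>y. D c y $ a $ \<alpha>) ` cball x0 d)"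
          by (rule compact_imp_bounded[OF compact_continuous_image[OF Dc compact_cball]])
        then obtain B where "\<forall>z\<in>(\<lambda>y. D c y $ a $ \<alpha>) ` cball x0 d. norm z \<le> B" unfolding bounded_iff ..
        then have B: "norm (D c y $ a $ \<alpha>) \<le> B" if "y \<in> cball x0 d" for y using that by simp
        have B0: "B \<ge> 0" using order_trans[OF norm_ge_zero B[of x0]] d(1) by simp
        \<comment> \<open>The limiting kernel is reflected because the derivative of y -> x0 - y is
          minus the identity.\<close>
        have int1: "(LINT y|lborel. \<rho> (- y)) = 1"
        proof -
          have "\<rho> \<in> borel_measurable borel" by (rule borel_measurable_continuous_onI[OF mollifierD(2)[OF mollifier]])
          from lborel_integral_affine[of "-1" \<rho> 0, OF _ this] mollifierD(5)[OF mollifier] show ?thesis by simp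
        qed
        have "((\<lambda>s. LINT y|lborel. (\<rho> ((x0 - y) /\<^sub>R s) / s ^ DIM(real^2)) *\<^sub>R
           (indicator (cball x0 d) y *\<^sub>R D c y $ a $ \<alpha>)) \<longlongrightarrow>
           (\<Sum>z\<in>{x0}. (LINT y|lborel. \<rho> (- y)) *\<^sub>R D c x0 $ a $ \<alpha>)) (at_right 0)"
        proof (rule blow_up[where R=R and Z="cball x0 d" and ?s0.0=1 and B=B])
          show "continuous_on UNIV \<rho>" by (rule mollifierD(2)[OF mollifier])
          show "norm w \<le> R" if "\<rho> w \<noteq> 0" for w using R(2)[OF that] .
          show "norm (indicator (cball x0 d) z *\<^sub>R D c z $ a $ \<alpha>) \<le> B" for z
            using B[of z] B0 by (cases "z \<in> cball x0 d") auto
          show "(\<lambda>z. \<rho> ((x0 - z) /\<^sub>R s) *\<^sub>R indicator (cball x0 d) z *\<^sub>R D c z $ a $ \<alpha>) \<in> borel_measurable borel" if "0 < s" for s :: real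
          proof (rule borel_measurable_scaleR)
            show "(\<lambda>z. \<rho> ((x0 - z) /\<^sub>R s)) \<in> borel_measurable borel"
              by (intro borel_measurable_continuous_onI continuous_on_compose2[OF mollifierD(2)[OF mollifier]] continuous_intros) auto
            show "(\<lambda>z. indicator (cball x0 d) z *\<^sub>R D c z $ a $ \<alpha>) \<in> borel_measurable borel"
              by (rule borel_measurable_continuous_on_indicator[OF _ Dc]) simp
          qed
          show "((\<lambda>x. x0 - x) has_derivative (\<lambda>y. - y)) (at z)" for z
            by (auto intro!: derivative_eq_intros)
          show "inj (\<lambda>y::real^2. - y)" by simp
          show "((\<lambda>s. indicator (cball x0 d) (z + s *\<^sub>R \<zeta>) *\<^sub>R D c (z + s *\<^sub>R \<zeta>) $ a $ \<alpha>) \<longlongrightarrow> D c x0 $ a $ \<alpha>) (at_right 0)"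
            if "z \<in> {x0}" for z \<zeta>
          proof (rule Lim_transform_eventually)
            have l: "((\<lambda>s. x0 + s *\<^sub>R \<zeta>) \<longlongrightarrow> x0 + 0 *\<^sub>R \<zeta>) (at_right 0)" by (intro tendsto_intros)
            have "isCont (\<lambda>y. D c y $ a $ \<alpha>) x0"
              using continuous_on_subset[OF Dc ball_subset_cball] d(1)
              by (simp add: continuous_on_eq_continuous_at)
            then show "((\<lambda>s. D c (x0 + s *\<^sub>R \<zeta>) $ a $ \<alpha>) \<longlongrightarrow> D c x0 $ a $ \<alpha>) (at_right 0)"
              by (rule isCont_tendsto_compose) (use l in simp)
            have "\<forall>\<^sub>F s in at_right 0. x0 + s *\<^sub>R \<zeta> \<in> ball x0 d"
              using l d(1) by (intro topological_tendstoD) auto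
            then show "\<forall>\<^sub>F s in at_right 0. D c (x0 + s *\<^sub>R \<zeta>) $ a $ \<alpha> =
               indicator (cball x0 d) (z + s *\<^sub>R \<zeta>) *\<^sub>R D c (z + s *\<^sub>R \<zeta>) $ a $ \<alpha>"
            proof eventually_elim
              case (elim s)
              then have "z + s *\<^sub>R \<zeta> \<in> cball x0 d" using that ball_subset_cball by blast
              then show ?case using that by simp
            qed
          qed
        qed (auto intro!: continuous_intros)
        then show ?thesis by (simp add: int1)
      qed
      have ev: "\<forall>\<^sub>F s in at_right (0::real). 0 < s \<and> R * s < d"
      proof (rule eventually_conj)
        have "((\<lambda>s. R * s) \<longlongrightarrow> R * 0) (at_right 0)" by (intro tendsto_intros)
        then show "\<forall>\<^sub>F s in at_right 0. R * s < d" using d(1) by (intro order_tendstoD) auto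
      qed (simp add: eventually_at_right_less)
      have "(LINT y|lborel. (\<rho> ((x0 - y) /\<^sub>R s) / s ^ DIM(real^2)) *\<^sub>R (indicator (cball x0 d) y *\<^sub>R D1 c y $ a $ \<alpha>)) =
          (LINT y|lborel. (\<rho> ((x0 - y) /\<^sub>R s) / s ^ DIM(real^2)) *\<^sub>R (indicator (cball x0 d) y *\<^sub>R D2 c y $ a $ \<alpha>))"
        if s: "0 < s" "R * s < d" for s
      proof -
        define \<eta> where "\<eta> = (\<lambda>y. \<rho> ((x0 - y) /\<^sub>R s) / s ^ DIM(real^2))"
        \<comment> \<open>The test form \<open>\<eta> e\<^sub>\<alpha> dx\<^sup>a\<close> picks out
          one component of the functional derivative; real multiples of the basis element keep it in
          the Lie algebra.\<close>
        define w where "w = (\<lambda>y. \<chi> i. if i = a then \<eta> y *\<^sub>R e \<alpha> else 0)"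
        have \<eta>0: "\<eta> y = 0" if "y \<notin> cball x0 d" for y
        proof (rule ccontr)
          assume "\<eta> y \<noteq> 0"
          then have "\<rho> ((x0 - y) /\<^sub>R s) \<noteq> 0" by (auto simp: \<eta>_def)
          then have "norm ((x0 - y) /\<^sub>R s) \<le> R" by (rule R(2))
          moreover have "norm ((x0 - y) /\<^sub>R s) = inverse s * norm (x0 - y)"
            using s(1) by (simp only: norm_scaleR abs_of_pos positive_imp_inverse_positive)
          ultimately have i: "inverse s * norm (x0 - y) \<le> R" by (simp only:)
          have "norm (x0 - y) = s * (inverse s * norm (x0 - y))" using s(1) by simp
          also have "\<dots> \<le> s * R" using s(1) by (intro mult_left_mono i) auto
          finally have "norm (x0 - y) \<le> R * s" by (simp add: mult.commute)
          then show False using that s by (simp add: dist_norm)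
        qed
        have \<eta>s: "smooth_on UNIV \<eta>"
        proof -
          have "smooth_on UNIV (\<lambda>y. (1 / s ^ DIM(real^2)) *\<^sub>R \<rho> (inverse s *\<^sub>R (x0 + - y)))"
            by (intro smooth_on_bounded_linear[OF bounded_linear_scaleR_right] open_UNIV
              smooth_on_compose[OF _ _ mollifierD(1)[OF mollifier]] smooth_on_add smooth_on_const
              smooth_on_bounded_linear[OF bounded_linear_minus[OF bounded_linear_ident]] smooth_on_ident) auto
          then show ?thesis unfolding \<eta>_def by (simp add: field_simps)
        qed
        have e\<alpha>: "e \<alpha> \<in> \<gg>" using e unfolding lie_basis_def by blast
        have ws: "smooth_on UNIV w" unfolding w_def
        proof (rule smooth_on_vec_lambda[OF open_UNIV])
          show "smooth_on UNIV (\<lambda>y. if i = a then \<eta> y *\<^sub>R e \<alpha> else 0)" for i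
            by (cases "i = a") (simp_all add: smooth_on_scaleR \<eta>s)
        qed
        have wg: "w y $ i \<in> \<gg>" for y i
          by (simp add: w_def subspace_scale[OF \<gg> e\<alpha>] subspace_0[OF \<gg>])
        have w0: "w y = 0" if "y \<notin> cball x0 d" for y using \<eta>0[OF that] by (simp add: w_def vec_eq_iff)
        have v: "one_form M \<gg> (extend_form M c w)" "form_support M (extend_form M c w) \<subseteq> cdom c"
          by (rule extend_form_one_form[OF c ws wg compact_cball d(2) _ \<gg>], erule w0)
            (rule extend_form_support[OF c ws wg compact_cball d(2) _ \<gg>], erule w0)
        have vc: "extend_form M c w c y = w y" if "y \<in> cimg c" for y
          by (rule extend_form_chart[OF c ws wg compact_cball d(2) _ \<gg> that]) (erule w0)
        have coords: "lie_coords K e (w y $ i) = (\<chi> \<beta>. if i = a \<and> \<beta> = \<alpha> then of_real (\<eta> y) else 0)" for y i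
        proof (rule lie_coords_eqI[OF e wg])
          show "(\<chi> \<beta>. if i = a \<and> \<beta> = \<alpha> then of_real (\<eta> y) else 0) $ \<beta> \<in> K" for \<beta>
            using K[of "\<eta> y"] K[of 0] by simp
          have "(\<Sum>\<beta>\<in>UNIV. cscale ((\<chi> \<beta>. if i = a \<and> \<beta> = \<alpha> then of_real (\<eta> y) else 0) $ \<beta>) (e \<beta>)) =
            (\<Sum>\<beta>\<in>UNIV. if \<beta> = \<alpha> then (if i = a then \<eta> y *\<^sub>R e \<alpha> else 0) else 0)"
          proof -
            have "cscale 0 X = 0" for X :: "'n cmat" by (simp add: cscale_def vec_eq_iff)
            then show ?thesis by (intro sum.cong[OF refl]) (auto simp: cscale_of_real)
          qed
          then show "w y $ i = (\<Sum>\<beta>\<in>UNIV. cscale ((\<chi> \<beta>. if i = a \<and> \<beta> = \<alpha> then of_real (\<eta> y) else 0) $ \<beta>) (e \<beta>))"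
            by (simp add: w_def)
        qed
        have eq: "indicator (cimg c) y *\<^sub>R (\<Sum>i\<in>UNIV. \<Sum>\<beta>\<in>UNIV. D c y $ i $ \<beta> *
            lie_coords K e (extend_form M c w c y $ i) $ \<beta>) = \<eta> y *\<^sub>R (indicator (cball x0 d) y *\<^sub>R D c y $ a $ \<alpha>)"
          for D :: "'p chart \<Rightarrow> real^2 \<Rightarrow> (complex^'b)^2" and y
        proof (cases "y \<in> cimg c")
          case True
          have "(\<Sum>i\<in>UNIV. \<Sum>\<beta>\<in>UNIV. D c y $ i $ \<beta> * lie_coords K e (w y $ i) $ \<beta>) =
            (\<Sum>i\<in>UNIV. \<Sum>\<beta>\<in>UNIV. if \<beta> = \<alpha> then (if i = a then D c y $ a $ \<alpha> * of_real (\<eta> y) else 0) else 0)"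
            by (intro sum.cong refl) (auto simp: coords)
          also have "\<dots> = \<eta> y *\<^sub>R D c y $ a $ \<alpha>" by (simp add: scaleR_conv_of_real mult.commute)
          finally show ?thesis using True \<eta>0[of y] vc[OF True] by (cases "y \<in> cball x0 d") auto
        next
          case False
          then have "y \<notin> cball x0 d" using d(2) by blast
          then show ?thesis using False by simp
        qed
        have "L1 (extend_form M c w) = L2 (extend_form M c w)" by (rule L12[OF v(1)])
        then show ?thesis
          using L1(2)[of "extend_form M c w"] L2(2)[of "extend_form M c w"] v(1,2)
          unfolding set_lebesgue_integral_def eq by (simp only: \<eta>_def simp_thms)
      qed
      then have "\<forall>\<^sub>F s in at_right 0. (LINT y|lborel. (\<rho> ((x0 - y) /\<^sub>R s) / s ^ DIM(real^2)) *\<^sub>R (indicator (cball x0 d) y *\<^sub>R D1 c y $ a $ \<alpha>)) =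
          (LINT y|lborel. (\<rho> ((x0 - y) /\<^sub>R s) / s ^ DIM(real^2)) *\<^sub>R (indicator (cball x0 d) y *\<^sub>R D2 c y $ a $ \<alpha>))"
        by (intro eventually_mono[OF ev]) blast
      from Lim_transform_eventually[OF conv[of D1, OF smooth_on_continuous[OF sm(1)]] this]
      show ?thesis
        by (rule tendsto_unique[OF trivial_limit_at_right_real _ conv[of D2, OF smooth_on_continuous[OF sm(2)]]])
    qed
    show ?thesis by (simp add: vec_eq_iff comp)
  qed
qed

lemma functional_derivative_wilson:
  fixes A :: "('p, 'n::finite) matform" and e :: "'b::finite \<Rightarrow> 'n cmat"
  assumes e: "lie_basis K \<gg> e" "subspace \<gg>" "\<And>r::real. of_real r \<in> K"
    and \<gamma>: "closed_path \<gamma>" and A: "admissible A" and s: "s > 0"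
  shows "functional_derivative M K \<gg> e (\<lambda>A. wilson M \<gamma> (smoothing M N U pu cf \<rho> s A)) A = wilson_derivative e \<gamma> s A"
  unfolding functional_derivative_def
  using wilson_functional_derivative[OF e(1) \<gamma> A s] functional_derivative_unique[OF e]
  by (intro the_equality) blast+

end

section \<open>Limit of the regularized bracket\<close>

definition cross2 :: "real^2 \<Rightarrow> real^2 \<Rightarrow> real" where
  "cross2 u v = u $ 1 * v $ 2 - u $ 2 * v $ 1"

lemma det_vector2: "det (vector [u, v] :: real^2^2) = cross2 u v"
  by (simp add: det_2 cross2_def)

lemma cross2_matrix: "cross2 (B *v u) (B *v v) = det B * cross2 u v"
  by (simp add: cross2_def det_2 matrix_vector_mult_def sum_2 algebra_simps)

lemma cross2_scaleR: "cross2 (r *\<^sub>R u) (q *\<^sub>R v) = r * q * cross2 u v"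
  by (simp add: cross2_def algebra_simps)

lemma cross2_zero [simp]: "cross2 0 v = 0" "cross2 u 0 = 0"
  by (simp_all add: cross2_def)

text \<open>The elementary tensor of a tangent vector and a matrix.\<close>

definition vecm :: "real^2 \<Rightarrow> 'n::finite cmat \<Rightarrow> ('n cmat)^2" where
  "vecm w m = (\<chi> a. (w $ a) *\<^sub>R m)"

lemma push_vecm: "push B (vecm w m) = vecm (B *v w) m"
  by (simp add: push_def vecm_def vec_eq_iff sum_2 matrix_vector_mult_def algebra_simps)

lemma vecm_scaleR: "r *\<^sub>R vecm w m = vecm (r *\<^sub>R w) m"
  by (simp add: vecm_def vec_eq_iff)

text \<open>The antisymmetric contraction by \<open>eps\<close> from the Poisson bracket, with a
  general bilinear form in place of the inverse Gram matrix.\<close>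

definition wedge :: "('n cmat \<Rightarrow> 'n cmat \<Rightarrow> complex) \<Rightarrow> ('n::finite cmat)^2 \<Rightarrow> ('n cmat)^2 \<Rightarrow> complex" where
  "wedge \<beta> P Q = \<beta> (P $ 1) (Q $ 2) - \<beta> (P $ 2) (Q $ 1)"

context
  fixes \<beta> :: "'n::finite cmat \<Rightarrow> 'n cmat \<Rightarrow> complex"
  assumes \<beta>: "bounded_bilinear \<beta>"
begin

interpretation bounded_bilinear \<beta> by (rule \<beta>)

lemma bounded_bilinear_wedge: "bounded_bilinear (wedge \<beta>)"
proof -
  have "linear (wedge \<beta> P)" for P
    by (rule linearI) (simp_all add: wedge_def add_right scaleR_right algebra_simps)
  moreover have "linear (\<lambda>P. wedge \<beta> P Q)" for Q
    by (rule linearI) (simp_all add: wedge_def add_left scaleR_left algebra_simps)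
  ultimately show ?thesis
    by (simp add: bilinear_conv_bounded_bilinear[symmetric] bilinear_def)
qed

lemma wedge_vecm: "wedge \<beta> (vecm u m) (vecm v m') = cross2 u v *\<^sub>R \<beta> m m'"
  by (simp add: wedge_def vecm_def cross2_def scaleR_left scaleR_right algebra_simps)

lemma wedge_push: "wedge \<beta> (push B P) (push B Q) = det B *\<^sub>R wedge \<beta> P Q"
  by (simp add: wedge_def push_def sum_2 det_2 add_left add_right scaleR_left scaleR_right algebra_simps)

end

text \<open>Merges the two curve integrals into one over pairs of times, the form in which the
  rescaling is carried out.\<close>

lemma bilinear_double_integral:
  fixes f :: "real \<Rightarrow> 'a::euclidean_space" and g :: "real \<Rightarrow> 'b::euclidean_space"
    and B :: "'a \<Rightarrow> 'b \<Rightarrow> complex"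
  assumes B: "bounded_bilinear B" and f: "continuous_on UNIV f" and g: "continuous_on UNIV g"
  shows "B (LINT t|lborel. indicator {a..b} t *\<^sub>R f t) (LINT t|lborel. indicator {c..d} t *\<^sub>R g t) =
    (LINT p|lborel. indicator ({a..b} \<times> {c..d}) p *\<^sub>R B (f (fst p)) (g (snd p)))"
proof -
  have fi: "integrable lborel (\<lambda>t. indicator {a..b} t *\<^sub>R f t)"
    by (rule borel_integrable_compact[OF compact_Icc continuous_on_subset[OF f]]) simp
  have gi: "integrable lborel (\<lambda>t. indicator {c..d} t *\<^sub>R g t)"
    by (rule borel_integrable_compact[OF compact_Icc continuous_on_subset[OF g]]) simp
  have "continuous_on ({a..b} \<times> {c..d}) (\<lambda>p. B (f (fst p)) (g (snd p)))"
    by (intro bounded_bilinear.continuous_on[OF B] continuous_on_compose2[OF f] continuous_on_compose2[OF g] continuous_intros) auto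
  from borel_integrable_compact[OF compact_Times[OF compact_Icc compact_Icc] this]
  have pi: "integrable (lborel \<Otimes>\<^sub>M lborel) (\<lambda>p. indicator ({a..b} \<times> {c..d}) p *\<^sub>R B (f (fst p)) (g (snd p)))"
    by (simp add: lborel_prod)
  have "B (LINT t|lborel. indicator {a..b} t *\<^sub>R f t) (LINT t|lborel. indicator {c..d} t *\<^sub>R g t) =
    (LINT t|lborel. B (indicator {a..b} t *\<^sub>R f t) (LINT u|lborel. indicator {c..d} u *\<^sub>R g u))"
    by (rule integral_bounded_linear[OF bounded_bilinear.bounded_linear_left[OF B] fi, symmetric])
  also have "\<dots> = (LINT t|lborel. LINT u|lborel. B (indicator {a..b} t *\<^sub>R f t) (indicator {c..d} u *\<^sub>R g u))"
    by (subst integral_bounded_linear[OF bounded_bilinear.bounded_linear_right[OF B] gi]) simp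
  also have "\<dots> = (LINT t|lborel. LINT u|lborel. indicator ({a..b} \<times> {c..d}) (t, u) *\<^sub>R B (f t) (g u))"
    by (simp add: indicator_times bounded_bilinear.scaleR_left[OF B] bounded_bilinear.scaleR_right[OF B] mult.commute)
  also have "\<dots> = (LINT p|lborel. indicator ({a..b} \<times> {c..d}) p *\<^sub>R B (f (fst p)) (g (snd p)))"
    using lborel_pair.integral_fst'[OF pi] by (simp add: lborel_prod)
  finally show ?thesis .
qed

text \<open>As a function of its starting point the integral over one period has derivative f(a + 1)
  - f(a) = 0. This freedom keeps crossings off the boundary of the time window.\<close>

lemma periodic_integral_shift:
  fixes f :: "real \<Rightarrow> 'a::euclidean_space"
  assumes "continuous_on UNIV f" "\<And>t. f (t + 1) = f t"
  shows "integral {0..1} f = integral {a..a+1} f"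
proof -
  obtain Z where Z: "\<And>t. (Z has_vector_derivative f t) (at t)" using global_antiderivative[OF assms(1)] by blast
  have int: "integral {b..b+1} f = Z (b + 1) - Z b" for b
    by (rule integral_unique[OF fundamental_theorem_of_calculus]) (auto intro: has_vector_derivative_at_within Z)
  have "((\<lambda>t. Z (1 + 1 * t) - Z t) has_vector_derivative 1 *\<^sub>R f (1 + 1 * t) - f t) (at t)" for t
    by (intro has_vector_derivative_diff has_vector_derivative_affine Z)
  then have "((\<lambda>t. Z (t + 1) - Z t) has_vector_derivative 0) (at t)" for t
    using assms(2) by (simp add: add.commute)
  from constant_vector_derivative_zero[OF this, of 0 a] int[of 0] int[of a] show ?thesis by simp
qed

context smoothing_setup
begin

text \<open>The tangent-vector part of \<open>patch_density\<close> at one time; mollifier and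
  holonomy are split off, since they behave differently in the limit.\<close>

definition vel_density :: "(real \<Rightarrow> 'p) \<Rightarrow> 'p chart \<Rightarrow> nat \<Rightarrow> real \<Rightarrow> real^2 \<Rightarrow> real^2" where
  "vel_density \<gamma> c k t x = (pu k (cinv c x) * det (jacobian (transition c (U k)) x)) *\<^sub>R
     (jacobian (transition (U k) c) (transition c (U k) x) *v cutvel \<gamma> k t)"

lemma kernel_continuous_fixed:
  assumes "closed_path \<gamma>" "k < N" "continuous_on UNIV m"
  shows "continuous_on UNIV (\<lambda>t. rho_scaled s (cmap (U k) (\<gamma> t) - y) *\<^sub>R hol_velocity \<gamma> m k t)"
proof -
  have "continuous_on UNIV (\<lambda>t. (\<lambda>z::real\<times>(real^2). rho_scaled s (cmap (U k) (\<gamma> (fst z)) - snd z) *\<^sub>R hol_velocity \<gamma> m k (fst z)) (t, y))"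
    by (rule continuous_on_compose2[OF kernel_jointly_continuous[OF assms rho_scaled_continuous]]) (auto intro!: continuous_intros)
  then show ?thesis by simp
qed

lemma kernelE_shift:
  assumes "closed_path \<gamma>" "k < N" "continuous_on UNIV m" "\<And>t. m (t + 1) = m t"
  shows "kernelE \<gamma> s m k y = (LINT t|lborel. indicator {a..a+1} t *\<^sub>R (rho_scaled s (cmap (U k) (\<gamma> t) - y) *\<^sub>R hol_velocity \<gamma> m k t))"
proof -
  have "kernelE \<gamma> s m k y = integral {0..1} (\<lambda>t. rho_scaled s (cmap (U k) (\<gamma> t) - y) *\<^sub>R hol_velocity \<gamma> m k t)"
    by (simp add: kernelE_def)
  also have "\<dots> = integral {a..a+1} (\<lambda>t. rho_scaled s (cmap (U k) (\<gamma> t) - y) *\<^sub>R hol_velocity \<gamma> m k t)"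
    by (rule periodic_integral_shift[OF kernel_continuous_fixed[OF assms(1-3)]])
      (simp add: hol_velocity_def cutvel_periodic[OF assms(1,2)] assms(4) closed_path_periodic[OF assms(1)])
  also have "\<dots> = (LINT t|lborel. indicator {a..a+1} t *\<^sub>R (rho_scaled s (cmap (U k) (\<gamma> t) - y) *\<^sub>R hol_velocity \<gamma> m k t))"
    using cbox_integral_eq_lborel[OF continuous_on_subset[OF kernel_continuous_fixed[OF assms(1-3)]], of a "a + 1" s y] by simp
  finally show ?thesis .
qed

lemma patch_density_eq_lborel:
  assumes \<gamma>: "closed_path \<gamma>" and k: "k < N" and m: "continuous_on UNIV m" "\<And>t. m (t + 1) = m t"
    and x: "c \<in> M" "x \<in> overlap c (U k)"
  shows "patch_density \<gamma> s m k c x = (LINT t|lborel. indicator {a..a+1} t *\<^sub>R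
     (rho_scaled s (cmap (U k) (\<gamma> t) - transition c (U k) x) *\<^sub>R vecm (vel_density \<gamma> c k t x) (m t)))"
proof -
  let ?B = "jacobian (transition (U k) c) (transition c (U k) x)" and ?r = "pu k (cinv c x) * det (jacobian (transition c (U k)) x)"
  let ?f = "\<lambda>t. rho_scaled s (cmap (U k) (\<gamma> t) - transition c (U k) x) *\<^sub>R hol_velocity \<gamma> m k t"
  have bl: "bounded_linear (\<lambda>P::('a cmat)^2. ?r *\<^sub>R push ?B P)"
    using linear_compose_scale_right[OF linear_push] by (simp add: linear_conv_bounded_linear)
  have int: "integrable lborel (\<lambda>t. indicator {a..a+1} t *\<^sub>R ?f t)"
    by (rule borel_integrable_compact[OF compact_Icc continuous_on_subset[OF kernel_continuous_fixed[OF \<gamma> k m(1)]]]) simp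
  have "patch_density \<gamma> s m k c x = ?r *\<^sub>R push ?B (kernelE \<gamma> s m k (transition c (U k) x))"
    using x by (simp add: patch_density_def)
  also have "kernelE \<gamma> s m k (transition c (U k) x) = (LINT t|lborel. indicator {a..a+1} t *\<^sub>R ?f t)"
    by (rule kernelE_shift[OF \<gamma> k m])
  finally have "patch_density \<gamma> s m k c x = ?r *\<^sub>R push ?B (LINT t|lborel. indicator {a..a+1} t *\<^sub>R ?f t)" .
  also have "\<dots> = (LINT t|lborel. ?r *\<^sub>R push ?B (indicator {a..a+1} t *\<^sub>R ?f t))"
    by (rule integral_bounded_linear[OF bl int, symmetric])
  also have "\<dots> = (LINT t|lborel. indicator {a..a+1} t *\<^sub>R
     (rho_scaled s (cmap (U k) (\<gamma> t) - transition c (U k) x) *\<^sub>R vecm (vel_density \<gamma> c k t x) (m t)))"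
  proof (rule Bochner_Integration.integral_cong[OF refl])
    fix t
    have "hol_velocity \<gamma> m k t = vecm (cutvel \<gamma> k t) (m t)" by (simp add: hol_velocity_def vecm_def)
    then show "?r *\<^sub>R push ?B (indicator {a..a+1} t *\<^sub>R ?f t) = indicator {a..a+1} t *\<^sub>R
     (rho_scaled s (cmap (U k) (\<gamma> t) - transition c (U k) x) *\<^sub>R vecm (vel_density \<gamma> c k t x) (m t))"
      by (simp add: push_scaleR push_vecm vel_density_def vecm_scaleR[symmetric] ac_simps)
  qed
  finally show ?thesis .
qed

text \<open>What remains of the integrand without the mollifiers and the holonomies. The index
  \<open>j\<close> comes from the surface integral, \<open>k\<close> and \<open>l\<close> from the
  smoothings of the two loops. Off the overlaps the transition maps are arbitrary, hence the
  explicit zero.\<close>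

definition crossing_weight :: "(real \<Rightarrow> 'p) \<Rightarrow> (real \<Rightarrow> 'p) \<Rightarrow> nat \<Rightarrow> nat \<Rightarrow> nat \<Rightarrow> (real \<times> real) \<times> (real^2) \<Rightarrow> real" where
  "crossing_weight \<gamma> \<gamma>' j k l z = (if snd z \<in> overlap (U j) (U k) \<inter> overlap (U j) (U l)
     then pu j (cinv (U j) (snd z)) * cross2 (vel_density \<gamma> (U j) k (fst (fst z)) (snd z)) (vel_density \<gamma>' (U j) l (snd (fst z)) (snd z)) else 0)"

definition patch_core :: "nat \<Rightarrow> nat \<Rightarrow> nat \<Rightarrow> (real^2) set" where
  "patch_core j k l = cmap (U j) ` (closure {p. pu j p \<noteq> 0} \<inter> closure {p. pu k p \<noteq> 0} \<inter> closure {p. pu l p \<noteq> 0})"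

lemma patch_core:
  assumes "j < N" "k < N" "l < N"
  shows "compact (patch_core j k l)" "patch_core j k l \<subseteq> overlap (U j) (U k) \<inter> overlap (U j) (U l)"
    "x \<in> overlap (U j) (U k) \<inter> overlap (U j) (U l) \<Longrightarrow> x \<notin> patch_core j k l \<Longrightarrow>
      pu j (cinv (U j) x) = 0 \<or> pu k (cinv (U j) x) = 0 \<or> pu l (cinv (U j) x) = 0"
proof -
  note Uj = pu(1)[OF assms(1)]
  let ?L = "closure {p. pu j p \<noteq> 0} \<inter> closure {p. pu k p \<noteq> 0} \<inter> closure {p. pu l p \<noteq> 0}"
  have sub: "?L \<subseteq> cdom (U j)" "?L \<subseteq> cdom (U k)" "?L \<subseteq> cdom (U l)" using pu(3) assms by blast+
  show "compact (patch_core j k l)" unfolding patch_core_def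
    by (intro compact_continuous_image continuous_on_subset[OF cmap_continuous[OF Uj] sub(1)] compact_surface closed_Int closed_closure)
  show "patch_core j k l \<subseteq> overlap (U j) (U k) \<inter> overlap (U j) (U l)"
    using sub unfolding patch_core_def overlap_def by blast
  assume x: "x \<in> overlap (U j) (U k) \<inter> overlap (U j) (U l)" "x \<notin> patch_core j k l"
  have "cinv (U j) x \<notin> ?L"
  proof
    assume "cinv (U j) x \<in> ?L"
    then have "cmap (U j) (cinv (U j) x) \<in> patch_core j k l" unfolding patch_core_def by (rule imageI)
    then show False using x by (simp add: overlap_iff[OF Uj] cmap_cinv[OF Uj])
  qed
  then have "cinv (U j) x \<notin> closure {p. pu j p \<noteq> 0} \<or> cinv (U j) x \<notin> closure {p. pu k p \<noteq> 0} \<or> cinv (U j) x \<notin> closure {p. pu l p \<noteq> 0}"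
    by blast
  then show "pu j (cinv (U j) x) = 0 \<or> pu k (cinv (U j) x) = 0 \<or> pu l (cinv (U j) x) = 0"
    using pu(6)[OF assms(1), of "cinv (U j) x"] pu(6)[OF assms(2), of "cinv (U j) x"] pu(6)[OF assms(3), of "cinv (U j) x"] by blast
qed

lemma crossing_weight_zero:
  assumes jkl: "j < N" "k < N" "l < N"
    and z: "z \<notin> ({t. \<gamma> t \<in> closure {p. cf k p \<noteq> 0}} \<times> {t. \<gamma>' t \<in> closure {p. cf l p \<noteq> 0}}) \<times> patch_core j k l"
  shows "crossing_weight \<gamma> \<gamma>' j k l z = 0"
proof (cases "snd z \<in> overlap (U j) (U k) \<inter> overlap (U j) (U l)")
  case True
  have "\<gamma> (fst (fst z)) \<notin> closure {p. cf k p \<noteq> 0} \<or> \<gamma>' (snd (fst z)) \<notin> closure {p. cf l p \<noteq> 0} \<or> snd z \<notin> patch_core j k l"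
    using z by (cases z; cases "fst z") simp
  then show ?thesis
  proof (elim disjE)
    assume "\<gamma> (fst (fst z)) \<notin> closure {p. cf k p \<noteq> 0}"
    then have "cutvel \<gamma> k (fst (fst z)) = 0" by (rule cutvel_support[OF jkl(2)])
    then show ?thesis by (simp add: crossing_weight_def vel_density_def)
  next
    assume "\<gamma>' (snd (fst z)) \<notin> closure {p. cf l p \<noteq> 0}"
    then have "cutvel \<gamma>' l (snd (fst z)) = 0" by (rule cutvel_support[OF jkl(3)])
    then show ?thesis by (simp add: crossing_weight_def vel_density_def)
  next
    assume "snd z \<notin> patch_core j k l"
    from patch_core(3)[OF jkl True this] show ?thesis by (auto simp: crossing_weight_def vel_density_def)
  qed
qed (auto simp: crossing_weight_def)

text \<open>The kernel factors alone need not be continuous, since \<open>cmap\<close> is arbitrary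
  off its chart; multiplied by the weight they extend by zero. Constant kernels give the continuity
  of the weight itself.\<close>

lemma crossing_weight_kernel_continuous:
  fixes r1 r2 :: "real^2 \<Rightarrow> real"
  assumes \<gamma>: "closed_path \<gamma>" "closed_path \<gamma>'" and jkl: "j < N" "k < N" "l < N"
    and r: "continuous_on UNIV r1" "continuous_on UNIV r2"
  shows "continuous_on UNIV (\<lambda>z. r1 (cmap (U k) (\<gamma> (fst (fst z))) - transition (U j) (U k) (snd z)) *
     r2 (cmap (U l) (\<gamma>' (snd (fst z))) - transition (U j) (U l) (snd z)) * crossing_weight \<gamma> \<gamma>' j k l z)"
proof (rule continuous_on_extend_zero)
  note Uj = pu(1)[OF jkl(1)] and Uk = pu(1)[OF jkl(2)] and Ul = pu(1)[OF jkl(3)]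
  let ?O = "overlap (U j) (U k) \<inter> overlap (U j) (U l)"
  let ?S = "({t. \<gamma> t \<in> cdom (U k)} \<times> {t. \<gamma>' t \<in> cdom (U l)}) \<times> ?O"
  let ?L = "({t. \<gamma> t \<in> closure {p. cf k p \<noteq> 0}} \<times> {t. \<gamma>' t \<in> closure {p. cf l p \<noteq> 0}}) \<times> patch_core j k l"
  show "open ?S" by (intro open_Times open_Int open_overlap Uj Uk Ul cutvel_domains \<gamma> jkl)
  show "closed ?L" by (intro closed_Times cutvel_domains \<gamma> jkl compact_imp_closed patch_core)
  show "?L \<subseteq> ?S" using patch_core(2)[OF jkl] cutvel_domains(3)[OF \<gamma>(1) jkl(2)] cutvel_domains(3)[OF \<gamma>(2) jkl(3)] by blast
  have pvc: "continuous_on ?S (\<lambda>z. vel_density \<delta> (U j) i (f z) (snd z) $ a)"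
    if d: "closed_path \<delta>" "i < N" "continuous_on ?S f" "\<And>z. z \<in> ?S \<Longrightarrow> snd z \<in> overlap (U j) (U i)" for \<delta> i f a
  proof -
    note Ui = pu(1)[OF d(2)]
    have T: "continuous_on ?S (\<lambda>z. transition (U j) (U i) (snd z))"
      by (rule continuous_on_compose2[OF smooth_on_continuous[OF smooth_transition[OF Uj Ui]] continuous_on_snd[OF continuous_on_id]])
       (use d(4) in blast)
    have D: "continuous_on ?S (\<lambda>z. det (jacobian (transition (U j) (U i)) (snd z)))"
      by (rule continuous_on_compose2[OF continuous_det_jacobian[OF Uj Ui] continuous_on_snd[OF continuous_on_id]])
       (use d(4) in blast)
    have J: "continuous_on ?S (\<lambda>z. jacobian (transition (U i) (U j)) (transition (U j) (U i) (snd z)) $ a $ b)" for b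
      by (rule continuous_on_compose2[OF continuous_jacobian[OF Ui Uj] T])
       (use d(4) transition_in_overlap[OF Uj Ui] in blast)
    have P: "continuous_on ?S (\<lambda>z. pu i (cinv (U j) (snd z)))"
      by (rule continuous_on_compose2[OF pu(5)[OF d(2) Uj] continuous_on_snd[OF continuous_on_id]])
       (use d(4) subsetD[OF overlap_subset[of "U j" "U i"]] in blast)
    have C: "continuous_on ?S (\<lambda>z. cutvel \<delta> i (f z) $ b)" for b
      by (intro continuous_on_component continuous_on_compose2[OF cutvel_continuous[OF d(1,2)] d(3)]) simp
    have eq: "vel_density \<delta> (U j) i (f z) (snd z) $ a = (pu i (cinv (U j) (snd z)) * det (jacobian (transition (U j) (U i)) (snd z))) *
      (\<Sum>b\<in>UNIV. jacobian (transition (U i) (U j)) (transition (U j) (U i) (snd z)) $ a $ b * cutvel \<delta> i (f z) $ b)" for z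
      by (simp add: vel_density_def matrix_vector_mult_def)
    show ?thesis unfolding eq by (intro continuous_intros P D J C)
  qed
  have f: "continuous_on ?S (\<lambda>z. fst (fst z))" "continuous_on ?S (\<lambda>z. snd (fst z))" by (intro continuous_intros)+
  have s: "\<And>z. z \<in> ?S \<Longrightarrow> snd z \<in> overlap (U j) (U k)" "\<And>z. z \<in> ?S \<Longrightarrow> snd z \<in> overlap (U j) (U l)" by auto
  have T: "continuous_on ?S (\<lambda>z. transition (U j) (U k) (snd z))" "continuous_on ?S (\<lambda>z. transition (U j) (U l) (snd z))"
    by (rule continuous_on_compose2[OF smooth_on_continuous[OF smooth_transition[OF Uj Uk]] continuous_on_snd[OF continuous_on_id]], use s in blast)
      (rule continuous_on_compose2[OF smooth_on_continuous[OF smooth_transition[OF Uj Ul]] continuous_on_snd[OF continuous_on_id]], use s in blast)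
  have G: "continuous_on ?S (\<lambda>z. cmap (U k) (\<gamma> (fst (fst z))))" "continuous_on ?S (\<lambda>z. cmap (U l) (\<gamma>' (snd (fst z))))"
    by (rule continuous_on_compose2[OF path_chart_continuous[OF \<gamma>(1) Uk] f(1)], force)
      (rule continuous_on_compose2[OF path_chart_continuous[OF \<gamma>(2) Ul] f(2)], force)
  have P: "continuous_on ?S (\<lambda>z. pu j (cinv (U j) (snd z)))"
    by (rule continuous_on_compose2[OF pu(5)[OF jkl(1) Uj] continuous_on_snd[OF continuous_on_id]])
     (use s subsetD[OF overlap_subset[of "U j" "U k"]] in blast)
  have "continuous_on ?S (\<lambda>z. r1 (cmap (U k) (\<gamma> (fst (fst z))) - transition (U j) (U k) (snd z)) *
     r2 (cmap (U l) (\<gamma>' (snd (fst z))) - transition (U j) (U l) (snd z)) *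
     (pu j (cinv (U j) (snd z)) * cross2 (vel_density \<gamma> (U j) k (fst (fst z)) (snd z)) (vel_density \<gamma>' (U j) l (snd (fst z)) (snd z))))"
    unfolding cross2_def
    by (intro continuous_on_mult continuous_on_diff continuous_on_compose2[OF r(1)] continuous_on_compose2[OF r(2)] P G T
        pvc \<gamma> jkl f s) auto
  then show "continuous_on ?S (\<lambda>z. r1 (cmap (U k) (\<gamma> (fst (fst z))) - transition (U j) (U k) (snd z)) *
     r2 (cmap (U l) (\<gamma>' (snd (fst z))) - transition (U j) (U l) (snd z)) * crossing_weight \<gamma> \<gamma>' j k l z)"
    by (rule continuous_on_eq) (use s in \<open>simp add: crossing_weight_def\<close>)
  show "r1 (cmap (U k) (\<gamma> (fst (fst z))) - transition (U j) (U k) (snd z)) *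
     r2 (cmap (U l) (\<gamma>' (snd (fst z))) - transition (U j) (U l) (snd z)) * crossing_weight \<gamma> \<gamma>' j k l z = 0" if "z \<notin> ?L" for z
    using crossing_weight_zero[OF jkl that] by simp
qed

lemma crossing_weight_continuous:
  assumes "closed_path \<gamma>" "closed_path \<gamma>'" "j < N" "k < N" "l < N"
  shows "continuous_on UNIV (crossing_weight \<gamma> \<gamma>' j k l)"
  using crossing_weight_kernel_continuous[OF assms, of "\<lambda>_. 1" "\<lambda>_. 1"] by simp

text \<open>For fixed x the two patch densities are integrals over one period each; Fubini joins
  them with the integral over x. The starting points \<open>a\<close> and \<open>b\<close> are free
  by periodicity.\<close>

lemma wedge_integral:
  fixes \<beta> :: "'n::finite cmat \<Rightarrow> 'n cmat \<Rightarrow> complex"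
  assumes \<beta>: "bounded_bilinear \<beta>" and \<gamma>: "closed_path \<gamma>" "closed_path \<gamma>'" and jkl: "j < N" "k < N" "l < N"
    and m: "continuous_on UNIV m" "\<And>t. m (t + 1) = m t" and m': "continuous_on UNIV m'" "\<And>t. m' (t + 1) = m' t"
  shows "(LINT x:cimg (U j)|lborel. pu j (cinv (U j) x) *\<^sub>R wedge \<beta> (patch_density \<gamma> s m k (U j) x) (patch_density \<gamma>' s m' l (U j) x)) =
    (LINT z|lborel. indicator ({a..a+1} \<times> {b..b+1}) (fst z) *\<^sub>R
      ((rho_scaled s (cmap (U k) (\<gamma> (fst (fst z))) - transition (U j) (U k) (snd z)) *
        rho_scaled s (cmap (U l) (\<gamma>' (snd (fst z))) - transition (U j) (U l) (snd z)) * crossing_weight \<gamma> \<gamma>' j k l z) *\<^sub>R \<beta> (m (fst (fst z))) (m' (snd (fst z)))))"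
    (is "_ = (LINT z|lborel. ?H z)")
proof -
  note Uj = pu(1)[OF jkl(1)]
  interpret \<beta>: bounded_bilinear \<beta> by (rule \<beta>)
  let ?Box = "{a..a+1} \<times> {b..b+1}"
  have c: "continuous_on UNIV (\<lambda>z. (rho_scaled s (cmap (U k) (\<gamma> (fst (fst z))) - transition (U j) (U k) (snd z)) *
        rho_scaled s (cmap (U l) (\<gamma>' (snd (fst z))) - transition (U j) (U l) (snd z)) * crossing_weight \<gamma> \<gamma>' j k l z) *\<^sub>R \<beta> (m (fst (fst z))) (m' (snd (fst z))))"
    by (intro continuous_on_scaleR crossing_weight_kernel_continuous \<gamma> jkl rho_scaled_continuous \<beta>.continuous_on
        continuous_on_compose2[OF m(1)] continuous_on_compose2[OF m'(1)] continuous_intros) auto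
  have "integrable lborel (\<lambda>z. indicator (?Box \<times> patch_core j k l) z *\<^sub>R
     ((rho_scaled s (cmap (U k) (\<gamma> (fst (fst z))) - transition (U j) (U k) (snd z)) *
        rho_scaled s (cmap (U l) (\<gamma>' (snd (fst z))) - transition (U j) (U l) (snd z)) * crossing_weight \<gamma> \<gamma>' j k l z) *\<^sub>R \<beta> (m (fst (fst z))) (m' (snd (fst z)))))"
    by (intro borel_integrable_compact compact_Times compact_Icc patch_core(1)[OF jkl] continuous_on_subset[OF c]) simp
  moreover have "indicator (?Box \<times> patch_core j k l) z *\<^sub>R
     ((rho_scaled s (cmap (U k) (\<gamma> (fst (fst z))) - transition (U j) (U k) (snd z)) *
        rho_scaled s (cmap (U l) (\<gamma>' (snd (fst z))) - transition (U j) (U l) (snd z)) * crossing_weight \<gamma> \<gamma>' j k l z) *\<^sub>R \<beta> (m (fst (fst z))) (m' (snd (fst z)))) = ?H z" for z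
  proof (cases "snd z \<in> patch_core j k l")
    case True
    then show ?thesis by (cases z) (simp add: indicator_times)
  next
    case False
    then have "crossing_weight \<gamma> \<gamma>' j k l z = 0" by (intro crossing_weight_zero[OF jkl]) (cases z, simp)
    then show ?thesis by simp
  qed
  ultimately have "integrable lborel ?H" by (simp only:)
  then have int: "integrable (lborel \<Otimes>\<^sub>M lborel) (\<lambda>(p, x). ?H (p, x))" by (simp only: lborel_prod case_prod_beta' prod.collapse)
  have "(LINT z|lborel. ?H z) = (LINT x|lborel. LINT p|lborel. ?H (p, x))"
    using lborel_pair.integral_snd[OF int] by (simp add: lborel_prod case_prod_beta')
  also have "\<dots> = (LINT x|lborel. indicator (cimg (U j)) x *\<^sub>R
     (pu j (cinv (U j) x) *\<^sub>R wedge \<beta> (patch_density \<gamma> s m k (U j) x) (patch_density \<gamma>' s m' l (U j) x)))"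
  proof (rule Bochner_Integration.integral_cong[OF refl])
    fix x
    show "(LINT p|lborel. ?H (p, x)) = indicator (cimg (U j)) x *\<^sub>R
     (pu j (cinv (U j) x) *\<^sub>R wedge \<beta> (patch_density \<gamma> s m k (U j) x) (patch_density \<gamma>' s m' l (U j) x))"
    proof (cases "x \<in> overlap (U j) (U k) \<inter> overlap (U j) (U l)")
      case True
      then have x: "x \<in> overlap (U j) (U k)" "x \<in> overlap (U j) (U l)" "x \<in> cimg (U j)"
        using overlap_subset by blast+
      define f where "f = (\<lambda>t. rho_scaled s (cmap (U k) (\<gamma> t) - transition (U j) (U k) x) *\<^sub>R vecm (vel_density \<gamma> (U j) k t x) (m t))"
      define g where "g = (\<lambda>t. rho_scaled s (cmap (U l) (\<gamma>' t) - transition (U j) (U l) x) *\<^sub>R vecm (vel_density \<gamma>' (U j) l t x) (m' t))"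
      have cont: "continuous_on UNIV (\<lambda>t. rho_scaled s (cmap (U i) (\<delta> t) - transition (U j) (U i) x) *\<^sub>R vecm (vel_density \<delta> (U j) i t x) (n t))"
        if d: "closed_path \<delta>" "i < N" "continuous_on UNIV n" for \<delta> i and n :: "real \<Rightarrow> 'n cmat"
      proof -
        have "continuous_on UNIV (\<lambda>t. (pu i (cinv (U j) x) * det (jacobian (transition (U j) (U i)) x)) *\<^sub>R
          push (jacobian (transition (U i) (U j)) (transition (U j) (U i) x))
           (rho_scaled s (cmap (U i) (\<delta> t) - transition (U j) (U i) x) *\<^sub>R hol_velocity \<delta> n i t))"
          by (intro continuous_intros bounded_linear.continuous_on[OF linear_push[unfolded linear_conv_bounded_linear]]
              kernel_continuous_fixed d)
        moreover have "hol_velocity \<delta> n i t = vecm (cutvel \<delta> i t) (n t)" for t by (simp add: hol_velocity_def vecm_def)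
        ultimately show ?thesis by (simp add: push_scaleR push_vecm vel_density_def vecm_scaleR[symmetric] ac_simps)
      qed
      have fc: "continuous_on UNIV f" unfolding f_def by (rule cont[OF \<gamma>(1) jkl(2) m(1)])
      have gc: "continuous_on UNIV g" unfolding g_def by (rule cont[OF \<gamma>(2) jkl(3) m'(1)])
      have "wedge \<beta> (patch_density \<gamma> s m k (U j) x) (patch_density \<gamma>' s m' l (U j) x) =
        (LINT p|lborel. indicator ?Box p *\<^sub>R wedge \<beta> (f (fst p)) (g (snd p)))"
        unfolding patch_density_eq_lborel[OF \<gamma>(1) jkl(2) m Uj x(1), of s a] patch_density_eq_lborel[OF \<gamma>(2) jkl(3) m' Uj x(2), of s b]
          f_def[symmetric] g_def[symmetric]
        using bilinear_double_integral[OF bounded_bilinear_wedge[OF \<beta>] fc gc, of a "a + 1" b "b + 1"] by (simp add: f_def g_def)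
      then have "indicator (cimg (U j)) x *\<^sub>R
         (pu j (cinv (U j) x) *\<^sub>R wedge \<beta> (patch_density \<gamma> s m k (U j) x) (patch_density \<gamma>' s m' l (U j) x)) =
        (LINT p|lborel. pu j (cinv (U j) x) *\<^sub>R (indicator ?Box p *\<^sub>R wedge \<beta> (f (fst p)) (g (snd p))))"
        by (simp only: integral_scaleR_right) (use x(3) in simp)
      also have "\<dots> = (LINT p|lborel. ?H (p, x))"
      proof (rule Bochner_Integration.integral_cong[OF refl])
        fix p
        have "wedge \<beta> (f (fst p)) (g (snd p)) = (rho_scaled s (cmap (U k) (\<gamma> (fst p)) - transition (U j) (U k) x) *
          rho_scaled s (cmap (U l) (\<gamma>' (snd p)) - transition (U j) (U l) x) *
          cross2 (vel_density \<gamma> (U j) k (fst p) x) (vel_density \<gamma>' (U j) l (snd p) x)) *\<^sub>R \<beta> (m (fst p)) (m' (snd p))"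
          by (simp only: f_def g_def vecm_scaleR wedge_vecm[OF \<beta>] cross2_scaleR)
        then show "pu j (cinv (U j) x) *\<^sub>R (indicator ?Box p *\<^sub>R wedge \<beta> (f (fst p)) (g (snd p))) = ?H (p, x)"
          using True by (simp add: crossing_weight_def ac_simps)
      qed
      finally show ?thesis by simp
    next
      case False
      then have "x \<notin> overlap (U j) (U k) \<or> x \<notin> overlap (U j) (U l)" by blast
      then have "wedge \<beta> (patch_density \<gamma> s m k (U j) x) (patch_density \<gamma>' s m' l (U j) x) = 0"
        by (auto simp: patch_density_def wedge_def \<beta>.zero_left \<beta>.zero_right)
      moreover have "crossing_weight \<gamma> \<gamma>' j k l (p, x) = 0" for p using False by (auto simp: crossing_weight_def)
      ultimately show ?thesis by simp
    qed
  qed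
  finally show ?thesis by (simp add: set_lebesgue_integral_def)
qed

end

section \<open>Crossings of two simple closed curves\<close>

text \<open>If the cross product vanished, \<open>u\<close> and \<open>v\<close> rotated by a right
  angle would be orthogonal to both vectors, hence to the whole plane, so both would be zero and
  could not span.\<close>

lemma cross2_nonzero:
  assumes "span {u, v} = (UNIV :: (real^2) set)" shows "cross2 u v \<noteq> 0"
proof
  assume c: "cross2 u v = 0"
  have *: "w = 0" if "w \<bullet> u = 0" "w \<bullet> v = 0" for w
  proof -
    have "orthogonal w w"
      by (rule orthogonal_to_span[of w "{u, v}"]) (use assms that in \<open>auto simp: orthogonal_def\<close>)
    then show ?thesis by (simp add: orthogonal_def)
  qed
  have "vector [- u $ 2, u $ 1] = (0 :: real^2)" "vector [- v $ 2, v $ 1] = (0 :: real^2)"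
    by (rule *; use c in \<open>simp add: inner_vec_def sum_2 cross2_def algebra_simps\<close>)+
  then have "u = 0" "v = 0" by (auto simp: vec_eq_iff forall_2)
  then have "(vector [1, 0] :: real^2) = 0" by (intro *) auto
  then show False by (simp add: vec_eq_iff forall_2)
qed

context surface
begin

context
  fixes \<gamma> assumes \<gamma>: "smooth_simple_closed_curve M \<gamma>"
begin

lemma simple_inj: assumes "t \<in> {0..<1}" "u \<in> {0..<1}" "\<gamma> t = \<gamma> u" shows "t = u"
proof -
  have "loop_free \<gamma>" using \<gamma> unfolding smooth_simple_closed_curve_def simple_path_def by blast
  then have "t = u \<or> t = 0 \<and> u = 1 \<or> t = 1 \<and> u = 0"
    using assms unfolding loop_free_def by (meson atLeastLessThan_iff atLeastAtMost_iff less_imp_le)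
  then show ?thesis using assms(1,2) by auto
qed

lemma param_eqI: "t \<in> {0..<1} \<Longrightarrow> \<gamma> t = p \<Longrightarrow> param \<gamma> p = t"
  unfolding param_def by (rule the_equality) (auto intro: simple_inj)

lemma param:
  assumes "p \<in> range \<gamma>" shows "param \<gamma> p \<in> {0..<1}" "\<gamma> (param \<gamma> p) = p"
proof -
  obtain t where t: "p = \<gamma> t" using assms by blast
  have "\<gamma> (frac t + of_int \<lfloor>t\<rfloor>) = \<gamma> (frac t)"
    by (rule periodic_of_int) (rule closed_path_periodic[OF simple_imp_closed_path[OF \<gamma>]])
  then have g: "\<gamma> (frac t) = p" by (simp add: frac_def t)
  have i: "frac t \<in> {0..<1}" by (simp add: frac_lt_1)
  have "param \<gamma> p = frac t" by (rule param_eqI[OF i g])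
  then show "param \<gamma> p \<in> {0..<1}" "\<gamma> (param \<gamma> p) = p" using g i by simp_all
qed

lemma ex_base: assumes "finite I" shows "\<exists>a\<in>{0..<1}. \<gamma> a \<notin> I"
proof (rule ccontr)
  assume "\<not> ?thesis"
  then have "\<gamma> ` {0..<1} \<subseteq> I" by blast
  then have "finite (\<gamma> ` {0..<1})" using assms finite_subset by blast
  moreover have "inj_on \<gamma> {0..<1}" using simple_inj by (auto intro: inj_onI)
  ultimately have "finite {0..<1::real}" by (rule finite_imageD)
  then show False by (simp add: infinite_Ico)
qed

text \<open>The time at which the curve passes \<open>p\<close> within the window starting at
  \<open>a\<close>, instead of the window starting at 0 used by \<open>param\<close>.\<close>

definition tau :: "real \<Rightarrow> 'p \<Rightarrow> real" where
  "tau a p = (if param \<gamma> p < a then param \<gamma> p + 1 else param \<gamma> p)"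

lemma tau:
  assumes a: "a \<in> {0..<1}" and p: "p \<in> range \<gamma>" "\<gamma> a \<noteq> p"
  shows "a < tau a p" "tau a p < a + 1" "\<gamma> (tau a p) = p"
    "t \<in> {a..a+1} \<Longrightarrow> \<gamma> t = p \<Longrightarrow> t = tau a p"
proof -
  note P = param[OF p(1)]
  note per = closed_path_periodic[OF simple_imp_closed_path[OF \<gamma>]]
  have ne: "param \<gamma> p \<noteq> a" using P p(2) by auto
  show "a < tau a p" "tau a p < a + 1" using P ne a by (auto simp: tau_def)
  show "\<gamma> (tau a p) = p" using P per by (simp add: tau_def)
  assume t: "t \<in> {a..a+1}" "\<gamma> t = p"
  have "t \<noteq> a" "t \<noteq> a + 1" using t p(2) per[of a] by auto
  show "t = tau a p"
  proof (cases "t < 1")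
    case True
    then have "param \<gamma> p = t" using t a by (intro param_eqI) auto
    then show ?thesis using t by (simp add: tau_def)
  next
    case False
    have "\<gamma> (t - 1) = p" using per[of "t - 1"] t by simp
    then have "param \<gamma> p = t - 1" using t a False by (intro param_eqI) auto
    then show ?thesis using t \<open>t \<noteq> a + 1\<close> by (simp add: tau_def)
  qed
qed

lemma tau_periodic: assumes "\<And>t. f (t + 1) = f t" shows "f (tau a p) = f (param \<gamma> p)"
  using assms by (simp add: tau_def)

end

text \<open>The sign is defined by the existence of a chart with positive determinant. Changing
  charts multiplies the cross product by a positive Jacobian determinant, so any one chart
  decides.\<close>

lemma crossing_sign_eq:
  assumes C: "smooth_simple_closed_curve M C" "smooth_simple_closed_curve M C'"
    and p: "p \<in> intersections C C'" and c: "c \<in> M" "p \<in> cdom c"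
    and t: "transversal_at M C C' p"
  defines "x \<equiv> cross2 (velocity c C (param C p) UNIV) (velocity c C' (param C' p) UNIV)"
  shows "x \<noteq> 0" "crossing_sign M C C' p = of_real (x / \<bar>x\<bar>)"
proof -
  show x0: "x \<noteq> 0" unfolding x_def
    by (rule cross2_nonzero) (use t c in \<open>unfold transversal_at_def, blast\<close>)
  have P: "C (param C p) = p" "C' (param C' p) = p"
    using p param[OF C(1)] param[OF C(2)] unfolding intersections_def by blast+
  have "(\<exists>d\<in>M. p \<in> cdom d \<and>
          det (vector [velocity d C (param C p) UNIV, velocity d C' (param C' p) UNIV] :: real^2^2) > 0) \<longleftrightarrow> x > 0"
  proof
    assume "\<exists>d\<in>M. p \<in> cdom d \<and>
          det (vector [velocity d C (param C p) UNIV, velocity d C' (param C' p) UNIV] :: real^2^2) > 0"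
    then obtain d where d: "d \<in> M" "p \<in> cdom d"
      "cross2 (velocity d C (param C p) UNIV) (velocity d C' (param C' p) UNIV) > 0"
      by (auto simp only: det_vector2)
    have "velocity d C (param C p) UNIV = jacobian (transition c d) (cmap c p) *v velocity c C (param C p) UNIV"
      using velocity_transition[OF simple_imp_closed_path[OF C(1)] c(1) d(1), of "param C p"] c d P by simp
    moreover have "velocity d C' (param C' p) UNIV = jacobian (transition c d) (cmap c p) *v velocity c C' (param C' p) UNIV"
      using velocity_transition[OF simple_imp_closed_path[OF C(2)] c(1) d(1), of "param C' p"] c d P by simp
    ultimately have "det (jacobian (transition c d) (cmap c p)) * x > 0" using d(3) by (simp add: cross2_matrix x_def)
    moreover have "det (jacobian (transition c d) (cmap c p)) > 0"
      using c d by (intro jacobian_det_pos) (simp_all add: overlap_iff cmap_in cinv_cmap)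
    ultimately show "x > 0" by (simp add: zero_less_mult_iff)
  next
    assume "x > 0"
    then show "\<exists>d\<in>M. p \<in> cdom d \<and>
          det (vector [velocity d C (param C p) UNIV, velocity d C' (param C' p) UNIV] :: real^2^2) > 0"
      using c unfolding det_vector2 x_def by blast
  qed
  then show "crossing_sign M C C' p = of_real (x / \<bar>x\<bar>)"
    using x0 by (simp add: crossing_sign_def abs_if)
qed

end

section \<open>Uniform convergence of holonomies and the contribution of a crossing\<close>

context smoothing_setup
begin

text \<open>For small s the smoothed generators stay within distance 1 of the unsmoothed one, so a
  single Lipschitz constant serves. Times up to 2 in absolute value contain every window of length 1
  starting in [0, 1).\<close>

lemma based_hol_uniform:
  fixes A :: "('p, 'n::finite) matform"
  assumes \<gamma>: "closed_path \<gamma>" and A: "admissible A"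
  shows "\<exists>K\<ge>0. \<forall>\<^sub>F s in at_right 0. \<forall>t. \<bar>t\<bar> \<le> 2 \<longrightarrow> norm (based_hol \<gamma> s A t) \<le> K"
    and "e > 0 \<Longrightarrow> \<forall>\<^sub>F s in at_right 0. \<forall>t. \<bar>t\<bar> \<le> 2 \<longrightarrow> norm (based_hol \<gamma> s A t - based_hol \<gamma> 0 A t) \<le> e"
proof -
  note cont = curveform_continuous[OF \<gamma> A]
  obtain B where B: "\<And>t. norm (curveform \<gamma> 0 A t) \<le> B"
    using periodic_bounded[OF cont curveform_periodic[OF \<gamma>]] by blast
  obtain C where C: "C \<ge> 0" "\<And>(X :: real \<Rightarrow> 'n cmat) Y e t. continuous_on UNIV X \<Longrightarrow> continuous_on UNIV Y \<Longrightarrow>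
     (\<forall>t. norm (X t) \<le> B + 1) \<Longrightarrow> (\<forall>t. norm (Y t) \<le> B + 1) \<Longrightarrow> (\<forall>t. norm (Y t - X t) \<le> e) \<Longrightarrow> \<bar>t\<bar> \<le> 2 \<Longrightarrow>
     norm (monodromy X t) \<le> C \<and> norm (monodromy Y t - monodromy X t) \<le> C * e"
    using monodromy_lipschitz[of "B + 1" 2, where 'n='n] by blast
  have B1: "\<forall>t. norm (curveform \<gamma> 0 A t) \<le> B + 1" using B by (meson add_increasing2 order_refl zero_le_one)
  have key: "\<forall>\<^sub>F s in at_right 0. \<forall>t. \<bar>t\<bar> \<le> 2 \<longrightarrow>
      norm (based_hol \<gamma> 0 A t) \<le> C \<and> norm (based_hol \<gamma> s A t - based_hol \<gamma> 0 A t) \<le> C * e" if e: "0 < e" "e \<le> 1" for e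
    using curveform_uniform[OF \<gamma> A e(1)]
  proof eventually_elim
    case (elim s)
    have "\<forall>t. norm (curveform \<gamma> s A t) \<le> B + 1"
    proof
      fix t
      have "norm (curveform \<gamma> s A t) \<le> norm (curveform \<gamma> 0 A t) + norm (curveform \<gamma> s A t - curveform \<gamma> 0 A t)"
        by (metis add.commute diff_add_cancel norm_triangle_ineq)
      also have "\<dots> \<le> B + 1" using B[of t] elim[rule_format, of t] e(2) by linarith
      finally show "norm (curveform \<gamma> s A t) \<le> B + 1" .
    qed
    from C(2)[OF cont cont B1 this elim] show ?case unfolding based_hol_def by blast
  qed
  have "\<forall>\<^sub>F s in at_right 0. \<forall>t. \<bar>t\<bar> \<le> 2 \<longrightarrow> norm (based_hol \<gamma> s A t) \<le> C + C * 1"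
    using key[of 1, simplified]
  proof eventually_elim
    case (elim s)
    show ?case
    proof (intro allI impI)
      fix t :: real assume "\<bar>t\<bar> \<le> 2"
      moreover have "norm (based_hol \<gamma> s A t) \<le> norm (based_hol \<gamma> 0 A t) + norm (based_hol \<gamma> s A t - based_hol \<gamma> 0 A t)"
        by (metis add.commute diff_add_cancel norm_triangle_ineq)
      ultimately show "norm (based_hol \<gamma> s A t) \<le> C + C * 1" using elim by fastforce
    qed
  qed
  then show "\<exists>K\<ge>0. \<forall>\<^sub>F s in at_right 0. \<forall>t. \<bar>t\<bar> \<le> 2 \<longrightarrow> norm (based_hol \<gamma> s A t) \<le> K"
    using C(1) by (intro exI[of _ "C + C * 1"]) auto
  show "\<forall>\<^sub>F s in at_right 0. \<forall>t. \<bar>t\<bar> \<le> 2 \<longrightarrow> norm (based_hol \<gamma> s A t - based_hol \<gamma> 0 A t) \<le> e" if e: "e > 0"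
  proof -
    \<comment> \<open>Dividing by \<open>C + 1\<close> avoids the case C = 0; the minimum with 1
      keeps the generators within the common bound.\<close>
    define e' where "e' = min 1 (e / (C + 1))"
    have e': "0 < e'" "e' \<le> 1" using e C(1) by (auto simp: e'_def)
    have "C * e' \<le> (C + 1) * (e / (C + 1))" using C(1) e by (intro mult_mono) (auto simp: e'_def)
    also have "\<dots> = e" using C(1) by simp
    finally have "C * e' \<le> e" .
    then show ?thesis using key[OF e'] by (auto elim!: eventually_mono intro: order_trans)
  qed
qed

text \<open>In the rescaled integral the base time moves together with s; uniform convergence plus
  continuity of the limit handles both dependences.\<close>

lemma based_hol_tendsto:
  fixes A :: "('p, 'n::finite) matform"
  assumes \<gamma>: "closed_path \<gamma>" and A: "admissible A" and t: "\<bar>t\<bar> < 2"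
  shows "((\<lambda>s. based_hol \<gamma> s A (t + s * u)) \<longlongrightarrow> based_hol \<gamma> 0 A t) (at_right 0)"
proof -
  have l: "((\<lambda>s. t + s * u) \<longlongrightarrow> t + 0 * u) (at_right 0)" by (intro tendsto_intros)
  have "\<forall>\<^sub>F s in at_right 0. t + s * u \<in> {-2<..<2}" using l t by (intro topological_tendstoD) auto
  then have ev: "\<forall>\<^sub>F s in at_right 0. \<bar>t + s * u\<bar> \<le> 2" by eventually_elim auto
  have "isCont (based_hol \<gamma> 0 A) t" using based_hol_continuous[OF \<gamma> A, of 0] by (simp add: continuous_on_eq_continuous_at)
  then have 1: "((\<lambda>s. based_hol \<gamma> 0 A (t + s * u)) \<longlongrightarrow> based_hol \<gamma> 0 A t) (at_right 0)"
    by (rule isCont_tendsto_compose) (use l in simp)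
  have "((\<lambda>s. based_hol \<gamma> s A (t + s * u) - based_hol \<gamma> 0 A (t + s * u)) \<longlongrightarrow> 0) (at_right 0)"
  proof (rule tendstoI)
    fix e :: real assume "e > 0"
    then have "\<forall>\<^sub>F s in at_right 0. \<forall>t. \<bar>t\<bar> \<le> 2 \<longrightarrow> norm (based_hol \<gamma> s A t - based_hol \<gamma> 0 A t) \<le> e / 2"
      by (intro based_hol_uniform(2)[OF \<gamma> A]) simp
    with ev show "\<forall>\<^sub>F s in at_right 0. dist (based_hol \<gamma> s A (t + s * u) - based_hol \<gamma> 0 A (t + s * u)) 0 < e"
    proof eventually_elim
      case (elim s)
      then have "norm (based_hol \<gamma> s A (t + s * u) - based_hol \<gamma> 0 A (t + s * u)) \<le> e / 2" by blast
      then show ?case using \<open>e > 0\<close> by (simp add: dist_norm)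
    qed
  qed
  from tendsto_add[OF this 1] show ?thesis by simp
qed

text \<open>On the curve itself the Jacobians to \<open>U k\<close> and back cancel and the cutoff
  is absorbed by \<open>pu k\<close>; only the density determinant survives.\<close>

lemma vel_density_at_crossing:
  assumes \<gamma>: "closed_path \<gamma>" and jk: "j < N" "k < N" and p: "\<gamma> t = p" "p \<in> cdom (U j)" "p \<in> cdom (U k)"
  shows "vel_density \<gamma> (U j) k t (cmap (U j) p) =
    (pu k p * det (jacobian (transition (U j) (U k)) (cmap (U j) p))) *\<^sub>R velocity (U j) \<gamma> t UNIV"
proof -
  note Uj = pu(1)[OF jk(1)] and Uk = pu(1)[OF jk(2)]
  let ?x = "cmap (U j) p"
  have x: "?x \<in> overlap (U j) (U k)" using p by (simp add: overlap_iff Uj Uk cmap_in cinv_cmap)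
  have "velocity (U k) \<gamma> t UNIV = jacobian (transition (U j) (U k)) ?x *v velocity (U j) \<gamma> t UNIV"
    using velocity_transition[OF \<gamma> Uj Uk, of t] p by simp
  then have "jacobian (transition (U k) (U j)) (transition (U j) (U k) ?x) *v velocity (U k) \<gamma> t UNIV = velocity (U j) \<gamma> t UNIV"
    using jacobian_inverse[OF Uj Uk x] by (simp add: matrix_vector_mul_assoc)
  moreover have "cutvel \<gamma> k t = cf k p *\<^sub>R velocity (U k) \<gamma> t UNIV" using p by (simp add: cutvel_def)
  moreover have "pu k p * cf k p = pu k p" by (rule cf(4)[OF jk(2)])
  ultimately show ?thesis
    by (simp add: vel_density_def cinv_cmap[OF Uj p(2)] matrix_vector_mult_scaleR ac_simps)
      auto
qed

text \<open>An instance of \<open>blow_up\<close> in the four variables (t, t', x). The determinants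
  in the weight cancel those produced by the kernel integral, and the cross product of the tangents
  is left divided by its absolute value.\<close>

lemma crossing_term_limit:
  fixes A :: "('p, 'n::finite) matform" and \<beta> :: "'n cmat \<Rightarrow> 'n cmat \<Rightarrow> complex"
  assumes \<beta>: "bounded_bilinear \<beta>" and A: "admissible A" and jkl: "j < N" "k < N" "l < N"
    and curves: "smooth_simple_closed_curve M C" "smooth_simple_closed_curve M C'"
    and fin: "finite (intersections C C')"
    and trans: "\<And>p. p \<in> intersections C C' \<Longrightarrow> transversal_at M C C' p"
  shows "((\<lambda>s. LINT x:cimg (U j)|lborel. pu j (cinv (U j) x) *\<^sub>R
       wedge \<beta> (patch_density C s (based_hol C s A) k (U j) x) (patch_density C' s (based_hol C' s A) l (U j) x)) \<longlongrightarrow>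
     (\<Sum>p\<in>intersections C C'. (pu j p * pu k p * pu l p) *\<^sub>R
       (crossing_sign M C C' p * \<beta> (based_hol C 0 A (param C p)) (based_hol C' 0 A (param C' p))))) (at_right 0)"
proof -
  interpret \<beta>: bounded_bilinear \<beta> by (rule \<beta>)
  note \<gamma> = simple_imp_closed_path[OF curves(1)] and \<gamma>' = simple_imp_closed_path[OF curves(2)]
  note Uj = pu(1)[OF jkl(1)] and Uk = pu(1)[OF jkl(2)] and Ul = pu(1)[OF jkl(3)]
  let ?I = "intersections C C'"
  \<comment> \<open>Integrating over periods that start off the crossings puts all crossings in the interior of the box.\<close>
  obtain a where a: "a \<in> {0..<1}" "C a \<notin> ?I" using ex_base[OF curves(1) fin] by blast
  obtain b where b: "b \<in> {0..<1}" "C' b \<notin> ?I" using ex_base[OF curves(2) fin] by blast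
  let ?\<tau> = "tau C a" and ?\<tau>' = "tau C' b"
  have \<tau>: "a < ?\<tau> p" "?\<tau> p < a + 1" "C (?\<tau> p) = p" "t \<in> {a..a+1} \<Longrightarrow> C t = p \<Longrightarrow> t = ?\<tau> p" if "p \<in> ?I" for p t
  proof -
    have *: "p \<in> range C" "C a \<noteq> p" using that a(2) unfolding intersections_def by auto
    note t = tau[OF curves(1) a(1) *]
    show "a < ?\<tau> p" "?\<tau> p < a + 1" "C (?\<tau> p) = p" by (rule t)+
    show "t \<in> {a..a+1} \<Longrightarrow> C t = p \<Longrightarrow> t = ?\<tau> p" by (rule t(4))
  qed
  have \<tau>': "b < ?\<tau>' p" "?\<tau>' p < b + 1" "C' (?\<tau>' p) = p" "t \<in> {b..b+1} \<Longrightarrow> C' t = p \<Longrightarrow> t = ?\<tau>' p" if "p \<in> ?I" for p t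
  proof -
    have *: "p \<in> range C'" "C' b \<noteq> p" using that b(2) unfolding intersections_def by auto
    note t = tau[OF curves(2) b(1) *]
    show "b < ?\<tau>' p" "?\<tau>' p < b + 1" "C' (?\<tau>' p) = p" by (rule t)+
    show "t \<in> {b..b+1} \<Longrightarrow> C' t = p \<Longrightarrow> t = ?\<tau>' p" by (rule t(4))
  qed
  obtain R where R: "R > 0" "\<And>y. \<rho> y \<noteq> 0 \<Longrightarrow> norm y \<le> R" using mollifierD(6)[OF mollifier] by blast
  let ?Box = "{a..a+1} \<times> {b..b+1}"
  let ?S = "transition (U j) (U k)" and ?S' = "transition (U j) (U l)"
  let ?W = "crossing_weight C C' j k l"
  define \<kappa> where "\<kappa> = (\<lambda>w::(real^2)\<times>(real^2). \<rho> (fst w) * \<rho> (snd w))"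
  define \<Phi> where "\<Phi> = (\<lambda>z::(real\<times>real)\<times>(real^2).
     (cmap (U k) (C (fst (fst z))) - ?S (snd z), cmap (U l) (C' (snd (fst z))) - ?S' (snd z)))"
  define F where "F = (\<lambda>s (z::(real\<times>real)\<times>(real^2)). indicator ?Box (fst z) *\<^sub>R
     (?W z *\<^sub>R \<beta> (based_hol C s A (fst (fst z))) (based_hol C' s A (snd (fst z)))))"
  \<comment> \<open>A compact set supporting all \<open>F s\<close>, on which the chart expressions
    in \<Phi> are continuous.\<close>
  define Z where "Z = (({a..a+1} \<inter> {t. C t \<in> closure {p. cf k p \<noteq> 0}}) \<times>
     ({b..b+1} \<inter> {t. C' t \<in> closure {p. cf l p \<noteq> 0}})) \<times> patch_core j k l"
  \<comment> \<open>Only crossings inside all three charts are zeros of \<Phi>; at the others one of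
    the three partition functions vanishes, so they can be restored at the end.\<close>
  define I' where "I' = {p \<in> ?I. p \<in> cdom (U j) \<and> p \<in> cdom (U k) \<and> p \<in> cdom (U l)}"
  define z where "z = (\<lambda>p. ((?\<tau> p, ?\<tau>' p), cmap (U j) p))"
  define L where "L = (\<lambda>y \<zeta>::(real\<times>real)\<times>(real^2).
     (jacobian ?S (snd y) *v (fst (fst \<zeta>) *\<^sub>R velocity (U j) C (fst (fst y)) UNIV - snd \<zeta>),
      jacobian ?S' (snd y) *v (snd (fst \<zeta>) *\<^sub>R velocity (U j) C' (snd (fst y)) UNIV - snd \<zeta>)))"
  define F0 where "F0 = (\<lambda>y::(real\<times>real)\<times>(real^2). ?W y *\<^sub>R \<beta> (based_hol C 0 A (fst (fst y))) (based_hol C' 0 A (snd (fst y))))"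
  have Wc: "continuous_on UNIV ?W" by (rule crossing_weight_continuous[OF \<gamma> \<gamma>' jkl])
  have kc: "continuous_on UNIV (\<lambda>z. rho_scaled s (cmap (U k) (C (fst (fst z))) - ?S (snd z)) *
      rho_scaled s (cmap (U l) (C' (snd (fst z))) - ?S' (snd z)) * ?W z)" for s
    by (rule crossing_weight_kernel_continuous[OF \<gamma> \<gamma>' jkl rho_scaled_continuous rho_scaled_continuous])
  have \<kappa>c: "continuous_on UNIV \<kappa>" unfolding \<kappa>_def
    by (intro continuous_intros continuous_on_compose2[OF mollifierD(2)[OF mollifier]]) auto
  have \<kappa>s: "norm w \<le> R + R" if "\<kappa> w \<noteq> 0" for w
    using norm_Pair_le[of "fst w" "snd w"] R(2)[of "fst w"] R(2)[of "snd w"] that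
    by (auto simp: \<kappa>_def)
  \<comment> \<open>Two factors s^-2 of the mollifiers make up the power s^-4 for the four
    dimensions.\<close>
  have rho_scaled_\<kappa>: "\<kappa> (\<Phi> z /\<^sub>R s) / s ^ DIM((real\<times>real)\<times>(real^2)) =
      rho_scaled s (cmap (U k) (C (fst (fst z))) - ?S (snd z)) * rho_scaled s (cmap (U l) (C' (snd (fst z))) - ?S' (snd z))" for s z
    by (simp add: \<kappa>_def \<Phi>_def rho_scaled_def inverse_eq_divide power4_eq_xxxx power2_eq_square)
  have eq: "(LINT x:cimg (U j)|lborel. pu j (cinv (U j) x) *\<^sub>R
       wedge \<beta> (patch_density C s (based_hol C s A) k (U j) x) (patch_density C' s (based_hol C' s A) l (U j) x)) =
     (LINT z|lborel. (\<kappa> (\<Phi> z /\<^sub>R s) / s ^ DIM((real\<times>real)\<times>(real^2))) *\<^sub>R F s z)" for s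
  proof -
    have "(LINT x:cimg (U j)|lborel. pu j (cinv (U j) x) *\<^sub>R
        wedge \<beta> (patch_density C s (based_hol C s A) k (U j) x) (patch_density C' s (based_hol C' s A) l (U j) x)) =
      (LINT z|lborel. indicator ?Box (fst z) *\<^sub>R
        ((rho_scaled s (cmap (U k) (C (fst (fst z))) - ?S (snd z)) * rho_scaled s (cmap (U l) (C' (snd (fst z))) - ?S' (snd z)) * ?W z) *\<^sub>R
          \<beta> (based_hol C s A (fst (fst z))) (based_hol C' s A (snd (fst z)))))"
      by (rule wedge_integral[OF \<beta> \<gamma> \<gamma>' jkl based_hol_continuous[OF \<gamma> A] based_hol_periodic[OF \<gamma> A]
        based_hol_continuous[OF \<gamma>' A] based_hol_periodic[OF \<gamma>' A]])
    also have "\<dots> = (LINT z|lborel. (\<kappa> (\<Phi> z /\<^sub>R s) / s ^ DIM((real\<times>real)\<times>(real^2))) *\<^sub>R F s z)"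
      by (rule Bochner_Integration.integral_cong[OF refl]) (simp only: rho_scaled_\<kappa> F_def scaleR_scaleR ac_simps)
    finally show ?thesis .
  qed
  have inO: "snd y \<in> overlap (U j) (U k)" "snd y \<in> overlap (U j) (U l)" if "y \<in> Z" for y
    using that patch_core(2)[OF jkl] by (auto simp: Z_def)
  have inD: "C (fst (fst y)) \<in> cdom (U k)" "C' (snd (fst y)) \<in> cdom (U l)" if "y \<in> Z" for y
    using that cf(1)[OF jkl(2)] cf(1)[OF jkl(3)] by (auto simp: Z_def)
  have cr: "cross2 (velocity (U j) C (param C p) UNIV) (velocity (U j) C' (param C' p) UNIV) \<noteq> 0"
    "crossing_sign M C C' p = of_real (cross2 (velocity (U j) C (param C p) UNIV) (velocity (U j) C' (param C' p) UNIV) /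
       \<bar>cross2 (velocity (U j) C (param C p) UNIV) (velocity (U j) C' (param C' p) UNIV)\<bar>)" if "p \<in> I'" for p
    using crossing_sign_eq[OF curves _ Uj _ trans] that by (auto simp: I'_def)
  have velper: "velocity (U j) C (?\<tau> p) UNIV = velocity (U j) C (param C p) UNIV"
    "velocity (U j) C' (?\<tau>' p) UNIV = velocity (U j) C' (param C' p) UNIV" if "p \<in> I'" for p
  proof -
    have p: "C (param C p) = p" "C' (param C' p) = p" "p \<in> cdom (U j)"
      using that param(2)[OF curves(1), of p] param(2)[OF curves(2), of p] by (auto simp: I'_def intersections_def)
    show "velocity (U j) C (?\<tau> p) UNIV = velocity (U j) C (param C p) UNIV"
      using velocity_periodic[OF \<gamma> Uj, of "param C p"] p by (simp add: tau_def[OF curves(1)])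
    show "velocity (U j) C' (?\<tau>' p) UNIV = velocity (U j) C' (param C' p) UNIV"
      using velocity_periodic[OF \<gamma>' Uj, of "param C' p"] p by (simp add: tau_def[OF curves(2)])
  qed
  have xO: "cmap (U j) p \<in> overlap (U j) (U k)" "cmap (U j) p \<in> overlap (U j) (U l)" if "p \<in> I'" for p
    using that by (simp_all add: I'_def overlap_iff Uj Uk Ul cmap_in cinv_cmap)
  have detp: "det (jacobian ?S (cmap (U j) p)) > 0" "det (jacobian ?S' (cmap (U j) p)) > 0" if "p \<in> I'" for p
    using jacobian_det_pos[OF Uj Uk xO(1)[OF that]] jacobian_det_pos[OF Uj Ul xO(2)[OF that]] by auto
  obtain K1 where K1: "K1 \<ge> 0" "\<forall>\<^sub>F s in at_right 0. \<forall>t. \<bar>t\<bar> \<le> 2 \<longrightarrow> norm (based_hol C s A t) \<le> K1"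
    using based_hol_uniform(1)[OF \<gamma> A] by blast
  obtain K2 where K2: "K2 \<ge> 0" "\<forall>\<^sub>F s in at_right 0. \<forall>t. \<bar>t\<bar> \<le> 2 \<longrightarrow> norm (based_hol C' s A t) \<le> K2"
    using based_hol_uniform(1)[OF \<gamma>' A] by blast
  obtain s0 where s0: "s0 > 0" "\<And>s t. 0 < s \<Longrightarrow> s < s0 \<Longrightarrow> \<bar>t\<bar> \<le> 2 \<Longrightarrow> norm (based_hol C s A t) \<le> K1 \<and> norm (based_hol C' s A t) \<le> K2"
  proof -
    have "\<forall>\<^sub>F s in at_right 0. \<forall>t. \<bar>t\<bar> \<le> 2 \<longrightarrow> norm (based_hol C s A t) \<le> K1 \<and> norm (based_hol C' s A t) \<le> K2"
      using K1(2) K2(2) by eventually_elim blast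
    then obtain s0 where "s0 > 0" "\<forall>s>0. s < s0 \<longrightarrow> (\<forall>t. \<bar>t\<bar> \<le> 2 \<longrightarrow> norm (based_hol C s A t) \<le> K1 \<and> norm (based_hol C' s A t) \<le> K2)"
      unfolding eventually_at_right_field by auto
    then show ?thesis using that by blast
  qed
  obtain B where B: "\<And>P Q. norm (\<beta> P Q) \<le> norm P * norm Q * B" "B \<ge> 0" using \<beta>.nonneg_bounded by blast
  have "bounded (?W ` (?Box \<times> patch_core j k l))"
    by (intro compact_imp_bounded compact_continuous_image continuous_on_subset[OF Wc] compact_Times compact_Icc patch_core(1)[OF jkl]) simp
  then obtain w where "\<forall>r\<in>?W ` (?Box \<times> patch_core j k l). norm r \<le> w" unfolding bounded_iff ..
  then have w: "\<bar>?W y\<bar> \<le> \<bar>w\<bar>" if "fst y \<in> ?Box" "snd y \<in> patch_core j k l" for y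
  proof -
    assume *: "\<forall>r\<in>?W ` (?Box \<times> patch_core j k l). norm r \<le> w"
    have "y \<in> ?Box \<times> patch_core j k l" using that by (simp add: mem_Times_iff)
    then have "norm (?W y) \<le> w" using * by blast
    then show ?thesis by simp
  qed
  have "((\<lambda>s. LINT z|lborel. (\<kappa> (\<Phi> z /\<^sub>R s) / s ^ DIM((real\<times>real)\<times>(real^2))) *\<^sub>R F s z) \<longlongrightarrow>
     (\<Sum>y\<in>z ` I'. (LINT \<zeta>|lborel. \<kappa> (L y \<zeta>)) *\<^sub>R F0 y)) (at_right 0)"
  proof (rule blow_up[OF \<kappa>c \<kappa>s, where Z=Z and ?s0.0=s0 and B="\<bar>w\<bar> * (K1 * K2 * B)"])
    show "compact Z" unfolding Z_def
      by (intro compact_Times compact_Int_closed compact_Icc patch_core(1)[OF jkl] cutvel_domains(2) \<gamma> \<gamma>' jkl)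
    show "continuous_on Z \<Phi>" unfolding \<Phi>_def
    proof (intro continuous_on_Pair continuous_on_diff)
      show "continuous_on Z (\<lambda>z. cmap (U k) (C (fst (fst z))))"
        by (rule continuous_on_compose2[OF path_chart_continuous[OF \<gamma> Uk]]) (use inD in \<open>auto intro!: continuous_intros\<close>)
      show "continuous_on Z (\<lambda>z. cmap (U l) (C' (snd (fst z))))"
        by (rule continuous_on_compose2[OF path_chart_continuous[OF \<gamma>' Ul]]) (use inD in \<open>auto intro!: continuous_intros\<close>)
      show "continuous_on Z (\<lambda>z. ?S (snd z))"
        by (rule continuous_on_compose2[OF smooth_on_continuous[OF smooth_transition[OF Uj Uk]]]) (use inO in \<open>auto intro!: continuous_intros\<close>)
      show "continuous_on Z (\<lambda>z. ?S' (snd z))"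
        by (rule continuous_on_compose2[OF smooth_on_continuous[OF smooth_transition[OF Uj Ul]]]) (use inO in \<open>auto intro!: continuous_intros\<close>)
    qed
    show "F s y = 0" if "y \<notin> Z" for s y
    proof (cases "fst y \<in> ?Box")
      case True
      then have "y \<notin> ({t. C t \<in> closure {p. cf k p \<noteq> 0}} \<times> {t. C' t \<in> closure {p. cf l p \<noteq> 0}}) \<times> patch_core j k l"
        using that unfolding Z_def by (cases y; cases "fst y") simp
      from crossing_weight_zero[OF jkl this] show ?thesis by (simp add: F_def)
    qed (simp add: F_def)
    show "norm (F s y) \<le> \<bar>w\<bar> * (K1 * K2 * B)" if s: "0 < s" "s < s0" for s y
    proof (cases "fst y \<in> ?Box \<and> snd y \<in> patch_core j k l")
      case True
      then have "\<bar>fst (fst y)\<bar> \<le> 2" "\<bar>snd (fst y)\<bar> \<le> 2" using a(1) b(1) by (auto simp: mem_Times_iff)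
      then have h: "norm (based_hol C s A (fst (fst y))) \<le> K1" "norm (based_hol C' s A (snd (fst y))) \<le> K2"
        using s0(2)[OF s] by blast+
      have "norm (\<beta> (based_hol C s A (fst (fst y))) (based_hol C' s A (snd (fst y)))) \<le> K1 * K2 * B"
        by (rule order_trans[OF B(1)]) (use h K1(1) B(2) in \<open>intro mult_right_mono mult_mono; simp\<close>)
      moreover have "\<bar>?W y\<bar> \<le> \<bar>w\<bar>" by (rule w) (use True in simp_all)
      ultimately have "\<bar>?W y\<bar> * norm (\<beta> (based_hol C s A (fst (fst y))) (based_hol C' s A (snd (fst y)))) \<le> \<bar>w\<bar> * (K1 * K2 * B)"
        by (intro mult_mono) auto
      then show ?thesis using True by (simp add: F_def)
    next
      case False
      have "F s y = 0"
      proof (cases "fst y \<in> ?Box")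
        case True
        then have "?W y = 0" using False by (intro crossing_weight_zero[OF jkl]) (auto simp: mem_Times_iff)
        then show ?thesis by (simp add: F_def)
      qed (simp add: F_def)
      then show ?thesis using K1(1) K2(1) B(2) by simp
    qed
    \<comment> \<open>Measurability is shown for the product only: \<kappa> composed with \<Phi> is
      uncontrolled off the charts, while the product is continuous on the closed time box and zero
      outside it.\<close>
    show "(\<lambda>z. \<kappa> (\<Phi> z /\<^sub>R s) *\<^sub>R F s z) \<in> borel_measurable borel" if s: "0 < s" for s
    proof -
      let ?f = "\<lambda>z. s ^ DIM((real\<times>real)\<times>(real^2)) *\<^sub>R ((rho_scaled s (cmap (U k) (C (fst (fst z))) - ?S (snd z)) *
          rho_scaled s (cmap (U l) (C' (snd (fst z))) - ?S' (snd z)) * ?W z) *\<^sub>R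
        \<beta> (based_hol C s A (fst (fst z))) (based_hol C' s A (snd (fst z))))"
      have "continuous_on (?Box \<times> UNIV) ?f"
        by (intro continuous_on_scaleR continuous_on_const continuous_on_subset[OF kc] \<beta>.continuous_on
           continuous_on_compose2[OF based_hol_continuous[OF \<gamma> A]] continuous_on_compose2[OF based_hol_continuous[OF \<gamma>' A]] continuous_intros) auto
      moreover have "closed (?Box \<times> (UNIV :: (real^2) set))" by (intro closed_Times closed_UNIV) auto
      ultimately have "(\<lambda>z. indicator (?Box \<times> UNIV) z *\<^sub>R ?f z) \<in> borel_measurable borel"
        by (intro borel_measurable_continuous_on_indicator) auto
      moreover have "indicator (?Box \<times> UNIV) z *\<^sub>R ?f z = \<kappa> (\<Phi> z /\<^sub>R s) *\<^sub>R F s z" for z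
      proof -
        have "\<kappa> (\<Phi> z /\<^sub>R s) = s ^ DIM((real\<times>real)\<times>(real^2)) * (\<kappa> (\<Phi> z /\<^sub>R s) / s ^ DIM((real\<times>real)\<times>(real^2)))" using s by simp
        also have "\<dots> = s ^ DIM((real\<times>real)\<times>(real^2)) * (rho_scaled s (cmap (U k) (C (fst (fst z))) - ?S (snd z)) *
          rho_scaled s (cmap (U l) (C' (snd (fst z))) - ?S' (snd z)))" by (simp only: rho_scaled_\<kappa>)
        finally have k: "\<kappa> (\<Phi> z /\<^sub>R s) = \<dots>" .
        have i: "indicator (?Box \<times> UNIV) z = (indicator ?Box (fst z) :: real)" by (cases z) (simp add: indicator_def)
        show ?thesis unfolding k i F_def scaleR_scaleR by (simp only: ac_simps)
      qed
      ultimately show ?thesis by (simp only:)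
    qed
    show "finite (z ` I')" using fin by (simp add: I'_def)
    \<comment> \<open>At a zero, both chart expressions say that the curve point equals the surface
      point with coordinate x; so x is a crossing, and the window determines the two times.\<close>
    show "y \<in> z ` I'" if y: "y \<in> Z" "\<Phi> y = 0" for y
    proof -
      define t t' x where "t = fst (fst y)" and "t' = snd (fst y)" and "x = snd y"
      have yy: "y = ((t, t'), x)" by (simp add: t_def t'_def x_def)
      have 1: "cmap (U k) (C t) = ?S x" "cmap (U l) (C' t') = ?S' x"
        using y(2) by (simp_all add: \<Phi>_def yy zero_prod_def)
      have x: "x \<in> overlap (U j) (U k)" "x \<in> overlap (U j) (U l)" "x \<in> cimg (U j)"
        using inO[OF y(1)] overlap_subset[of "U j" "U k"] by (auto simp: x_def)
      have d: "C t \<in> cdom (U k)" "C' t' \<in> cdom (U l)" using inD[OF y(1)] by (simp_all add: t_def t'_def)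
      have "cinv (U k) (cmap (U k) (C t)) = cinv (U k) (?S x)" "cinv (U l) (cmap (U l) (C' t')) = cinv (U l) (?S' x)"
        using 1 by simp_all
      then have p: "C t = cinv (U j) x" "C' t' = cinv (U j) x"
        by (simp_all add: cinv_cmap[OF Uk d(1)] cinv_cmap[OF Ul d(2)] cinv_transition[OF Uj Uk x(1)] cinv_transition[OF Uj Ul x(2)])
      have I: "cinv (U j) x \<in> ?I" unfolding intersections_def using p by (metis IntI rangeI)
      have I': "cinv (U j) x \<in> I'" using I x d p by (simp add: I'_def cinv_in[OF Uj])
      have "t \<in> {a..a+1}" "t' \<in> {b..b+1}" using y(1) by (auto simp: Z_def yy)
      then have "t = ?\<tau> (cinv (U j) x)" "t' = ?\<tau>' (cinv (U j) x)" using \<tau>(4)[OF I] \<tau>'(4)[OF I] p by blast+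
      then have "y = z (cinv (U j) x)" using x(3) by (simp add: z_def yy cmap_cinv[OF Uj])
      then show ?thesis using I' by blast
    qed
    show "\<Phi> y = 0" if "y \<in> z ` I'" for y
      using that \<tau>(3) \<tau>'(3) by (auto simp: \<Phi>_def z_def I'_def transition_cmap[OF Uj] zero_prod_def)
    show "(\<Phi> has_derivative L y) (at y)" if y: "y \<in> z ` I'" for y
    proof -
      obtain p where p: "p \<in> I'" "y = z p" using y by blast
      then have pI: "p \<in> ?I" "p \<in> cdom (U j)" "p \<in> cdom (U k)" "p \<in> cdom (U l)" by (auto simp: I'_def)
      have v: "velocity (U k) C (?\<tau> p) UNIV = jacobian ?S (cmap (U j) p) *v velocity (U j) C (?\<tau> p) UNIV"
        using velocity_transition[OF \<gamma> Uj Uk, of "?\<tau> p"] \<tau>(3)[OF pI(1)] pI by simp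
      have v': "velocity (U l) C' (?\<tau>' p) UNIV = jacobian ?S' (cmap (U j) p) *v velocity (U j) C' (?\<tau>' p) UNIV"
        using velocity_transition[OF \<gamma>' Uj Ul, of "?\<tau>' p"] \<tau>'(3)[OF pI(1)] pI by simp
      have 1: "((\<lambda>z. cmap (U k) (C (fst (fst z)))) has_derivative (\<lambda>\<zeta>. fst (fst \<zeta>) *\<^sub>R velocity (U k) C (?\<tau> p) UNIV)) (at y)"
      proof (rule has_derivative_compose[where f="\<lambda>z. fst (fst z)" and g="\<lambda>t. cmap (U k) (C t)"])
        show "((\<lambda>z. fst (fst z)) has_derivative (\<lambda>z. fst (fst z))) (at y)" by (auto intro!: derivative_eq_intros)
        show "((\<lambda>t. cmap (U k) (C t)) has_derivative (\<lambda>u. u *\<^sub>R velocity (U k) C (?\<tau> p) UNIV)) (at (fst (fst y)))"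
          using path_has_derivative[OF \<gamma> Uk, of "?\<tau> p"] \<tau>(3)[OF pI(1)] pI by (simp add: p(2) z_def has_vector_derivative_def)
      qed
      have 2: "((\<lambda>z. cmap (U l) (C' (snd (fst z)))) has_derivative (\<lambda>\<zeta>. snd (fst \<zeta>) *\<^sub>R velocity (U l) C' (?\<tau>' p) UNIV)) (at y)"
      proof (rule has_derivative_compose[where f="\<lambda>z. snd (fst z)" and g="\<lambda>t. cmap (U l) (C' t)"])
        show "((\<lambda>z. snd (fst z)) has_derivative (\<lambda>z. snd (fst z))) (at y)" by (auto intro!: derivative_eq_intros)
        show "((\<lambda>t. cmap (U l) (C' t)) has_derivative (\<lambda>u. u *\<^sub>R velocity (U l) C' (?\<tau>' p) UNIV)) (at (snd (fst y)))"
          using path_has_derivative[OF \<gamma>' Ul, of "?\<tau>' p"] \<tau>'(3)[OF pI(1)] pI by (simp add: p(2) z_def has_vector_derivative_def)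
      qed
      have 3: "((\<lambda>z. T (snd z)) has_derivative (\<lambda>\<zeta>. J *v snd \<zeta>)) (at y)"
        if "(T has_derivative (\<lambda>v. J *v v)) (at (cmap (U j) p))" for T :: "real^2 \<Rightarrow> real^2" and J
        by (rule has_derivative_compose[where f=snd and g=T]) (use that in \<open>auto simp: p(2) z_def intro!: derivative_eq_intros\<close>)
      have "(\<Phi> has_derivative (\<lambda>\<zeta>. (fst (fst \<zeta>) *\<^sub>R velocity (U k) C (?\<tau> p) UNIV - jacobian ?S (cmap (U j) p) *v snd \<zeta>,
          snd (fst \<zeta>) *\<^sub>R velocity (U l) C' (?\<tau>' p) UNIV - jacobian ?S' (cmap (U j) p) *v snd \<zeta>))) (at y)"
        unfolding \<Phi>_def
        by (intro has_derivative_Pair has_derivative_diff 1 2 3 transition_has_derivative Uj Uk Ul xO p(1))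
      moreover have "L y = (\<lambda>\<zeta>. (fst (fst \<zeta>) *\<^sub>R velocity (U k) C (?\<tau> p) UNIV - jacobian ?S (cmap (U j) p) *v snd \<zeta>,
          snd (fst \<zeta>) *\<^sub>R velocity (U l) C' (?\<tau>' p) UNIV - jacobian ?S' (cmap (U j) p) *v snd \<zeta>))"
        unfolding L_def v v' by (simp add: p(2) z_def matrix_vector_mult_diff_distrib matrix_vector_mult_scaleR)
      ultimately show ?thesis by simp
    qed
    show "inj (L y)" if y: "y \<in> z ` I'" for y
    proof -
      obtain p where p: "p \<in> I'" "y = z p" using y by blast
      show ?thesis unfolding L_def
        by (rule crossing_map_inj(2))
         (use detp[OF p(1)] cr(1)[OF p(1)] velper[OF p(1)] in \<open>simp_all add: p(2) z_def det_vector2\<close>)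
    qed
    show "((\<lambda>s. F s (y + s *\<^sub>R \<zeta>)) \<longlongrightarrow> F0 y) (at_right 0)" if y: "y \<in> z ` I'" for y \<zeta>
    proof -
      obtain p where p: "p \<in> I'" "y = z p" using y by blast
      then have pI: "p \<in> ?I" by (simp add: I'_def)
      have fy: "fst (fst y) = ?\<tau> p" "snd (fst y) = ?\<tau>' p" by (simp_all add: p z_def)
      have l: "((\<lambda>s. y + s *\<^sub>R \<zeta>) \<longlongrightarrow> y + 0 *\<^sub>R \<zeta>) (at_right 0)" by (intro tendsto_intros)
      have "y \<in> ({a<..<a+1} \<times> {b<..<b+1}) \<times> UNIV" using \<tau>(1,2)[OF pI] \<tau>'(1,2)[OF pI] by (simp add: p z_def)
      then have "\<forall>\<^sub>F s in at_right 0. y + s *\<^sub>R \<zeta> \<in> ({a<..<a+1} \<times> {b<..<b+1}) \<times> UNIV"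
        using l by (intro topological_tendstoD) (auto intro!: open_Times)
      then have ev: "\<forall>\<^sub>F s in at_right 0. ?W (y + s *\<^sub>R \<zeta>) *\<^sub>R \<beta> (based_hol C s A (fst (fst y) + s * fst (fst \<zeta>))) (based_hol C' s A (snd (fst y) + s * snd (fst \<zeta>))) = F s (y + s *\<^sub>R \<zeta>)"
      proof eventually_elim
        case (elim s)
        then have "fst (y + s *\<^sub>R \<zeta>) \<in> ?Box" by (auto simp: mem_Times_iff)
        then show ?case by (simp add: F_def)
      qed
      have "isCont ?W y" using continuous_on_eq_continuous_at[OF open_UNIV] Wc by blast
      then have 1: "((\<lambda>s. ?W (y + s *\<^sub>R \<zeta>)) \<longlongrightarrow> ?W y) (at_right 0)"
        by (rule isCont_tendsto_compose) (use l in simp)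
      have 2: "((\<lambda>s. based_hol C s A (fst (fst y) + s * fst (fst \<zeta>))) \<longlongrightarrow> based_hol C 0 A (fst (fst y))) (at_right 0)"
        by (rule based_hol_tendsto[OF \<gamma> A]) (use \<tau>(1,2)[OF pI] a(1) fy in auto)
      have 3: "((\<lambda>s. based_hol C' s A (snd (fst y) + s * snd (fst \<zeta>))) \<longlongrightarrow> based_hol C' 0 A (snd (fst y))) (at_right 0)"
        by (rule based_hol_tendsto[OF \<gamma>' A]) (use \<tau>'(1,2)[OF pI] b(1) fy in auto)
      show ?thesis unfolding F0_def
        by (rule Lim_transform_eventually[OF tendsto_scaleR[OF 1 \<beta>.tendsto[OF 2 3]] ev])
    qed
  qed (assumption | rule s0(1))+
  moreover have "(\<Sum>y\<in>z ` I'. (LINT \<zeta>|lborel. \<kappa> (L y \<zeta>)) *\<^sub>R F0 y) =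
     (\<Sum>p\<in>?I. (pu j p * pu k p * pu l p) *\<^sub>R
       (crossing_sign M C C' p * \<beta> (based_hol C 0 A (param C p)) (based_hol C' 0 A (param C' p))))"
  proof -
    have "inj_on z I'"
    proof (rule inj_onI)
      fix p q assume "p \<in> I'" "q \<in> I'" "z p = z q"
      then have *: "?\<tau> p = ?\<tau> q" and pq: "p \<in> ?I" "q \<in> ?I" by (simp_all add: z_def I'_def)
      have "p = C (?\<tau> p)" by (rule \<tau>(3)[OF pq(1), symmetric])
      also have "\<dots> = C (?\<tau> q)" by (simp only: *)
      also have "\<dots> = q" by (rule \<tau>(3)[OF pq(2)])
      finally show "p = q" .
    qed
    then have "(\<Sum>y\<in>z ` I'. (LINT \<zeta>|lborel. \<kappa> (L y \<zeta>)) *\<^sub>R F0 y) = (\<Sum>p\<in>I'. (LINT \<zeta>|lborel. \<kappa> (L (z p) \<zeta>)) *\<^sub>R F0 (z p))"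
      by (simp add: sum.reindex)
    also have "\<dots> = (\<Sum>p\<in>I'. (pu j p * pu k p * pu l p) *\<^sub>R
       (crossing_sign M C C' p * \<beta> (based_hol C 0 A (param C p)) (based_hol C' 0 A (param C' p))))"
    proof (rule sum.cong[OF refl])
      fix p assume p: "p \<in> I'"
      then have pI: "p \<in> ?I" "p \<in> cdom (U j)" "p \<in> cdom (U k)" "p \<in> cdom (U l)" by (auto simp: I'_def)
      let ?v = "velocity (U j) C (param C p) UNIV" and ?v' = "velocity (U j) C' (param C' p) UNIV"
      let ?x = "cmap (U j) p"
      define D D' X where "D = det (jacobian ?S ?x)" and "D' = det (jacobian ?S' ?x)" and "X = cross2 ?v ?v'"
      have pos: "D > 0" "D' > 0" "X \<noteq> 0" using detp[OF p] cr(1)[OF p] by (simp_all add: D_def D'_def X_def)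
      have int: "(LINT \<zeta>|lborel. \<kappa> (L (z p) \<zeta>)) = 1 / (\<bar>D\<bar> * \<bar>D'\<bar> * \<bar>X\<bar>)"
        using crossing_integral[OF mollifierD(2)[OF mollifier] R(2) mollifierD(5)[OF mollifier],
            of "jacobian ?S ?x" "jacobian ?S' ?x" ?v ?v'] pos
        by (simp add: \<kappa>_def L_def z_def velper[OF p] det_vector2 D_def D'_def X_def)
      have W: "?W (z p) = pu j p * (pu k p * D * (pu l p * D') * X)"
        using xO[OF p] by (simp add: crossing_weight_def z_def cinv_cmap[OF Uj pI(2)] vel_density_at_crossing[OF \<gamma> jkl(1,2) \<tau>(3)[OF pI(1)] pI(2,3)]
            vel_density_at_crossing[OF \<gamma>' jkl(1,3) \<tau>'(3)[OF pI(1)] pI(2,4)] cross2_scaleR velper[OF p] D_def D'_def X_def)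
      have h: "based_hol C 0 A (?\<tau> p) = based_hol C 0 A (param C p)" "based_hol C' 0 A (?\<tau>' p) = based_hol C' 0 A (param C' p)"
        by (rule tau_periodic[OF curves(1), where f="based_hol C 0 A"], rule based_hol_periodic[OF \<gamma> A])
          (rule tau_periodic[OF curves(2), where f="based_hol C' 0 A"], rule based_hol_periodic[OF \<gamma>' A])
      \<comment> \<open>\<open>D\<close> and \<open>D'\<close> are positive, so they cancel
        completely; \<open>X\<close> keeps its sign.\<close>
      have "(1 / (\<bar>D\<bar> * \<bar>D'\<bar> * \<bar>X\<bar>)) * ?W (z p) = (pu j p * pu k p * pu l p) * (X / \<bar>X\<bar>)"
        unfolding W using pos by (simp add: field_simps)
      then have "(LINT \<zeta>|lborel. \<kappa> (L (z p) \<zeta>)) *\<^sub>R F0 (z p) =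
        ((pu j p * pu k p * pu l p) * (X / \<bar>X\<bar>)) *\<^sub>R \<beta> (based_hol C 0 A (param C p)) (based_hol C' 0 A (param C' p))"
        by (simp only: int F0_def scaleR_scaleR) (simp add: z_def h)
      also have "\<dots> = (pu j p * pu k p * pu l p) *\<^sub>R
       (crossing_sign M C C' p * \<beta> (based_hol C 0 A (param C p)) (based_hol C' 0 A (param C' p)))"
        unfolding cr(2)[OF p] X_def[symmetric] by (simp add: scaleR_conv_of_real mult.assoc)
      finally show "(LINT \<zeta>|lborel. \<kappa> (L (z p) \<zeta>)) *\<^sub>R F0 (z p) = (pu j p * pu k p * pu l p) *\<^sub>R
       (crossing_sign M C C' p * \<beta> (based_hol C 0 A (param C p)) (based_hol C' 0 A (param C' p)))" .
    qed
    also have "\<dots> = (\<Sum>p\<in>?I. (pu j p * pu k p * pu l p) *\<^sub>R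
       (crossing_sign M C C' p * \<beta> (based_hol C 0 A (param C p)) (based_hol C' 0 A (param C' p))))"
    proof (rule sum.mono_neutral_left[OF fin])
      show "I' \<subseteq> ?I" by (auto simp: I'_def)
      show "\<forall>p\<in>?I - I'. (pu j p * pu k p * pu l p) *\<^sub>R
       (crossing_sign M C C' p * \<beta> (based_hol C 0 A (param C p)) (based_hol C' 0 A (param C' p))) = 0"
        using pu(7)[OF jkl(1)] pu(7)[OF jkl(2)] pu(7)[OF jkl(3)] by (auto simp: I'_def)
    qed
    finally show ?thesis .
  qed
  ultimately show ?thesis unfolding eq by (simp only:)
qed

end

section \<open>The bracket in terms of holonomies\<close>

text \<open>The inverse of the trace form, evaluated on the linear functionals X -> trace (P X) and
  X -> trace (Q X) on the Lie algebra.\<close>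

definition inverse_form :: "('b::finite \<Rightarrow> 'n::finite cmat) \<Rightarrow> 'n cmat \<Rightarrow> 'n cmat \<Rightarrow> complex" where
  "inverse_form e P Q = (\<Sum>\<alpha>\<in>UNIV. \<Sum>\<beta>\<in>UNIV. matrix_inv (gram e) $ \<alpha> $ \<beta> * trace (P ** e \<alpha>) * trace (Q ** e \<beta>))"

lemma bounded_bilinear_gform: "bounded_bilinear (inverse_form (e :: 'b::finite \<Rightarrow> 'n::finite cmat))"
proof -
  note simps = bounded_bilinear.add_left[OF bounded_bilinear_matmul] matmul_scaleR_left
    linear_add[OF trace_linear] linear_cmul[OF trace_linear]
  have "linear (inverse_form e P)" for P
    by (rule linearI) (simp_all add: inverse_form_def simps algebra_simps sum.distrib scaleR_sum_right)
  moreover have "linear (\<lambda>P. inverse_form e P Q)" for Q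
    by (rule linearI) (simp_all add: inverse_form_def simps algebra_simps sum.distrib scaleR_sum_right)
  ultimately show ?thesis
    by (simp add: bilinear_conv_bounded_bilinear[symmetric] bilinear_def)
qed

lemma eps_sum: "(\<Sum>a\<in>UNIV. \<Sum>b\<in>UNIV. eps a b * f a b) = f 1 2 - f 2 1"
  by (simp add: sum_2 eps_def)

context smoothing_setup
begin

lemma wedge_wilson_derivative:
  "(\<Sum>\<alpha>\<in>UNIV. \<Sum>\<beta>\<in>UNIV. \<Sum>a\<in>UNIV. \<Sum>b\<in>UNIV. eps a b * matrix_inv (gram e) $ \<alpha> $ \<beta> *
     wilson_derivative e \<gamma> s A c x $ a $ \<alpha> * wilson_derivative e \<gamma>' s A c x $ b $ \<beta>) =
   wedge (inverse_form e) (loop_density \<gamma> s (based_hol \<gamma> s A) c x) (loop_density \<gamma>' s (based_hol \<gamma>' s A) c x)"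
proof -
  have "(\<Sum>a\<in>UNIV. \<Sum>b\<in>UNIV. eps a b * matrix_inv (gram e) $ \<alpha> $ \<beta> *
     wilson_derivative e \<gamma> s A c x $ a $ \<alpha> * wilson_derivative e \<gamma>' s A c x $ b $ \<beta>) =
     matrix_inv (gram e) $ \<alpha> $ \<beta> * wilson_derivative e \<gamma> s A c x $ 1 $ \<alpha> * wilson_derivative e \<gamma>' s A c x $ 2 $ \<beta> -
     matrix_inv (gram e) $ \<alpha> $ \<beta> * wilson_derivative e \<gamma> s A c x $ 2 $ \<alpha> * wilson_derivative e \<gamma>' s A c x $ 1 $ \<beta>" for \<alpha> \<beta>
    using eps_sum[of "\<lambda>a b. matrix_inv (gram e) $ \<alpha> $ \<beta> * wilson_derivative e \<gamma> s A c x $ a $ \<alpha> * wilson_derivative e \<gamma>' s A c x $ b $ \<beta>"]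
    by (simp only: mult.assoc)
  then show ?thesis by (simp add: wedge_def inverse_form_def wilson_derivative_def sum_subtractf)
qed

text \<open>The functional derivatives are replaced by the explicit densities, the surface integral
  by its value for the given partition, and the contraction is expanded bilinearly. Each patch term
  is integrable because \<open>pu j\<close> has compact support in its chart.\<close>

lemma bracket_eq:
  fixes A :: "('p, 'n::finite) matform" and e :: "'b::finite \<Rightarrow> 'n cmat"
  assumes e: "lie_basis K \<gg> e" "subspace \<gg>" "\<And>r::real. of_real r \<in> K"
    and \<gamma>: "closed_path \<gamma>" "closed_path \<gamma>'" and A: "admissible A" and s: "s > 0"
  shows "poisson_bracket M K \<gg> e (\<lambda>A. wilson M \<gamma> (smoothing M N U pu cf \<rho> s A)) (\<lambda>A. wilson M \<gamma>' (smoothing M N U pu cf \<rho> s A)) A =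
    (\<Sum>j<N. \<Sum>k<N. \<Sum>l<N. LINT x:cimg (U j)|lborel. pu j (cinv (U j) x) *\<^sub>R
       wedge (inverse_form e) (patch_density \<gamma> s (based_hol \<gamma> s A) k (U j) x) (patch_density \<gamma>' s (based_hol \<gamma>' s A) l (U j) x))"
proof -
  interpret w: bounded_bilinear "wedge (inverse_form e)" by (rule bounded_bilinear_wedge[OF bounded_bilinear_gform])
  note m = based_hol_continuous[OF \<gamma>(1) A, of s] and m' = based_hol_continuous[OF \<gamma>(2) A, of s]
  let ?w = "\<lambda>c x. wedge (inverse_form e) (loop_density \<gamma> s (based_hol \<gamma> s A) c x) (loop_density \<gamma>' s (based_hol \<gamma>' s A) c x)"
  have dens: "density ?w"
    unfolding density_def
  proof (intro conjI ballI)
    show "continuous_on (cimg c) (?w c)" if "c \<in> M" for c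
      by (intro w.continuous_on smooth_on_continuous loop_density_smooth \<gamma> m m' that)
    fix c d x assume c: "c \<in> M" and d: "d \<in> M" and x: "x \<in> overlap c d"
    let ?D = "det (jacobian (transition c d) x)"
    \<comment> \<open>Each vector density contributes a factor \<open>?D\<close>, and the wedge of
      the pushed vectors contributes the inverse determinant; a single \<open>?D\<close> remains, as
      for a density.\<close>
    have "?D * det (jacobian (transition d c) (transition c d x)) = 1"
      using arg_cong[OF jacobian_inverse[OF c d x], of det] by (simp add: det_mul mult.commute)
    then show "?w c x = ?D *\<^sub>R ?w d (transition c d x)"
      by (simp add: loop_density_transition[OF c d x] w.scaleR_left w.scaleR_right wedge_push[OF bounded_bilinear_gform] mult.assoc)
  qed
  have "poisson_bracket M K \<gg> e (\<lambda>A. wilson M \<gamma> (smoothing M N U pu cf \<rho> s A)) (\<lambda>A. wilson M \<gamma>' (smoothing M N U pu cf \<rho> s A)) A =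
    surface_integral M ?w"
    unfolding poisson_bracket_def functional_derivative_wilson[OF e \<gamma>(1) A s] functional_derivative_wilson[OF e \<gamma>(2) A s]
      wedge_wilson_derivative ..
  also have "\<dots> = (\<Sum>j<N. LINT x:cimg (U j)|lborel. pu j (cinv (U j) x) *\<^sub>R ?w (U j) x)"
    by (rule surface_integral_eq[OF dens partition])
  also have "\<dots> = (\<Sum>j<N. \<Sum>k<N. \<Sum>l<N. LINT x:cimg (U j)|lborel. pu j (cinv (U j) x) *\<^sub>R
       wedge (inverse_form e) (patch_density \<gamma> s (based_hol \<gamma> s A) k (U j) x) (patch_density \<gamma>' s (based_hol \<gamma>' s A) l (U j) x))"
  proof (rule sum.cong[OF refl])
    fix j assume "j \<in> {..<N}"
    then have j: "j < N" by simp
    note Uj = pu(1)[OF j]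
    let ?f = "\<lambda>k l x. pu j (cinv (U j) x) *\<^sub>R wedge (inverse_form e) (patch_density \<gamma> s (based_hol \<gamma> s A) k (U j) x) (patch_density \<gamma>' s (based_hol \<gamma>' s A) l (U j) x)"
    have int: "integrable lborel (\<lambda>x. indicator (cimg (U j)) x *\<^sub>R ?f k l x)" if kl: "k < N" "l < N" for k l
    proof -
      have "set_integrable lborel (cimg (U j)) (?f k l)"
      proof (rule set_integrable_chart[OF Uj _ pu(2,3)[OF j]])
        show "continuous_on (cimg (U j)) (?f k l)"
          by (intro continuous_on_scaleR pu(5)[OF j Uj] w.continuous_on smooth_on_continuous patch_density_smooth \<gamma> kl m m' Uj)
        show "?f k l x = 0" if "cinv (U j) x \<notin> closure {p. pu j p \<noteq> 0}" for x using pu(6)[OF j that] by simp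
      qed
      then show ?thesis unfolding set_integrable_def .
    qed
    have "indicator (cimg (U j)) x *\<^sub>R pu j (cinv (U j) x) *\<^sub>R ?w (U j) x = (\<Sum>k<N. \<Sum>l<N. indicator (cimg (U j)) x *\<^sub>R ?f k l x)" for x
      unfolding loop_density_def w.sum_left w.sum_right scaleR_sum_right by (rule sum.swap)
    then have "(LINT x:cimg (U j)|lborel. pu j (cinv (U j) x) *\<^sub>R ?w (U j) x) =
      (LINT x|lborel. (\<Sum>k<N. \<Sum>l<N. indicator (cimg (U j)) x *\<^sub>R ?f k l x))"
      unfolding set_lebesgue_integral_def by (simp only:)
    also have "\<dots> = (\<Sum>k<N. \<Sum>l<N. LINT x|lborel. indicator (cimg (U j)) x *\<^sub>R ?f k l x)"
      using int by (subst Bochner_Integration.integral_sum; (intro Bochner_Integration.integrable_sum sum.cong refl Bochner_Integration.integral_sum)?) auto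
    finally show "(LINT x:cimg (U j)|lborel. pu j (cinv (U j) x) *\<^sub>R ?w (U j) x) =
      (\<Sum>k<N. \<Sum>l<N. LINT x:cimg (U j)|lborel. ?f k l x)"
      unfolding set_lebesgue_integral_def .
  qed
  finally show ?thesis .
qed

text \<open>Every crossing occurs with the weights of three partition indices; summing over each
  index gives 1, so the choice of smoothing data drops out of the limit.\<close>

lemma regularized_bracket:
  fixes A :: "('p, 'n::finite) matform" and e :: "'b::finite \<Rightarrow> 'n cmat"
  assumes e: "lie_basis K \<gg> e" "subspace \<gg>" "\<And>r::real. of_real r \<in> K"
    and curves: "smooth_simple_closed_curve M C" "smooth_simple_closed_curve M C'"
    and fin: "finite (intersections C C')"
    and trans: "\<And>p. p \<in> intersections C C' \<Longrightarrow> transversal_at M C C' p"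
    and A: "admissible A"
  shows "has_regularized_bracket M K \<gg> e (smoothing M N U pu cf \<rho>) (wilson M C) (wilson M C') A
    (\<Sum>p\<in>intersections C C'. crossing_sign M C C' p * inverse_form e (based_hol C 0 A (param C p)) (based_hol C' 0 A (param C' p)))"
  unfolding has_regularized_bracket_def
proof
  note \<gamma> = simple_imp_closed_path[OF curves(1)] and \<gamma>' = simple_imp_closed_path[OF curves(2)]
  have pos: "\<forall>\<^sub>F s in at_right (0::real). 0 < s" by (simp add: eventually_at_right_less)
  show "\<forall>\<^sub>F s in at_right 0.
        (\<exists>D. has_functional_derivative M K \<gg> e (\<lambda>A. wilson M C (smoothing M N U pu cf \<rho> s A)) A D) \<and>
        (\<exists>D. has_functional_derivative M K \<gg> e (\<lambda>A. wilson M C' (smoothing M N U pu cf \<rho> s A)) A D)"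
    using pos
  proof eventually_elim
    case (elim s)
    show ?case
      using wilson_functional_derivative[OF e(1) \<gamma> A elim] wilson_functional_derivative[OF e(1) \<gamma>' A elim] by blast
  qed
  let ?g = "\<lambda>p. crossing_sign M C C' p * inverse_form e (based_hol C 0 A (param C p)) (based_hol C' 0 A (param C' p))"
  have "((\<lambda>s. \<Sum>j<N. \<Sum>k<N. \<Sum>l<N. LINT x:cimg (U j)|lborel. pu j (cinv (U j) x) *\<^sub>R
       wedge (inverse_form e) (patch_density C s (based_hol C s A) k (U j) x) (patch_density C' s (based_hol C' s A) l (U j) x)) \<longlongrightarrow>
    (\<Sum>j<N. \<Sum>k<N. \<Sum>l<N. \<Sum>p\<in>intersections C C'. (pu j p * pu k p * pu l p) *\<^sub>R ?g p)) (at_right 0)"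
    by (intro tendsto_sum crossing_term_limit[OF bounded_bilinear_gform A _ _ _ curves fin trans]) auto
  moreover have "(\<Sum>j<N. \<Sum>k<N. \<Sum>l<N. \<Sum>p\<in>intersections C C'. (pu j p * pu k p * pu l p) *\<^sub>R ?g p) =
    (\<Sum>p\<in>intersections C C'. ?g p)"
  proof -
    have "(\<Sum>j<N. \<Sum>k<N. \<Sum>l<N. \<Sum>p\<in>intersections C C'. (pu j p * pu k p * pu l p) *\<^sub>R ?g p) =
      (\<Sum>j<N. \<Sum>k<N. \<Sum>p\<in>intersections C C'. \<Sum>l<N. (pu j p * pu k p * pu l p) *\<^sub>R ?g p)"
      by (intro sum.cong refl sum.swap)
    also have "\<dots> = (\<Sum>j<N. \<Sum>p\<in>intersections C C'. \<Sum>k<N. \<Sum>l<N. (pu j p * pu k p * pu l p) *\<^sub>R ?g p)"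
      by (intro sum.cong refl sum.swap)
    also have "\<dots> = (\<Sum>p\<in>intersections C C'. \<Sum>j<N. \<Sum>k<N. \<Sum>l<N. (pu j p * pu k p * pu l p) *\<^sub>R ?g p)"
      by (rule sum.swap)
    also have "\<dots> = (\<Sum>p\<in>intersections C C'. ?g p)"
    proof (rule sum.cong[OF refl])
      fix p
      have "(\<Sum>j<N. \<Sum>k<N. \<Sum>l<N. (pu j p * pu k p * pu l p) *\<^sub>R ?g p) =
        (\<Sum>j<N. \<Sum>k<N. \<Sum>l<N. pu j p * pu k p * pu l p) *\<^sub>R ?g p"
        by (simp only: scaleR_sum_left)
      also have "(\<Sum>j<N. \<Sum>k<N. \<Sum>l<N. pu j p * pu k p * pu l p) = 1"
        by (simp only: sum_distrib_left[symmetric] sum_pu mult_1_right)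
      finally show "(\<Sum>j<N. \<Sum>k<N. \<Sum>l<N. (pu j p * pu k p * pu l p) *\<^sub>R ?g p) = ?g p" by simp
    qed
    finally show ?thesis .
  qed
  moreover have "\<forall>\<^sub>F s in at_right 0. (\<Sum>j<N. \<Sum>k<N. \<Sum>l<N. LINT x:cimg (U j)|lborel. pu j (cinv (U j) x) *\<^sub>R
       wedge (inverse_form e) (patch_density C s (based_hol C s A) k (U j) x) (patch_density C' s (based_hol C' s A) l (U j) x)) =
     poisson_bracket M K \<gg> e (\<lambda>A. wilson M C (smoothing M N U pu cf \<rho> s A)) (\<lambda>A. wilson M C' (smoothing M N U pu cf \<rho> s A)) A"
    using pos by eventually_elim (rule bracket_eq[OF e \<gamma> \<gamma>' A, symmetric])
  ultimately show "((\<lambda>s. poisson_bracket M K \<gg> e (\<lambda>A. wilson M C (smoothing M N U pu cf \<rho> s A)) (\<lambda>A. wilson M C' (smoothing M N U pu cf \<rho> s A)) A) \<longlongrightarrow>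
    (\<Sum>p\<in>intersections C C'. ?g p)) (at_right 0)"
    using Lim_transform_eventually by fastforce
qed

section \<open>Wilson loops of concatenated curves\<close>

lemma based_hol_zero_flow:
  assumes "flow (curveform \<gamma> 0 A) h g" shows "based_hol \<gamma> 0 A t = g t ** h 1 ** h t"
  unfolding based_hol_def by (rule monodromy_eq[OF assms])

lemma wilson_loop_product:
  fixes A :: "('p, 'n::finite) matform"
  assumes \<gamma>: "closed_path \<gamma>" "closed_path \<gamma>'" and A: "one_form M \<gg> A"
  shows "wilson M (loop_product \<gamma> p \<gamma>') A = trace (based_hol \<gamma> 0 A (param \<gamma> p) ** based_hol \<gamma>' 0 A (param \<gamma>' p))"
proof -
  note adm = one_form_admissible[OF A]
  obtain h g where f: "flow (curveform \<gamma> 0 A) h g" using curveform_flow[OF \<gamma>(1) adm] by blast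
  obtain h' g' where f': "flow (curveform \<gamma>' 0 A) h' g'" using curveform_flow[OF \<gamma>(2) adm] by blast
  show ?thesis unfolding wilson_def loop_product_def
    by (simp add: hol_loop_product[OF \<gamma>(1) pulls_back_one_form[OF \<gamma>(1) A] f \<gamma>(2) pulls_back_one_form[OF \<gamma>(2) A] f']
        based_hol_zero_flow[OF f] based_hol_zero_flow[OF f'])
qed

text \<open>Reversal maps t to 1 - t, except that t = 0 would be sent to 1, which lies outside the
  half-open parameter interval.\<close>

lemma param_reversepath:
  assumes \<gamma>: "smooth_simple_closed_curve M \<gamma>" and p: "p \<in> range \<gamma>"
  shows "param (reversepath \<gamma>) p = (if param \<gamma> p = 0 then 0 else 1 - param \<gamma> p)"
  unfolding param_def[of "reversepath \<gamma>"]
proof (rule the_equality)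
  note P = param[OF \<gamma> p]
  have 1: "\<gamma> 1 = \<gamma> 0" using closed_path_periodic[OF simple_imp_closed_path[OF \<gamma>], of 0] by simp
  show "(if param \<gamma> p = 0 then 0 else 1 - param \<gamma> p) \<in> {0..<1} \<and>
      reversepath \<gamma> (if param \<gamma> p = 0 then 0 else 1 - param \<gamma> p) = p"
  proof (cases "param \<gamma> p = 0")
    case True then show ?thesis using P(2) 1 by (simp add: reversepath_def)
  next
    case False then show ?thesis using P by (simp add: reversepath_def)
  qed
  fix t assume t: "t \<in> {0..<1} \<and> reversepath \<gamma> t = p"
  show "t = (if param \<gamma> p = 0 then 0 else 1 - param \<gamma> p)"
  proof (cases "t = 0")
    case True
    then have "param \<gamma> p = 0" using t 1 by (intro param_eqI[OF \<gamma>]) (auto simp: reversepath_def)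
    then show ?thesis using True by simp
  next
    case False
    then have "param \<gamma> p = 1 - t" using t by (intro param_eqI[OF \<gamma>]) (auto simp: reversepath_def)
    then show ?thesis using t by auto
  qed
qed

text \<open>The reversed curve contributes the inverse of the based holonomy. It is described only
  by the equation it satisfies, which is the form in which the two-by-two trace identity uses
  it.\<close>

lemma wilson_loop_product_reverse:
  fixes A :: "('p, 'n::finite) matform"
  assumes \<gamma>: "closed_path \<gamma>" "smooth_simple_closed_curve M \<gamma>'" and A: "one_form M \<gg> A" and p: "p \<in> range \<gamma>'"
  shows "\<exists>R. based_hol \<gamma>' 0 A (param \<gamma>' p) ** R = mat 1 \<and>
    wilson M (loop_product \<gamma> p (reversepath \<gamma>')) A = trace (based_hol \<gamma> 0 A (param \<gamma> p) ** R)"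
proof -
  note adm = one_form_admissible[OF A] and \<gamma>' = simple_imp_closed_path[OF \<gamma>(2)]
  obtain h g where f: "flow (curveform \<gamma> 0 A) h g" using curveform_flow[OF \<gamma>(1) adm] by blast
  obtain h' g' where f': "flow (curveform \<gamma>' 0 A) h' g'" using curveform_flow[OF \<gamma>' adm] by blast
  note D = flowD[OF f']
  \<comment> \<open>The time on the original curve matching the basepoint of the reversed one. It is
    1 rather than 0 when the parameter of \<open>p\<close> is 0, a difference removed by
    periodicity.\<close>
  define u where "u = 1 - param (reversepath \<gamma>') p"
  define R where "R = g' u ** g' 1 ** h' u"
  have u: "based_hol \<gamma>' 0 A u = based_hol \<gamma>' 0 A (param \<gamma>' p)"
    using based_hol_periodic[OF \<gamma>' adm, of 0 0] unfolding u_def param_reversepath[OF \<gamma>(2) p] by simp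
  have "based_hol \<gamma>' 0 A u ** R = g' u ** h' 1 ** (h' u ** g' u) ** g' 1 ** h' u"
    by (simp only: based_hol_zero_flow[OF f'] R_def matrix_mul_assoc)
  also have "\<dots> = g' u ** h' 1 ** mat 1 ** g' 1 ** h' u" by (simp only: D(3))
  also have "\<dots> = g' u ** (h' 1 ** g' 1) ** h' u" by (simp only: matrix_mul_rid matrix_mul_assoc)
  also have "\<dots> = mat 1" by (simp only: D(3,4) matrix_mul_rid)
  finally have 1: "based_hol \<gamma>' 0 A (param \<gamma>' p) ** R = mat 1" by (simp add: u)
  have z: "h' (1 - 1) = mat 1" using D(1) by simp
  have 2: "g' (1 - b) ** h' 1 ** (g' 1 ** h' (1 - 1)) ** (g' 1 ** h' (1 - b)) = g' (1 - b) ** g' 1 ** h' (1 - b)" for b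
  proof -
    have "g' (1 - b) ** h' 1 ** (g' 1 ** h' (1 - 1)) ** (g' 1 ** h' (1 - b)) =
      g' (1 - b) ** (h' 1 ** g' 1) ** (g' 1 ** h' (1 - b))" by (simp only: z matrix_mul_rid matrix_mul_assoc)
    also have "\<dots> = g' (1 - b) ** (g' 1 ** h' (1 - b))" by (simp only: D(3) matrix_mul_rid)
    finally show ?thesis by (simp only: matrix_mul_assoc)
  qed
  have "hol M (loop_product \<gamma> p (reversepath \<gamma>')) A = based_hol \<gamma> 0 A (param \<gamma> p) ** R"
    unfolding loop_product_def
      hol_loop_product[OF \<gamma>(1) pulls_back_one_form[OF \<gamma>(1) A] f closed_path_reverse[OF \<gamma>']
        pulls_back_reverse[OF \<gamma>' pulls_back_one_form[OF \<gamma>' A]] flow_reverse[OF f']]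
      2 R_def u_def based_hol_zero_flow[OF f] ..
  then show ?thesis using 1 by (auto simp: wilson_def)
qed

end

section \<open>Trace identities\<close>

lemma gram_symmetric: "gram e $ \<alpha> $ \<beta> = gram e $ \<beta> $ \<alpha>"
  by (simp add: gram_def) (rule trace_mul_sym)

text \<open>\<open>Q\<close> enters only through its traces with the basis, so it may be replaced by
  any combination of basis elements having the same traces. The inverse Gram matrix then recovers
  the coefficients \<open>k\<close>.\<close>

lemma inverse_form_eq_trace:
  fixes e :: "'b::finite \<Rightarrow> 'n::finite cmat" and k :: "complex^'b"
  assumes inv: "invertible (gram e)"
    and Q: "\<And>\<beta>. trace (Q ** e \<beta>) = trace ((\<Sum>\<delta>\<in>UNIV. cscale (k $ \<delta>) (e \<delta>)) ** e \<beta>)"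
  shows "inverse_form e P Q = trace (P ** (\<Sum>\<delta>\<in>UNIV. cscale (k $ \<delta>) (e \<delta>)))"
proof -
  have left: "trace (cscale z X ** Y) = z * trace (X ** Y)" for z and X Y :: "'n cmat"
    by (simp add: trace_def matrix_matrix_mult_def cscale_def sum_distrib_left ac_simps)
  have "matrix_inv (gram e) ** gram e = mat 1"
    using inv unfolding invertible_def matrix_inv_def by (rule someI2_ex) blast
  then have k: "matrix_inv (gram e) *v (gram e *v k) = k" by (simp add: matrix_vector_mul_assoc)
  have vy: "trace (Q ** e \<beta>) = (gram e *v k) $ \<beta>" for \<beta>
  proof -
    have "trace (Q ** e \<beta>) = (\<Sum>\<delta>\<in>UNIV. k $ \<delta> * gram e $ \<delta> $ \<beta>)"
      by (simp add: Q bounded_bilinear.sum_left[OF bounded_bilinear_matmul] linear_sum[OF trace_linear] left gram_def)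
    then show ?thesis by (simp add: matrix_vector_mult_def gram_symmetric[of e _ \<beta>] mult.commute)
  qed
  have "(B *v y) $ \<alpha> = (\<Sum>\<beta>\<in>UNIV. B $ \<alpha> $ \<beta> * y $ \<beta>)" for B :: "complex^'b^'b" and y \<alpha>
    by (simp add: matrix_vector_mult_def)
  from this[of "matrix_inv (gram e)" "gram e *v k"]
  have "(\<Sum>\<beta>\<in>UNIV. matrix_inv (gram e) $ \<alpha> $ \<beta> * trace (Q ** e \<beta>)) = k $ \<alpha>" for \<alpha>
    by (simp only: k vy)
  then have "inverse_form e P Q = (\<Sum>\<alpha>\<in>UNIV. trace (P ** e \<alpha>) * k $ \<alpha>)"
    unfolding inverse_form_def by (simp add: sum_distrib_left[symmetric] mult.commute[of _ "trace (P ** _)"] mult.assoc)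
  then show ?thesis by (simp add: matmul_sum_right linear_sum[OF trace_linear] trace_cscale_right mult.commute)
qed

text \<open>A kernel vector of the Gram matrix is a combination of basis elements that is
  trace-orthogonal to all of them; the premise says that there is none but zero.\<close>

lemma gram_invertibleI:
  fixes e :: "'b::finite \<Rightarrow> 'n::finite cmat"
  assumes "\<And>k::complex^'b. (\<And>\<alpha>. trace (e \<alpha> ** (\<Sum>\<delta>\<in>UNIV. cscale (k $ \<delta>) (e \<delta>))) = 0) \<Longrightarrow> k = 0"
  shows "invertible (gram e)"
proof -
  have "k = 0" if "gram e *v k = 0" for k
  proof (rule assms)
    fix \<alpha>
    have "trace (e \<alpha> ** (\<Sum>\<delta>\<in>UNIV. cscale (k $ \<delta>) (e \<delta>))) = (gram e *v k) $ \<alpha>"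
      by (simp add: matmul_sum_right linear_sum[OF trace_linear] trace_cscale_right matrix_vector_mult_def gram_def mult.commute)
    then show "trace (e \<alpha> ** (\<Sum>\<delta>\<in>UNIV. cscale (k $ \<delta>) (e \<delta>))) = 0" using that by simp
  qed
  then have "\<exists>B. B ** gram e = mat 1" using matrix_left_invertible_ker by blast
  then show ?thesis by (simp add: invertible_left_inverse)
qed

lemma lie_basis_zero:
  assumes "lie_basis K \<gg> e" "0 \<in> \<gg>" "0 \<in> K" "\<And>\<alpha>. k $ \<alpha> \<in> K" "(\<Sum>\<delta>\<in>UNIV. cscale (k $ \<delta>) (e \<delta>)) = 0"
  shows "k = 0"
proof -
  have "lie_coords K e 0 = k" by (rule lie_coords_eqI[OF assms(1,2,4)]) (use assms(5) in simp)
  moreover have "lie_coords K e 0 = 0"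
    by (rule lie_coords_eqI[OF assms(1,2)]) (use assms(3) in \<open>simp_all add: cscale_def vec_eq_iff\<close>)
  ultimately show ?thesis by simp
qed

lemma trace_matrix_unit: "trace ((\<chi> a b. if a = j \<and> b = i then 1 else 0) ** X) = (X :: 'n::finite cmat) $ i $ j"
proof -
  have "((\<chi> a b. if a = j \<and> b = i then 1 else 0) ** X) $ a $ a =
    (\<Sum>k\<in>UNIV. if k = i then (if a = j then X $ k $ a else 0) else 0)" for a
  proof -
    have "(if k = i then 1 else 0) * y = (if k = i then y else 0)" for k and y :: complex by simp
    then show ?thesis by (cases "a = j") (simp_all add: matrix_matrix_mult_def)
  qed
  then show ?thesis by (simp add: trace_def)
qed

text \<open>The basis spans all matrices, so trace-orthogonality can be tested on matrix units,
  which gives nondegeneracy, and \<open>Q\<close> is itself a combination of basis elements.\<close>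

lemma inverse_form_gl:
  fixes e :: "'b::finite \<Rightarrow> 'n::finite cmat"
  assumes e: "lie_basis UNIV gl_algebra e" shows "inverse_form e P Q = trace (P ** Q)"
proof -
  have co: "Q = (\<Sum>\<delta>\<in>UNIV. cscale (lie_coords UNIV e Q $ \<delta>) (e \<delta>))" for Q
    by (rule lie_coords(2)[OF e]) (simp add: gl_algebra_def)
  have "invertible (gram e)"
  proof (rule gram_invertibleI)
    fix k :: "complex^'b" assume k: "\<And>\<alpha>. trace (e \<alpha> ** (\<Sum>\<delta>\<in>UNIV. cscale (k $ \<delta>) (e \<delta>))) = 0"
    let ?X = "\<Sum>\<delta>\<in>UNIV. cscale (k $ \<delta>) (e \<delta>)"
    have Y: "trace (Y ** ?X) = 0" for Y
    proof -
      have "trace (?X ** Y) = (\<Sum>\<alpha>\<in>UNIV. lie_coords UNIV e Y $ \<alpha> * trace (?X ** e \<alpha>))"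
        by (subst co[of Y]) (simp add: matmul_sum_right linear_sum[OF trace_linear] trace_cscale_right)
      also have "\<dots> = 0" using k by (simp add: trace_mul_sym[of ?X])
      finally show ?thesis by (simp add: trace_mul_sym[of Y])
    qed
    have "?X = 0"
    proof -
      have "?X $ i $ j = 0" for i j
      proof -
        show ?thesis using Y trace_matrix_unit[of j i ?X] by simp
      qed
      then show ?thesis by (simp add: vec_eq_iff)
    qed
    then show "k = 0" by (intro lie_basis_zero[OF e]) (auto simp: gl_algebra_def)
  qed
  from inverse_form_eq_trace[OF this, of Q "lie_coords UNIV e Q" P] co[of Q] show ?thesis by simp
qed

section \<open>The trace form on su(2) and traces in SU(2)\<close>

lemma subspace_su2: "subspace su2_algebra"
  unfolding subspace_def su2_algebra_def
  by (auto simp: trace_def sum_2 algebra_simps scaleR_conv_of_real[where 'a=complex])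
    (simp_all flip: distrib_left)

lemma su2_entries:
  assumes "X \<in> su2_algebra"
  shows "cnj (X $ 1 $ 1) = - X $ 1 $ 1" "X $ 2 $ 2 = - X $ 1 $ 1" "X $ 2 $ 1 = - cnj (X $ 1 $ 2)"
  using assms unfolding su2_algebra_def by (auto simp: trace_def sum_2 eq_neg_iff_add_eq_0 add.commute)

lemma su2_trace_real:
  assumes "X \<in> su2_algebra" "Y \<in> su2_algebra" shows "Im (trace (X ** Y)) = 0"
proof -
  have r: "Re (X $ 1 $ 1) = 0" "Re (Y $ 1 $ 1) = 0"
    using su2_entries(1)[OF assms(1)] su2_entries(1)[OF assms(2)] by (simp_all add: complex_eq_iff)
  show ?thesis
    by (simp add: trace_def matrix_matrix_mult_def sum_2 su2_entries(2,3)[OF assms(1)] su2_entries(2,3)[OF assms(2)] r)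
qed

text \<open>The trace form is negative definite on su(2): the trace of the square is minus twice a
  sum of three real squares.\<close>

lemma su2_trace_square:
  assumes "X \<in> su2_algebra" "trace (X ** X) = 0" shows "X = 0"
proof -
  have r: "Re (X $ 1 $ 1) = 0"
    using su2_entries(1)[OF assms(1)] by (simp add: complex_eq_iff)
  have "Re (trace (X ** X)) = - 2 * ((Im (X $ 1 $ 1))\<^sup>2 + (Re (X $ 1 $ 2))\<^sup>2 + (Im (X $ 1 $ 2))\<^sup>2)"
    by (simp add: trace_def matrix_matrix_mult_def sum_2 su2_entries(2,3)[OF assms(1)] r power2_eq_square algebra_simps)
  then have "(Im (X $ 1 $ 1))\<^sup>2 + (Re (X $ 1 $ 2))\<^sup>2 + (Im (X $ 1 $ 2))\<^sup>2 = 0" using assms(2) by simp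
  then have "Im (X $ 1 $ 1) = 0" "Re (X $ 1 $ 2) = 0" "Im (X $ 1 $ 2) = 0"
    by (simp_all add: add_nonneg_eq_0_iff)
  then show ?thesis
    using r by (simp add: vec_eq_iff forall_2 su2_entries(2,3)[OF assms(1)] complex_eq_iff)
qed

text \<open>The basis is real but the Gram matrix is complex, so complex kernel vectors must be
  excluded. Traces of products in su(2) are real, so the real and imaginary parts of a kernel vector
  are kernel vectors separately, and definiteness kills each.\<close>

lemma gram_su2_invertible:
  fixes e :: "'c::finite \<Rightarrow> 2 cmat"
  assumes e: "lie_basis \<real> su2_algebra e" shows "invertible (gram e)"
proof (rule gram_invertibleI)
  fix k :: "complex^'c" assume k: "\<And>\<alpha>. trace (e \<alpha> ** (\<Sum>\<delta>\<in>UNIV. cscale (k $ \<delta>) (e \<delta>))) = 0"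
  have e_in: "e \<alpha> \<in> su2_algebra" for \<alpha> using e unfolding lie_basis_def by blast
  define P where "P = (\<lambda>f::complex \<Rightarrow> real. \<Sum>\<delta>\<in>UNIV. f (k $ \<delta>) *\<^sub>R e \<delta>)"
  have P_in: "P f \<in> su2_algebra" for f unfolding P_def
    by (intro subspace_sum[OF subspace_su2] subspace_scale[OF subspace_su2] e_in)
  have X: "trace (e \<alpha> ** (\<Sum>\<delta>\<in>UNIV. cscale (k $ \<delta>) (e \<delta>))) = trace (e \<alpha> ** P Re) + \<i> * trace (e \<alpha> ** P Im)" for \<alpha>
  proof -
    have "k $ \<delta> * z = Re (k $ \<delta>) *\<^sub>R z + \<i> * (Im (k $ \<delta>) *\<^sub>R z)" for \<delta> z
      by (simp add: complex_eq_iff)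
    then show ?thesis
      by (simp add: P_def matmul_sum_right linear_sum[OF trace_linear] trace_cscale_right matmul_scaleR_right
          linear_cmul[OF trace_linear] sum.distrib sum_distrib_left)
  qed
  have z: "trace (e \<alpha> ** P Re) = 0" "trace (e \<alpha> ** P Im) = 0" for \<alpha>
    using k[of \<alpha>] su2_trace_real[OF e_in P_in, of \<alpha> Re] su2_trace_real[OF e_in P_in, of \<alpha> Im]
    unfolding X by (auto simp: complex_eq_iff)
  have "P f = 0" if "\<And>\<alpha>. trace (e \<alpha> ** P f) = 0" for f
  proof (rule su2_trace_square[OF P_in])
    have "trace (P f ** P f) = (\<Sum>\<delta>\<in>UNIV. f (k $ \<delta>) *\<^sub>R trace (e \<delta> ** P f))"
      by (subst (1) P_def) (simp add: bounded_bilinear.sum_left[OF bounded_bilinear_matmul] matmul_scaleR_left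
          linear_sum[OF trace_linear] linear_cmul[OF trace_linear])
    then show "trace (P f ** P f) = 0" using that by simp
  qed
  then have P0: "P Re = 0" "P Im = 0" using z by blast+
  have "f (k $ \<alpha>) = 0" if "P f = 0" for f \<alpha>
  proof -
    have "cscale (of_real r) X = r *\<^sub>R X" for r and X :: "2 cmat"
      by (simp add: cscale_def vec_eq_iff scaleR_conv_of_real[where 'a=complex])
    then have "(\<chi> \<delta>. complex_of_real (f (k $ \<delta>))) = 0"
      using that by (intro lie_basis_zero[OF e subspace_0[OF subspace_su2]]) (auto simp: P_def)
    then show ?thesis by (simp add: vec_eq_iff)
  qed
  then show "k = 0" using P0 by (simp add: vec_eq_iff complex_eq_iff)
qed

text \<open>The complexification of su(2) is sl(2): a traceless matrix is its anti-Hermitian part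
  plus i times another anti-Hermitian matrix, both traceless.\<close>

lemma traceless_span_su2:
  fixes e :: "'c::finite \<Rightarrow> 2 cmat" and H :: "2 cmat"
  assumes e: "lie_basis \<real> su2_algebra e" and H: "trace H = 0"
  shows "\<exists>k::complex^'c. H = (\<Sum>\<delta>\<in>UNIV. cscale (k $ \<delta>) (e \<delta>))"
proof -
  define P where "P = (\<chi> i j. (H $ i $ j - cnj (H $ j $ i)) / 2)"
  define Q where "Q = (\<chi> i j. - \<i> * (H $ i $ j + cnj (H $ j $ i)) / 2)"
  have H2: "H $ 2 $ 2 = - H $ 1 $ 1" using H by (simp add: trace_def sum_2 eq_neg_iff_add_eq_0 add.commute)
  have "P \<in> su2_algebra" "Q \<in> su2_algebra"
    unfolding su2_algebra_def P_def Q_def by (auto simp: trace_def sum_2 H2 complex_eq_iff field_simps)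
  then obtain p q where p: "P = (\<Sum>\<delta>\<in>UNIV. cscale (p $ \<delta>) (e \<delta>))" and q: "Q = (\<Sum>\<delta>\<in>UNIV. cscale (q $ \<delta>) (e \<delta>))"
    using lie_coords(2)[OF e] by meson
  have "H $ i $ j = P $ i $ j + \<i> * Q $ i $ j" for i j
    by (simp add: P_def Q_def field_simps)
  then have "H = P + cscale \<i> Q" by (simp add: vec_eq_iff cscale_def)
  also have "\<dots> = (\<Sum>\<delta>\<in>UNIV. cscale ((\<chi> \<delta>. p $ \<delta> + \<i> * q $ \<delta>) $ \<delta>) (e \<delta>))"
    unfolding p q by (simp add: vec_eq_iff cscale_def sum_distrib_left sum.distrib algebra_simps)
  finally show ?thesis by blast
qed

text \<open>A holonomy is not traceless, but the basis elements are, so subtracting the scalar part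
  of \<open>Q\<close> changes none of its traces with them. The subtracted part accounts for the
  product of traces.\<close>

lemma inverse_form_su2:
  fixes e :: "'c::finite \<Rightarrow> 2 cmat" and P Q :: "2 cmat"
  assumes e: "lie_basis \<real> su2_algebra e"
  shows "inverse_form e P Q = trace (P ** Q) - trace P * trace Q / 2"
proof -
  define Q0 where "Q0 = Q - cscale (trace Q / 2) (mat 1)"
  have "trace Q0 = 0" by (simp add: Q0_def trace_def sum_2 cscale_def mat_def)
  then obtain k :: "complex^'c" where k: "Q0 = (\<Sum>\<delta>\<in>UNIV. cscale (k $ \<delta>) (e \<delta>))" using traceless_span_su2[OF e] by blast
  have tr: "trace (e \<beta>) = 0" for \<beta> using e unfolding lie_basis_def su2_algebra_def by blast
  have "trace (Q ** e \<beta>) = trace (Q0 ** e \<beta>)" for \<beta>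
  proof -
    have "e \<beta> $ 2 $ 2 = - e \<beta> $ 1 $ 1"
      using tr[of \<beta>] by (simp add: trace_def sum_2 eq_neg_iff_add_eq_0 add.commute)
    then show ?thesis
      by (simp add: Q0_def trace_def sum_2 cscale_def mat_def matrix_matrix_mult_def field_simps)
  qed
  then have "inverse_form e P Q = trace (P ** Q0)"
    unfolding k by (rule inverse_form_eq_trace[OF gram_su2_invertible[OF e]])
  also have "\<dots> = trace (P ** Q) - trace P * trace Q / 2"
    by (simp add: Q0_def trace_def sum_2 cscale_def mat_def matrix_matrix_mult_def field_simps)
  finally show ?thesis .
qed

lemma trace_mult_inverse_2:
  fixes P Q R :: "2 cmat"
  assumes "det Q = 1" "Q ** R = mat 1" shows "trace (P ** R) = trace P * trace Q - trace (P ** Q)"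
proof -
  \<comment> \<open>By Cayley-Hamilton for two-by-two matrices of determinant 1, this is the inverse
    of \<open>Q\<close>.\<close>
  define S where "S = cscale (trace Q) (mat 1) - Q"
  have d: "Q $ 1 $ 1 * Q $ 2 $ 2 - Q $ 1 $ 2 * Q $ 2 $ 1 = 1" using assms(1) by (simp add: det_2)
  have "S ** Q = mat 1"
    using d by (simp add: S_def vec_eq_iff forall_2 matrix_matrix_mult_def sum_2 cscale_def mat_def trace_def algebra_simps)
  then have "S = S ** (Q ** R)" using assms(2) by simp
  also have "\<dots> = R" using \<open>S ** Q = mat 1\<close> by (simp add: matrix_mul_assoc)
  finally have "S = R" .
  show ?thesis unfolding \<open>S = R\<close>[symmetric]
    by (simp add: S_def trace_def sum_2 cscale_def mat_def matrix_matrix_mult_def algebra_simps)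
qed

text \<open>Liouville's formula: the logarithmic derivative of the determinant is the trace of the
  generator, here verified directly from the two-by-two determinant.\<close>

lemma flow_det_one:
  fixes X h g :: "real \<Rightarrow> 2 cmat"
  assumes f: "flow X h g" and X: "\<And>t. trace (X t) = 0" shows "det (h t) = 1" "det (g t) = 1"
proof -
  have ent: "((\<lambda>t. h t $ i $ j) has_vector_derivative (h t ** X t) $ i $ j) (at t)" for i j t
    using bounded_linear.has_vector_derivative[OF bounded_linear_compose[OF bounded_linear_vec_nth bounded_linear_vec_nth] flowD(5)[OF f]]
    by simp
  have tr: "X t $ 2 $ 2 = - X t $ 1 $ 1" for t
    using X[of t] by (simp add: trace_def sum_2 eq_neg_iff_add_eq_0 add.commute)
  have "((\<lambda>t. h t $ 1 $ 1 * h t $ 2 $ 2 - h t $ 1 $ 2 * h t $ 2 $ 1) has_vector_derivative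
     (h t $ 1 $ 1 * (h t ** X t) $ 2 $ 2 + (h t ** X t) $ 1 $ 1 * h t $ 2 $ 2 -
     (h t $ 1 $ 2 * (h t ** X t) $ 2 $ 1 + (h t ** X t) $ 1 $ 2 * h t $ 2 $ 1))) (at t)" for t
    by (intro has_vector_derivative_diff has_vector_derivative_mult ent)
  then have "((\<lambda>t. det (h t)) has_vector_derivative 0) (at t)" for t
    by (simp add: det_2 matrix_matrix_mult_def sum_2 tr algebra_simps)
  then have "det (h t) = det (h 0)" by (rule constant_vector_derivative_zero)
  then show "det (h t) = 1" by (simp add: flowD[OF f])
  moreover have "det (h t) * det (g t) = 1" using arg_cong[OF flowD(3)[OF f], of det] by (simp add: det_mul)
  ultimately show "det (g t) = 1" by simp
qed

lemma (in smoothing_setup) based_hol_su2_det: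
  assumes \<gamma>: "closed_path \<gamma>" and A: "one_form M su2_algebra A" shows "det (based_hol \<gamma> 0 A t) = 1"
proof -
  obtain h g where f: "flow (curveform \<gamma> 0 A) h g" using curveform_flow[OF \<gamma> one_form_admissible[OF A]] by blast
  have "trace (curveform \<gamma> 0 A t) = 0" for t
  proof -
    obtain c where c: "c \<in> M" "\<gamma> t \<in> cdom c" using ex_chart by blast
    have "trace (A c (cmap c (\<gamma> t)) $ a) = 0" for a
      using one_formD(2)[OF A c(1) cmap_in[OF c]] unfolding su2_algebra_def by blast
    then show ?thesis
      using pulls_backD[OF pulls_back_one_form[OF \<gamma> A] c]
      by (simp add: linear_sum[OF trace_linear] linear_cmul[OF trace_linear] flip: pulls_backD[OF pulls_back_one_form[OF \<gamma> A] c])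
  qed
  note d = flow_det_one[OF f this]
  show ?thesis by (simp add: based_hol_zero_flow[OF f] det_mul d)
qed

theorem mainTheorem4:
  fixes M :: "'p::t2_space chart set"
    and C C' :: "real \<Rightarrow> 'p"
    and N :: nat
    and U :: "nat \<Rightarrow> 'p chart"
    and pu cf :: "nat \<Rightarrow> 'p \<Rightarrow> real"
    and \<rho> :: "real^2 \<Rightarrow> real"
    and e_gl :: "'b::finite \<Rightarrow> complex^'n::finite^'n"
    and e_su :: "'c::finite \<Rightarrow> complex^2^2"
  assumes surface: "closed_oriented_surface M"
    and curve: "smooth_simple_closed_curve M C"
    and curve': "smooth_simple_closed_curve M C'"
    and finitely_many: "finite (intersections C C')"
    and transversal: "\<forall>p\<in>intersections C C'. transversal_at M C C' p"
    and smoothing: "smoothing_data M N U pu cf \<rho>"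
  shows
    "(lie_basis UNIV gl_algebra e_gl \<longrightarrow>
       (\<forall>A :: ('p, 'n) matform. one_form M gl_algebra A \<longrightarrow>
          has_regularized_bracket M UNIV gl_algebra e_gl (smoothing M N U pu cf \<rho>)
            (wilson M C) (wilson M C') A
            (\<Sum>p\<in>intersections C C'. crossing_sign M C C' p * wilson M (loop_product C p C') A)))
     \<and>
     (lie_basis \<real> su2_algebra e_su \<longrightarrow>
       (\<forall>A :: ('p, 2) matform. one_form M su2_algebra A \<longrightarrow>
          has_regularized_bracket M \<real> su2_algebra e_su (smoothing M N U pu cf \<rho>)
            (wilson M C) (wilson M C') A
            (1 / 2 * (\<Sum>p\<in>intersections C C'. crossing_sign M C C' p *
               (wilson M (loop_product C p C') A
                - wilson M (loop_product C p (reversepath C')) A)))))"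
proof (intro conjI impI allI)
  interpret smoothing_setup M N U pu cf \<rho>
    by (intro smoothing_setup.intro surface.intro smoothing_setup_axioms.intro surface smoothing)
  note \<gamma> = simple_imp_closed_path[OF curve] and \<gamma>' = simple_imp_closed_path[OF curve']
  have trans: "\<And>p. p \<in> intersections C C' \<Longrightarrow> transversal_at M C C' p" using transversal by blast
  {
    fix A :: "('p, 'n) matform"
    assume e: "lie_basis UNIV gl_algebra e_gl" and A: "one_form M gl_algebra A"
    have "subspace (gl_algebra :: 'n cmat set)" by (simp add: gl_algebra_def)
    from regularized_bracket[OF e this _ curve curve' finitely_many trans one_form_admissible[OF A]]
    show "has_regularized_bracket M UNIV gl_algebra e_gl (smoothing M N U pu cf \<rho>) (wilson M C) (wilson M C') A
            (\<Sum>p\<in>intersections C C'. crossing_sign M C C' p * wilson M (loop_product C p C') A)"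
      by (simp add: inverse_form_gl[OF e] wilson_loop_product[OF \<gamma> \<gamma>' A])
  next
    fix A :: "('p, 2) matform"
    assume e: "lie_basis \<real> su2_algebra e_su" and A: "one_form M su2_algebra A"
    have eq: "inverse_form e_su (based_hol C 0 A (param C p)) (based_hol C' 0 A (param C' p)) =
      1 / 2 * (wilson M (loop_product C p C') A - wilson M (loop_product C p (reversepath C')) A)"
      if p: "p \<in> intersections C C'" for p
    proof -
      let ?H = "based_hol C 0 A (param C p)" and ?H' = "based_hol C' 0 A (param C' p)"
      have pr: "p \<in> range C'" using p by (simp add: intersections_def)
      obtain R where R: "?H' ** R = mat 1" "wilson M (loop_product C p (reversepath C')) A = trace (?H ** R)"
        using wilson_loop_product_reverse[OF \<gamma> curve' A pr] by blast
      \<comment> \<open>With Q^-1 for the reversed loop, tr P tr Q = tr (P Q) + tr (P Q^-1);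
        inserted into tr (P Q) - tr P tr Q / 2 this leaves half the difference of the two
        loops.\<close>
      show ?thesis
        by (simp add: inverse_form_su2[OF e] wilson_loop_product[OF \<gamma> \<gamma>' A] R(2)
            trace_mult_inverse_2[OF based_hol_su2_det[OF \<gamma>' A] R(1)] field_simps)
    qed
    have "(\<Sum>p\<in>intersections C C'. crossing_sign M C C' p * inverse_form e_su (based_hol C 0 A (param C p)) (based_hol C' 0 A (param C' p))) =
      1 / 2 * (\<Sum>p\<in>intersections C C'. crossing_sign M C C' p *
               (wilson M (loop_product C p C') A - wilson M (loop_product C p (reversepath C')) A))"
      unfolding sum_distrib_left by (rule sum.cong[OF refl]) (simp add: eq)
    moreover have "has_regularized_bracket M \<real> su2_algebra e_su (smoothing M N U pu cf \<rho>) (wilson M C) (wilson M C') A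
      (\<Sum>p\<in>intersections C C'. crossing_sign M C C' p * inverse_form e_su (based_hol C 0 A (param C p)) (based_hol C' 0 A (param C' p)))"
      by (rule regularized_bracket[OF e subspace_su2 Reals_of_real curve curve' finitely_many trans one_form_admissible[OF A]])
    ultimately show "has_regularized_bracket M \<real> su2_algebra e_su (smoothing M N U pu cf \<rho>)
            (wilson M C) (wilson M C') A
            (1 / 2 * (\<Sum>p\<in>intersections C C'. crossing_sign M C C' p *
               (wilson M (loop_product C p C') A - wilson M (loop_product C p (reversepath C')) A)))"
      by (simp only:)
  }
qed

end
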